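(* Let $M>0$, let $K_1,K_2$ satisfy $$K_1\in C^4(\overline{\Omega'}\times\overline{\Omega'}),\ \|K_1\|_{C^4(\overline{\Omega'}\times\overline{\Omega'})}<M,\qquad K_2\in C^4(\overline\Omega\times\overline\Omega),\ \|K_2\|_{C^4(\overline\Omega\times\overline\Omega)}<M,$$ and let $a\in C^3(\overline\Omega)$, $s\in C^{2,1}(\overline Q_T)$ with $\|a\|_{C^3(\overline\Omega)}<M$, $\|s\|_{C^{2,1}(\overline Q_T)}<M$. Assume that there exist two vector functions $(u_i,m_i,b_i)\in Y_1(M)\times Y_2(M)$, $i=1,2$, such that $(u_i,m_i)$ satisfies the mean field games system (MFGS) of the context with $b=b_i$, and $$\begin{aligned}&u_i(x,0)=p_i(x),\quad m_i(x,0)=q_i(x),\quad x\in\Omega,\\&u_i(x,T)=F_i(x),\quad m_i(x,T)=G_i(x),\quad x\in\Omega,\\&u_i|_{S_T}=f_{0,i},\quad \partial_nu_i|_{S_T}=f_{1,i},\quad m_i|_{S_T}=g_{0,i},\quad \partial_nm_i|_{S_T}=g_{1,i},\end{aligned}$$ where the lateral Cauchy data are complete, i.e. $f_{0,i},f_{1,i},g_{0,i},g_{1,i}$ are known for all $(x,t)\in S_T$. In addition, assume that there exists a number $c>0$ such that $$\min_{(x,t)\in\overline Q_T}\Big|\int_{\Omega'}K_1(\overline x,\overline y)\,m_2(x_1,\overline y,t)\,d\overline y+\int_{x_1}^{A_1}\Big(\int_{\Omega'}K_2(x,y_1,\overline y)\,m_2(y_1,\overline y,t)\,d\overline y\Big)dy_1\Big|\ge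 c.$$ Then there exists a number $C_1=C_1(M,c,\Omega,T)>0$, depending only on the listed parameters, such that the following Lipschitz stability estimates are valid. For $j=0,1$, each of the two norms $$\|\partial_t^ju_1-\partial_t^ju_2\|_{H^{2,1}(Q_T)},\qquad\|\partial_t^jm_1-\partial_t^jm_2\|_{H^{2,1}(Q_T)}$$ is at most $$\begin{aligned}&C_1\big(\|p_1-p_2\|_{H^4(\Omega)}+\|q_1-q_2\|_{H^4(\Omega)}\big)+C_1\big(\|F_1-F_2\|_{H^4(\Omega)}+\|G_1-G_2\|_{H^4(\Omega)}\big)\\&+C_1\big(\|\partial_tf_{0,1}-\partial_tf_{0,2}\|_{H^{2,1}(S_T)}+\|\partial_tf_{1,1}-\partial_tf_{1,2}\|_{H^{1,0}(S_T)}\big)\\&+C_1\big(\|\partial_tg_{0,1}-\partial_tg_{0,2}\|_{H^{2,1}(S_T)}+\|\partial_tg_{1,1}-\partial_tg_{1,2}\|_{H^{1,0}(S_T)}\big),\end{aligned}$$ and $$\begin{aligned}\|b_1-b_2\|_{L_2(\Omega)}\le{}&\|p_1-p_2\|_{H^4(\Omega)}+\|q_1-q_2\|_{H^4(\Omega)}+\|F_1-F_2\|_{H^4(\Omega)}+\|G_1-G_2\|_{H^4(\Omega)}\\&+\|\partial_tf_{0,1}-\partial_tf_{0,2}\|_{H^{2,1}(S_T)}+\|\partial_tf_{1,1}-\partial_tf_{1,2}\|_{H^{1,0}(S_T)}.\end{aligned}$$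
   Context: Let $n\ge1$, $A_1,\dots,A_n>0$, $T>0$. For $x=(x_1,\dots,x_n)$ write $\overline x=(x_2,\dots,x_n)$. Put $\Omega=\{x:-A_i<x_i<A_i,\ i=1,\dots,n\}$, $\Omega'=\{\overline x:-A_i<x_i<A_i,\ i=2,\dots,n\}$, $Q_T=\Omega\times(0,T)$, $S_T=\partial\Omega\times(0,T)$; $\partial_i^\pm\Omega_T=\{x\in\partial\Omega:x_i=\pm A_i\}\times(0,T)$, $i=1,\dots,n$. $\partial_n$ is the outward normal derivative. All functions are real valued. (MFGS) The mean field games system with coefficient $b$ is, in $Q_T$, $$\begin{aligned}&u_t+\Delta u-\tfrac{a(x)}{2}|\nabla u|^2+b(x)\Big[\int_{\Omega'}K_1(\overline x,\overline y)m(x_1,\overline y,t)\,d\overline y+\int_{x_1}^{A_1}\Big(\int_{\Omega'}K_2(x,y_1,\overline y)m(y_1,\overline y,t)\,d\overline y\Big)dy_1\Big]+s(x,t)m=0,\\&m_t-\Delta m-\operatorname{div}\big(a(x)\,m\,\nabla u\big)=0.\end{aligned}$$ (This is the system with global interaction term $\int_\Omega K(x,y)m(y,t)\,dy$ for the kernel $K(x,y)=b(x)\{\delta(x_1-y_1)K_1(\overline x,\overline y)+H(y_1-x_1)K_2(x,y)\}$, with $\delta(\cdot)$ the delta function and $H$ the Heaviside function.) Spaces: $\|u\|_{C^{2k,k}(\overline Q_T)}=\max_{|\alpha|+2m\le2k}\|D_x^\alpha\partial_t^mu\|_{C(\overline Q_T)}$; $\|u\|^2_{H^{2k,k}(Q_T)}=\sum_{|\alpha|+2m\le2k}\|D^\alpha_x\partial_t^mu\|^2_{L_2(Q_T)}$.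 On faces, $$\|u\|^2_{H^{2,1}(\partial_i^\pm\Omega_T)}=\sum_{j\ne i}\|u_{x_j}\|^2_{L_2(\partial_i^\pm\Omega_T)}+\sum_{(j,s)\ne(i,i)}\|u_{x_jx_s}\|^2_{L_2(\partial_i^\pm\Omega_T)}+\sum_{j=0}^1\|\partial_t^ju\|^2_{L_2(\partial_i^\pm\Omega_T)},$$ $$\|u\|^2_{H^{1,0}(\partial_i^\pm\Omega_T)}=\sum_{j\ne i}\|u_{x_j}\|^2_{L_2(\partial_i^\pm\Omega_T)}+\|u\|^2_{L_2(\partial_i^\pm\Omega_T)}.$$ Squared norms over $S_T$ are sums of squared norms over all faces. When the $H^{2,1}$ norm is applied to Dirichlet data, the derivatives in it are those of the underlying function $u_i$ (or $m_i$), so mixed normal-tangential derivatives are tangential derivatives of the Neumann data. Sets: $Y_1(M)=\{(u,m):u,m\in C^{6,3}(\overline Q_T),\ \|u\|_{C^{6,3}(\overline Q_T)}<M,\ \|m\|_{C^{6,3}(\overline Q_T)}<M\}$ and $Y_2(M)=\{b\in C^4(\overline\Omega):\|b\|_{C^4(\overline\Omega)}<M\}$.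
   Formalization: The last estimate, for the L_2 norm of b_1−b_2, is false as printed (no constant, no g-terms); it is proved with the full right-hand side of the preceding estimates, i.e. with the constant C_1 and including the terms in g_0 and g_1. *)

theory Defs
  imports "HOL-Analysis.Analysis"
begin

section \<open>Classical derivatives on open or closed sets\<close>

text \<open>
  The derivative of \<open>f\<close> at \<open>x\<close> in the direction \<open>v\<close>, taken within \<open>S\<close>. At interior points of \<open>S\<close> this is the
  usual directional derivative, at boundary points of a closed box it is the one-sided one. Only the
  values of \<open>f\<close> on \<open>S\<close> matter.
\<close>

definition pd :: "'a::real_normed_vector set \<Rightarrow> 'a \<Rightarrow> ('a \<Rightarrow> real) \<Rightarrow> 'a \<Rightarrow> real" where
  "pd S v f x = vector_derivative (\<lambda>h. f (x + h *\<^sub>R v)) (at 0 within {h. x + h *\<^sub>R v \<in> S})"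

definition pds :: "'a::real_normed_vector set \<Rightarrow> 'a list \<Rightarrow> ('a \<Rightarrow> real) \<Rightarrow> 'a \<Rightarrow> real" where
  "pds S vs f = foldr (pd S) vs f"

text \<open>
  A list of directions from \<open>V\<close> of total weight at most \<open>k\<close> is a derivative of order at most \<open>k\<close>; giving the
  time direction weight 2 yields the parabolic order \<open>|\<alpha>| + 2m\<close>. Lists (all orders of differentiation)
  are used instead of multi-indices; the maximum over lists is the maximum over multi-indices, because
  the derivatives of a function of the class commute.
\<close>

definition dir_lists :: "'a set \<Rightarrow> ('a \<Rightarrow> nat) \<Rightarrow> nat \<Rightarrow> 'a list set" where
  "dir_lists V w k = {vs. set vs \<subseteq> V \<and> sum_list (map w vs) \<le> k}"

definition Ck_on ::
  "'a::real_normed_vector set \<Rightarrow> 'a set \<Rightarrow> ('a \<Rightarrow> nat) \<Rightarrow> nat \<Rightarrow> ('a \<Rightarrow> real) \<Rightarrow> bool" where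
  "Ck_on S V w k f \<longleftrightarrow>
     (\<forall>vs \<in> dir_lists V w k. continuous_on S (pds S vs f)) \<and>
     (\<forall>v vs. v # vs \<in> dir_lists V w k \<longrightarrow>
        (\<forall>x\<in>S. (\<lambda>h. pds S vs f (x + h *\<^sub>R v)) differentiable (at 0 within {h. x + h *\<^sub>R v \<in> S})))"

text \<open>Only used for \<open>f\<close> with \<open>Ck_on S V w k f\<close> and \<open>S\<close> compact, so that the supremum is an attained maximum.\<close>

definition Ck_norm ::
  "'a::real_normed_vector set \<Rightarrow> 'a set \<Rightarrow> ('a \<Rightarrow> nat) \<Rightarrow> nat \<Rightarrow> ('a \<Rightarrow> real) \<Rightarrow> real" where
  "Ck_norm S V w k f = (SUP (vs, x) \<in> dir_lists V w k \<times> S. \<bar>pds S vs f x\<bar>)"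

section \<open>Geometry\<close>

text \<open>
  Vectors in n-space are elements of \<open>real ^ 'n\<close> with an ordered index type. The first index plays the
  role of 1. A barred vector (the coordinates other than the first) is represented by the vector
  whose first coordinate is 0; this also covers \<open>n = 1\<close>, where there is exactly one barred vector.
\<close>

type_synonym 'n rvec = "(real, 'n) vec"

definition ix1 :: "'n::{finite,wellorder}" where
  "ix1 = (LEAST i. True)"

definition bar :: "'n::{finite,wellorder} rvec \<Rightarrow> 'n rvec" where
  "bar x = (\<chi> i. if i = ix1 then 0 else x $ i)"

definition Omega :: "'n::{finite,wellorder} rvec \<Rightarrow> ('n rvec) set" where
  "Omega A = {x. \<forall>i. - A $ i < x $ i \<and> x $ i < A $ i}"

definition cOmega :: "'n::{finite,wellorder} rvec \<Rightarrow> ('n rvec) set" where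
  "cOmega A = closure (Omega A)"

definition cOmega' :: "'n::{finite,wellorder} rvec \<Rightarrow> ('n rvec) set" where
  "cOmega' A = {x. x $ ix1 = 0 \<and> (\<forall>i. i \<noteq> ix1 \<longrightarrow> - A $ i \<le> x $ i \<and> x $ i \<le> A $ i)}"

definition QT :: "'n::{finite,wellorder} rvec \<Rightarrow> real \<Rightarrow> ('n rvec \<times> real) set" where
  "QT A T = Omega A \<times> {0<..<T}"

definition cQT :: "'n::{finite,wellorder} rvec \<Rightarrow> real \<Rightarrow> ('n rvec \<times> real) set" where
  "cQT A T = closure (QT A T)"

definition ST :: "'n::{finite,wellorder} rvec \<Rightarrow> real \<Rightarrow> ('n rvec \<times> real) set" where
  "ST A T = frontier (Omega A) \<times> {0<..<T}"

text \<open>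
  The face of \<open>\<Omega>\<close> with \<open>x\<^sub>i = \<sigma> A\<^sub>i\<close>, \<open>\<sigma> = \<plusminus>1\<close>, without its edges, where the outward normal is not defined
  (the edges are a null set of the face).
\<close>

definition face :: "'n::{finite,wellorder} rvec \<Rightarrow> 'n \<Rightarrow> real \<Rightarrow> ('n rvec) set" where
  "face A i \<sigma> = {x. x $ i = \<sigma> * A $ i \<and> (\<forall>j. j \<noteq> i \<longrightarrow> - A $ j < x $ j \<and> x $ j < A $ j)}"

text \<open>
  The \<open>(n-1)\<close>-dimensional Lebesgue integral of \<open>g\<close> over the slice of \<open>\<Omega>\<close> with \<open>x\<^sub>i = r\<close>. With \<open>i = ix1\<close> it is
  the integral over \<open>\<Omega>'\<close> of \<open>g (r, _)\<close>; with \<open>r = \<plusminus> A\<^sub>i\<close> it is the surface integral over a face.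
  For \<open>n = 1\<close> it is the value of \<open>g\<close> at the only point of the slice.
\<close>

definition slice_integral ::
  "'n::{finite,wellorder} rvec \<Rightarrow> 'n \<Rightarrow> real \<Rightarrow> ('n rvec \<Rightarrow> real) \<Rightarrow> real" where
  "slice_integral A i r g =
     (LINT y : (\<Pi>\<^sub>E j\<in>UNIV - {i}. {- A $ j <..< A $ j}) | (\<Pi>\<^sub>M j\<in>UNIV - {i}. lborel).
        g (\<chi> j. if j = i then r else y j))"

section \<open>Spaces of continuously differentiable functions\<close>

definition e_space :: "'n::{finite,wellorder} \<Rightarrow> 'n rvec \<times> real" where
  "e_space i = (axis i 1, 0)"

definition e_time :: "'n::{finite,wellorder} rvec \<times> real" where
  "e_time = (0, 1)"

definition par_dirs :: "('n::{finite,wellorder} rvec \<times> real) set" where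
  "par_dirs = insert e_time (range e_space)"

definition par_weight :: "'n::{finite,wellorder} rvec \<times> real \<Rightarrow> nat" where
  "par_weight v = (if v = e_time then 2 else 1)"

definition C_par ::
  "'n::{finite,wellorder} rvec \<Rightarrow> real \<Rightarrow> nat \<Rightarrow> ('n rvec \<times> real \<Rightarrow> real) \<Rightarrow> bool" where
  "C_par A T k u \<longleftrightarrow> Ck_on (cQT A T) par_dirs par_weight (2 * k) u"

definition C_par_norm ::
  "'n::{finite,wellorder} rvec \<Rightarrow> real \<Rightarrow> nat \<Rightarrow> ('n rvec \<times> real \<Rightarrow> real) \<Rightarrow> real" where
  "C_par_norm A T k u = Ck_norm (cQT A T) par_dirs par_weight (2 * k) u"

definition C_Omega :: "'n::{finite,wellorder} rvec \<Rightarrow> nat \<Rightarrow> ('n rvec \<Rightarrow> real) \<Rightarrow> bool" where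
  "C_Omega A k f \<longleftrightarrow> Ck_on (cOmega A) Basis (\<lambda>_. 1) k f"

definition C_Omega_norm :: "'n::{finite,wellorder} rvec \<Rightarrow> nat \<Rightarrow> ('n rvec \<Rightarrow> real) \<Rightarrow> real" where
  "C_Omega_norm A k f = Ck_norm (cOmega A) Basis (\<lambda>_. 1) k f"

definition C_Omega2 ::
  "'n::{finite,wellorder} rvec \<Rightarrow> nat \<Rightarrow> ('n rvec \<times> 'n rvec \<Rightarrow> real) \<Rightarrow> bool" where
  "C_Omega2 A k f \<longleftrightarrow> Ck_on (cOmega A \<times> cOmega A) Basis (\<lambda>_. 1) k f"

definition C_Omega2_norm ::
  "'n::{finite,wellorder} rvec \<Rightarrow> nat \<Rightarrow> ('n rvec \<times> 'n rvec \<Rightarrow> real) \<Rightarrow> real" where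
  "C_Omega2_norm A k f = Ck_norm (cOmega A \<times> cOmega A) Basis (\<lambda>_. 1) k f"

definition bar_dirs2 :: "('n::{finite,wellorder} rvec \<times> 'n rvec) set" where
  "bar_dirs2 = (\<lambda>j. (axis j 1, 0)) ` (UNIV - {ix1}) \<union> (\<lambda>j. (0, axis j 1)) ` (UNIV - {ix1})"

definition C_Omega'2 ::
  "'n::{finite,wellorder} rvec \<Rightarrow> nat \<Rightarrow> ('n rvec \<times> 'n rvec \<Rightarrow> real) \<Rightarrow> bool" where
  "C_Omega'2 A k f \<longleftrightarrow> Ck_on (cOmega' A \<times> cOmega' A) bar_dirs2 (\<lambda>_. 1) k f"

definition C_Omega'2_norm ::
  "'n::{finite,wellorder} rvec \<Rightarrow> nat \<Rightarrow> ('n rvec \<times> 'n rvec \<Rightarrow> real) \<Rightarrow> real" where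
  "C_Omega'2_norm A k f = Ck_norm (cOmega' A \<times> cOmega' A) bar_dirs2 (\<lambda>_. 1) k f"

definition Y1 :: "'n::{finite,wellorder} rvec \<Rightarrow> real \<Rightarrow> real \<Rightarrow>
    (('n rvec \<times> real \<Rightarrow> real) \<times> ('n rvec \<times> real \<Rightarrow> real)) set" where
  "Y1 A T M = {(u, m). C_par A T 3 u \<and> C_par A T 3 m \<and> C_par_norm A T 3 u < M \<and> C_par_norm A T 3 m < M}"

definition Y2 :: "'n::{finite,wellorder} rvec \<Rightarrow> real \<Rightarrow> ('n rvec \<Rightarrow> real) set" where
  "Y2 A M = {b. C_Omega A 4 b \<and> C_Omega_norm A 4 b < M}"

section \<open>Sobolev norms\<close>

text \<open>
  The derivatives are the classical ones of \<^const>\<open>pd\<close>; the norms are only applied to functions for which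
  these exist and are continuous. A multi-index \<open>\<alpha>\<close> is turned into the list of directions ordered by
  index, so that each \<open>D\<^sup>\<alpha>\<close> is counted once.
\<close>

definition mi_list :: "('n::{finite,wellorder} \<Rightarrow> nat) \<Rightarrow> 'n list" where
  "mi_list \<alpha> = concat (map (\<lambda>i. replicate (\<alpha> i) i) (sorted_list_of_set UNIV))"

definition L2_Omega :: "'n::{finite,wellorder} rvec \<Rightarrow> ('n rvec \<Rightarrow> real) \<Rightarrow> real" where
  "L2_Omega A f = sqrt (LINT x : Omega A | lborel. (f x)\<^sup>2)"

definition H_Omega :: "'n::{finite,wellorder} rvec \<Rightarrow> nat \<Rightarrow> ('n rvec \<Rightarrow> real) \<Rightarrow> real" where
  "H_Omega A k f =
     sqrt (\<Sum>\<alpha> \<in> {\<alpha> :: 'n \<Rightarrow> nat. sum \<alpha> UNIV \<le> k}.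
       (L2_Omega A (pds (Omega A) (map (\<lambda>i. axis i 1) (mi_list \<alpha>)) f))\<^sup>2)"

definition L2_QT :: "'n::{finite,wellorder} rvec \<Rightarrow> real \<Rightarrow> ('n rvec \<times> real \<Rightarrow> real) \<Rightarrow> real" where
  "L2_QT A T f = sqrt (LINT z : QT A T | lborel. (f z)\<^sup>2)"

text \<open>The norm of \<open>H\<^bsup>2k,k\<^esup>(Q\<^sub>T)\<close>.\<close>

definition H_par :: "'n::{finite,wellorder} rvec \<Rightarrow> real \<Rightarrow> nat \<Rightarrow> ('n rvec \<times> real \<Rightarrow> real) \<Rightarrow> real" where
  "H_par A T k f =
     sqrt (\<Sum>(\<alpha>, m) \<in> {(\<alpha> :: 'n \<Rightarrow> nat, m). sum \<alpha> UNIV + 2 * m \<le> 2 * k}.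
       (L2_QT A T (pds (cQT A T) (map e_space (mi_list \<alpha>) @ replicate m e_time) f))\<^sup>2)"

definition L2_face ::
  "'n::{finite,wellorder} rvec \<Rightarrow> real \<Rightarrow> 'n \<Rightarrow> real \<Rightarrow> ('n rvec \<times> real \<Rightarrow> real) \<Rightarrow> real" where
  "L2_face A T i \<sigma> g =
     sqrt (LINT t : {0<..<T} | lborel. slice_integral A i (\<sigma> * A $ i) (\<lambda>x. (g (x, t))\<^sup>2))"

text \<open>
  The \<open>H\<^bsup>2,1\<^esup>\<close> norm on \<open>S\<^sub>T\<close> of Dirichlet data takes the underlying function \<open>w\<close> on the closure of \<open>Q\<^sub>T\<close>
  as its argument: the sum contains the mixed normal-tangential derivatives, which are
  not determined by the restriction of \<open>w\<close> to \<open>S\<^sub>T\<close>.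
\<close>

definition H21_face_sq ::
  "'n::{finite,wellorder} rvec \<Rightarrow> real \<Rightarrow> 'n \<Rightarrow> real \<Rightarrow> ('n rvec \<times> real \<Rightarrow> real) \<Rightarrow> real" where
  "H21_face_sq A T i \<sigma> w =
     (\<Sum>j\<in>UNIV - {i}. (L2_face A T i \<sigma> (pd (cQT A T) (e_space j) w))\<^sup>2)
   + (\<Sum>(j, s)\<in>UNIV - {(i, i)}. (L2_face A T i \<sigma> (pds (cQT A T) [e_space s, e_space j] w))\<^sup>2)
   + (\<Sum>j\<le>1. (L2_face A T i \<sigma> (pds (cQT A T) (replicate j e_time) w))\<^sup>2)"

definition H21_ST :: "'n::{finite,wellorder} rvec \<Rightarrow> real \<Rightarrow> ('n rvec \<times> real \<Rightarrow> real) \<Rightarrow> real" where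
  "H21_ST A T w = sqrt (\<Sum>i\<in>UNIV. \<Sum>\<sigma>\<in>{-1, 1}. H21_face_sq A T i \<sigma> w)"

text \<open>Here \<open>g\<close> is a function on \<open>S\<^sub>T\<close>; away from the edges of the face only tangential derivatives occur.\<close>

definition H10_face_sq ::
  "'n::{finite,wellorder} rvec \<Rightarrow> real \<Rightarrow> 'n \<Rightarrow> real \<Rightarrow> ('n rvec \<times> real \<Rightarrow> real) \<Rightarrow> real" where
  "H10_face_sq A T i \<sigma> g =
     (\<Sum>j\<in>UNIV - {i}. (L2_face A T i \<sigma> (pd (ST A T) (e_space j) g))\<^sup>2) + (L2_face A T i \<sigma> g)\<^sup>2"

definition H10_ST :: "'n::{finite,wellorder} rvec \<Rightarrow> real \<Rightarrow> ('n rvec \<times> real \<Rightarrow> real) \<Rightarrow> real" where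
  "H10_ST A T g = sqrt (\<Sum>i\<in>UNIV. \<Sum>\<sigma>\<in>{-1, 1}. H10_face_sq A T i \<sigma> g)"

section \<open>The mean field games system\<close>

definition Dx ::
  "'n::{finite,wellorder} rvec \<Rightarrow> real \<Rightarrow> 'n \<Rightarrow> ('n rvec \<times> real \<Rightarrow> real) \<Rightarrow> 'n rvec \<times> real \<Rightarrow> real" where
  "Dx A T i u = pd (cQT A T) (e_space i) u"

definition Dt ::
  "'n::{finite,wellorder} rvec \<Rightarrow> real \<Rightarrow> ('n rvec \<times> real \<Rightarrow> real) \<Rightarrow> 'n rvec \<times> real \<Rightarrow> real" where
  "Dt A T u = pd (cQT A T) e_time u"

definition Lap ::
  "'n::{finite,wellorder} rvec \<Rightarrow> real \<Rightarrow> ('n rvec \<times> real \<Rightarrow> real) \<Rightarrow> 'n rvec \<times> real \<Rightarrow> real" where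
  "Lap A T u z = (\<Sum>i\<in>UNIV. Dx A T i (Dx A T i u) z)"

definition interaction ::
  "'n::{finite,wellorder} rvec \<Rightarrow> ('n rvec \<times> 'n rvec \<Rightarrow> real) \<Rightarrow> ('n rvec \<times> 'n rvec \<Rightarrow> real) \<Rightarrow>
   ('n rvec \<times> real \<Rightarrow> real) \<Rightarrow> 'n rvec \<times> real \<Rightarrow> real" where
  "interaction A K1 K2 m = (\<lambda>(x, t).
     slice_integral A ix1 (x $ ix1) (\<lambda>y. K1 (bar x, bar y) * m (y, t))
   + (LINT r : {x $ ix1 .. A $ ix1} | lborel. slice_integral A ix1 r (\<lambda>y. K2 (x, y) * m (y, t))))"

definition MFGS ::
  "'n::{finite,wellorder} rvec \<Rightarrow> real \<Rightarrow> ('n rvec \<times> 'n rvec \<Rightarrow> real) \<Rightarrow> ('n rvec \<times> 'n rvec \<Rightarrow> real) \<Rightarrow>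
   ('n rvec \<Rightarrow> real) \<Rightarrow> ('n rvec \<times> real \<Rightarrow> real) \<Rightarrow> ('n rvec \<Rightarrow> real) \<Rightarrow>
   ('n rvec \<times> real \<Rightarrow> real) \<Rightarrow> ('n rvec \<times> real \<Rightarrow> real) \<Rightarrow> bool" where
  "MFGS A T K1 K2 a s b u m \<longleftrightarrow> (\<forall>(x, t)\<in>QT A T.
     Dt A T u (x, t) + Lap A T u (x, t) - a x / 2 * (\<Sum>i\<in>UNIV. (Dx A T i u (x, t))\<^sup>2)
       + b x * interaction A K1 K2 m (x, t) + s (x, t) * m (x, t) = 0 \<and>
     Dt A T m (x, t) - Lap A T m (x, t)
       - (\<Sum>i\<in>UNIV. Dx A T i (\<lambda>z. a (fst z) * m z * Dx A T i u z) (x, t)) = 0)"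

text \<open>
  Initial value, terminal value, Dirichlet and Neumann data of \<open>u\<close>. The outward normal derivative on the
  face \<open>x\<^sub>i = \<sigma> A\<^sub>i\<close> is \<open>\<sigma>\<close> times the derivative in \<open>x\<^sub>i\<close>.
\<close>

definition has_data ::
  "'n::{finite,wellorder} rvec \<Rightarrow> real \<Rightarrow> ('n rvec \<times> real \<Rightarrow> real) \<Rightarrow>
   ('n rvec \<Rightarrow> real) \<Rightarrow> ('n rvec \<Rightarrow> real) \<Rightarrow>
   ('n rvec \<times> real \<Rightarrow> real) \<Rightarrow> ('n rvec \<times> real \<Rightarrow> real) \<Rightarrow> bool" where
  "has_data A T u p F f0 f1 \<longleftrightarrow>
     (\<forall>x\<in>Omega A. u (x, 0) = p x \<and> u (x, T) = F x) \<and>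
     (\<forall>z\<in>ST A T. u z = f0 z) \<and>
     (\<forall>i. \<forall>\<sigma>\<in>{-1, 1}. \<forall>z\<in>face A i \<sigma> \<times> {0<..<T}. \<sigma> * Dx A T i u z = f1 z)"

end

theory Submission
  imports Defs
begin

text \<open>
  Let \<open>U\<close> and \<open>N\<close> be the differences of the two solutions and \<open>J\<close> the interaction term of \<open>m\<^sub>2\<close>, which is
  bounded away from zero. Divided by \<open>J\<close>, the difference of the first equations reads
  \<open>z + (b\<^sub>1 - b\<^sub>2) + Y / J = 0\<close> with \<open>z = \<partial>\<^sub>t U / J\<close> and \<open>Y\<close> free of time derivatives. Hence \<open>b\<^sub>1 - b\<^sub>2\<close> is bounded by
  \<open>z\<close> at \<open>t = 0\<close> and the data, and \<open>z(T) - z(0)\<close> is bounded by the data alone. Differentiation in \<open>t\<close> shows that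
  \<open>\<partial>\<^sub>t z + \<Delta> z\<close> and \<open>\<partial>\<^sub>t n - \<Delta> n\<close>, \<open>n = \<partial>\<^sub>t N\<close>, are of lower order, except for \<open>\<Delta> z\<close> in the second expression.

  Both are estimated by a Carleman inequality with the weight \<open>exp (2 l X^2)\<close>, \<open>X = x\<^sub>1 + A\<^sub>1 + 1\<close>. It does not depend on
  \<open>t\<close>, so that the ends of the time interval only contribute the difference of one quantity at \<open>T\<close> and at \<open>0\<close>, and it
  increases in \<open>x\<^sub>1\<close>, so that the interaction term is bounded in the weighted space uniformly in \<open>l\<close>. The inequality
  gains \<open>l^3\<close> for \<open>n^2\<close> and loses only \<open>l\<close> for \<open>(\<Delta> z)^2\<close>, which closes the estimate for a large \<open>l\<close>.
\<close>

section \<open>Directional derivatives\<close>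

text \<open>The obstacle is that the unknown coefficient leaves neither \<open>z(0)\<close> nor
  \<open>z(T)\<close> under the control of the data. In the end terms of the Carleman inequality for
  \<open>z\<close> the difference of squares is therefore split by Young's inequality into a large
  multiple of the squared jump and \<open>\<epsilon>\<close> times the trace at
  \<open>t = 0\<close>. That trace is bounded by interior norms with a constant independent of
  \<open>\<epsilon>\<close>, so it is absorbed after \<open>l\<close> has been fixed. The
  coefficient also survives in the equation differentiated in time, with the factor
  \<open>Jt\<close>; there it is bounded by data and the weighted trace of \<open>z\<close> at
  \<open>t = 0\<close>, which is interpolated between \<open>l^2 z^2\<close> and
  \<open>zt^2 / l^2\<close>, each smaller by a factor \<open>l\<close> than the gain of the Carleman
  inequality. For \<open>n\<close> both ends are data: the second equation and its spatial
  derivatives express \<open>n\<close> and its gradient at \<open>t = 0\<close> and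
  \<open>t = T\<close> by spatial derivatives of order at most three, which the \<open>H^4\<close>
  norms control.\<close>

definition hpd :: "'a::real_normed_vector set \<Rightarrow> 'a \<Rightarrow> ('a \<Rightarrow> real) \<Rightarrow> ('a \<Rightarrow> real) \<Rightarrow> bool" where
  "hpd S v f f' \<longleftrightarrow>
     (\<forall>x\<in>S. ((\<lambda>h. f (x + h *\<^sub>R v)) has_real_derivative f' x) (at 0 within {h. x + h *\<^sub>R v \<in> S}))"

lemma hpd_add: "hpd S v f f' \<Longrightarrow> hpd S v g g' \<Longrightarrow> hpd S v (\<lambda>x. f x + g x) (\<lambda>x. f' x + g' x)"
  by (auto simp: hpd_def intro!: DERIV_add)

lemma hpd_diff: "hpd S v f f' \<Longrightarrow> hpd S v g g' \<Longrightarrow> hpd S v (\<lambda>x. f x - g x) (\<lambda>x. f' x - g' x)"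
  by (auto simp: hpd_def intro!: DERIV_diff)

lemma hpd_mult:
  "hpd S v f f' \<Longrightarrow> hpd S v g g' \<Longrightarrow> hpd S v (\<lambda>x. f x * g x) (\<lambda>x. f' x * g x + f x * g' x)"
  unfolding hpd_def by (auto intro!: derivative_eq_intros)

lemma hpd_cmult: "hpd S v f f' \<Longrightarrow> hpd S v (\<lambda>x. c * f x) (\<lambda>x. c * f' x)"
  unfolding hpd_def by (auto intro!: derivative_eq_intros)

lemma hpd_const: "hpd S v (\<lambda>x. c) (\<lambda>x. 0)"
  unfolding hpd_def by auto

lemma hpd_square: "hpd S v f f' \<Longrightarrow> hpd S v (\<lambda>x. (f x)^2) (\<lambda>x. 2 * (f x * f' x))"
  unfolding hpd_def by (auto intro!: derivative_eq_intros)

lemma hpd_divide: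
  "hpd S v f f' \<Longrightarrow> hpd S v g g' \<Longrightarrow> (\<And>x. x \<in> S \<Longrightarrow> g x \<noteq> 0) \<Longrightarrow>
    hpd S v (\<lambda>x. f x / g x) (\<lambda>x. (f' x - f x / g x * g' x) / g x)"
  unfolding hpd_def by (auto intro!: derivative_eq_intros simp: field_simps)

lemma hpd_sum:
  "(\<And>i. i \<in> I \<Longrightarrow> hpd S v (f i) (f' i)) \<Longrightarrow> hpd S v (\<lambda>x. \<Sum>i\<in>I. f i x) (\<lambda>x. \<Sum>i\<in>I. f' i x)"
  unfolding hpd_def by (auto intro!: DERIV_sum)

lemma hpd_chain:
  assumes "hpd S v f f'" "\<And>y. (F has_real_derivative F' y) (at y)"
  shows "hpd S v (\<lambda>x. F (f x)) (\<lambda>x. F' (f x) * f' x)"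
  unfolding hpd_def
proof
  fix x assume "x \<in> S"
  then have "((\<lambda>h. f (x + h *\<^sub>R v)) has_real_derivative f' x) (at 0 within {h. x + h *\<^sub>R v \<in> S})"
    using assms(1) by (auto simp: hpd_def)
  from DERIV_chain2[OF _ this, of F "F' (f x)"] assms(2)
  show "((\<lambda>h. F (f (x + h *\<^sub>R v))) has_real_derivative F' (f x) * f' x) (at 0 within {h. x + h *\<^sub>R v \<in> S})"
    by simp
qed

lemma hpd_cong:
  assumes "hpd S v f f'" "\<And>x. x \<in> S \<Longrightarrow> f x = g x" "\<And>x. x \<in> S \<Longrightarrow> f' x = g' x"
  shows "hpd S v g g'"
  unfolding hpd_def
proof
  fix x assume x: "x \<in> S"
  have "((\<lambda>h. f (x + h *\<^sub>R v)) has_real_derivative g' x) (at 0 within {h. x + h *\<^sub>R v \<in> S})"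
    using assms(1,3) x by (auto simp: hpd_def)
  then show "((\<lambda>h. g (x + h *\<^sub>R v)) has_real_derivative g' x) (at 0 within {h. x + h *\<^sub>R v \<in> S})"
    unfolding has_field_derivative_def
    by (rule has_derivative_transform[rotated 2]) (use assms(2) x in auto)
qed

text \<open>The factor may be negative: at the far face of a closed box a coordinate direction
  leaves the box and only its opposite can be followed.\<close>

lemma hpd_scale:
  assumes "hpd S v f f'"
  shows "hpd S (c *\<^sub>R v) f (\<lambda>x. c * f' x)"
  unfolding hpd_def
proof
  fix x assume x: "x \<in> S"
  have "((\<lambda>h. f (x + h *\<^sub>R v)) has_real_derivative f' x) (at 0 within {h. x + h *\<^sub>R v \<in> S})"
    using assms x by (auto simp: hpd_def)
  then have "((\<lambda>h. f (x + h *\<^sub>R v)) has_real_derivative f' x)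
      (at (0*c) within (\<lambda>h. h * c) ` {h. x + h *\<^sub>R (c *\<^sub>R v) \<in> S})"
    by (auto elim!: has_field_derivative_subset)
  moreover have "((\<lambda>h. h * c) has_real_derivative c) (at 0 within {h. x + h *\<^sub>R (c *\<^sub>R v) \<in> S})"
    by (auto intro!: derivative_eq_intros)
  ultimately have "((\<lambda>h. f (x + h *\<^sub>R v)) \<circ> (\<lambda>h. h * c) has_real_derivative f' x * c)
     (at 0 within {h. x + h *\<^sub>R c *\<^sub>R v \<in> S})"
    by (rule DERIV_image_chain)
  then
  show "((\<lambda>h. f (x + h *\<^sub>R c *\<^sub>R v)) has_real_derivative c * f' x)
     (at 0 within {h. x + h *\<^sub>R c *\<^sub>R v \<in> S})"
    by (simp add: o_def mult.commute)
qed

lemma hpd_line: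
  assumes "hpd S v f f'" "\<And>s. s \<in> I \<Longrightarrow> x + s *\<^sub>R v \<in> S" "s \<in> I"
  shows "((\<lambda>s. f (x + s *\<^sub>R v)) has_real_derivative f' (x + s *\<^sub>R v)) (at s within I)"
proof -
  have "((\<lambda>h. f (x + s *\<^sub>R v + h *\<^sub>R v)) has_real_derivative f' (x + s *\<^sub>R v))
     (at 0 within {h. x + s *\<^sub>R v + h *\<^sub>R v \<in> S})"
    using assms by (auto simp: hpd_def)
  moreover have "(\<lambda>h. h - s) ` I \<subseteq> {h. x + s *\<^sub>R v + h *\<^sub>R v \<in> S}"
    using assms(2) by (auto simp: algebra_simps)
  ultimately have *: "((\<lambda>h. f (x + s *\<^sub>R v + h *\<^sub>R v)) has_real_derivative f' (x + s *\<^sub>R v))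
     (at (s - s) within (\<lambda>h. h - s) ` I)"
    by (simp add: has_field_derivative_subset)
  have "((\<lambda>h. h - s) has_real_derivative 1) (at s within I)"
    by (auto intro!: derivative_eq_intros)
  from DERIV_image_chain[OF * this]
  show ?thesis by (simp add: o_def algebra_simps)
qed

text \<open>Bridge from the relation \<open>hpd\<close>, for which sum, product and chain rules
  compose, to the function \<open>pd\<close>. The latter is a choice among derivatives, so the
  filter must be nontrivial: at an isolated parameter value every number is a derivative.\<close>

lemma pd_eq:
  assumes "hpd S v f f'" "x \<in> S" "at 0 within {h. x + h *\<^sub>R v \<in> S} \<noteq> bot"
  shows "pd S v f x = f' x"
  unfolding pd_def
  by (rule vector_derivative_within) (use assms in \<open>auto simp: hpd_def has_real_derivative_iff_has_vector_derivative\<close>)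

lemma hpd_unique:
  assumes "hpd S v f f'" "hpd S v f f''" "x \<in> S" "at 0 within {h. x + h *\<^sub>R v \<in> S} \<noteq> bot"
  shows "f' x = f'' x"
  using pd_eq[OF assms(1) assms(3,4)] pd_eq[OF assms(2) assms(3,4)] by simp

lemma pd_cong:
  assumes "\<And>x. x \<in> S \<Longrightarrow> f x = g x" "x \<in> S"
  shows "pd S v f x = pd S v g x"
  unfolding pd_def vector_derivative_def
proof (rule arg_cong[where f=Eps], rule ext)
  fix f'
  show "((\<lambda>h. f (x + h *\<^sub>R v)) has_vector_derivative f') (at 0 within {h. x + h *\<^sub>R v \<in> S}) =
        ((\<lambda>h. g (x + h *\<^sub>R v)) has_vector_derivative f') (at 0 within {h. x + h *\<^sub>R v \<in> S})"
    by (rule has_vector_derivative_cong_ev) (use assms in \<open>auto simp: eventually_nhds intro!: exI[of _ UNIV]\<close>)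
qed

section \<open>Symmetry of mixed derivatives up to the boundary\<close>

text \<open>Stated at the corner of a square, because at a boundary point of a closed box each
  direction can be followed to one side only. The mixed difference of \<open>F\<close> over a square
  of side \<open>h\<close> is written by the mean value theorem as \<open>h^2\<close> times a value
  of \<open>Fst\<close> and also as \<open>h^2\<close> times a value of \<open>Fts\<close>; for
  \<open>h\<close> tending to 0 continuity identifies both limits.\<close>

lemma clairaut_unit_square:
  fixes F Fs Ft Fst Fts :: "real \<Rightarrow> real \<Rightarrow> real"
  assumes ds: "\<And>s t. s \<in> {0..1} \<Longrightarrow> t \<in> {0..1} \<Longrightarrow> ((\<lambda>s. F s t) has_real_derivative Fs s t) (at s within {0..1})"
    and dt: "\<And>s t. s \<in> {0..1} \<Longrightarrow> t \<in> {0..1} \<Longrightarrow> ((\<lambda>t. F s t) has_real_derivative Ft s t) (at t within {0..1})"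
    and dst: "\<And>s t. s \<in> {0..1} \<Longrightarrow> t \<in> {0..1} \<Longrightarrow> ((\<lambda>t. Fs s t) has_real_derivative Fst s t) (at t within {0..1})"
    and dts: "\<And>s t. s \<in> {0..1} \<Longrightarrow> t \<in> {0..1} \<Longrightarrow> ((\<lambda>s. Ft s t) has_real_derivative Fts s t) (at s within {0..1})"
    and cst: "continuous_on ({0..1} \<times> {0..1}) (\<lambda>(s, t). Fst s t)"
    and cts: "continuous_on ({0..1} \<times> {0..1}) (\<lambda>(s, t). Fts s t)"
  shows "Fst 0 0 = Fts 0 0"
proof -
  have mv: "\<exists>\<xi>\<in>{0<..<h}. f h - f 0 = f' \<xi> * h"
    if "0 < h" "h \<le> 1" "\<And>s. s \<in> {0..1} \<Longrightarrow> (f has_real_derivative f' s) (at s within {0..1})"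
    for f f' and h :: real
  proof -
    have "\<exists>\<xi>\<in>{0<..<h}. f h - f 0 = (\<lambda>u. f' \<xi> * u) (h - 0)"
    proof (rule mvt_simple)
      fix s assume "0 \<le> s" "s \<le> h"
      then have "(f has_real_derivative f' s) (at s within {0..h})"
        using that by (intro has_field_derivative_subset[OF that(3)]) auto
      then show "(f has_derivative (\<lambda>u. f' s * u)) (at s within {0..h})"
        by (simp add: has_field_derivative_def)
    qed (use that in auto)
    then show ?thesis by simp
  qed
  have ex: "\<exists>p q. p \<in> {0..h} \<times> {0..h} \<and> q \<in> {0..h} \<times> {0..h} \<and> (\<lambda>(s, t). Fst s t) p = (\<lambda>(s, t). Fts s t) q"
    if h: "0 < h" "h \<le> 1" for h :: real
  proof -
    have "\<exists>\<xi>\<in>{0<..<h}. (F h h - F h 0) - (F 0 h - F 0 0) = (Fs \<xi> h - Fs \<xi> 0) * h"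
      using h by (intro mv[of h "\<lambda>s. F s h - F s 0"] DERIV_diff ds) auto
    then obtain \<xi> where \<xi>: "\<xi> \<in> {0<..<h}" "(F h h - F h 0) - (F 0 h - F 0 0) = (Fs \<xi> h - Fs \<xi> 0) * h" by blast
    have "\<exists>\<eta>\<in>{0<..<h}. Fs \<xi> h - Fs \<xi> 0 = Fst \<xi> \<eta> * h"
      using h \<xi> by (intro mv[of h "\<lambda>t. Fs \<xi> t"] dst) auto
    then obtain \<eta> where \<eta>: "\<eta> \<in> {0<..<h}" "Fs \<xi> h - Fs \<xi> 0 = Fst \<xi> \<eta> * h" by blast
    have "\<exists>\<xi>\<in>{0<..<h}. (F h h - F 0 h) - (F h 0 - F 0 0) = (Ft h \<xi> - Ft 0 \<xi>) * h"
      using h by (intro mv[of h "\<lambda>t. F h t - F 0 t"] DERIV_diff dt) auto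
    then obtain \<xi>' where \<xi>': "\<xi>' \<in> {0<..<h}" "(F h h - F 0 h) - (F h 0 - F 0 0) = (Ft h \<xi>' - Ft 0 \<xi>') * h" by blast
    have "\<exists>\<eta>\<in>{0<..<h}. Ft h \<xi>' - Ft 0 \<xi>' = Fts \<eta> \<xi>' * h"
      using h \<xi>' by (intro mv[of h "\<lambda>s. Ft s \<xi>'"] dts) auto
    then obtain \<eta>' where \<eta>': "\<eta>' \<in> {0<..<h}" "Ft h \<xi>' - Ft 0 \<xi>' = Fts \<eta>' \<xi>' * h" by blast
    have "Fst \<xi> \<eta> * h * h = Fts \<eta>' \<xi>' * h * h"
      using \<xi>(2) \<eta>(2) \<xi>'(2) \<eta>'(2) by (simp add: algebra_simps)
    then have "Fst \<xi> \<eta> = Fts \<eta>' \<xi>'" using h by simp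
    then show ?thesis using \<xi> \<eta> \<xi>' \<eta>'
      by (intro exI[of _ "(\<xi>, \<eta>)"] exI[of _ "(\<eta>', \<xi>')"]) auto
  qed
  define hh where "hh n = 1 / real (Suc n)" for n
  have "\<forall>n. \<exists>p q. p \<in> {0..hh n} \<times> {0..hh n} \<and> q \<in> {0..hh n} \<times> {0..hh n} \<and> (\<lambda>(s, t). Fst s t) p = (\<lambda>(s, t). Fts s t) q"
    using ex by (auto simp: hh_def)
  then obtain p q where pq: "\<And>n. p n \<in> {0..hh n} \<times> {0..hh n}" "\<And>n. q n \<in> {0..hh n} \<times> {0..hh n}"
     "\<And>n. (\<lambda>(s, t). Fst s t) (p n) = (\<lambda>(s, t). Fts s t) (q n)"
    by metis
  have hh0: "hh \<longlonglongrightarrow> 0" unfolding hh_def by (rule LIMSEQ_Suc[OF lim_1_over_n])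
  have lim: "r \<longlonglongrightarrow> (0, 0)" if "\<And>n. r n \<in> {0..hh n} \<times> {0..hh n}" for r :: "nat \<Rightarrow> real \<times> real"
  proof -
    have "(\<lambda>n. fst (r n)) \<longlonglongrightarrow> 0"
      by (rule tendsto_sandwich[OF _ _ tendsto_const hh0]) (use that in \<open>auto simp: mem_Times_iff\<close>)
    moreover have "(\<lambda>n. snd (r n)) \<longlonglongrightarrow> 0"
      by (rule tendsto_sandwich[OF _ _ tendsto_const hh0]) (use that in \<open>auto simp: mem_Times_iff\<close>)
    ultimately have "(\<lambda>n. (fst (r n), snd (r n))) \<longlonglongrightarrow> (0, 0)" by (rule tendsto_Pair)
    then show ?thesis by simp
  qed
  have sub: "r n \<in> {0..1} \<times> {0..1}" if "\<And>n. r n \<in> {0..hh n} \<times> {0..hh n}" for r :: "nat \<Rightarrow> real \<times> real" and n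
  proof -
    have "hh n \<le> 1" by (auto simp: hh_def)
    then show ?thesis using that[of n] by (auto simp: mem_Times_iff)
  qed
  have 1: "(\<lambda>n. (\<lambda>(s, t). Fst s t) (p n)) \<longlonglongrightarrow> (\<lambda>(s, t). Fst s t) (0, 0)"
    by (rule continuous_on_tendsto_compose[OF cst lim[of p]]) (use pq(1) sub[of p] in auto)
  have 2: "(\<lambda>n. (\<lambda>(s, t). Fts s t) (q n)) \<longlonglongrightarrow> (\<lambda>(s, t). Fts s t) (0, 0)"
    by (rule continuous_on_tendsto_compose[OF cts lim[of q]]) (use pq(2) sub[of q] in auto)
  show ?thesis using LIMSEQ_unique[OF 1] 2 pq(3) by simp
qed

text \<open>The unit square is mapped to the parallelogram spanned by \<open>a v\<close> and
  \<open>b w\<close>; sign and size of \<open>a\<close> and \<open>b\<close> are free, so that it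
  can be placed inside \<open>S\<close> from any point of a box.\<close>

lemma hpd_commute:
  assumes f: "hpd S v f fv" "hpd S w f fw" "hpd S w fv fvw" "hpd S v fw fwv"
    and c: "continuous_on S fvw" "continuous_on S fwv"
    and ab: "a \<noteq> 0" "b \<noteq> 0"
      "\<And>s t. s \<in> {0..1} \<Longrightarrow> t \<in> {0..1} \<Longrightarrow> x + (s * a) *\<^sub>R v + (t * b) *\<^sub>R w \<in> S"
  shows "fvw x = fwv x"
proof -
  define p where "p s t = x + s *\<^sub>R (a *\<^sub>R v) + t *\<^sub>R (b *\<^sub>R w)" for s t
  have pS: "p s t \<in> S" if "s \<in> {0..1}" "t \<in> {0..1}" for s t
    using ab(3)[OF that] by (simp add: p_def)
  have p1: "p s t = (x + t *\<^sub>R (b *\<^sub>R w)) + s *\<^sub>R (a *\<^sub>R v)" for s t by (simp add: p_def)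
  have p2: "p s t = (x + s *\<^sub>R (a *\<^sub>R v)) + t *\<^sub>R (b *\<^sub>R w)" for s t by (simp add: p_def)
  have cp: "continuous_on ({0..1} \<times> {0..1}) (\<lambda>z. g (p (fst z) (snd z)))" if "continuous_on S g" for g :: "_ \<Rightarrow> real"
  proof (rule continuous_on_compose2[OF that])
    show "continuous_on ({0..1} \<times> {0..1}) (\<lambda>z. p (fst z) (snd z))"
      unfolding p_def by (intro continuous_intros)
  qed (use pS in auto)
  have "b * (a * fvw (p 0 0)) = a * (b * fwv (p 0 0))"
  proof (rule clairaut_unit_square[where F="\<lambda>s t. f (p s t)" and Fs="\<lambda>s t. a * fv (p s t)"
        and Ft="\<lambda>s t. b * fw (p s t)" and Fst="\<lambda>s t. b * (a * fvw (p s t))" and Fts="\<lambda>s t. a * (b * fwv (p s t))"])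
    fix s t :: real assume st: "s \<in> {0..1}" "t \<in> {0..1}"
    show "((\<lambda>s. f (p s t)) has_real_derivative a * fv (p s t)) (at s within {0..1})"
      unfolding p1 by (rule hpd_line[OF hpd_scale[OF f(1)]]) (use pS st in \<open>auto simp del: scaleR_scaleR simp: p1[symmetric]\<close>)
    show "((\<lambda>t. f (p s t)) has_real_derivative b * fw (p s t)) (at t within {0..1})"
      unfolding p2 by (rule hpd_line[OF hpd_scale[OF f(2)]]) (use pS st in \<open>auto simp del: scaleR_scaleR simp: p2[symmetric]\<close>)
    show "((\<lambda>t. a * fv (p s t)) has_real_derivative b * (a * fvw (p s t))) (at t within {0..1})"
      unfolding p2 by (rule hpd_line[OF hpd_scale[OF hpd_cmult[OF f(3)]]]) (use pS st in \<open>auto simp del: scaleR_scaleR simp: p2[symmetric]\<close>)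
    show "((\<lambda>s. b * fw (p s t)) has_real_derivative a * (b * fwv (p s t))) (at s within {0..1})"
      unfolding p1 by (rule hpd_line[OF hpd_scale[OF hpd_cmult[OF f(4)]]]) (use pS st in \<open>auto simp del: scaleR_scaleR simp: p1[symmetric]\<close>)
  qed (use cp[OF c(1)] cp[OF c(2)] in \<open>auto simp: case_prod_beta intro!: continuous_intros\<close>)
  then show ?thesis using ab by (simp add: p_def)
qed

section \<open>Integrals over boxes, slices and faces\<close>

definition slice_pt :: "'n::finite \<Rightarrow> real \<Rightarrow> ('n \<Rightarrow> real) \<Rightarrow> (real, 'n) vec" where
  "slice_pt i r y = (\<chi> j. if j = i then r else y j)"

lemma slice_pt_nth [simp]: "slice_pt i r y $ j = (if j = i then r else y j)"
  by (simp add: slice_pt_def)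

lemma mem_box_slice_pt:
  "slice_pt i r y \<in> box l u \<longleftrightarrow> (\<forall>j\<in>UNIV - {i}. y j \<in> {l $ j<..<u $ j}) \<and> r \<in> {l $ i<..<u $ i}"
  unfolding mem_box_cart by (auto simp: split: if_splits)

lemma measurable_slice_pt [measurable]:
  "(\<lambda>(y, r). slice_pt i r y) \<in> (\<Pi>\<^sub>M j\<in>UNIV - {i}. lborel) \<Otimes>\<^sub>M lborel \<rightarrow>\<^sub>M (borel :: (real, 'n::finite) vec measure)"
proof (subst borel_measurable_euclidean_space, safe)
  fix b :: "(real, 'n) vec" assume "b \<in> Basis"
  then obtain j where j: "b = axis j 1" by (auto simp: Basis_vec_def)
  have "(\<lambda>x. (case x of (y, r) \<Rightarrow> slice_pt i r y) \<bullet> b) = (\<lambda>x. if j = i then snd x else fst x j)"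
    by (auto simp: j slice_pt_def inner_axis split_beta)
  also have "\<dots> \<in> borel_measurable ((\<Pi>\<^sub>M j\<in>UNIV - {i}. lborel) \<Otimes>\<^sub>M lborel)"
  proof (cases "j = i")
    case False
    then have "(\<lambda>x. fst x j) \<in> borel_measurable ((\<Pi>\<^sub>M j\<in>UNIV - {i}. lborel) \<Otimes>\<^sub>M (lborel :: real measure))"
      by (intro measurable_compose[OF measurable_fst] measurable_component_singleton[where M="\<lambda>_. lborel", simplified]) auto
    then show ?thesis using False by simp
  qed auto
  finally show "(\<lambda>x. (case x of (y, r) \<Rightarrow> slice_pt i r y) \<bullet> b) \<in> borel_measurable ((\<Pi>\<^sub>M j\<in>UNIV - {i}. lborel) \<Otimes>\<^sub>M lborel)" .
qed

lemma sigma_finite_PiM_lborel: "finite I \<Longrightarrow> sigma_finite_measure (\<Pi>\<^sub>M j\<in>I. (lborel :: real measure))"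
  by (intro product_sigma_finite.sigma_finite) (auto simp: product_sigma_finite_def sigma_finite_lborel)

text \<open>Lebesgue measure is determined by its values on boxes, and under \<open>slice_pt\<close>
  a box corresponds to a box in the other coordinates times an interval. For \<open>n = 1\<close>
  the product over the empty index set is a point mass, so that one argument serves all
  dimensions.\<close>

lemma lborel_eq_slices:
  "(lborel :: (real, 'n::finite) vec measure) =
     distr ((\<Pi>\<^sub>M j\<in>UNIV - {i}. lborel) \<Otimes>\<^sub>M lborel) borel (\<lambda>(y, r). slice_pt i r y)"
proof (rule lborel_eqI)
  fix l u :: "(real, 'n) vec"
  assume le: "\<And>b. b \<in> Basis \<Longrightarrow> l \<bullet> b \<le> u \<bullet> b"
  have le': "l $ j \<le> u $ j" for j using le[of "axis j 1"] by (simp add: axis_in_Basis_iff inner_axis)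
  interpret P: product_sigma_finite "\<lambda>_::'n. lborel :: real measure"
    by (auto simp: product_sigma_finite_def sigma_finite_lborel)
  let ?P = "\<Pi>\<^sub>M j\<in>UNIV - {i}. lborel :: real measure"
  have "(\<lambda>(y, r). slice_pt i r y) -` box l u \<inter> space (?P \<Otimes>\<^sub>M lborel) =
     (\<Pi>\<^sub>E j\<in>UNIV - {i}. {l $ j<..<u $ j}) \<times> {l $ i<..<u $ i}"
  proof -
    have "p \<in> (\<lambda>(y, r). slice_pt i r y) -` box l u \<inter> space (?P \<Otimes>\<^sub>M lborel) \<longleftrightarrow>
       p \<in> (\<Pi>\<^sub>E j\<in>UNIV - {i}. {l $ j<..<u $ j}) \<times> {l $ i<..<u $ i}" for p
      unfolding space_pair_measure space_PiM
      by (cases p) (simp add: mem_box_slice_pt PiE_iff, blast)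
    then show ?thesis by blast
  qed
  then have "emeasure (distr (?P \<Otimes>\<^sub>M lborel) borel (\<lambda>(y, r). slice_pt i r y)) (box l u) =
     emeasure (?P \<Otimes>\<^sub>M lborel) ((\<Pi>\<^sub>E j\<in>UNIV - {i}. {l $ j<..<u $ j}) \<times> {l $ i<..<u $ i})"
    by (simp add: emeasure_distr)
  also have "\<dots> = emeasure ?P (\<Pi>\<^sub>E j\<in>UNIV - {i}. {l $ j<..<u $ j}) * emeasure lborel {l $ i<..<u $ i}"
    by (intro lborel.emeasure_pair_measure_Times) auto
  also have "\<dots> = (\<Prod>j\<in>UNIV - {i}. ennreal (u $ j - l $ j)) * ennreal (u $ i - l $ i)"
    by (subst P.emeasure_PiM) (auto simp: le')
  also have "\<dots> = (\<Prod>j\<in>UNIV. ennreal (u $ j - l $ j))"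
    by (subst (2) prod.remove[of _ i]) (auto simp: mult.commute)
  also have "\<dots> = ennreal (\<Prod>j\<in>UNIV. u $ j - l $ j)"
    by (rule prod_ennreal) (use le' in auto)
  also have "(\<Prod>j\<in>UNIV. u $ j - l $ j) = (\<Prod>b\<in>Basis. (u - l) \<bullet> b)"
  proof -
    have "(Basis :: (real, 'n) vec set) = (\<lambda>j. axis j 1) ` UNIV" by (auto simp: Basis_vec_def)
    moreover have "inj (\<lambda>j::'n. axis j (1::real))" by (auto simp: inj_on_def axis_eq_axis)
    ultimately have "(\<Prod>b\<in>Basis. (u - l) \<bullet> b) = (\<Prod>j\<in>UNIV. (u - l) \<bullet> axis j 1)"
      by (metis (no_types, lifting) prod.reindex_cong)
    then show ?thesis by (simp add: inner_axis)
  qed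
  finally show "emeasure (distr (?P \<Otimes>\<^sub>M lborel) borel (\<lambda>(y, r). slice_pt i r y)) (box l u) =
      ennreal (\<Prod>b\<in>Basis. (u - l) \<bullet> b)" .
qed simp

lemma Omega_box: "Omega A = box (- A) A"
  by (auto simp: Omega_def mem_box_cart)

lemma open_Omega [simp]: "open (Omega A)" by (simp add: Omega_box open_box)

definition slice_measure :: "(real, 'n::finite) vec \<Rightarrow> 'n \<Rightarrow> ('n \<Rightarrow> real) measure" where
  "slice_measure A i = restrict_space (\<Pi>\<^sub>M j\<in>UNIV - {i}. lborel) (\<Pi>\<^sub>E j\<in>UNIV - {i}. {- A $ j <..< A $ j})"

lemma sets_slice_box: "(\<Pi>\<^sub>E j\<in>UNIV - {i}. {- A $ j <..< A $ j}) \<in> sets (\<Pi>\<^sub>M j\<in>UNIV - {i::'n::finite}. (lborel::real measure))"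
  by (intro sets_PiM_I_finite) auto

lemma space_slice_measure: "space (slice_measure A i) = (\<Pi>\<^sub>E j\<in>UNIV - {i}. {- A $ j <..< A $ j})"
  by (auto simp: slice_measure_def space_restrict_space space_PiM)

lemma slice_integral_eq: "slice_integral A i r g = (LINT y|slice_measure A i. g (slice_pt i r y))"
  unfolding slice_integral_def slice_measure_def set_lebesgue_integral_def slice_pt_def[symmetric]
  by (subst integral_restrict_space) (use sets_slice_box[of i A] in \<open>auto simp: sets.Int_space_eq2\<close>)

lemma finite_slice_measure: "finite_measure (slice_measure A i)"
proof
  interpret P: product_sigma_finite "\<lambda>_::'n. lborel :: real measure"
    by (auto simp: product_sigma_finite_def sigma_finite_lborel)
  have "emeasure (slice_measure A i) (space (slice_measure A i)) =
      emeasure (\<Pi>\<^sub>M j\<in>UNIV - {i}. lborel) (\<Pi>\<^sub>E j\<in>UNIV - {i}. {- A $ j <..< A $ j})"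
    unfolding space_slice_measure unfolding slice_measure_def
    by (subst emeasure_restrict_space) (use sets_slice_box[of i A] in \<open>auto simp: sets.Int_space_eq2\<close>)
  also have "\<dots> = (\<Prod>j\<in>UNIV - {i}. emeasure lborel {- A $ j <..< A $ j})"
    by (rule P.emeasure_PiM) auto
  also have "\<dots> < \<infinity>"
  proof -
    have "emeasure lborel {- A $ j <..< A $ j} < top" for j
      using emeasure_bounded_finite[of "{- A $ j <..< A $ j}"] by simp
    then have "\<exists>j\<in>UNIV - {i}. emeasure lborel {- A $ j <..< A $ j} = top \<Longrightarrow> False"
      by (metis less_irrefl)
    then show ?thesis
      by (auto simp only: less_top[symmetric] ennreal_prod_eq_top infinity_ennreal_def)
  qed
  finally show "emeasure (slice_measure A i) (space (slice_measure A i)) \<noteq> \<infinity>" by simp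
qed

section \<open>Positive linear functionals on continuous functions\<close>

text \<open>The integrals over the box, the cylinder, a slice or a face and their weighted variants
  all have these three properties on continuous functions. Finite sums, comparison and the
  Cauchy-Schwarz inequality are thus derived once, without integrability arguments at each
  use.\<close>

locale posfun =
  fixes K :: "'a::topological_space set" and L :: "('a \<Rightarrow> real) \<Rightarrow> real"
  assumes L_add: "continuous_on K f \<Longrightarrow> continuous_on K g \<Longrightarrow> L (\<lambda>x. f x + g x) = L f + L g"
    and L_cmult: "continuous_on K f \<Longrightarrow> L (\<lambda>x. c * f x) = c * L f"
    and L_mono: "continuous_on K f \<Longrightarrow> continuous_on K g \<Longrightarrow> (\<And>x. x \<in> K \<Longrightarrow> f x \<le> g x) \<Longrightarrow> L f \<le> L g"
begin

lemma L_cong: "continuous_on K f \<Longrightarrow> (\<And>x. x \<in> K \<Longrightarrow> f x = g x) \<Longrightarrow> L f = L g"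
  using L_mono[of f g] L_mono[of g f] continuous_on_cong[of K K f g] by (auto intro!: antisym)

lemma L_zero: "L (\<lambda>x. 0) = 0"
  using L_cmult[of "\<lambda>x. 0" 0] by simp

lemma L_diff:
  assumes "continuous_on K f" "continuous_on K g" shows "L (\<lambda>x. f x - g x) = L f - L g"
proof -
  have "L (\<lambda>x. f x + (-1) * g x) = L f + L (\<lambda>x. (-1) * g x)"
    by (intro L_add assms continuous_intros)
  also have "L (\<lambda>x. (-1) * g x) = (-1) * L g" by (intro L_cmult assms)
  finally show ?thesis by simp
qed

lemma L_sum:
  assumes "finite I" "\<And>i. i \<in> I \<Longrightarrow> continuous_on K (f i)"
  shows "L (\<lambda>x. \<Sum>i\<in>I. f i x) = (\<Sum>i\<in>I. L (f i))"
  using assms by (induction I rule: finite_induct) (auto simp: L_zero L_add continuous_on_sum)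

lemma L_nonneg: "continuous_on K f \<Longrightarrow> (\<And>x. x \<in> K \<Longrightarrow> 0 \<le> f x) \<Longrightarrow> 0 \<le> L f"
  using L_mono[of "\<lambda>x. 0" f] by (simp add: L_zero)

lemma L_abs_le:
  assumes "continuous_on K f" "continuous_on K g" "\<And>x. x \<in> K \<Longrightarrow> \<bar>f x\<bar> \<le> g x"
  shows "\<bar>L f\<bar> \<le> L g"
proof -
  have "L f \<le> L g" using assms by (intro L_mono) (auto dest: abs_le_D1)
  moreover have "L (\<lambda>x. (-1) * f x) \<le> L g"
    using assms by (intro L_mono continuous_intros) (auto dest: abs_le_D2)
  ultimately show ?thesis using L_cmult[OF assms(1), of "-1"] by linarith
qed

lemma L_const: "L (\<lambda>x. c) = c * L (\<lambda>x. 1)"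
  using L_cmult[of "\<lambda>x. 1" c] by simp

text \<open>Cauchy-Schwarz against the constant 1: \<open>L ((s - f)^2)\<close> is nonnegative for
  every real \<open>s\<close>, and the best choice is \<open>s = L f / L 1\<close>.\<close>

lemma L_square_le:
  assumes f: "continuous_on K f"
  shows "(L f)^2 \<le> L (\<lambda>x. 1) * L (\<lambda>x. (f x)^2)"
proof -
  have p: "0 \<le> L (\<lambda>x. 1)" by (intro L_nonneg) auto
  have key: "2 * s * L f \<le> s^2 * L (\<lambda>x. 1) + L (\<lambda>x. (f x)^2)" for s
  proof -
    have "L (\<lambda>x. (2 * s) * f x) \<le> L (\<lambda>x. s^2 * 1 + (f x)^2)"
      using sum_squares_bound[of s]
      by (intro L_mono continuous_intros f) (auto simp: mult.assoc)
    also have "\<dots> = L (\<lambda>x. s^2 * 1) + L (\<lambda>x. (f x)^2)" by (intro L_add continuous_intros f)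
    also have "L (\<lambda>x. s^2 * 1) = s^2 * L (\<lambda>x. 1)" by (intro L_cmult continuous_intros)
    finally show ?thesis using L_cmult[OF f, of "2 * s"] by simp
  qed
  show ?thesis
  proof (cases "L (\<lambda>x. 1) = 0")
    case True
    have "L f = 0"
    proof (rule ccontr)
      assume "L f \<noteq> 0"
      \<comment> \<open>If \<open>L 1 = 0\<close>, the inequality \<open>key\<close> is linear in
        \<open>s\<close>; this value of \<open>s\<close> violates it as soon as \<open>L f\<close>
        is nonzero.\<close>
      define s where "s = (L (\<lambda>x. (f x)^2) + 1) / (2 * L f)"
      have "s * (2 * L f) = L (\<lambda>x. (f x)^2) + 1"
        using \<open>L f \<noteq> 0\<close> by (simp add: s_def del: distrib_left_numeral)
      then show False using key[of s] True by (simp add: mult_ac)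
    qed
    then show ?thesis using True by simp
  next
    case False
    then show ?thesis using key[of "L f / L (\<lambda>x. 1)"] p
      by (simp add: field_simps power2_eq_square)
  qed
qed

end

section \<open>Integrals depending on a parameter\<close>

lemma (in finite_measure) continuous_on_integral_param:
  fixes H :: "'p::metric_space \<Rightarrow> 'a \<Rightarrow> real"
  assumes c: "\<And>y. y \<in> space M \<Longrightarrow> continuous_on S (\<lambda>p. H p y)"
    and m: "\<And>p. p \<in> S \<Longrightarrow> H p \<in> borel_measurable M"
    and b: "\<And>p y. p \<in> S \<Longrightarrow> y \<in> space M \<Longrightarrow> \<bar>H p y\<bar> \<le> C"
  shows "continuous_on S (\<lambda>p. \<integral>y. H p y \<partial>M)"
  unfolding continuous_on_sequentially
proof safe
  fix p :: "nat \<Rightarrow> 'p" and a assume p: "a \<in> S" "\<forall>n. p n \<in> S" "p \<longlonglongrightarrow> a"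
  show "((\<lambda>p. \<integral>y. H p y \<partial>M) \<circ> p) \<longlonglongrightarrow> (\<integral>y. H a y \<partial>M)"
    unfolding o_def
  proof (rule integral_dominated_convergence[where w="\<lambda>_. C"])
    show "AE y in M. (\<lambda>n. H (p n) y) \<longlonglongrightarrow> H a y"
      using c p unfolding continuous_on_sequentially by (auto simp: o_def)
  qed (use p m b in auto)
qed

text \<open>Dominated convergence for the difference quotients. On the convex set \<open>I\<close>
  the mean value inequality bounds them by \<open>C\<close>, which is integrable as the measure is
  finite.\<close>

lemma (in finite_measure) has_real_derivative_integral_param:
  fixes H :: "real \<Rightarrow> 'a \<Rightarrow> real"
  assumes d: "\<And>y s. y \<in> space M \<Longrightarrow> s \<in> I \<Longrightarrow> ((\<lambda>s. H s y) has_real_derivative H' s y) (at s within I)"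
    and I: "convex I" "a \<in> I"
    and m: "\<And>s. s \<in> I \<Longrightarrow> H s \<in> borel_measurable M"
    and b0: "\<And>s y. s \<in> I \<Longrightarrow> y \<in> space M \<Longrightarrow> \<bar>H s y\<bar> \<le> C0"
    and b: "\<And>s y. s \<in> I \<Longrightarrow> y \<in> space M \<Longrightarrow> \<bar>H' s y\<bar> \<le> C"
    and m': "H' a \<in> borel_measurable M"
  shows "((\<lambda>s. \<integral>y. H s y \<partial>M) has_real_derivative (\<integral>y. H' a y \<partial>M)) (at a within I)"
  unfolding has_field_derivative_iff tendsto_at_iff_sequentially
proof safe
  fix p :: "nat \<Rightarrow> real" assume p: "\<forall>n. p n \<in> I - {a}" "p \<longlonglongrightarrow> a"
  have int: "integrable M (H s)" if "s \<in> I" for s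
    using that m b0 by (intro integrable_const_bound[where B=C0]) auto
  have "(\<lambda>n. \<integral>y. (H (p n) y - H a y) / (p n - a) \<partial>M) \<longlonglongrightarrow> (\<integral>y. H' a y \<partial>M)"
  proof (rule integral_dominated_convergence[where w="\<lambda>_. C"])
    show "AE y in M. (\<lambda>n. (H (p n) y - H a y) / (p n - a)) \<longlonglongrightarrow> H' a y"
    proof (rule AE_I2)
      fix y assume "y \<in> space M"
      from d[OF this I(2)] show "(\<lambda>n. (H (p n) y - H a y) / (p n - a)) \<longlonglongrightarrow> H' a y"
        using p unfolding has_field_derivative_iff tendsto_at_iff_sequentially by (auto simp: o_def)
    qed
    show "AE y in M. norm ((H (p n) y - H a y) / (p n - a)) \<le> C" for n
    proof (rule AE_I2)
      fix y assume y: "y \<in> space M"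
      have "norm (H (p n) y - H a y) \<le> C * norm (p n - a)"
        by (rule field_differentiable_bound[OF I(1) d[OF y]]) (use b y p I in auto)
      then show "norm ((H (p n) y - H a y) / (p n - a)) \<le> C"
        using p by (auto simp: field_simps)
    qed
    show "(\<lambda>y. (H (p n) y - H a y) / (p n - a)) \<in> borel_measurable M" for n
      using p m[of "p n"] m[OF I(2)] by auto
  qed (use m' in auto)
  also have "(\<lambda>n. \<integral>y. (H (p n) y - H a y) / (p n - a) \<partial>M) =
      (\<lambda>n. ((\<integral>y. H (p n) y \<partial>M) - (\<integral>y. H a y \<partial>M)) / (p n - a))"
    using p int I by (auto simp: Bochner_Integration.integral_diff)
  finally show "((\<lambda>s. ((\<integral>y. H s y \<partial>M) - (\<integral>y. H a y \<partial>M)) / (s - a)) \<circ> p) \<longlonglongrightarrow> (\<integral>y. H' a y \<partial>M)"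
    by (simp add: o_def)
qed

lemma integral_FTC_open:
  fixes f :: "real \<Rightarrow> real"
  assumes "a < b" "\<And>s. s \<in> {a..b} \<Longrightarrow> (F has_real_derivative f s) (at s within {a..b})" "continuous_on {a..b} f"
  shows "(LINT s:{a<..<b}|lborel. f s) = F b - F a"
proof -
  have "(LINT s:{a<..<b}|lborel. f s) = (LINT s:{a..b}|lborel. f s)"
    using assms(1)
    by (intro set_integral_discrete_difference[where X="{a, b}"]) auto
  also have "\<dots> = F b - F a"
    unfolding set_lebesgue_integral_def
    by (rule integral_FTC_Icc) (use assms in \<open>auto simp: has_real_derivative_iff_has_vector_derivative\<close>)
  finally show ?thesis .
qed

section \<open>Integrals over the box, the cylinder and its faces\<close>

definition IO :: "'n::{finite,wellorder} rvec \<Rightarrow> ('n rvec \<Rightarrow> real) \<Rightarrow> real" where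
  "IO A f = (LINT x:Omega A|lborel. f x)"

definition IQ :: "'n::{finite,wellorder} rvec \<Rightarrow> real \<Rightarrow> ('n rvec \<times> real \<Rightarrow> real) \<Rightarrow> real" where
  "IQ A T f = (LINT z:QT A T|lborel. f z)"

definition IB :: "'n::{finite,wellorder} rvec \<Rightarrow> real \<Rightarrow> 'n \<Rightarrow> real \<Rightarrow> ('n rvec \<times> real \<Rightarrow> real) \<Rightarrow> real" where
  "IB A T i \<sigma> f = (LINT t:{0<..<T}|lborel. slice_integral A i (\<sigma> * A $ i) (\<lambda>x. f (x, t)))"

lemma set_integrable_compact_open:
  fixes f :: "'a::euclidean_space \<Rightarrow> real"
  assumes "compact K" "continuous_on K f" "S \<subseteq> K" "S \<in> sets borel"
  shows "set_integrable lborel S f"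
proof -
  have "set_integrable lborel K f"
    using borel_integrable_compact[OF assms(1,2)] by (simp add: set_integrable_def indicator_def if_distrib cong: if_cong)
  then show ?thesis by (rule set_integrable_subset) (use assms in auto)
qed

lemma posfun_set_integral:
  fixes S :: "'a::euclidean_space set"
  assumes "compact K" "S \<subseteq> K" "S \<in> sets borel"
  shows "posfun K (\<lambda>f. LINT x:S|lborel. f x)"
proof
  note int = set_integrable_compact_open[OF assms(1) _ assms(2,3)]
  fix f g :: "'a \<Rightarrow> real" and c :: real assume f: "continuous_on K f"
  show "(LINT x:S|lborel. c * f x) = c * (LINT x:S|lborel. f x)" by simp
  assume g: "continuous_on K g"
  show "(LINT x:S|lborel. f x + g x) = (LINT x:S|lborel. f x) + (LINT x:S|lborel. g x)"
    by (intro set_integral_add int f g)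
  assume "\<And>x. x \<in> K \<Longrightarrow> f x \<le> g x"
  then show "(LINT x:S|lborel. f x) \<le> (LINT x:S|lborel. g x)"
    by (intro set_integral_mono int f g) (use assms in auto)
qed

locale boxdom =
  fixes A :: "'n::{finite,wellorder} rvec" and T :: real
  assumes A_pos: "0 < A $ i" and T_pos: "0 < T"
begin

abbreviation "cQ \<equiv> cQT A T"
abbreviation "contQ \<equiv> continuous_on cQ"
abbreviation "hpdQ \<equiv> hpd cQ"
abbreviation "es \<equiv> e_space :: 'n \<Rightarrow> 'n rvec \<times> real"

lemma cOmega_cbox: "cOmega A = cbox (- A) A"
proof -
  have "0 \<in> box (- A) A" using A_pos by (auto simp: mem_box_cart)
  then show ?thesis unfolding cOmega_def Omega_box by (intro closure_box) auto
qed

lemma mem_cOmega: "x \<in> cOmega A \<longleftrightarrow> (\<forall>i. - A $ i \<le> x $ i \<and> x $ i \<le> A $ i)"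
  by (auto simp: cOmega_cbox mem_box_cart)

lemma cQT_eq: "cQ = cOmega A \<times> {0..T}"
  using T_pos by (simp add: cQT_def QT_def closure_Times cOmega_def)

lemma mem_cQT: "(x, t) \<in> cQ \<longleftrightarrow> x \<in> cOmega A \<and> 0 \<le> t \<and> t \<le> T"
  by (auto simp: cQT_eq)

lemma compact_cOmega: "compact (cOmega A)" by (simp add: cOmega_cbox compact_cbox)

lemma compact_cQT: "compact cQ"
  by (simp add: cQT_eq compact_Times compact_cOmega)

lemma Omega_sub: "Omega A \<subseteq> cOmega A" by (simp add: cOmega_def closure_subset)

lemma QT_sub: "QT A T \<subseteq> cQ" by (simp add: cQT_def closure_subset)

lemma open_QT: "open (QT A T)" by (auto simp: QT_def intro!: open_Times)

sublocale O: posfun "cOmega A" "IO A"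
  unfolding IO_def by (intro posfun_set_integral compact_cOmega Omega_sub) auto

sublocale Q: posfun "cQ" "IQ A T"
  unfolding IQ_def by (intro posfun_set_integral compact_cQT QT_sub borel_open open_QT)

lemma slice_pt_cOmega:
  assumes "r \<in> {- A $ i..A $ i}" "y \<in> space (slice_measure A i)"
  shows "slice_pt i r y \<in> cOmega A"
  unfolding mem_cOmega
proof
  fix j show "- A $ j \<le> slice_pt i r y $ j \<and> slice_pt i r y $ j \<le> A $ j"
    using assms by (cases "j = i") (auto simp: space_slice_measure PiE_iff less_imp_le)
qed

lemma cont_slice_bounded:
  fixes f :: "'n rvec \<Rightarrow> real"
  assumes "continuous_on (cOmega A) f"
  obtains C where "\<And>x. x \<in> cOmega A \<Longrightarrow> \<bar>f x\<bar> \<le> C"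
proof -
  have "bounded (f ` cOmega A)"
    using compact_continuous_image[OF assms compact_cOmega] by (rule compact_imp_bounded)
  then show ?thesis using that by (auto simp: bounded_iff)
qed

lemma measurable_cont_restrict:
  fixes f :: "'n rvec \<Rightarrow> real"
  assumes "continuous_on (cOmega A) f"
  shows "(\<lambda>x. indicator (cOmega A) x * f x) \<in> borel_measurable borel"
  using borel_measurable_continuous_on_indicator[OF _ assms] compact_cOmega
  by (simp add: compact_imp_closed)

lemma measurable_slice:
  fixes f :: "'n rvec \<Rightarrow> real"
  assumes f: "continuous_on (cOmega A) f" and r: "r \<in> {- A $ i..A $ i}"
  shows "(\<lambda>y. f (slice_pt i r y)) \<in> borel_measurable (slice_measure A i)"
proof -
  have "(\<lambda>y. (y, r)) \<in> slice_measure A i \<rightarrow>\<^sub>M (\<Pi>\<^sub>M j\<in>UNIV - {i}. lborel) \<Otimes>\<^sub>M lborel"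
    unfolding slice_measure_def by (intro measurable_Pair measurable_restrict_space1) auto
  from measurable_compose[OF this measurable_slice_pt]
  have "slice_pt i r \<in> slice_measure A i \<rightarrow>\<^sub>M borel" by simp
  from measurable_compose[OF this measurable_cont_restrict[OF f]]
  show ?thesis
    by (rule measurable_cong[THEN iffD1, rotated]) (use slice_pt_cOmega[OF r] in \<open>auto simp: indicator_def\<close>)
qed

lemma integrable_slice:
  fixes f :: "'n rvec \<Rightarrow> real"
  assumes f: "continuous_on (cOmega A) f" and r: "r \<in> {- A $ i..A $ i}"
  shows "integrable (slice_measure A i) (\<lambda>y. f (slice_pt i r y))"
proof -
  obtain C where C: "\<And>x. x \<in> cOmega A \<Longrightarrow> \<bar>f x\<bar> \<le> C" using cont_slice_bounded[OF f] by auto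
  interpret finite_measure "slice_measure A i" by (rule finite_slice_measure)
  show ?thesis
    by (rule integrable_const_bound[where B=C])
       (use C slice_pt_cOmega[OF r] in \<open>auto intro!: measurable_slice f r\<close>)
qed

lemma posfun_slice:
  assumes r: "r \<in> {- A $ i..A $ i}"
  shows "posfun (cOmega A) (slice_integral A i r)"
proof
  note int = integrable_slice[OF _ r]
  fix f g :: "'n rvec \<Rightarrow> real" and c :: real assume f: "continuous_on (cOmega A) f"
  show "slice_integral A i r (\<lambda>x. c * f x) = c * slice_integral A i r f" by (simp add: slice_integral_eq)
  assume g: "continuous_on (cOmega A) g"
  show "slice_integral A i r (\<lambda>x. f x + g x) = slice_integral A i r f + slice_integral A i r g"
    unfolding slice_integral_eq by (intro Bochner_Integration.integral_add int f g)
  assume le: "\<And>x. x \<in> cOmega A \<Longrightarrow> f x \<le> g x"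
  show "slice_integral A i r f \<le> slice_integral A i r g"
    unfolding slice_integral_eq by (intro integral_mono int f g le slice_pt_cOmega[OF r])
qed

text \<open>Fubini in both orders after splitting off the \<open>i\<close>-th coordinate: slice by
  slice for the interaction term, line by line for the fundamental theorem of calculus.\<close>

lemma
  fixes f :: "'n rvec \<Rightarrow> real"
  assumes f: "continuous_on (cOmega A) f"
  shows IO_eq_slices: "IO A f = (LINT r:{- A $ i<..<A $ i}|lborel. slice_integral A i r f)"
    and IO_eq_lines: "IO A f = (\<integral>y. (LINT r:{- A $ i<..<A $ i}|lborel. f (slice_pt i r y)) \<partial>slice_measure A i)"
proof -
  let ?P = "\<Pi>\<^sub>M j\<in>UNIV - {i}. lborel :: real measure"
  let ?F = "\<lambda>x. indicator (Omega A) x * f x"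
  let ?Y = "\<Pi>\<^sub>E j\<in>UNIV - {i}. {- A $ j <..< A $ j}"
  let ?I = "{- A $ i<..<A $ i}"
  interpret P: sigma_finite_measure ?P by (rule sigma_finite_PiM_lborel) simp
  interpret PS: pair_sigma_finite ?P "lborel :: real measure" ..
  have int: "integrable lborel ?F"
    using set_integrable_compact_open[OF compact_cOmega f Omega_sub] by (simp add: set_integrable_def)
  have F: "?F (slice_pt i r y) = indicator ?I r * (indicator ?Y y * f (slice_pt i r y))" if "y \<in> space ?P" for y r
    using that unfolding Omega_box
    by (auto simp: indicator_def mem_box_slice_pt space_PiM PiE_iff)
  have int': "integrable (?P \<Otimes>\<^sub>M lborel) (\<lambda>p. ?F (slice_pt i (snd p) (fst p)))"
    using int unfolding lborel_eq_slices[of i]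
    using borel_measurable_integrable[OF int]
    by (subst (asm) integrable_distr_eq) (auto simp: split_beta)
  have eq: "IO A f = (\<integral>p. ?F (slice_pt i (snd p) (fst p)) \<partial>(?P \<Otimes>\<^sub>M lborel))"
    unfolding IO_def set_lebesgue_integral_def
    using borel_measurable_integrable[OF int]
    by (subst lborel_eq_slices[of i], subst integral_distr) (auto simp: split_beta)
  also have "\<dots> = (\<integral>r. (\<integral>y. ?F (slice_pt i r y) \<partial>?P) \<partial>lborel)"
    using PS.integral_snd[of "\<lambda>y r. ?F (slice_pt i r y)"] int' unfolding case_prod_unfold by metis
  also have "\<dots> = (\<integral>r. (\<integral>y. indicator ?I r * (indicator ?Y y * f (slice_pt i r y)) \<partial>?P) \<partial>lborel)"
    by (intro Bochner_Integration.integral_cong refl F)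
  also have "\<dots> = (LINT r:?I|lborel. slice_integral A i r f)"
    by (simp add: set_lebesgue_integral_def slice_integral_def slice_pt_def)
  finally show "IO A f = (LINT r:?I|lborel. slice_integral A i r f)" .
  note eq
  also have "(\<integral>p. ?F (slice_pt i (snd p) (fst p)) \<partial>(?P \<Otimes>\<^sub>M lborel)) = (\<integral>y. (\<integral>r. ?F (slice_pt i r y) \<partial>lborel) \<partial>?P)"
    using PS.integral_fst'[OF int'] by simp
  also have "\<dots> = (\<integral>y. (\<integral>r. indicator ?Y y * (indicator ?I r * f (slice_pt i r y)) \<partial>lborel) \<partial>?P)"
    by (intro Bochner_Integration.integral_cong refl) (subst F, simp_all add: mult_ac)
  also have "\<dots> = (\<integral>y. (LINT r:?I|lborel. f (slice_pt i r y)) \<partial>slice_measure A i)"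
    unfolding slice_measure_def
    by (subst integral_restrict_space)
       (use sets_slice_box[of i A] in \<open>auto simp: sets.Int_space_eq2 set_lebesgue_integral_def\<close>)
  finally show "IO A f = (\<integral>y. (LINT r:?I|lborel. f (slice_pt i r y)) \<partial>slice_measure A i)" .
qed

lemma
  assumes f: "contQ f"
  shows IQ_eq_time: "IQ A T f = (LINT t:{0<..<T}|lborel. IO A (\<lambda>x. f (x, t)))"
    and IQ_eq_space: "IQ A T f = IO A (\<lambda>x. LINT t:{0<..<T}|lborel. f (x, t))"
proof -
  let ?F = "\<lambda>z. indicator (QT A T) z * f z"
  have int: "integrable (lborel \<Otimes>\<^sub>M lborel) ?F"
    using set_integrable_compact_open[OF compact_cQT f QT_sub] open_QT
    by (simp add: set_integrable_def lborel_prod)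
  have F: "?F (x, t) = indicator {0<..<T} t * (indicator (Omega A) x * f (x, t))" for x t
    by (auto simp: QT_def indicator_def)
  have eq: "IQ A T f = (\<integral>z. ?F z \<partial>(lborel \<Otimes>\<^sub>M lborel))"
    by (simp add: IQ_def set_lebesgue_integral_def lborel_prod)
  show "IQ A T f = (LINT t:{0<..<T}|lborel. IO A (\<lambda>x. f (x, t)))"
    unfolding eq using lborel_pair.integral_snd[of "\<lambda>x t. ?F (x, t)"] int
    unfolding case_prod_unfold prod.collapse by (simp add: F IO_def set_lebesgue_integral_def)
  have "(\<integral>x. (\<integral>t. ?F (x, t) \<partial>lborel) \<partial>lborel) =
     (\<integral>x. (\<integral>t. indicator (Omega A) x * (indicator {0<..<T} t * f (x, t)) \<partial>lborel) \<partial>lborel)"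
    by (intro Bochner_Integration.integral_cong refl) (subst F, simp add: mult_ac)
  then show "IQ A T f = IO A (\<lambda>x. LINT t:{0<..<T}|lborel. f (x, t))"
    unfolding eq lborel_pair.integral_fst'[OF int, symmetric]
    by (simp add: IO_def set_lebesgue_integral_def)
qed

lemma cont_at_time:
  fixes f :: "'n rvec \<times> real \<Rightarrow> real"
  assumes "contQ f" "t \<in> {0..T}"
  shows "continuous_on (cOmega A) (\<lambda>x. f (x, t))"
  by (rule continuous_on_compose2[OF assms(1)]) (use assms(2) in \<open>auto simp: mem_cQT intro!: continuous_intros\<close>)

lemma cQT_bounded:
  fixes f :: "'n rvec \<times> real \<Rightarrow> real"
  assumes "contQ f"
  obtains C where "\<And>z. z \<in> cQ \<Longrightarrow> \<bar>f z\<bar> \<le> C"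
proof -
  have "bounded (f ` cQ)"
    using compact_continuous_image[OF assms compact_cQT] by (rule compact_imp_bounded)
  then show ?thesis using that by (auto simp: bounded_iff)
qed

lemma cont_slice_integral_time:
  assumes f: "contQ f" and r: "r \<in> {- A $ i..A $ i}"
  shows "continuous_on {0..T} (\<lambda>t. slice_integral A i r (\<lambda>x. f (x, t)))"
proof -
  obtain C where C: "\<And>z. z \<in> cQ \<Longrightarrow> \<bar>f z\<bar> \<le> C" using cQT_bounded[OF f] by auto
  interpret finite_measure "slice_measure A i" by (rule finite_slice_measure)
  show ?thesis
    unfolding slice_integral_eq
  proof (rule continuous_on_integral_param[where C=C])
    fix y assume "y \<in> space (slice_measure A i)"
    then show "continuous_on {0..T} (\<lambda>t. f (slice_pt i r y, t))"
      by (intro continuous_on_compose2[OF f]) (auto simp: mem_cQT slice_pt_cOmega[OF r] intro!: continuous_intros)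
  next
    fix t assume "t \<in> {0..T}"
    then show "(\<lambda>y. f (slice_pt i r y, t)) \<in> borel_measurable (slice_measure A i)"
      by (intro measurable_slice[of "\<lambda>x. f (x, t)"] cont_at_time f r)
  qed (use C r slice_pt_cOmega in \<open>auto simp: mem_cQT\<close>)
qed

lemma set_integrable_time:
  fixes h :: "real \<Rightarrow> real"
  shows "continuous_on {0..T} h \<Longrightarrow> set_integrable lborel {0<..<T} h"
  by (rule set_integrable_compact_open[where K="{0..T}"]) auto

lemma face_coord: "\<sigma> \<in> {-1, 1} \<Longrightarrow> \<sigma> * A $ i \<in> {- A $ i..A $ i}"
  using A_pos[of i] by auto

lemma posfun_IB:
  assumes \<sigma>: "\<sigma> \<in> {-1, 1}"
  shows "posfun cQ (IB A T i \<sigma>)"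
proof
  interpret S: posfun "cOmega A" "slice_integral A i (\<sigma> * A $ i)" by (rule posfun_slice[OF face_coord[OF \<sigma>]])
  note int = set_integrable_time[OF cont_slice_integral_time[OF _ face_coord[OF \<sigma>]]]
  have cong: "(LINT t:{0<..<T}|lborel. h t) = (LINT t:{0<..<T}|lborel. h' t)"
    if "\<And>t. t \<in> {0<..<T} \<Longrightarrow> h t = h' t" for h h' :: "real \<Rightarrow> real"
    using that by (intro set_lebesgue_integral_cong) auto
  fix f g :: "'n rvec \<times> real \<Rightarrow> real" and c :: real assume f: "contQ f"
  note ft = cont_at_time[OF f]
  have "IB A T i \<sigma> (\<lambda>x. c * f x) = (LINT t:{0<..<T}|lborel. c * slice_integral A i (\<sigma> * A $ i) (\<lambda>x. f (x, t)))"
    unfolding IB_def by (intro cong S.L_cmult ft) auto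
  then show "IB A T i \<sigma> (\<lambda>x. c * f x) = c * IB A T i \<sigma> f" by (simp add: IB_def)
  assume g: "contQ g"
  note gt = cont_at_time[OF g]
  have "IB A T i \<sigma> (\<lambda>x. f x + g x) = (LINT t:{0<..<T}|lborel.
     slice_integral A i (\<sigma> * A $ i) (\<lambda>x. f (x, t)) + slice_integral A i (\<sigma> * A $ i) (\<lambda>x. g (x, t)))"
    unfolding IB_def by (intro cong S.L_add ft gt) auto
  also have "\<dots> = IB A T i \<sigma> f + IB A T i \<sigma> g"
    unfolding IB_def by (intro set_integral_add int f g)
  finally show "IB A T i \<sigma> (\<lambda>x. f x + g x) = IB A T i \<sigma> f + IB A T i \<sigma> g" .
  assume le: "\<And>x. x \<in> cQ \<Longrightarrow> f x \<le> g x"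
  show "IB A T i \<sigma> f \<le> IB A T i \<sigma> g"
    unfolding IB_def
  proof (intro set_integral_mono int f g)
    fix t assume "t \<in> {0<..<T}"
    then show "slice_integral A i (\<sigma> * A $ i) (\<lambda>x. f (x, t)) \<le> slice_integral A i (\<sigma> * A $ i) (\<lambda>x. g (x, t))"
      by (intro S.L_mono ft gt le) (auto simp: mem_cQT)
  qed
qed

section \<open>The divergence theorem on the cylinder, one component at a time\<close>

lemma e_space_shift: "(x, t) + s *\<^sub>R es i = (x + s *\<^sub>R axis i 1, t)"
  by (simp add: e_space_def)

lemma e_time_shift: "(x, t) + s *\<^sub>R e_time = (x, t + s)"
  by (simp add: e_time_def)

lemma slice_pt_shift: "slice_pt i 0 y + s *\<^sub>R axis i 1 = slice_pt i s y"
  by (auto simp: vec_eq_iff axis_def)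

lemma IQ_div_space:
  assumes f: "hpdQ (es i) f f'" "contQ f" "contQ f'"
  shows "IQ A T f' = IB A T i 1 f - IB A T i (-1) f"
proof -
  let ?S = "slice_integral A i"
  have "IO A (\<lambda>x. f' (x, t)) = ?S (A $ i) (\<lambda>x. f (x, t)) - ?S (- A $ i) (\<lambda>x. f (x, t))"
    if t: "t \<in> {0<..<T}" for t
  proof -
    note ft = cont_at_time[OF f(2), of t] and ft' = cont_at_time[OF f(3), of t]
    have "IO A (\<lambda>x. f' (x, t)) = (\<integral>y. (LINT r:{- A $ i<..<A $ i}|lborel. f' (slice_pt i r y, t)) \<partial>slice_measure A i)"
      using t by (intro IO_eq_lines ft') auto
    also have "\<dots> = (\<integral>y. f (slice_pt i (A $ i) y, t) - f (slice_pt i (- A $ i) y, t) \<partial>slice_measure A i)"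
    proof (intro Bochner_Integration.integral_cong refl)
      fix y assume y: "y \<in> space (slice_measure A i)"
      have in_c: "(slice_pt i r y, t) \<in> cQ" if "r \<in> {- A $ i..A $ i}" for r
        using t slice_pt_cOmega[OF that y] by (auto simp: mem_cQT)
      have eq: "(slice_pt i 0 y, t) + r *\<^sub>R es i = (slice_pt i r y, t)" for r
        by (simp add: e_space_shift slice_pt_shift)
      show "(LINT r:{- A $ i<..<A $ i}|lborel. f' (slice_pt i r y, t)) = f (slice_pt i (A $ i) y, t) - f (slice_pt i (- A $ i) y, t)"
      proof (rule integral_FTC_open[where F="\<lambda>r. f (slice_pt i r y, t)"])
        show "- A $ i < A $ i" using A_pos[of i] by simp
        show "((\<lambda>r. f (slice_pt i r y, t)) has_real_derivative f' (slice_pt i s y, t)) (at s within {- A $ i..A $ i})"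
          if "s \<in> {- A $ i..A $ i}" for s
          using hpd_line[OF f(1), of "{- A $ i..A $ i}" "(slice_pt i 0 y, t)" s] that in_c by (simp add: eq)
        have "continuous_on {- A $ i..A $ i} (\<lambda>r. f' ((slice_pt i 0 y, t) + r *\<^sub>R es i))"
          by (intro continuous_on_compose2[OF f(3)] continuous_intros) (auto simp: eq in_c)
        then show "continuous_on {- A $ i..A $ i} (\<lambda>r. f' (slice_pt i r y, t))" by (simp add: eq)
      qed
    qed
    also have "\<dots> = ?S (A $ i) (\<lambda>x. f (x, t)) - ?S (- A $ i) (\<lambda>x. f (x, t))"
      unfolding slice_integral_eq
      by (intro Bochner_Integration.integral_diff integrable_slice[of "\<lambda>x. f (x, t)"] ft) (use t A_pos[of i] in auto)
    finally show ?thesis .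
  qed
  then have "IQ A T f' = (LINT t:{0<..<T}|lborel. ?S (A $ i) (\<lambda>x. f (x, t)) - ?S (- A $ i) (\<lambda>x. f (x, t)))"
    unfolding IQ_eq_time[OF f(3)] by (intro set_lebesgue_integral_cong) auto
  also have "\<dots> = IB A T i 1 f - IB A T i (-1) f"
    unfolding IB_def using A_pos[of i]
    by (subst set_integral_diff) (auto intro!: set_integrable_time cont_slice_integral_time f(2))
  finally show ?thesis .
qed

lemma IQ_div_time:
  assumes f: "hpdQ e_time f f'" "contQ f" "contQ f'"
  shows "IQ A T f' = IO A (\<lambda>x. f (x, T)) - IO A (\<lambda>x. f (x, 0))"
proof -
  have "(LINT t:{0<..<T}|lborel. f' (x, t)) = f (x, T) - f (x, 0)" if x: "x \<in> Omega A" for x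
  proof (rule integral_FTC_open[where F="\<lambda>t. f (x, t)"])
    have x': "x \<in> cOmega A" using x Omega_sub by auto
    show "((\<lambda>t. f (x, t)) has_real_derivative f' (x, s)) (at s within {0..T})" if "s \<in> {0..T}" for s
      using hpd_line[OF f(1), of "{0..T}" "(x, 0)" s] that x' by (simp add: e_time_shift mem_cQT)
    show "continuous_on {0..T} (\<lambda>t. f' (x, t))"
      by (intro continuous_on_compose2[OF f(3)] continuous_intros) (auto simp: x' mem_cQT)
  qed (use T_pos in auto)
  then have "IQ A T f' = IO A (\<lambda>x. f (x, T) - f (x, 0))"
    unfolding IQ_eq_space[OF f(3)] IO_def by (intro set_lebesgue_integral_cong) auto
  also have "\<dots> = IO A (\<lambda>x. f (x, T)) - IO A (\<lambda>x. f (x, 0))"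
    using T_pos by (intro O.L_diff cont_at_time f) auto
  finally show ?thesis .
qed

lemma cont_IO_time:
  assumes f: "contQ f"
  shows "continuous_on {0..T} (\<lambda>t. IO A (\<lambda>x. f (x, t)))"
proof -
  obtain C where C: "\<And>z. z \<in> cQ \<Longrightarrow> \<bar>f z\<bar> \<le> C" using cQT_bounded[OF f] by auto
  let ?M = "restrict_space lborel (Omega A)"
  have "emeasure lborel (Omega A) < \<infinity>"
    by (rule emeasure_bounded_finite) (simp add: Omega_box)
  then interpret finite_measure ?M
    by (intro finite_measureI) (simp add: emeasure_restrict_space space_restrict_space)
  have eq: "IO A h = (\<integral>x. h x \<partial>?M)" for h
    unfolding IO_def set_lebesgue_integral_def by (subst integral_restrict_space) auto
  show ?thesis unfolding eq
  proof (rule continuous_on_integral_param[where C=C])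
    fix x assume "x \<in> space ?M"
    then have "x \<in> cOmega A" using Omega_sub by (auto simp: space_restrict_space)
    then show "continuous_on {0..T} (\<lambda>t. f (x, t))"
      by (intro continuous_on_compose2[OF f]) (auto simp: mem_cQT intro!: continuous_intros)
  next
    fix t assume "t \<in> {0..T}"
    then have "set_integrable lborel (Omega A) (\<lambda>x. f (x, t))"
      by (intro set_integrable_compact_open[OF compact_cOmega] cont_at_time f Omega_sub) auto
    then have "integrable ?M (\<lambda>x. f (x, t))"
      by (subst integrable_restrict_space) (auto simp: set_integrable_def)
    then show "(\<lambda>x. f (x, t)) \<in> borel_measurable ?M" by simp
  qed (use C Omega_sub in \<open>auto simp: mem_cQT space_restrict_space\<close>)
qed

text \<open>Nonlocal terms admit no pointwise comparison; they are estimated in the spatial norm at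
  each fixed time, and this is then integrated over time.\<close>

lemma IQ_mono_time:
  assumes f: "contQ f" and g: "contQ g"
    and le: "\<And>t. t \<in> {0..T} \<Longrightarrow> IO A (\<lambda>x. f (x, t)) \<le> IO A (\<lambda>x. g (x, t))"
  shows "IQ A T f \<le> IQ A T g"
  unfolding IQ_eq_time[OF f] IQ_eq_time[OF g]
  by (intro set_integral_mono set_integrable_time cont_IO_time f g le) auto

lemma IQ_space_only:
  assumes h: "continuous_on (cOmega A) h"
  shows "IQ A T (\<lambda>z. h (fst z)) = T * IO A h"
proof -
  have c: "contQ (\<lambda>z. h (fst z))"
    by (intro continuous_on_compose2[OF h] continuous_intros) (auto simp: mem_cQT)
  show ?thesis unfolding IQ_eq_time[OF c] using T_pos
    by (simp add: set_lebesgue_integral_def)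
qed

section \<open>Coordinate directions at boundary points of the cylinder\<close>

text \<open>Both directions are followed towards the centre of the cylinder. Each step is a quarter
  of the corresponding side (\<open>A $ i / 2\<close> out of \<open>2 * A $ i\<close>,
  \<open>T / 4\<close> out of \<open>T\<close>), so that two steps still fit when both directions
  coincide.\<close>

lemma line_in_cQT:
  assumes "z \<in> cQ" "v \<in> par_dirs" "w \<in> par_dirs"
  obtains a b where "a \<noteq> 0" "b \<noteq> 0"
    "\<And>s t. s \<in> {0..1} \<Longrightarrow> t \<in> {0..1} \<Longrightarrow> z + (s * a) *\<^sub>R v + (t * b) *\<^sub>R w \<in> cQ"
proof -
  obtain x et where z: "z = (x, et)" by (cases z)
  define \<delta> where "\<delta> v = (if v = e_time then (if et \<le> T / 2 then T / 4 else - T / 4)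
      else (let i = (SOME i. v = es i) in (if x $ i \<le> 0 then A $ i / 2 else - A $ i / 2)))" for v :: "'n rvec \<times> real"
  have ne: "es i \<noteq> (e_time :: 'n rvec \<times> real)" for i by (simp add: e_space_def e_time_def)
  have some: "(SOME j. es i = (es j :: 'n rvec \<times> real)) = i" for i
    by (rule some_equality) (auto simp: e_space_def axis_eq_axis)
  have \<delta>t: "\<delta> e_time = (if et \<le> T / 2 then T / 4 else - T / 4)" by (simp add: \<delta>_def)
  have \<delta>x: "\<delta> (es i) = (if x $ i \<le> 0 then A $ i / 2 else - A $ i / 2)" for i
    by (simp add: \<delta>_def ne some)
  have nz: "\<delta> v \<noteq> 0" if "v \<in> par_dirs" for v
  proof -
    have "A $ i \<noteq> 0" "T \<noteq> 0" for i using A_pos[of i] T_pos by auto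
    then show ?thesis using that by (auto simp: par_dirs_def \<delta>t \<delta>x split: if_splits)
  qed
  show ?thesis
  proof (rule that[of "\<delta> v" "\<delta> w"])
    fix s t :: real assume st: "s \<in> {0..1}" "t \<in> {0..1}"
    have sx: "0 \<le> s * A $ i" "s * A $ i \<le> A $ i" "0 \<le> t * A $ i" "t * A $ i \<le> A $ i" for i
      using st A_pos[of i] by (auto intro: mult_left_le_one_le less_imp_le)
    have sT: "0 \<le> s * T" "s * T \<le> T" "0 \<le> t * T" "t * T \<le> T"
      using st T_pos by (auto intro: mult_left_le_one_le less_imp_le)
    have x: "- A $ k \<le> x $ k" "x $ k \<le> A $ k" for k using assms(1) by (auto simp: z mem_cQT mem_cOmega)
    have et: "0 \<le> et" "et \<le> T" using assms(1) by (auto simp: z mem_cQT)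
    have xin: "x + (s * \<delta> (es i)) *\<^sub>R axis i 1 \<in> cOmega A"
       "x + (t * \<delta> (es i)) *\<^sub>R axis i 1 \<in> cOmega A" for i
    proof -
      have "- A $ k \<le> (x + (s * \<delta> (es i)) *\<^sub>R axis i 1) $ k \<and> (x + (s * \<delta> (es i)) *\<^sub>R axis i 1) $ k \<le> A $ k"
        "- A $ k \<le> (x + (t * \<delta> (es i)) *\<^sub>R axis i 1) $ k \<and> (x + (t * \<delta> (es i)) *\<^sub>R axis i 1) $ k \<le> A $ k" for k
        using sx[of i] x[of k] x[of i] by (auto simp: axis_def \<delta>x)
      then show "x + (s * \<delta> (es i)) *\<^sub>R axis i 1 \<in> cOmega A"
       "x + (t * \<delta> (es i)) *\<^sub>R axis i 1 \<in> cOmega A" unfolding mem_cOmega by blast+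
    qed
    have xxin: "x + (s * \<delta> (es i)) *\<^sub>R axis i 1 + (t * \<delta> (es j)) *\<^sub>R axis j 1 \<in> cOmega A" for i j
      unfolding mem_cOmega
    proof
      fix k show "- A $ k \<le> (x + (s * \<delta> (es i)) *\<^sub>R axis i 1 + (t * \<delta> (es j)) *\<^sub>R axis j 1) $ k \<and>
         (x + (s * \<delta> (es i)) *\<^sub>R axis i 1 + (t * \<delta> (es j)) *\<^sub>R axis j 1) $ k \<le> A $ k"
        using sx[of i] sx[of j] x[of k] x[of i] x[of j]
        by (auto simp: axis_def \<delta>x)
    qed
    have tin: "0 \<le> et + s * \<delta> e_time" "et + s * \<delta> e_time \<le> T" "0 \<le> et + t * \<delta> e_time" "et + t * \<delta> e_time \<le> T"
       "0 \<le> et + s * \<delta> e_time + t * \<delta> e_time" "et + s * \<delta> e_time + t * \<delta> e_time \<le> T"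
      using sT et by (auto simp: \<delta>t algebra_simps)
    have x0: "x \<in> cOmega A" using assms(1) by (auto simp: z mem_cQT)
    show "z + (s * \<delta> v) *\<^sub>R v + (t * \<delta> w) *\<^sub>R w \<in> cQ"
      using assms(2,3) tin xin xxin x0 et
      by (auto simp: z par_dirs_def e_space_shift e_time_shift mem_cQT simp del: scaleR_left.add)
  qed (use nz assms in auto)
qed

lemma at_within_line:
  fixes z v :: "'a::real_normed_vector"
  assumes "a \<noteq> 0" "\<And>s. s \<in> {0..1} \<Longrightarrow> z + (s * a) *\<^sub>R v \<in> S"
  shows "at 0 within {h. z + h *\<^sub>R v \<in> S} \<noteq> bot"
proof -
  have "0 islimpt {h. z + h *\<^sub>R v \<in> S}"
    unfolding islimpt_approachable
  proof safe
    fix e :: real assume e: "0 < e"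
    define s where "s = min 1 (e / (2 * \<bar>a\<bar>))"
    have s: "0 < s" "s \<le> 1" "s * \<bar>a\<bar> \<le> e / 2"
      using e assms(1) by (auto simp: s_def field_simps min_def)
    then show "\<exists>x'\<in>{h. z + h *\<^sub>R v \<in> S}. x' \<noteq> 0 \<and> dist x' 0 < e"
      using assms e by (intro bexI[of _ "s * a"]) (auto simp: abs_mult)
  qed
  then show ?thesis by (simp add: trivial_limit_within)
qed

lemma cQT_thick:
  assumes "z \<in> cQ" "v \<in> par_dirs"
  shows "at 0 within {h. z + h *\<^sub>R v \<in> cQ} \<noteq> bot"
proof -
  obtain a b where ab: "a \<noteq> 0" "b \<noteq> 0"
    "\<And>s t. s \<in> {0..1} \<Longrightarrow> t \<in> {0..1} \<Longrightarrow> z + (s * a) *\<^sub>R v + (t * b) *\<^sub>R v \<in> cQ"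
    using line_in_cQT[OF assms assms(2)] by metis
  show ?thesis
    by (rule at_within_line[OF ab(1)]) (use ab(3)[of _ 0] in auto)
qed

lemma hpd_commute_cQT:
  assumes "hpdQ v f fv" "hpdQ w f fw" "hpdQ w fv fvw" "hpdQ v fw fwv"
    and "contQ fvw" "contQ fwv"
    and z: "z \<in> cQ" and vw: "v \<in> par_dirs" "w \<in> par_dirs"
  shows "fvw z = fwv z"
proof -
  obtain a b where ab: "a \<noteq> 0" "b \<noteq> 0"
    "\<And>s t. s \<in> {0..1} \<Longrightarrow> t \<in> {0..1} \<Longrightarrow> z + (s * a) *\<^sub>R v + (t * b) *\<^sub>R w \<in> cQ"
    using line_in_cQT[OF z vw] by metis
  show ?thesis by (rule hpd_commute[OF assms(1-6) ab])
qed

lemma hpd_unique_cQT: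
  assumes "hpdQ v f f'" "hpdQ v g g'" "\<And>z. z \<in> cQ \<Longrightarrow> f z = g z"
    "z \<in> cQ" "v \<in> par_dirs"
  shows "f' z = g' z"
  using hpd_unique[OF hpd_cong[OF assms(1), of g f'] assms(2,4) cQT_thick[OF assms(4,5)]] assms(3) by simp

lemma par_dirs_simps [simp]: "es i \<in> par_dirs" "e_time \<in> par_dirs"
  by (auto simp: par_dirs_def)

end

section \<open>The Carleman estimate\<close>

context boxdom
begin

section \<open>The weight and the class of functions with two spatial and one time
  derivative\<close>

definition Ximax :: real where "Ximax = 2 * A $ ix1 + 1"

text \<open>The shift by \<open>A $ ix1 + 1\<close> makes \<open>Xi\<close> at least 1 on the closed
  cylinder. Hence \<open>Xi^2\<close> has no critical point there and the gain
  \<open>l^3 * Xi^2\<close> in front of the squared function does not degenerate.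
  \<open>del1\<close> is the gradient of \<open>Xi\<close>.\<close>

definition Xi :: "'n rvec \<times> real \<Rightarrow> real" where "Xi p = fst p $ ix1 + A $ ix1 + 1"

definition del1 :: "'n \<Rightarrow> real" where "del1 i = (if i = ix1 then 1 else 0)"

text \<open>The square root of the Carleman weight: the weight is carried by squares of
  \<open>Ew l * z\<close>.\<close>

definition Ew :: "real \<Rightarrow> 'n rvec \<times> real \<Rightarrow> real" where "Ew l p = exp (l * (Xi p)^2)"

text \<open>All derivatives are named arguments. The mixed derivative \<open>z1t\<close> is both the
  time derivative of the gradient and the gradient of the time derivative; the divergence identities
  trade one form for the other.\<close>

definition smooth21 :: "('n rvec \<times> real \<Rightarrow> real) \<Rightarrow> ('n \<Rightarrow> 'n rvec \<times> real \<Rightarrow> real) \<Rightarrow>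
    ('n \<Rightarrow> 'n \<Rightarrow> 'n rvec \<times> real \<Rightarrow> real) \<Rightarrow> ('n rvec \<times> real \<Rightarrow> real) \<Rightarrow>
    ('n \<Rightarrow> 'n rvec \<times> real \<Rightarrow> real) \<Rightarrow> bool" where
  "smooth21 z z1 z2 zt z1t \<longleftrightarrow>
     (\<forall>i. hpdQ (es i) z (z1 i)) \<and> hpdQ e_time z zt \<and>
     (\<forall>i j. hpdQ (es j) (z1 i) (z2 i j)) \<and>
     (\<forall>i. hpdQ e_time (z1 i) (z1t i)) \<and> (\<forall>i. hpdQ (es i) zt (z1t i)) \<and>
     contQ z \<and> (\<forall>i. contQ (z1 i)) \<and>
     (\<forall>i j. contQ (z2 i j)) \<and> contQ zt \<and>
     (\<forall>i. contQ (z1t i)) \<and> (\<forall>i j. \<forall>p\<in>cQ. z2 i j p = z2 j i p)"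

lemma smooth21D:
  assumes "smooth21 z z1 z2 zt z1t"
  shows "hpdQ (es i) z (z1 i)" "hpdQ e_time z zt"
    "hpdQ (es j) (z1 i) (z2 i j)" "hpdQ e_time (z1 i) (z1t i)"
    "hpdQ (es i) zt (z1t i)" "contQ z" "contQ (z1 i)"
    "contQ (z2 i j)" "contQ zt" "contQ (z1t i)"
    "p \<in> cQ \<Longrightarrow> z2 i j p = z2 j i p"
  using assms unfolding smooth21_def by blast+

text \<open>The equality of the two mixed derivatives \<open>z1t\<close> and \<open>zt1\<close> and
  the symmetry of \<open>z2\<close> come from commuting continuous derivatives, which is valid up to
  the boundary of the cylinder.\<close>

lemma smooth21I:
  assumes "\<And>i. hpdQ (es i) z (z1 i)" "hpdQ e_time z zt"
    "\<And>i j. hpdQ (es j) (z1 i) (z2 i j)" "\<And>i. hpdQ e_time (z1 i) (z1t i)"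
    "\<And>i. hpdQ (es i) zt (zt1 i)"
    "contQ z" "\<And>i. contQ (z1 i)"
    "\<And>i j. contQ (z2 i j)" "contQ zt"
    "\<And>i. contQ (z1t i)" "\<And>i. contQ (zt1 i)"
  shows "smooth21 z z1 z2 zt z1t"
proof -
  have eq: "z1t i p = zt1 i p" if "p \<in> cQ" for i p
    using hpd_commute_cQT[OF assms(1,2,4,5,10,11) that] by simp
  have sym: "z2 i j p = z2 j i p" if "p \<in> cQ" for i j p
    using hpd_commute_cQT[OF assms(1,1,3,3,8,8) that] by simp
  have "hpdQ (es i) zt (z1t i)" for i
    by (rule hpd_cong[OF assms(5)]) (auto simp: eq)
  then show ?thesis unfolding smooth21_def using assms sym by blast
qed

lemma Xi_bounds: "p \<in> cQ \<Longrightarrow> 1 \<le> Xi p \<and> Xi p \<le> Ximax"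
  by (cases p) (auto simp: mem_cQT mem_cOmega Xi_def Ximax_def dest: spec[of _ ix1])

lemma Ximax_ge: "1 \<le> Ximax" using A_pos[of ix1] by (simp add: Ximax_def)

lemma hpd_Xi: "hpdQ (es i) Xi (\<lambda>p. del1 i)"
  unfolding hpd_def
proof
  fix p assume "p \<in> cQ"
  have "Xi (p + h *\<^sub>R es i) = Xi p + h * del1 i" for h
    by (cases p) (auto simp: Xi_def e_space_def del1_def axis_def)
  then show "((\<lambda>h. Xi (p + h *\<^sub>R es i)) has_real_derivative del1 i)
      (at 0 within {h. p + h *\<^sub>R es i \<in> cQ})"
    by (auto intro!: derivative_eq_intros)
qed

lemma hpd_Xi_time: "hpdQ e_time Xi (\<lambda>p. 0)"
  unfolding hpd_def by (auto simp: Xi_def e_time_def)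

lemma cont_Xi: "continuous_on S Xi"
  unfolding Xi_def by (intro continuous_intros)

lemma cont_Ew: "continuous_on S (Ew l)"
  unfolding Ew_def by (intro continuous_intros cont_Xi)

lemma hpd_Ew: "hpdQ (es i) (Ew l) (\<lambda>p. del1 i * (2 * l * Xi p * Ew l p))"
proof -
  have "hpdQ (es i) (\<lambda>p. exp (l * (Xi p)^2)) (\<lambda>p. exp (l * (Xi p)^2) * (l * (2 * (Xi p * del1 i))))"
    by (rule hpd_chain[where F=exp and F'=exp, OF hpd_cmult[OF hpd_square[OF hpd_Xi]]]) (rule DERIV_exp)
  then show ?thesis by (rule hpd_cong) (auto simp: Ew_def)
qed

lemma hpd_Ew_time: "hpdQ e_time (Ew l) (\<lambda>p. 0)"
  unfolding hpd_def by (auto simp: Ew_def Xi_def e_time_def)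

lemma Ew_pos: "0 < Ew l p" by (simp add: Ew_def)

lemma Ew_le: "p \<in> cQ \<Longrightarrow> 0 \<le> l \<Longrightarrow> Ew l p \<le> exp (l * Ximax^2)"
  using Xi_bounds[of p] by (auto simp: Ew_def intro!: mult_left_mono power_mono)

lemma Ew_ge: "0 \<le> l \<Longrightarrow> 1 \<le> Ew l p"
  by (simp add: Ew_def)

lemma sum_del1: "(\<Sum>j\<in>UNIV. del1 j * f j) = f ix1"
  by (simp add: del1_def if_distrib[of "\<lambda>x. x * _"] cong: if_cong)

lemma sum_del1_one: "sum del1 UNIV = 1"
  using sum_del1[of "\<lambda>_. 1"] by simp

section \<open>Conjugation by the weight\<close>

text \<open>\<open>cg1\<close>, \<open>cg2\<close> and \<open>cg1t\<close> are the first, second and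
  mixed space-time derivatives of the conjugated function \<open>Ew l * z\<close>.\<close>

definition cg1 where "cg1 l z z1 i p = Ew l p * (z1 i p + del1 i * (2 * l * Xi p * z p))"
definition cg2 where "cg2 l z z1 z2 i j p = Ew l p * (z2 i j p + del1 i * (2 * l * (del1 j * z p + Xi p * z1 j p)))
   + del1 j * (2 * l * Xi p * Ew l p) * (z1 i p + del1 i * (2 * l * Xi p * z p))"
definition cg1t where "cg1t l zt z1t i p = Ew l p * (z1t i p + del1 i * (2 * l * Xi p * zt p))"

lemma hpd_mult_cong:
  "hpd S v f f' \<Longrightarrow> hpd S v g g' \<Longrightarrow> (\<And>x. x \<in> S \<Longrightarrow> f' x * g x + f x * g' x = h x) \<Longrightarrow>
    hpd S v (\<lambda>x. f x * g x) h"
  by (rule hpd_cong[OF hpd_mult]) auto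

lemma smooth21_conj:
  assumes z: "smooth21 z z1 z2 zt z1t"
  shows "smooth21 (\<lambda>p. Ew l p * z p) (cg1 l z z1) (cg2 l z z1 z2) (\<lambda>p. Ew l p * zt p) (cg1t l zt z1t)"
proof (rule smooth21I[where ?zt1.0="cg1t l zt z1t"])
  note D = smooth21D[OF z]
  show "hpdQ (es i) (\<lambda>p. Ew l p * z p) (cg1 l z z1 i)" for i
    by (rule hpd_mult_cong[OF hpd_Ew D(1)]) (auto simp: cg1_def algebra_simps)
  show "hpdQ e_time (\<lambda>p. Ew l p * z p) (\<lambda>p. Ew l p * zt p)"
    by (rule hpd_mult_cong[OF hpd_Ew_time D(2)]) auto
  show "hpdQ (es j) (cg1 l z z1 i) (cg2 l z z1 z2 i j)" for i j
    unfolding cg1_def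
    by (rule hpd_mult_cong[OF hpd_Ew hpd_add[OF D(3) hpd_cmult[OF hpd_mult[OF hpd_cmult[OF hpd_Xi] D(1)]]]])
       (auto simp: cg2_def algebra_simps)
  show "hpdQ e_time (cg1 l z z1 i) (cg1t l zt z1t i)" for i
    unfolding cg1_def
    by (rule hpd_mult_cong[OF hpd_Ew_time hpd_add[OF D(4) hpd_cmult[OF hpd_mult[OF hpd_cmult[OF hpd_Xi_time] D(2)]]]])
       (auto simp: cg1t_def algebra_simps)
  show "hpdQ (es i) (\<lambda>p. Ew l p * zt p) (cg1t l zt z1t i)" for i
    by (rule hpd_mult_cong[OF hpd_Ew D(5)]) (auto simp: cg1t_def algebra_simps)
qed (unfold cg1_def cg2_def cg1t_def, auto intro!: continuous_intros cont_Ew cont_Xi smooth21D[OF z])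

section \<open>The pointwise Carleman identity and its integral\<close>

text \<open>For \<open>g = Ew l * z\<close> the conjugate of
  \<open>s \<partial>_t + \<Delta>\<close> is \<open>S + B\<close>. The splitting into symmetric and
  skew part would have \<open>- 2 l g\<close> in \<open>B\<close> and only
  \<open>\<Delta> g + 4 l^2 X^2 g\<close> in \<open>S\<close>; modulo divergences the squared
  gradient then has coefficient 0 in \<open>2 S B\<close>. Moving one \<open>l g\<close> from
  \<open>B\<close> to \<open>S\<close> raises this coefficient to \<open>2 l\<close>, while
  \<open>g^2\<close> keeps the leading coefficient \<open>24 l^3 X^2\<close>.\<close>

lemma carleman_identity:
  fixes l s :: real
  assumes g: "smooth21 g g1 g2 gt g1t" and p: "p \<in> cQ"
  defines "S \<equiv> (\<Sum>j\<in>UNIV. g2 j j p) + 4 * l^2 * (Xi p)^2 * g p + l * g p"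
    and "B \<equiv> s * gt p - 4 * l * Xi p * g1 ix1 p - 3 * l * g p"
    and "Q \<equiv> \<lambda>p. \<Sum>k\<in>UNIV. (g1 k p)^2"
  shows "(\<Sum>j\<in>UNIV.
      2 * s * (g2 j j p * gt p + g1 j p * g1t j p)
      - 8 * l * (del1 j * (g1 ix1 p * g1 j p) + Xi p * (g2 ix1 j p * g1 j p) + Xi p * (g1 ix1 p * g2 j j p))
      - 6 * l * (g1 j p * g1 j p + g p * g2 j j p)
      + del1 j * (4 * l * Q p + 4 * l * Xi p * (\<Sum>k\<in>UNIV. 2 * (g1 k p * g2 k j p))
        - (48 * l^3 * (Xi p)^2 + 4 * l^2) * (g p)^2 - (16 * l^3 * (Xi p)^3 + 4 * l^2 * Xi p) * (2 * (g p * g1 j p))))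
    + (- s * (\<Sum>k\<in>UNIV. 2 * (g1 k p * g1t k p)) + s * (4 * l^2 * (Xi p)^2 + l) * (2 * (g p * gt p)))
    = 2 * S * B - (8 * l * (g1 ix1 p)^2 + 2 * l * Q p + (24 * l^3 * (Xi p)^2 - 2 * l^2) * (g p)^2)"
proof -
  \<comment> \<open>After summation over the coordinates \<open>M\<close> cancels between the flux
    and the time derivative and \<open>P\<close> cancels within the flux; the terms with
    \<open>L\<close> are those of \<open>2 S B\<close>.\<close>
  define M where "M = (\<Sum>j\<in>UNIV. g1 j p * g1t j p)"
  define P where "P = (\<Sum>j\<in>UNIV. g1 j p * g2 j ix1 p)"
  define L where "L = (\<Sum>j\<in>UNIV. g2 j j p)"
  have P': "(\<Sum>j\<in>UNIV. g2 ix1 j p * g1 j p) = P"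
    unfolding P_def using smooth21D(11)[OF g p] by (intro sum.cong) (auto simp: mult.commute)
  have Q': "(\<Sum>j\<in>UNIV. g1 j p * g1 j p) = Q p" by (simp add: Q_def power2_eq_square)
  show ?thesis
    unfolding sum.distrib sum_subtractf sum_distrib_left[symmetric] sum_distrib_right[symmetric] sum_del1
      distrib_left right_diff_distrib S_def B_def
    apply (simp only: sum.distrib sum_subtractf sum_distrib_left[symmetric] sum_distrib_right[symmetric] sum_del1
      P' Q' L_def[symmetric] M_def[symmetric] P_def[symmetric])
    by (simp add: algebra_simps power2_eq_square power3_eq_cube sum_del1_one)
qed

text \<open>Primitives of the two brackets in \<open>carleman_identity\<close>: the first is the
  divergence of \<open>carl_flux\<close>, the second is the time derivative of
  \<open>- s * carl_time\<close>.\<close>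

definition carl_flux where
  "carl_flux l s g g1 gt j p = 2 * s * (g1 j p * gt p) - 8 * l * (Xi p * (g1 ix1 p * g1 j p)) - 6 * l * (g p * g1 j p)
     + del1 j * (4 * l * (Xi p * (\<Sum>k\<in>UNIV. (g1 k p)^2)) - (16 * l^3 * (Xi p)^3 + 4 * l^2 * Xi p) * (g p)^2)"

definition carl_time where
  "carl_time l g g1 p = (\<Sum>k\<in>UNIV. (g1 k p)^2) - (4 * l^2 * (Xi p)^2 + l) * (g p)^2"

lemma hpd_carl_flux:
  assumes g: "smooth21 g g1 g2 gt g1t"
  shows "hpdQ (es j) (carl_flux l s g g1 gt j) (\<lambda>p.
      2 * s * (g2 j j p * gt p + g1 j p * g1t j p)
      - 8 * l * (del1 j * (g1 ix1 p * g1 j p) + Xi p * (g2 ix1 j p * g1 j p) + Xi p * (g1 ix1 p * g2 j j p))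
      - 6 * l * (g1 j p * g1 j p + g p * g2 j j p)
      + del1 j * (4 * l * (\<Sum>k\<in>UNIV. (g1 k p)^2) + 4 * l * Xi p * (\<Sum>k\<in>UNIV. 2 * (g1 k p * g2 k j p))
        - (48 * l^3 * (Xi p)^2 + 4 * l^2) * (g p)^2 - (16 * l^3 * (Xi p)^3 + 4 * l^2 * Xi p) * (2 * (g p * g1 j p))))"
proof -
  note D = smooth21D[OF g]
  have X3: "hpdQ (es j) (\<lambda>p. 16 * l^3 * (Xi p)^3 + 4 * l^2 * Xi p)
     (\<lambda>p. (48 * l^3 * (Xi p)^2 + 4 * l^2) * del1 j)"
    by (rule hpd_chain[where F="\<lambda>x. 16 * l^3 * x^3 + 4 * l^2 * x", OF hpd_Xi])
       (auto intro!: derivative_eq_intros)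
  have dd: "del1 j * del1 j = del1 j" by (simp add: del1_def)
  have "hpdQ (es j) (carl_flux l s g g1 gt j) (\<lambda>p.
      2 * s * (g2 j j p * gt p + g1 j p * g1t j p)
      - 8 * l * (del1 j * (g1 ix1 p * g1 j p) + Xi p * (g2 ix1 j p * g1 j p + g1 ix1 p * g2 j j p))
      - 6 * l * (g1 j p * g1 j p + g p * g2 j j p)
      + del1 j * (4 * l * (del1 j * (\<Sum>k\<in>UNIV. (g1 k p)^2) + Xi p * (\<Sum>k\<in>UNIV. 2 * (g1 k p * g2 k j p)))
        - ((48 * l^3 * (Xi p)^2 + 4 * l^2) * del1 j * (g p)^2 + (16 * l^3 * (Xi p)^3 + 4 * l^2 * Xi p) * (2 * (g p * g1 j p)))))"
    unfolding carl_flux_def by (intro hpd_add hpd_diff hpd_cmult hpd_mult hpd_sum hpd_square hpd_Xi X3 D)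
  then show ?thesis
    by (rule hpd_cong) (auto simp: del1_def algebra_simps)
qed

lemma hpd_carl_time:
  assumes g: "smooth21 g g1 g2 gt g1t"
  shows "hpdQ e_time (\<lambda>p. - s * carl_time l g g1 p)
    (\<lambda>p. - s * (\<Sum>k\<in>UNIV. 2 * (g1 k p * g1t k p)) + s * (4 * l^2 * (Xi p)^2 + l) * (2 * (g p * gt p)))"
proof -
  note D = smooth21D[OF g]
  have X3: "hpdQ e_time (\<lambda>p. 4 * l^2 * (Xi p)^2 + l) (\<lambda>p. 8 * l^2 * Xi p * 0)"
    by (rule hpd_chain[where F="\<lambda>x. 4 * l^2 * x^2 + l", OF hpd_Xi_time])
       (auto intro!: derivative_eq_intros)
  have "hpdQ e_time (\<lambda>p. - s * carl_time l g g1 p)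
    (\<lambda>p. - s * ((\<Sum>k\<in>UNIV. 2 * (g1 k p * g1t k p)) - ((8 * l^2 * Xi p * 0) * (g p)^2 + (4 * l^2 * (Xi p)^2 + l) * (2 * (g p * gt p)))))"
    unfolding carl_time_def
    by (rule hpd_cmult[OF hpd_diff[OF hpd_sum[OF hpd_square[OF D(4)]] hpd_mult[OF X3 hpd_square[OF D(2)]]]])
  then show ?thesis by (rule hpd_cong) (auto simp: algebra_simps)
qed

lemma cont_carl_flux: "smooth21 g g1 g2 gt g1t \<Longrightarrow> contQ (carl_flux l s g g1 gt j)"
  using smooth21D(6-10)[of g g1 g2 gt g1t] unfolding carl_flux_def by (intro continuous_intros cont_Xi) auto

lemma cont_carl_time: "smooth21 g g1 g2 gt g1t \<Longrightarrow> contQ (carl_time l g g1)"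
  using smooth21D(6-10)[of g g1 g2 gt g1t] unfolding carl_time_def by (intro continuous_intros cont_Xi) auto

text \<open>\<open>(S + B)^2\<close> is \<open>S^2 + B^2 + 2 S B\<close>, and the identity replaces
  \<open>2 S B\<close> by positive terms and divergences. The number 22 is the least value of
  \<open>24 X^2 - 2 / l\<close>, reached for \<open>X = l = 1\<close>.\<close>

lemma carleman_integrated:
  fixes l s :: real
  assumes g: "smooth21 g g1 g2 gt g1t" and l: "1 \<le> l"
  defines "S \<equiv> \<lambda>p. (\<Sum>j\<in>UNIV. g2 j j p) + 4 * l^2 * (Xi p)^2 * g p + l * g p"
    and "B \<equiv> \<lambda>p. s * gt p - 4 * l * Xi p * g1 ix1 p - 3 * l * g p"
  shows "IQ A T (\<lambda>p. (S p)^2 + (B p)^2 + 8 * l * (g1 ix1 p)^2 + 2 * l * (\<Sum>k\<in>UNIV. (g1 k p)^2) + 22 * l^3 * (g p)^2)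
    \<le> IQ A T (\<lambda>p. (S p + B p)^2)
      - (\<Sum>j\<in>UNIV. IB A T j 1 (carl_flux l s g g1 gt j) - IB A T j (-1) (carl_flux l s g g1 gt j))
      + s * (IO A (\<lambda>x. carl_time l g g1 (x, T)) - IO A (\<lambda>x. carl_time l g g1 (x, 0)))"
proof -
  define DF where "DF j p = (
      2 * s * (g2 j j p * gt p + g1 j p * g1t j p)
      - 8 * l * (del1 j * (g1 ix1 p * g1 j p) + Xi p * (g2 ix1 j p * g1 j p) + Xi p * (g1 ix1 p * g2 j j p))
      - 6 * l * (g1 j p * g1 j p + g p * g2 j j p)
      + del1 j * (4 * l * (\<Sum>k\<in>UNIV. (g1 k p)^2) + 4 * l * Xi p * (\<Sum>k\<in>UNIV. 2 * (g1 k p * g2 k j p))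
        - (48 * l^3 * (Xi p)^2 + 4 * l^2) * (g p)^2 - (16 * l^3 * (Xi p)^3 + 4 * l^2 * Xi p) * (2 * (g p * g1 j p))))" for j p
  define DT where "DT p = - s * (\<Sum>k\<in>UNIV. 2 * (g1 k p * g1t k p)) + s * (4 * l^2 * (Xi p)^2 + l) * (2 * (g p * gt p))" for p
  note cD = smooth21D(6-10)[OF g]
  have cDF: "contQ (DF j)" for j
    unfolding DF_def by (intro continuous_intros cD cont_Xi)
  have cDT: "contQ DT"
    unfolding DT_def by (intro continuous_intros cD cont_Xi)
  have cS: "contQ S" and cB: "contQ B"
    unfolding S_def B_def by (intro continuous_intros cD cont_Xi)+
  let ?P = "\<lambda>p. (S p)^2 + (B p)^2 + 8 * l * (g1 ix1 p)^2 + 2 * l * (\<Sum>k\<in>UNIV. (g1 k p)^2) + 22 * l^3 * (g p)^2"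
  have pw: "?P p \<le> ((S p + B p)^2 - (\<Sum>j\<in>UNIV. DF j p)) - DT p" if p: "p \<in> cQ" for p
  proof -
    have id: "(\<Sum>j\<in>UNIV. DF j p) + DT p
      = 2 * S p * B p - (8 * l * (g1 ix1 p)^2 + 2 * l * (\<Sum>k\<in>UNIV. (g1 k p)^2) + (24 * l^3 * (Xi p)^2 - 2 * l^2) * (g p)^2)"
      unfolding DF_def DT_def S_def B_def by (rule carleman_identity[OF g p])
    have "1 \<le> (Xi p)^2" using Xi_bounds[OF p] by simp
    then have "l^3 * 1 \<le> l^3 * (Xi p)^2" using l by (intro mult_left_mono) auto
    moreover have "l^2 \<le> l^3" using l by (intro power_increasing) auto
    ultimately have "22 * l^3 \<le> 24 * l^3 * (Xi p)^2 - 2 * l^2" by linarith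
    then have "22 * l^3 * (g p)^2 \<le> (24 * l^3 * (Xi p)^2 - 2 * l^2) * (g p)^2" by (intro mult_right_mono) auto
    then show ?thesis using id by (simp add: power2_sum)
  qed
  have "IQ A T ?P \<le> IQ A T (\<lambda>p. ((S p + B p)^2 - (\<Sum>j\<in>UNIV. DF j p)) - DT p)"
    by (intro Q.L_mono pw continuous_intros cS cB cD cDF cDT)
  also have "\<dots> = IQ A T (\<lambda>p. (S p + B p)^2) - IQ A T (\<lambda>p. \<Sum>j\<in>UNIV. DF j p) - IQ A T DT"
  proof -
    have c1: "contQ (\<lambda>p. (S p + B p)^2)" "contQ (\<lambda>p. \<Sum>j\<in>UNIV. DF j p)"
      by (intro continuous_intros cS cB cDF)+
    show ?thesis using Q.L_diff[OF continuous_on_diff[OF c1] cDT] Q.L_diff[OF c1] by simp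
  qed
  also have "IQ A T (\<lambda>p. \<Sum>j\<in>UNIV. DF j p) = (\<Sum>j\<in>UNIV. IQ A T (DF j))"
    by (intro Q.L_sum cDF) auto
  also have "\<dots> = (\<Sum>j\<in>UNIV. IB A T j 1 (carl_flux l s g g1 gt j) - IB A T j (-1) (carl_flux l s g g1 gt j))"
    by (intro sum.cong refl IQ_div_space cDF cont_carl_flux[OF g] hpd_cong[OF hpd_carl_flux[OF g]]) (simp_all add: DF_def)
  also have "IQ A T DT = IO A (\<lambda>x. - s * carl_time l g g1 (x, T)) - IO A (\<lambda>x. - s * carl_time l g g1 (x, 0))"
    by (rule IQ_div_time[OF hpd_carl_time[OF g, of s l, folded DT_def]])
       (intro cDT continuous_intros cont_carl_time[OF g])+
  also have "\<dots> = - s * (IO A (\<lambda>x. carl_time l g g1 (x, T)) - IO A (\<lambda>x. carl_time l g g1 (x, 0)))"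
    using T_pos cont_at_time[OF cont_carl_time[OF g]]
    by (subst O.L_cmult, simp, subst O.L_cmult, simp) (simp add: algebra_simps)
  finally show ?thesis by simp
qed

section \<open>Return from the conjugated function; bounds for the lateral terms\<close>

definition grad2 where "grad2 z1 p = (\<Sum>k\<in>UNIV. (z1 k p)^2 :: real)" for z1 :: "'n \<Rightarrow> 'n rvec \<times> real \<Rightarrow> real"
definition lapl where "lapl z2 p = (\<Sum>k\<in>UNIV. z2 k k p :: real)" for z2 :: "'n \<Rightarrow> 'n \<Rightarrow> 'n rvec \<times> real \<Rightarrow> real"
definition bdens where "bdens z z1 zt p = (z p)^2 + grad2 z1 p + (zt p)^2"
definition Lat where "Lat z z1 zt = (\<Sum>j\<in>UNIV. IB A T j 1 (bdens z z1 zt) + IB A T j (-1) (bdens z z1 zt))"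

lemma grad2_nonneg: "0 \<le> grad2 z1 p" unfolding grad2_def by (intro sum_nonneg) auto

lemma grad2_ge: "(z1 k p)^2 \<le> grad2 z1 p"
  unfolding grad2_def by (rule member_le_sum) auto

lemma cont_grad2: "(\<And>k. continuous_on K (z1 k)) \<Longrightarrow> continuous_on K (grad2 z1)"
  unfolding grad2_def by (intro continuous_intros)

lemma cont_lapl: "(\<And>i j. continuous_on K (z2 i j)) \<Longrightarrow> continuous_on K (lapl z2)"
  unfolding lapl_def by (intro continuous_intros)

lemma cont_bdens: "continuous_on K z \<Longrightarrow> (\<And>k. continuous_on K (z1 k)) \<Longrightarrow> continuous_on K zt \<Longrightarrow>
    continuous_on K (bdens z z1 zt)"
  unfolding bdens_def by (intro continuous_intros cont_grad2)

lemma lapl_conj: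
  "lapl (cg2 l z z1 z2) p = Ew l p * (lapl z2 p + 4 * l * Xi p * z1 ix1 p + (2 * l + 4 * l^2 * (Xi p)^2) * z p)"
proof -
  have "lapl (cg2 l z z1 z2) p = (\<Sum>j\<in>UNIV. Ew l p * z2 j j p +
     del1 j * (Ew l p * (2 * l * (del1 j * z p + Xi p * z1 j p)) + 2 * l * Xi p * Ew l p * (z1 j p + del1 j * (2 * l * Xi p * z p))))"
    unfolding lapl_def cg2_def by (intro sum.cong) (auto simp: algebra_simps)
  also have "\<dots> = Ew l p * lapl z2 p + (Ew l p * (2 * l * (del1 ix1 * z p + Xi p * z1 ix1 p)) + 2 * l * Xi p * Ew l p * (z1 ix1 p + del1 ix1 * (2 * l * Xi p * z p)))"
    unfolding sum.distrib sum_del1 by (simp add: lapl_def sum_distrib_left)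
  also have "\<dots> = Ew l p * (lapl z2 p + 4 * l * Xi p * z1 ix1 p + (2 * l + 4 * l^2 * (Xi p)^2) * z p)"
    by (simp add: del1_def algebra_simps power2_eq_square)
  finally show ?thesis .
qed

lemma grad2_conj_eq:
  "grad2 (cg1 l z z1) p = (Ew l p)^2 * (grad2 z1 p + 4 * l * Xi p * z p * z1 ix1 p + 4 * l^2 * (Xi p)^2 * (z p)^2)"
proof -
  have "grad2 (cg1 l z z1) p = (\<Sum>j\<in>UNIV. (Ew l p)^2 * (z1 j p)^2 + del1 j * ((Ew l p)^2 * (4 * l * Xi p * z p * z1 j p + 4 * l^2 * (Xi p)^2 * (z p)^2)))"
    unfolding grad2_def cg1_def by (intro sum.cong) (auto simp: del1_def algebra_simps power2_eq_square)
  then show ?thesis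
    unfolding sum.distrib sum_del1 by (simp add: grad2_def sum_distrib_left algebra_simps)
qed

lemma sq3: "(a + b + c)^2 \<le> 3 * a^2 + 3 * b^2 + 3 * (c::real)^2"
proof -
  have "0 \<le> (a - b)^2 + (b - c)^2 + (a - c)^2" by simp
  then show ?thesis by (simp add: power2_eq_square algebra_simps)
qed

text \<open>The time derivative is read off from \<open>B\<close> and the Laplacian from
  \<open>S\<close>, in both cases up to \<open>4 l X g_1 + 3 l g\<close>. Squared and divided by
  \<open>l\<close>, these errors have the sizes \<open>l g_1^2\<close> and \<open>l g^2\<close>,
  which the integrated inequality dominates; this explains the factor \<open>1 / l\<close> in front
  of \<open>zt^2 + D^2\<close>.\<close>

lemma carleman_lower_alg:
  fixes l X Y E z zt D G z1 s Sv Bv Q g :: real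
  assumes l: "1 \<le> l" and X: "1 \<le> X" "X \<le> Y" and s: "s^2 = 1"
    and g: "g = E * z" and g1: "g1 = E * (z1 + 2 * l * X * z)"
    and S: "Sv = E * (D + 4 * l * X * z1 + (2 * l + 4 * l^2 * X^2) * z) + 4 * l^2 * X^2 * g + l * g"
    and B: "Bv = s * (E * zt) - 4 * l * X * g1 - 3 * l * g"
    and Q: "Q = E^2 * (G + 4 * l * X * z * z1 + 4 * l^2 * X^2 * z^2)" and Q0: "g1^2 \<le> Q"
  shows "Sv + Bv = E * (s * zt + D)"
    and "E^2 * ((zt^2 + D^2) / l + l * G + l^3 * z^2) \<le> 14 * Y^2 * (Sv^2 + Bv^2 + 8 * l * g1^2 + 2 * l * Q + 22 * l^3 * g^2)"
proof -
  show "Sv + Bv = E * (s * zt + D)"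
    unfolding S B g g1 by (simp add: algebra_simps power2_eq_square)
  have Y: "1 \<le> Y^2" "X^2 \<le> Y^2" using X by (auto intro!: power_mono)
  have l0: "0 < l" using l by simp
  have sq_i: "(4 * l * X * g1)^2 \<le> 16 * l^2 * Y^2 * g1^2"
    using Y by (auto simp: power_mult_distrib intro!: mult_right_mono mult_left_mono)
  have bnd: "u^2 / l \<le> 6 * Y^2 * (v^2 + 8 * l * g1^2 + 22 * l^3 * g^2)"
    if "u^2 \<le> 3 * v^2 + 3 * (4 * l * X * g1)^2 + 3 * (3 * l * g)^2" for u v :: real
  proof -
    have "u^2 \<le> 3 * v^2 + 48 * l^2 * Y^2 * g1^2 + 27 * l^2 * g^2"
      using that sq_i by (simp add: power_mult_distrib)
    then have "u^2 / l \<le> (3 * v^2 + 48 * l^2 * Y^2 * g1^2 + 27 * l^2 * g^2) / l"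
      using l0 by (intro divide_right_mono) auto
    also have "\<dots> = 3 * (v^2 / l) + 6 * Y^2 * (8 * l * g1^2) + 27 * l * g^2"
      using l0 by (simp add: field_simps power2_eq_square)
    also have "\<dots> \<le> 6 * Y^2 * v^2 + 6 * Y^2 * (8 * l * g1^2) + 6 * Y^2 * (22 * l^3 * g^2)"
    proof (intro add_mono order_refl)
      have "v^2 / l \<le> v^2 / 1" using l by (intro divide_left_mono) auto
      moreover have "1 * v^2 \<le> Y^2 * v^2" using Y by (intro mult_right_mono) auto
      moreover have "0 \<le> Y^2 * v^2" by simp
      ultimately show "3 * (v^2 / l) \<le> 6 * Y^2 * v^2" unfolding mult.assoc by linarith
      have "l ^ 1 \<le> l ^ 3" using l by (intro power_increasing) auto
      then have i1: "l * g^2 \<le> l^3 * g^2" by (intro mult_right_mono) auto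
      have i2: "1 * (l^3 * g^2) \<le> Y^2 * (l^3 * g^2)" using Y l by (intro mult_right_mono) auto
      have i3: "0 \<le> l * g^2" using l0 by simp
      have "27 * (l * g^2) \<le> 132 * (Y^2 * (l^3 * g^2))" using i1 i2 i3 by linarith
      then show "27 * l * g^2 \<le> 6 * Y^2 * (22 * l^3 * g^2)" by (simp add: mult_ac)
    qed
    finally show ?thesis by (simp add: algebra_simps)
  qed
  have t: "(E * zt)^2 / l \<le> 6 * Y^2 * (Bv^2 + 8 * l * g1^2 + 22 * l^3 * g^2)"
  proof (rule bnd)
    have "(E * zt)^2 = s^2 * (E * zt)^2" by (simp add: s)
    also have "\<dots> = (Bv + 4 * l * X * g1 + 3 * l * g)^2" by (simp add: B power_mult_distrib)
    also have "\<dots> \<le> 3 * Bv^2 + 3 * (4 * l * X * g1)^2 + 3 * (3 * l * g)^2" by (rule sq3)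
    finally show "(E * zt)^2 \<le> 3 * Bv^2 + 3 * (4 * l * X * g1)^2 + 3 * (3 * l * g)^2" .
  qed
  have d: "(E * D)^2 / l \<le> 6 * Y^2 * (Sv^2 + 8 * l * g1^2 + 22 * l^3 * g^2)"
  proof (rule bnd)
    have "E * D = Sv + (- (4 * l * X * g1)) + (- (3 * l * g))"
      unfolding S g g1 by (simp add: algebra_simps power2_eq_square)
    then have "(E * D)^2 \<le> 3 * Sv^2 + 3 * (- (4 * l * X * g1))^2 + 3 * (- (3 * l * g))^2" using sq3 by metis
    then show "(E * D)^2 \<le> 3 * Sv^2 + 3 * (4 * l * X * g1)^2 + 3 * (3 * l * g)^2" by simp
  qed
  have g3: "0 \<le> l^3 * g^2" using l by simp
  have gg: "E^2 * (l * G) \<le> 2 * l * Q + 8 * l^3 * Y^2 * g^2"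
  proof -
    have "E^2 * G = Q - 4 * l * X * g * g1 + 4 * l^2 * X^2 * g^2"
      unfolding Q g g1 by (simp add: algebra_simps power2_eq_square)
    moreover have "- (4 * l * X * g * g1) \<le> g1^2 + 4 * l^2 * X^2 * g^2"
      using zero_le_power2[of "g1 + 2 * l * X * g"] by (simp add: power2_eq_square algebra_simps)
    moreover have "8 * l^2 * (X^2 * g^2) = 4 * l^2 * X^2 * g^2 + 4 * l^2 * X^2 * g^2" by simp
    ultimately have "E^2 * G \<le> 2 * Q + 8 * l^2 * (X^2 * g^2)" using Q0 by linarith
    also have "\<dots> \<le> 2 * Q + 8 * l^2 * (Y^2 * g^2)" using Y by (intro add_mono mult_left_mono mult_right_mono) auto
    finally have "l * (E^2 * G) \<le> l * (2 * Q + 8 * l^2 * (Y^2 * g^2))" using l0 by (intro mult_left_mono) auto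
    then show ?thesis by (simp add: algebra_simps power2_eq_square power3_eq_cube)
  qed
  have "E^2 * ((zt^2 + D^2) / l + l * G + l^3 * z^2) = (E * zt)^2 / l + (E * D)^2 / l + E^2 * (l * G) + l^3 * g^2"
    unfolding g by (simp add: algebra_simps add_divide_distrib power_mult_distrib)
  also have "\<dots> \<le> 6 * Y^2 * (Bv^2 + 8 * l * g1^2 + 22 * l^3 * g^2) + 6 * Y^2 * (Sv^2 + 8 * l * g1^2 + 22 * l^3 * g^2)
     + (2 * l * Q + 8 * l^3 * Y^2 * g^2) + l^3 * g^2"
    by (intro add_mono t d gg order_refl)
  \<comment> \<open>In units of \<open>Y^2 * l^3 * g^2\<close> the zero order terms add up to at
    most 273, against \<open>14 * 22 = 308\<close>.\<close>
  also have "\<dots> \<le> 14 * Y^2 * (Sv^2 + Bv^2 + 8 * l * g1^2 + 2 * l * Q + 22 * l^3 * g^2)"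
  proof -
    have Qn: "0 \<le> Q" using Q0 zero_le_power2[of g1] by linarith
    have 1: "1 * (l * Q) \<le> Y^2 * (l * Q)" using Y l Qn by (intro mult_right_mono) auto
    have 2: "1 * (l^3 * g^2) \<le> Y^2 * (l^3 * g^2)" using Y g3 by (intro mult_right_mono)
    have 3: "0 \<le> Y^2 * Sv^2" "0 \<le> Y^2 * Bv^2" "0 \<le> Y^2 * (l * g1^2)" "0 \<le> Y^2 * (l * Q)" using l0 Qn by simp_all
    have "6 * Y^2 * (Bv^2 + 8 * l * g1^2 + 22 * l^3 * g^2) + 6 * Y^2 * (Sv^2 + 8 * l * g1^2 + 22 * l^3 * g^2)
     + (2 * l * Q + 8 * l^3 * Y^2 * g^2) + l^3 * g^2 =
        6 * (Y^2 * Sv^2) + 6 * (Y^2 * Bv^2) + 96 * (Y^2 * (l * g1^2)) + 272 * (Y^2 * (l^3 * g^2)) + 2 * (l * Q) + l^3 * g^2"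
      by (simp add: algebra_simps)
    also have "\<dots> \<le> 14 * (Y^2 * Sv^2) + 14 * (Y^2 * Bv^2) + 112 * (Y^2 * (l * g1^2)) + 28 * (Y^2 * (l * Q)) + 308 * (Y^2 * (l^3 * g^2))"
      using 1 2 3 g3 by linarith
    also have "\<dots> = 14 * Y^2 * (Sv^2 + Bv^2 + 8 * l * g1^2 + 2 * l * Q + 22 * l^3 * g^2)"
      by (simp add: algebra_simps)
    finally show ?thesis .
  qed
  finally show "E^2 * ((zt^2 + D^2) / l + l * G + l^3 * z^2) \<le> 14 * Y^2 * (Sv^2 + Bv^2 + 8 * l * g1^2 + 2 * l * Q + 22 * l^3 * g^2)" .
qed

lemma grad2_conj_le:
  assumes "p \<in> cQ" "0 \<le> l"
  shows "grad2 (cg1 l z z1) p \<le> (Ew l p)^2 * (2 * grad2 z1 p + 8 * l^2 * Ximax^2 * (z p)^2)"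
proof -
  have "4 * l * Xi p * z p * z1 ix1 p \<le> (z1 ix1 p)^2 + 4 * l^2 * (Xi p)^2 * (z p)^2"
    using zero_le_power2[of "z1 ix1 p - 2 * l * Xi p * z p"] by (simp add: power2_eq_square algebra_simps)
  moreover have "l^2 * (Xi p)^2 * (z p)^2 \<le> l^2 * Ximax^2 * (z p)^2"
    using Xi_bounds[OF assms(1)] by (intro mult_right_mono mult_left_mono power_mono) auto
  ultimately have "grad2 z1 p + 4 * l * Xi p * z p * z1 ix1 p + 4 * l^2 * (Xi p)^2 * (z p)^2
      \<le> 2 * grad2 z1 p + 8 * l^2 * Ximax^2 * (z p)^2"
    using grad2_ge[of z1 ix1 p] by simp
  then show ?thesis unfolding grad2_conj_eq by (intro mult_left_mono) auto
qed

text \<open>A bound growing exponentially in \<open>l\<close>. It multiplies only lateral terms and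
  terms at the ends of the time interval, and \<open>l\<close> is fixed before those are
  estimated.\<close>

definition wbd :: "real \<Rightarrow> real" where
  "wbd l = (exp (l * Ximax^2))^2 * (2 + 8 * l^2 * Ximax^2)"

lemma wbd_nonneg: "0 \<le> wbd l" by (simp add: wbd_def)

lemma conj_dens_le:
  assumes p: "p \<in> cQ" and l: "0 \<le> l"
  shows "(Ew l p * z p)^2 + grad2 (cg1 l z z1) p \<le> wbd l * ((z p)^2 + grad2 z1 p)"
    and "bdens (\<lambda>p. Ew l p * z p) (cg1 l z z1) (\<lambda>p. Ew l p * zt p) p \<le> wbd l * bdens z z1 zt p"
proof -
  have E: "(Ew l p)^2 \<le> (exp (l * Ximax^2))^2"
    using Ew_le[OF p l] Ew_pos[of l p] by (intro power_mono) auto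
  have Y: "0 \<le> l^2 * Ximax^2" by simp
  have "(Ew l p * z p)^2 + grad2 (cg1 l z z1) p \<le> (Ew l p)^2 * (2 * grad2 z1 p + (1 + 8 * l^2 * Ximax^2) * (z p)^2)"
    using grad2_conj_le[OF p l, of z z1] by (simp add: algebra_simps power_mult_distrib)
  also have "\<dots> \<le> (exp (l * Ximax^2))^2 * ((2 + 8 * l^2 * Ximax^2) * ((z p)^2 + grad2 z1 p))"
    using E grad2_nonneg[of z1 p] Y
    by (intro mult_mono) (auto simp: algebra_simps intro!: add_nonneg_nonneg mult_nonneg_nonneg)
  finally show 1: "(Ew l p * z p)^2 + grad2 (cg1 l z z1) p \<le> wbd l * ((z p)^2 + grad2 z1 p)"
    by (simp add: wbd_def mult.assoc)
  have "(Ew l p * zt p)^2 \<le> (exp (l * Ximax^2))^2 * (1 * (zt p)^2)"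
    using E by (auto simp: power_mult_distrib intro!: mult_right_mono)
  also have "\<dots> \<le> (exp (l * Ximax^2))^2 * ((2 + 8 * l^2 * Ximax^2) * (zt p)^2)"
    using Y by (intro mult_left_mono mult_right_mono) auto
  finally have "(Ew l p * zt p)^2 \<le> wbd l * (zt p)^2" by (simp add: wbd_def mult.assoc)
  then show "bdens (\<lambda>p. Ew l p * z p) (cg1 l z z1) (\<lambda>p. Ew l p * zt p) p \<le> wbd l * bdens z z1 zt p"
    using 1 unfolding bdens_def by (simp add: distrib_left)
qed

definition fbd :: "real \<Rightarrow> real" where
  "fbd l = 2 + 12 * l * Ximax + 6 * l + 16 * l^3 * Ximax^3 + 4 * l^2 * Ximax"

lemma fbd_nonneg: "0 \<le> l \<Longrightarrow> 0 \<le> fbd l"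
  using Ximax_ge by (simp add: fbd_def)

lemma carl_flux_le:
  assumes p: "p \<in> cQ" and l: "0 \<le> l" and s: "s \<in> {-1, 1}"
  shows "\<bar>carl_flux l s g g1 gt j p\<bar> \<le> fbd l * bdens g g1 gt p"
proof -
  let ?b = "bdens g g1 gt p" and ?X = "Xi p" and ?Y = Ximax
  have X: "1 \<le> ?X" "?X \<le> ?Y" using Xi_bounds[OF p] by auto
  have b: "(g p)^2 \<le> ?b" "grad2 g1 p \<le> ?b" "(gt p)^2 \<le> ?b" "0 \<le> ?b"
    using grad2_nonneg[of g1 p] by (auto simp: bdens_def)
  have b1: "(g1 k p)^2 \<le> ?b" for k using grad2_ge[of g1 k p] b by linarith
  have pr: "\<bar>u * v\<bar> \<le> ?b" if "u^2 \<le> ?b" "v^2 \<le> ?b" for u v :: real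
  proof -
    have "2 * \<bar>u * v\<bar> \<le> u^2 + v^2" using sum_squares_bound[of "\<bar>u\<bar>" "\<bar>v\<bar>"] by (simp add: abs_mult mult.assoc)
    then show ?thesis using that by linarith
  qed
  have t1: "\<bar>2 * s * (g1 j p * gt p)\<bar> \<le> 2 * ?b"
    using pr[OF b1 b(3), of j] s by (auto simp: abs_mult)
  have t2: "\<bar>8 * l * (?X * (g1 ix1 p * g1 j p))\<bar> \<le> 8 * l * ?Y * ?b"
  proof -
    have "?X * \<bar>g1 ix1 p * g1 j p\<bar> \<le> ?Y * ?b" using X b1 by (intro mult_mono pr) auto
    then have "8 * l * (?X * \<bar>g1 ix1 p * g1 j p\<bar>) \<le> 8 * l * (?Y * ?b)" using l by (intro mult_left_mono) auto
    then show ?thesis using X l by (simp add: abs_mult mult.assoc)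
  qed
  have t3: "\<bar>6 * l * (g p * g1 j p)\<bar> \<le> 6 * l * ?b"
    using mult_left_mono[OF pr[OF b(1) b1, of j], of "6 * l"] l by (simp add: abs_mult mult.assoc)
  have t4: "\<bar>del1 j * (4 * l * (?X * grad2 g1 p) - (16 * l^3 * ?X^3 + 4 * l^2 * ?X) * (g p)^2)\<bar>
     \<le> 4 * l * ?Y * ?b + (16 * l^3 * ?Y^3 + 4 * l^2 * ?Y) * ?b"
  proof -
    have u: "0 \<le> 4 * l * (?X * grad2 g1 p)" using l X grad2_nonneg[of g1 p] by simp
    have "?X * grad2 g1 p \<le> ?Y * ?b" using X b grad2_nonneg by (intro mult_mono) auto
    then have u': "4 * l * (?X * grad2 g1 p) \<le> 4 * l * (?Y * ?b)" using l by (intro mult_left_mono) auto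
    have v: "0 \<le> (16 * l^3 * ?X^3 + 4 * l^2 * ?X) * (g p)^2" using l X by simp
    have v': "(16 * l^3 * ?X^3 + 4 * l^2 * ?X) * (g p)^2 \<le> (16 * l^3 * ?Y^3 + 4 * l^2 * ?Y) * ?b"
      using l X b by (intro mult_mono add_mono mult_left_mono power_mono) auto
    show ?thesis using u u' v v' by (auto simp: del1_def)
  qed
  have "carl_flux l s g g1 gt j p = 2 * s * (g1 j p * gt p) - 8 * l * (?X * (g1 ix1 p * g1 j p)) - 6 * l * (g p * g1 j p)
     + del1 j * (4 * l * (?X * grad2 g1 p) - (16 * l^3 * ?X^3 + 4 * l^2 * ?X) * (g p)^2)"
    by (simp add: carl_flux_def grad2_def)
  then have "\<bar>carl_flux l s g g1 gt j p\<bar> \<le> 2 * ?b + 8 * l * ?Y * ?b + 6 * l * ?b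
     + (4 * l * ?Y * ?b + (16 * l^3 * ?Y^3 + 4 * l^2 * ?Y) * ?b)"
    using t1 t2 t3 t4 by linarith
  also have "\<dots> = fbd l * ?b" by (simp add: fbd_def algebra_simps)
  finally show ?thesis .
qed

text \<open>The Carleman estimate for \<open>\<plusminus>\<partial>\<^sub>t + \<Delta>\<close> with the time-independent weight \<open>exp (2 l X^2)\<close>, where
  \<open>X = x\<^sub>1 + A\<^sub>1 + 1\<close>. The terms at \<open>t = 0\<close> and \<open>t = T\<close> enter only through a difference.\<close>

lemma carleman:
  assumes z: "smooth21 z z1 z2 zt z1t" and l: "1 \<le> l" and s: "s \<in> {-1, 1}"
  shows "IQ A T (\<lambda>p. (Ew l p)^2 * (((zt p)^2 + (lapl z2 p)^2) / l + l * grad2 z1 p + l^3 * (z p)^2))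
    \<le> 14 * Ximax^2 * (IQ A T (\<lambda>p. (Ew l p)^2 * (s * zt p + lapl z2 p)^2) + fbd l * wbd l * Lat z z1 zt
        + s * (IO A (\<lambda>x. carl_time l (\<lambda>p. Ew l p * z p) (cg1 l z z1) (x, T))
              - IO A (\<lambda>x. carl_time l (\<lambda>p. Ew l p * z p) (cg1 l z z1) (x, 0))))"
proof -
  define g where "g = (\<lambda>p. Ew l p * z p)"
  define gt where "gt = (\<lambda>p. Ew l p * zt p)"
  define g1 where "g1 = cg1 l z z1"
  define g2 where "g2 = cg2 l z z1 z2"
  have sg: "smooth21 g g1 g2 gt (cg1t l zt z1t)"
    unfolding g_def gt_def g1_def g2_def by (rule smooth21_conj[OF z])
  define S where "S = (\<lambda>p. (\<Sum>j\<in>UNIV. g2 j j p) + 4 * l^2 * (Xi p)^2 * g p + l * g p)"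
  define B where "B = (\<lambda>p. s * gt p - 4 * l * Xi p * g1 ix1 p - 3 * l * g p)"
  let ?P = "\<lambda>p. (S p)^2 + (B p)^2 + 8 * l * (g1 ix1 p)^2 + 2 * l * (\<Sum>k\<in>UNIV. (g1 k p)^2) + 22 * l^3 * (g p)^2"
  let ?flux = "\<Sum>j\<in>UNIV. IB A T j 1 (carl_flux l s g g1 gt j) - IB A T j (-1) (carl_flux l s g g1 gt j)"
  note cz = smooth21D(6-10)[OF z] and cg = smooth21D(6-10)[OF sg]
  have alg: "S p + B p = Ew l p * (s * zt p + lapl z2 p)"
    "(Ew l p)^2 * (((zt p)^2 + (lapl z2 p)^2) / l + l * grad2 z1 p + l^3 * (z p)^2) \<le> 14 * Ximax^2 * ?P p"
    if p: "p \<in> cQ" for p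
  proof -
    have X: "1 \<le> Xi p" "Xi p \<le> Ximax" using Xi_bounds[OF p] by auto
    have 1: "s^2 = 1" using s by auto
    have 2: "g1 ix1 p = Ew l p * (z1 ix1 p + 2 * l * Xi p * z p)" by (simp add: g1_def cg1_def del1_def)
    have 3: "S p = Ew l p * (lapl z2 p + 4 * l * Xi p * z1 ix1 p + (2 * l + 4 * l^2 * (Xi p)^2) * z p)
        + 4 * l^2 * (Xi p)^2 * g p + l * g p"
      unfolding S_def g2_def lapl_conj[symmetric] by (simp add: lapl_def)
    have 4: "B p = s * (Ew l p * zt p) - 4 * l * Xi p * g1 ix1 p - 3 * l * g p" by (simp add: B_def gt_def)
    have 5: "(\<Sum>k\<in>UNIV. (g1 k p)^2) = (Ew l p)^2 * (grad2 z1 p + 4 * l * Xi p * z p * z1 ix1 p + 4 * l^2 * (Xi p)^2 * (z p)^2)"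
      unfolding g1_def grad2_def[symmetric] by (rule grad2_conj_eq)
    have 6: "(g1 ix1 p)^2 \<le> (\<Sum>k\<in>UNIV. (g1 k p)^2)" using grad2_ge[of g1 ix1 p] by (simp add: grad2_def)
    have 7: "g p = Ew l p * z p" by (simp add: g_def)
    note alg = carleman_lower_alg[OF l X 1 7 2 3 4 5 6]
    show "S p + B p = Ew l p * (s * zt p + lapl z2 p)" by (rule alg(1))
    show "(Ew l p)^2 * (((zt p)^2 + (lapl z2 p)^2) / l + l * grad2 z1 p + l^3 * (z p)^2) \<le> 14 * Ximax^2 * ?P p"
      using alg(2) by (simp add: mult.assoc)
  qed
  have cS: "contQ S" "contQ B"
    unfolding S_def B_def by (intro continuous_intros cg cont_Xi)+
  have l0: "l \<noteq> 0" using l by auto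
  have "IQ A T (\<lambda>p. (Ew l p)^2 * (((zt p)^2 + (lapl z2 p)^2) / l + l * grad2 z1 p + l^3 * (z p)^2))
     \<le> IQ A T (\<lambda>p. 14 * Ximax^2 * ?P p)"
    by (intro Q.L_mono alg(2) continuous_intros cont_Ew cz cont_lapl cont_grad2 cS cg cont_Xi) (use l0 in auto)
  also have "\<dots> = 14 * Ximax^2 * IQ A T ?P"
    by (intro Q.L_cmult continuous_intros cS cg)
  also have "\<dots> \<le> 14 * Ximax^2 * (IQ A T (\<lambda>p. (S p + B p)^2) - ?flux
      + s * (IO A (\<lambda>x. carl_time l g g1 (x, T)) - IO A (\<lambda>x. carl_time l g g1 (x, 0))))"
    unfolding S_def B_def by (intro mult_left_mono carleman_integrated[OF sg l]) auto
  also have "IQ A T (\<lambda>p. (S p + B p)^2) = IQ A T (\<lambda>p. (Ew l p)^2 * (s * zt p + lapl z2 p)^2)"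
    by (intro Q.L_cong continuous_intros cS) (simp add: alg power_mult_distrib)
  also have "14 * Ximax^2 * (IQ A T (\<lambda>p. (Ew l p)^2 * (s * zt p + lapl z2 p)^2) - ?flux
      + s * (IO A (\<lambda>x. carl_time l g g1 (x, T)) - IO A (\<lambda>x. carl_time l g g1 (x, 0))))
    \<le> 14 * Ximax^2 * (IQ A T (\<lambda>p. (Ew l p)^2 * (s * zt p + lapl z2 p)^2) + fbd l * wbd l * Lat z z1 zt
      + s * (IO A (\<lambda>x. carl_time l g g1 (x, T)) - IO A (\<lambda>x. carl_time l g g1 (x, 0))))"
  proof -
    have f: "\<bar>IB A T j \<sigma> (carl_flux l s g g1 gt j)\<bar> \<le> fbd l * wbd l * IB A T j \<sigma> (bdens z z1 zt)"
      if \<sigma>: "\<sigma> \<in> {-1, 1}" for j \<sigma>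
    proof -
      interpret B: posfun "cQ" "IB A T j \<sigma>" by (rule posfun_IB[OF \<sigma>])
      have "\<bar>carl_flux l s g g1 gt j p\<bar> \<le> fbd l * wbd l * bdens z z1 zt p" if p: "p \<in> cQ" for p
      proof -
        have "\<bar>carl_flux l s g g1 gt j p\<bar> \<le> fbd l * bdens g g1 gt p" using l by (intro carl_flux_le p s) auto
        also have "\<dots> \<le> fbd l * (wbd l * bdens z z1 zt p)"
          unfolding g_def g1_def gt_def using l by (intro mult_left_mono conj_dens_le p fbd_nonneg) auto
        finally show ?thesis by (simp add: mult.assoc)
      qed
      then have "\<bar>IB A T j \<sigma> (carl_flux l s g g1 gt j)\<bar> \<le> IB A T j \<sigma> (\<lambda>p. fbd l * wbd l * bdens z z1 zt p)"
        by (intro B.L_abs_le cont_carl_flux[OF sg] continuous_intros cont_bdens cz)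
      also have "\<dots> = fbd l * wbd l * IB A T j \<sigma> (bdens z z1 zt)"
        by (intro B.L_cmult cont_bdens cz)
      finally show ?thesis .
    qed
    have "- ?flux = (\<Sum>j\<in>UNIV. - IB A T j 1 (carl_flux l s g g1 gt j) + IB A T j (-1) (carl_flux l s g g1 gt j))"
      by (simp add: sum_negf[symmetric])
    also have "\<dots> \<le> (\<Sum>j\<in>UNIV. fbd l * wbd l * IB A T j 1 (bdens z z1 zt) + fbd l * wbd l * IB A T j (-1) (bdens z z1 zt))"
      using f by (intro sum_mono add_mono) (auto simp: abs_le_iff)
    also have "\<dots> = fbd l * wbd l * Lat z z1 zt"
      unfolding Lat_def by (simp add: sum_distrib_left distrib_left)
    finally show ?thesis by (intro mult_left_mono) auto
  qed
  finally show ?thesis unfolding g_def g1_def .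
qed

section \<open>The terms at the ends of the time interval\<close>

definition tbd :: "real \<Rightarrow> real" where "tbd l = (1 + 4 * l^2 * Ximax^2 + l) * wbd l"

lemma tbd_nonneg: "0 \<le> l \<Longrightarrow> 0 \<le> tbd l" by (simp add: tbd_def wbd_nonneg)

lemma Xi_sq_le: "p \<in> cQ \<Longrightarrow> 0 \<le> l \<Longrightarrow> 4 * l^2 * (Xi p)^2 + l \<le> 4 * l^2 * Ximax^2 + l"
  using Xi_bounds[of p] by (auto intro!: mult_left_mono power_mono)

lemma carl_time_le:
  assumes p: "p \<in> cQ" and l: "0 \<le> l"
  shows "\<bar>carl_time l (\<lambda>p. Ew l p * z p) (cg1 l z z1) p\<bar> \<le> tbd l * ((z p)^2 + grad2 z1 p)"
proof -
  let ?D = "wbd l * ((z p)^2 + grad2 z1 p)"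
  have G: "(Ew l p * z p)^2 + grad2 (cg1 l z z1) p \<le> ?D" by (rule conj_dens_le[OF p l])
  have G0: "0 \<le> grad2 (cg1 l z z1) p" by (rule grad2_nonneg)
  have "(4 * l^2 * (Xi p)^2 + l) * (Ew l p * z p)^2 \<le> (4 * l^2 * Ximax^2 + l) * ?D"
    using G G0 l by (intro mult_mono Xi_sq_le p) (auto intro: order_trans[rotated])
  moreover have "0 \<le> (4 * l^2 * (Xi p)^2 + l) * (Ew l p * z p)^2" using l by simp
  moreover have "carl_time l (\<lambda>p. Ew l p * z p) (cg1 l z z1) p
     = grad2 (cg1 l z z1) p - (4 * l^2 * (Xi p)^2 + l) * (Ew l p * z p)^2"
    by (simp add: carl_time_def grad2_def)
  moreover have "grad2 (cg1 l z z1) p \<le> ?D" using G zero_le_power2[of "Ew l p * z p"] by linarith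
  moreover have "0 \<le> (4 * l^2 * Ximax^2 + l) * ?D"
    using l grad2_nonneg[of z1 p] by (intro mult_nonneg_nonneg add_nonneg_nonneg wbd_nonneg) auto
  moreover have "0 \<le> ?D" using grad2_nonneg[of z1 p] by (intro mult_nonneg_nonneg wbd_nonneg) auto
  ultimately have "\<bar>carl_time l (\<lambda>p. Ew l p * z p) (cg1 l z z1) p\<bar> \<le> ?D + (4 * l^2 * Ximax^2 + l) * ?D"
    using G0 by linarith
  then show ?thesis by (simp add: tbd_def algebra_simps)
qed

text \<open>Since \<open>Xi\<close> and the weight do not depend on time, the conjugated quantities
  at \<open>T\<close> and at 0 differ by the conjugate of the jump. Young's inequality applied to
  \<open>a^2 - b^2 = 2 b (a - b) + (a - b)^2\<close> puts only the small factor
  \<open>\<epsilon>\<close> on the values at \<open>t = 0\<close>.\<close>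

lemma carl_time_diff_le:
  assumes p: "(x, 0) \<in> cQ" and l: "0 \<le> l" and \<epsilon>: "0 < \<epsilon>"
  shows "\<bar>carl_time l (\<lambda>p. Ew l p * z p) (cg1 l z z1) (x, T) - carl_time l (\<lambda>p. Ew l p * z p) (cg1 l z z1) (x, 0)\<bar>
    \<le> tbd l * ((1 + 1 / \<epsilon>) * ((z (x, T) - z (x, 0))^2 + (\<Sum>k\<in>UNIV. (z1 k (x, T) - z1 k (x, 0))^2))
        + \<epsilon> * ((z (x, 0))^2 + grad2 z1 (x, 0)))"
proof -
  define dz where "dz p = z (fst p, T) - z (fst p, 0)" for p :: "'n rvec \<times> real"
  define dz1 where "dz1 k p = z1 k (fst p, T) - z1 k (fst p, 0)" for p :: "'n rvec \<times> real" and k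
  let ?q = "4 * l^2 * (Xi (x, 0))^2 + l"
  have Xe: "Xi (x, T) = Xi (x, 0)" "Ew l (x, T) = Ew l (x, 0)" by (simp_all add: Xi_def Ew_def)
  have sq: "\<bar>a^2 - b^2\<bar> \<le> (1 + 1 / \<epsilon>) * (a - b)^2 + \<epsilon> * b^2" for a b :: real
  proof -
    have e: "a^2 - b^2 = 2 * (b * (a - b)) + (a - b)^2" by (simp add: power2_eq_square algebra_simps)
    have "0 \<le> (\<bar>a - b\<bar> / sqrt \<epsilon> - sqrt \<epsilon> * \<bar>b\<bar>)^2" by simp
    also have "\<dots> = (a - b)^2 / \<epsilon> - 2 * \<bar>b * (a - b)\<bar> + \<epsilon> * b^2"
      using \<epsilon> by (simp add: power2_diff power_divide power_mult_distrib abs_mult)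
    finally have "\<bar>2 * (b * (a - b))\<bar> \<le> (a - b)^2 / \<epsilon> + \<epsilon> * b^2" by simp
    moreover have "(1 + 1 / \<epsilon>) * (a - b)^2 + \<epsilon> * b^2 = (a - b)^2 + ((a - b)^2 / \<epsilon> + \<epsilon> * b^2)"
      by (simp add: distrib_right)
    ultimately show ?thesis unfolding e using zero_le_power2[of "a - b"] by linarith
  qed
  have d1: "cg1 l z z1 k (x, T) - cg1 l z z1 k (x, 0) = cg1 l dz dz1 k (x, 0)" for k
    by (simp add: cg1_def Xe dz_def dz1_def algebra_simps)
  have d0: "Ew l (x, T) * z (x, T) - Ew l (x, 0) * z (x, 0) = Ew l (x, 0) * dz (x, 0)"
    by (simp add: Xe dz_def algebra_simps)
  let ?d = "(Ew l (x, 0) * dz (x, 0))^2" and ?b = "(Ew l (x, 0) * z (x, 0))^2"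
  let ?dg = "grad2 (cg1 l dz dz1) (x, 0)" and ?bg = "grad2 (cg1 l z z1) (x, 0)"
  have s1: "\<bar>(Ew l (x, T) * z (x, T))^2 - ?b\<bar> \<le> (1 + 1 / \<epsilon>) * ?d + \<epsilon> * ?b"
    using sq[of "Ew l (x, T) * z (x, T)" "Ew l (x, 0) * z (x, 0)"] by (simp add: d0)
  have s2: "\<bar>grad2 (cg1 l z z1) (x, T) - ?bg\<bar> \<le> (1 + 1 / \<epsilon>) * ?dg + \<epsilon> * ?bg"
  proof -
    have "\<bar>grad2 (cg1 l z z1) (x, T) - ?bg\<bar> = \<bar>\<Sum>k\<in>UNIV. (cg1 l z z1 k (x, T))^2 - (cg1 l z z1 k (x, 0))^2\<bar>"
      by (simp add: grad2_def sum_subtractf)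
    also have "\<dots> \<le> (\<Sum>k\<in>UNIV. \<bar>(cg1 l z z1 k (x, T))^2 - (cg1 l z z1 k (x, 0))^2\<bar>)" by (rule sum_abs)
    also have "\<dots> \<le> (\<Sum>k\<in>UNIV. (1 + 1 / \<epsilon>) * (cg1 l dz dz1 k (x, 0))^2 + \<epsilon> * (cg1 l z z1 k (x, 0))^2)"
      by (intro sum_mono) (metis sq d1)
    also have "\<dots> = (1 + 1 / \<epsilon>) * ?dg + \<epsilon> * ?bg"
      by (simp add: grad2_def sum.distrib sum_distrib_left)
    finally show ?thesis .
  qed
  define Dd where "Dd = (1 + 1 / \<epsilon>) * (wbd l * ((dz (x, 0))^2 + grad2 dz1 (x, 0))) + \<epsilon> * (wbd l * ((z (x, 0))^2 + grad2 z1 (x, 0)))"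
  have tot: "((1 + 1 / \<epsilon>) * ?d + \<epsilon> * ?b) + ((1 + 1 / \<epsilon>) * ?dg + \<epsilon> * ?bg) \<le> Dd"
  proof -
    have "(1 + 1 / \<epsilon>) * (?d + ?dg) + \<epsilon> * (?b + ?bg) \<le> Dd"
      unfolding Dd_def using \<epsilon> conj_dens_le(1)[OF p l]
      by (intro add_mono mult_left_mono) auto
    then show ?thesis by (simp add: algebra_simps)
  qed
  have n: "0 \<le> (1 + 1 / \<epsilon>) * ?d + \<epsilon> * ?b" "0 \<le> (1 + 1 / \<epsilon>) * ?dg + \<epsilon> * ?bg"
    using \<epsilon> grad2_nonneg by (auto intro!: add_nonneg_nonneg mult_nonneg_nonneg)
  have q: "0 \<le> ?q" using l by simp
  have "\<bar>?q * ((Ew l (x, T) * z (x, T))^2 - ?b)\<bar> \<le> ?q * ((1 + 1 / \<epsilon>) * ?d + \<epsilon> * ?b)"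
    unfolding abs_mult abs_of_nonneg[OF q] by (intro mult_left_mono s1 q)
  also have "\<dots> \<le> (4 * l^2 * Ximax^2 + l) * Dd"
    using n tot l by (intro mult_mono Xi_sq_le p) auto
  finally have s3: "\<bar>?q * ((Ew l (x, T) * z (x, T))^2 - ?b)\<bar> \<le> (4 * l^2 * Ximax^2 + l) * Dd" .
  have "carl_time l (\<lambda>p. Ew l p * z p) (cg1 l z z1) (x, T) - carl_time l (\<lambda>p. Ew l p * z p) (cg1 l z z1) (x, 0)
     = (grad2 (cg1 l z z1) (x, T) - ?bg) - ?q * ((Ew l (x, T) * z (x, T))^2 - ?b)"
    unfolding carl_time_def grad2_def[symmetric] Xe(1) by (simp add: algebra_simps)
  then have "\<bar>carl_time l (\<lambda>p. Ew l p * z p) (cg1 l z z1) (x, T) - carl_time l (\<lambda>p. Ew l p * z p) (cg1 l z z1) (x, 0)\<bar>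
     \<le> Dd + (4 * l^2 * Ximax^2 + l) * Dd"
    using s2 s3 tot n by linarith
  also have "\<dots> = tbd l * ((1 + 1 / \<epsilon>) * ((dz (x, 0))^2 + grad2 dz1 (x, 0)) + \<epsilon> * ((z (x, 0))^2 + grad2 z1 (x, 0)))"
    unfolding Dd_def tbd_def by (simp add: algebra_simps)
  finally show ?thesis by (simp add: dz_def dz1_def grad2_def)
qed

section \<open>Traces at the initial time, by means of the cutoff \<open>1 - t / T\<close>\<close>

lemma theta_bounds: "p \<in> cQ \<Longrightarrow> 0 \<le> 1 - snd p / T \<and> 1 - snd p / T \<le> 1"
  using T_pos by (cases p) (auto simp: mem_cQT)

lemma hpd_theta: "hpd S e_time (\<lambda>p. 1 - snd p / T) (\<lambda>p. - 1 / T)"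
  unfolding hpd_def using T_pos by (auto simp: e_time_def divide_simps intro!: derivative_eq_intros)

lemma hpd_theta_space: "hpd S (es i) (\<lambda>p. 1 - snd p / T) (\<lambda>p. 0)"
  unfolding hpd_def by (auto simp: e_space_def)

text \<open>The cutoff is 1 at \<open>t = 0\<close> and vanishes at \<open>t = T\<close>. In the
  time derivative of the cutoff times the squared gradient, the product of the gradients of
  \<open>z\<close> and \<open>zt\<close> is a divergence minus \<open>zt\<close> times the
  Laplacian, so that no mixed derivative remains and the flux becomes the lateral term.\<close>

lemma trace_initial:
  assumes z: "smooth21 z z1 z2 zt z1t"
  shows "IO A (\<lambda>x. (z (x, 0))^2 + grad2 z1 (x, 0))
     \<le> (1 / T + 2) * IQ A T (\<lambda>p. (zt p)^2 + (lapl z2 p)^2 + grad2 z1 p + (z p)^2) + Lat z z1 zt"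
proof -
  note D = smooth21D[OF z] and c = smooth21D(6-10)[OF z]
  let ?\<theta> = "\<lambda>p :: 'n rvec \<times> real. 1 - snd p / T"
  have c\<theta>: "continuous_on K ?\<theta>" for K using T_pos by (intro continuous_intros) auto
  define F where "F p = ?\<theta> p * ((z p)^2 + grad2 z1 p)" for p
  define F' where "F' p = - 1 / T * ((z p)^2 + grad2 z1 p) + ?\<theta> p * (2 * (z p * zt p) + (\<Sum>k\<in>UNIV. 2 * (z1 k p * z1t k p)))" for p
  define G where "G j p = ?\<theta> p * (2 * (z1 j p * zt p))" for j p
  define G' where "G' j p = ?\<theta> p * (2 * (z2 j j p * zt p + z1 j p * z1t j p))" for j p
  have cF: "contQ F" "contQ F'"
    unfolding F_def F'_def by (intro continuous_intros c cont_grad2 c\<theta>)+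
  have cG: "contQ (G j)" "contQ (G' j)" for j
    unfolding G_def G'_def by (intro continuous_intros c cont_grad2 c\<theta>)+
  have hF: "hpdQ e_time F F'"
    unfolding F_def F'_def grad2_def
    by (rule hpd_mult[OF hpd_theta hpd_add[OF hpd_square[OF D(2)] hpd_sum[OF hpd_square[OF D(4)]]]])
  have hG: "hpdQ (es j) (G j) (G' j)" for j
    unfolding G_def G'_def
    by (rule hpd_mult_cong[OF hpd_theta_space hpd_cmult[OF hpd_mult[OF D(3) D(5)]]]) auto
  let ?R = "\<lambda>p. (1 / T + 2) * ((zt p)^2 + (lapl z2 p)^2 + grad2 z1 p + (z p)^2)"
  have "IO A (\<lambda>x. (z (x, 0))^2 + grad2 z1 (x, 0)) = - IQ A T F'"
    using IQ_div_time[OF hF cF] T_pos by (simp add: F_def O.L_zero)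
  also have "\<dots> = IQ A T (\<lambda>p. - 1 * F' p)" by (subst Q.L_cmult[OF cF(2)]) simp
  also have "\<dots> \<le> IQ A T (\<lambda>p. ?R p - (\<Sum>j\<in>UNIV. G' j p))"
  proof (intro Q.L_mono continuous_intros c cF cG cont_lapl cont_grad2)
    fix p assume p: "p \<in> cQ"
    have th: "0 \<le> ?\<theta> p" "?\<theta> p \<le> 1" using theta_bounds[OF p] by auto
    have t: "\<bar>?\<theta> p * (2 * (a * b))\<bar> \<le> a^2 + b^2" for a b :: real
    proof -
      have "\<bar>?\<theta> p * (2 * (a * b))\<bar> \<le> 1 * \<bar>2 * (a * b)\<bar>"
        unfolding abs_mult[of "?\<theta> p"] using th by (intro mult_right_mono) auto
      also have "\<dots> \<le> a^2 + b^2" using sum_squares_bound[of "\<bar>a\<bar>" "\<bar>b\<bar>"] by (simp add: abs_mult mult.assoc)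
      finally show ?thesis .
    qed
    have "(\<Sum>j\<in>UNIV. G' j p) = ?\<theta> p * (2 * (lapl z2 p * zt p)) + ?\<theta> p * (\<Sum>k\<in>UNIV. 2 * (z1 k p * z1t k p))"
      unfolding G'_def lapl_def by (simp add: sum_distrib_left sum_distrib_right sum.distrib[symmetric] algebra_simps)
    then have "- 1 * F' p + (\<Sum>j\<in>UNIV. G' j p) = 1 / T * ((z p)^2 + grad2 z1 p) - ?\<theta> p * (2 * (z p * zt p)) + ?\<theta> p * (2 * (lapl z2 p * zt p))"
      unfolding F'_def by (simp add: algebra_simps)
    also have "\<dots> \<le> 1 / T * ((z p)^2 + grad2 z1 p) + ((z p)^2 + (zt p)^2) + ((lapl z2 p)^2 + (zt p)^2)"
      using t[of "z p" "zt p"] t[of "lapl z2 p" "zt p"] by linarith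
    also have "\<dots> \<le> 1 / T * ((zt p)^2 + (lapl z2 p)^2 + grad2 z1 p + (z p)^2) + 2 * ((zt p)^2 + (lapl z2 p)^2 + grad2 z1 p + (z p)^2)"
    proof -
      have "1 / T * ((z p)^2 + grad2 z1 p) \<le> 1 / T * ((zt p)^2 + (lapl z2 p)^2 + grad2 z1 p + (z p)^2)"
        using T_pos by (intro mult_left_mono) auto
      note h = this
      have "u + (a + b) + (c + b) \<le> v + 2 * (b + c + g + a)" if "u \<le> v" "0 \<le> a" "0 \<le> c" "0 \<le> g" for u v a b c g :: real
        using that by simp
      from this[OF h zero_le_power2 zero_le_power2 grad2_nonneg] show ?thesis .
    qed
    also have "\<dots> = ?R p" by (simp add: algebra_simps)
    finally show "- 1 * F' p \<le> ?R p - (\<Sum>j\<in>UNIV. G' j p)" by simp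
  qed
  also have "\<dots> = IQ A T ?R - (\<Sum>j\<in>UNIV. IQ A T (G' j))"
    by (subst Q.L_diff) (auto intro!: continuous_intros c cG cont_lapl cont_grad2 Q.L_sum)
  also have "(\<Sum>j\<in>UNIV. IQ A T (G' j)) = (\<Sum>j\<in>UNIV. IB A T j 1 (G j) - IB A T j (-1) (G j))"
    by (intro sum.cong refl IQ_div_space hG cG)
  finally have m: "IO A (\<lambda>x. (z (x, 0))^2 + grad2 z1 (x, 0))
     \<le> IQ A T ?R - (\<Sum>j\<in>UNIV. IB A T j 1 (G j) - IB A T j (-1) (G j))" .
  have b: "- (\<Sum>j\<in>UNIV. IB A T j 1 (G j) - IB A T j (-1) (G j)) \<le> Lat z z1 zt"
  proof -
    have f: "\<bar>IB A T j \<sigma> (G j)\<bar> \<le> IB A T j \<sigma> (bdens z z1 zt)" if \<sigma>: "\<sigma> \<in> {-1, 1}" for j \<sigma>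
    proof (intro posfun.L_abs_le[OF posfun_IB[OF \<sigma>]] cG cont_bdens c)
      fix p assume p: "p \<in> cQ"
      have "\<bar>G j p\<bar> \<le> 1 * \<bar>2 * (z1 j p * zt p)\<bar>"
        unfolding G_def abs_mult[of "?\<theta> p"] using theta_bounds[OF p] by (intro mult_right_mono) auto
      also have "\<dots> \<le> (z1 j p)^2 + (zt p)^2" using sum_squares_bound[of "\<bar>z1 j p\<bar>" "\<bar>zt p\<bar>"] by (simp add: abs_mult mult.assoc)
      finally show "\<bar>G j p\<bar> \<le> bdens z z1 zt p" unfolding bdens_def using grad2_ge[of z1 j p] zero_le_power2[of "z p"] by linarith
    qed
    have "- (\<Sum>j\<in>UNIV. IB A T j 1 (G j) - IB A T j (-1) (G j)) = (\<Sum>j\<in>UNIV. - IB A T j 1 (G j) + IB A T j (-1) (G j))"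
      by (simp add: sum_negf[symmetric])
    also have "\<dots> \<le> Lat z z1 zt"
      unfolding Lat_def using f by (intro sum_mono add_mono) (auto simp: abs_le_iff)
    finally show ?thesis .
  qed
  have "IQ A T ?R = (1 / T + 2) * IQ A T (\<lambda>p. (zt p)^2 + (lapl z2 p)^2 + grad2 z1 p + (z p)^2)"
    by (intro Q.L_cmult continuous_intros c cont_lapl cont_grad2)
  with m b show ?thesis by linarith
qed

text \<open>The product \<open>2 z zt\<close> is split by Young's inequality as
  \<open>l^2 z^2 + zt^2 / l^2\<close>. The Carleman inequality gains \<open>l^3\<close> and
  \<open>1 / l\<close> for these squares, so a factor \<open>l\<close> is left for
  absorption.\<close>

lemma trace_weighted:
  assumes z: "smooth21 z z1 z2 zt z1t" and l: "0 < l"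
  shows "IO A (\<lambda>x. (Ew l (x, 0))^2 * (z (x, 0))^2)
     \<le> IQ A T (\<lambda>p. (Ew l p)^2 * ((1 / T + l^2) * (z p)^2 + (zt p)^2 / l^2))"
proof -
  note D = smooth21D[OF z] and c = smooth21D(6-10)[OF z]
  let ?\<theta> = "\<lambda>p :: 'n rvec \<times> real. 1 - snd p / T"
  have c\<theta>: "continuous_on K ?\<theta>" for K using T_pos by (intro continuous_intros) auto
  define F where "F p = ?\<theta> p * (Ew l p * z p)^2" for p
  define F' where "F' p = - 1 / T * (Ew l p * z p)^2 + ?\<theta> p * (2 * ((Ew l p * z p) * (Ew l p * zt p)))" for p
  have cF: "contQ F" "contQ F'"
    unfolding F_def F'_def by (intro continuous_intros c cont_Ew c\<theta>)+
  have hF: "hpdQ e_time F F'"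
    unfolding F_def F'_def
    by (rule hpd_mult[OF hpd_theta hpd_square[OF smooth21D(2)[OF smooth21_conj[OF z]]]])
  have "IO A (\<lambda>x. (Ew l (x, 0))^2 * (z (x, 0))^2) = - IQ A T F'"
    using IQ_div_time[OF hF cF] T_pos by (simp add: F_def O.L_zero power_mult_distrib)
  also have "\<dots> = IQ A T (\<lambda>p. - 1 * F' p)" by (subst Q.L_cmult[OF cF(2)]) simp
  also have "\<dots> \<le> IQ A T (\<lambda>p. (Ew l p)^2 * ((1 / T + l^2) * (z p)^2 + (zt p)^2 / l^2))"
  proof (intro Q.L_mono continuous_intros c cF cont_Ew)
    fix p assume p: "p \<in> cQ"
    have th: "0 \<le> ?\<theta> p" "?\<theta> p \<le> 1" using theta_bounds[OF p] by auto
    have "0 \<le> (l * \<bar>z p\<bar> - \<bar>zt p\<bar> / l)^2" by simp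
    also have "\<dots> = l^2 * (z p)^2 + (zt p)^2 / l^2 - 2 * \<bar>z p * zt p\<bar>"
      using l by (simp add: power2_diff power_divide power_mult_distrib abs_mult)
    finally have y: "2 * \<bar>z p * zt p\<bar> \<le> l^2 * (z p)^2 + (zt p)^2 / l^2" by simp
    have h: "?\<theta> p * (2 * \<bar>z p * zt p\<bar>) \<le> 1 * (2 * \<bar>z p * zt p\<bar>)"
      using th by (intro mult_right_mono) auto
    have "- (?\<theta> p * (2 * (z p * zt p))) \<le> l^2 * (z p)^2 + (zt p)^2 / l^2"
    proof -
      have "- (2 * (z p * zt p)) \<le> 2 * \<bar>z p * zt p\<bar>" by linarith
      from mult_left_mono[OF this th(1)] have "- (?\<theta> p * (2 * (z p * zt p))) \<le> ?\<theta> p * (2 * \<bar>z p * zt p\<bar>)" by (simp only: mult_minus_right)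
      also have "\<dots> \<le> l^2 * (z p)^2 + (zt p)^2 / l^2" by (rule order_trans[OF h]) (use y in simp)
      finally show ?thesis .
    qed
    then have "1 / T * (z p)^2 - ?\<theta> p * (2 * (z p * zt p)) \<le> (1 / T + l^2) * (z p)^2 + (zt p)^2 / l^2"
      by (simp add: algebra_simps)
    then have "(Ew l p)^2 * (1 / T * (z p)^2 - ?\<theta> p * (2 * (z p * zt p))) \<le> (Ew l p)^2 * ((1 / T + l^2) * (z p)^2 + (zt p)^2 / l^2)"
      by (intro mult_left_mono) auto
    then show "- 1 * F' p \<le> (Ew l p)^2 * ((1 / T + l^2) * (z p)^2 + (zt p)^2 / l^2)"
      unfolding F'_def by (simp add: algebra_simps power2_eq_square)
  qed (use l in auto)
  finally show ?thesis .
qed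

end

section \<open>Absorption of the lower order terms\<close>

lemma (in posfun) L_lin4:
  assumes "continuous_on K f0" "continuous_on K f1" "continuous_on K f2" "continuous_on K f3"
  shows "L (\<lambda>x. c0 * f0 x + c1 * f1 x + c2 * f2 x + c3 * f3 x) = c0 * L f0 + c1 * L f1 + c2 * L f2 + c3 * L f3"
  using assms by (simp add: L_add L_cmult continuous_on_add continuous_on_mult_left)

context boxdom
begin

text \<open>The \<open>a\<close>s stand for the weighted integrals of \<open>zt^2\<close>, the
  squared Laplacian, the squared gradient and \<open>z^2\<close>, the \<open>b\<close>s for those of
  \<open>n\<close>. In the first inequality everything but \<open>P * b3\<close> is absorbed, whence
  \<open>a1\<close>, \<open>a2\<close>, \<open>a3\<close> are at most
  \<open>2 l (P b3 + Rz)\<close>. Inserted into the second this costs \<open>6 P^2 l b3\<close>, to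
  be compared with the gain \<open>l^3 b3\<close>. The threshold for \<open>l\<close> lets every
  absorption consume at most half of the corresponding gain.\<close>

lemma absorption_algebra:
  fixes l P :: real
  assumes P: "1 \<le> P" and T': "0 \<le> T'" and l: "5 * P * (2 + T') + 1 \<le> l"
    and pos: "0 \<le> a0" "0 \<le> a1" "0 \<le> a2" "0 \<le> a3" "0 \<le> b0" "0 \<le> b1" "0 \<le> b2" "0 \<le> b3" "0 \<le> Rz" "0 \<le> Rn"
    and z: "(a0 + a1) / l + l * a2 + l^3 * a3 \<le> P * (a3 + a2 + b3 + ((T' + l^2) * a3 + a0 / l^2)) + Rz"
    and n: "(b0 + b1) / l + l * b2 + l^3 * b3 \<le> P * (a1 + a2 + a3 + b3 + b2) + Rn"
  shows "b0 + b1 + b2 + b3 \<le> 16 * l * (6 * l * P * Rz + Rn)"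
    and "a0 + a1 + a2 + a3 \<le> 8 * l * (P * (16 * l * (6 * l * P * Rz + Rn)) + Rz)"
proof -
  have PT: "0 \<le> P * T'" using P T' by simp
  have l1: "1 \<le> l" "10 * P \<le> l" "5 * (P * T') \<le> l" "10 * P + 5 * (P * T') \<le> l"   proof -
    have "5 * P * (2 + T') = 10 * P + 5 * (P * T')" by (simp add: algebra_simps)
    then have "10 * P + 5 * (P * T') + 1 \<le> l" using l by simp
    then show "1 \<le> l" "10 * P \<le> l" "5 * (P * T') \<le> l" "10 * P + 5 * (P * T') \<le> l" using P PT by linarith+
  qed
  have l0: "0 < l" using l1 by simp
  have ll: "l \<le> l^2" "l^2 \<le> l^3" "1 \<le> l^2" "1 \<le> l^3" "l \<le> l^3"
    using l1 power_increasing[of 1 2 l] power_increasing[of 2 3 l] power_increasing[of 1 3 l] by auto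
  have z0: "P * (a0 / l^2) \<le> 1 / 2 * (a0 / l)"
  proof -
    have "P * (a0 / l^2) = (P / l) * (a0 / l)" by (simp add: power2_eq_square)
    also have "\<dots> \<le> 1 / 2 * (a0 / l)" using l1 l0 P pos by (intro mult_right_mono) (auto simp: field_simps)
    finally show ?thesis .
  qed
  have z2: "P * a2 \<le> 1 / 2 * (l * a2)"
    using mult_right_mono[of P "1 / 2 * l" a2] l1 P pos by (simp add: mult.assoc)
  have z3: "P * (a3 + (T' + l^2) * a3) \<le> 1 / 2 * (l^3 * a3)"
  proof -
    have "P * (1 + T' + l^2) \<le> P * (l^2 + T' * l^2 + l^2)"
      using P T' ll mult_left_mono[OF ll(3) T'] by (intro mult_left_mono) auto
    also have "\<dots> = (2 * P + P * T') * l^2" by (simp add: algebra_simps)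
    also have "\<dots> \<le> (1 / 2 * l) * l^2" using l1 by (intro mult_right_mono) auto
    finally have "P * (1 + T' + l^2) \<le> 1 / 2 * l^3" by (simp add: power2_eq_square power3_eq_cube mult.assoc)
    then have "P * (1 + T' + l^2) * a3 \<le> 1 / 2 * l^3 * a3" using pos by (intro mult_right_mono) auto
    then show ?thesis by (simp add: algebra_simps)
  qed
  have "P * (a3 + a2 + b3 + ((T' + l^2) * a3 + a0 / l^2)) = P * (a3 + (T' + l^2) * a3) + P * a2 + P * b3 + P * (a0 / l^2)"
    by (simp add: algebra_simps)
  moreover have "(a0 + a1) / l = a0 / l + a1 / l" by (simp add: add_divide_distrib)
  ultimately have zz: "1 / 2 * (a0 / l) + a1 / l + 1 / 2 * (l * a2) + 1 / 2 * (l^3 * a3) \<le> P * b3 + Rz"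
    using z z0 z2 z3 by linarith
  have nn: "0 \<le> a0 / l" "0 \<le> a1 / l" "0 \<le> l * a2" "0 \<le> l^3 * a3" "0 \<le> b0 / l" "0 \<le> b1 / l" "0 \<le> l * b2" "0 \<le> l^3 * b3"
    using pos l0 by auto
  have PR: "0 \<le> P * b3 + Rz" using P pos by simp
  have up: "x \<le> 2 * l * y" if "1 / 2 * (x / l) \<le> y" for x y
    using that l0 by (simp add: field_simps)
  have up2: "x \<le> 2 * l * y" if "1 / 2 * (l^k * x) \<le> y" "0 \<le> x" for x y and k :: nat
  proof -
    have "1 * x \<le> l^k * x" using l1 that by (intro mult_right_mono one_le_power) auto
    then have "x \<le> 2 * y" using that by simp
    also have "\<dots> \<le> 2 * l * y" using that l1 l0 mult_right_mono[of 1 l "2 * y"] \<open>1 * x \<le> l^k * x\<close> by simp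
    finally show ?thesis .
  qed
  have a: "a0 \<le> 2 * l * (P * b3 + Rz)" "a1 \<le> 2 * l * (P * b3 + Rz)" "a2 \<le> 2 * l * (P * b3 + Rz)" "a3 \<le> 2 * l * (P * b3 + Rz)"
    using zz nn by (intro up up2[of 1, simplified] up2[of 3] pos; simp)+
  have asum: "P * (a1 + a2 + a3) \<le> P * (6 * l * (P * b3 + Rz))"
    using a P by (intro mult_left_mono) auto
  have lP: "(5 * P)^2 \<le> (l / 2)^2" using l1 P by (intro power_mono) auto
  have n3: "P * (6 * l * (P * b3)) + P * b3 \<le> 1 / 2 * (l^3 * b3)"
  proof -
    have "25 * P^2 \<le> 1 / 4 * l^2" using lP by (simp add: power_mult_distrib power_divide)
    then have "6 * P^2 \<le> 1 / 4 * l^2" using zero_le_power2[of P] by linarith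
    then have "6 * P^2 * l \<le> 1 / 4 * l^2 * l" using l0 by (intro mult_right_mono) auto
    moreover have "P \<le> 1 / 4 * l^3" using l1 ll P by linarith
    ultimately have "6 * P^2 * l + P \<le> 1 / 2 * l^3" by (simp add: power2_eq_square power3_eq_cube)
    then have "(6 * P^2 * l + P) * b3 \<le> 1 / 2 * l^3 * b3" using pos by (intro mult_right_mono) auto
    then show ?thesis by (simp add: algebra_simps power2_eq_square)
  qed
  have n2: "P * b2 \<le> 1 / 2 * (l * b2)"
    using mult_right_mono[of P "1 / 2 * l" b2] l1 P pos by (simp add: mult.assoc)
  have "P * (a1 + a2 + a3 + b3 + b2) = P * (a1 + a2 + a3) + P * b3 + P * b2" by (simp add: algebra_simps)
  moreover have "P * (6 * l * (P * b3 + Rz)) = P * (6 * l * (P * b3)) + 6 * l * P * Rz" by (simp add: algebra_simps)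
  moreover have "(b0 + b1) / l = b0 / l + b1 / l" by (simp add: add_divide_distrib)
  ultimately have bb: "b0 / l + b1 / l + 1 / 2 * (l * b2) + 1 / 2 * (l^3 * b3) \<le> 6 * l * P * Rz + Rn"
    using n asum n3 n2 by linarith
  have b: "b0 \<le> 2 * l * (6 * l * P * Rz + Rn)" "b1 \<le> 2 * l * (6 * l * P * Rz + Rn)"
    "b2 \<le> 2 * l * (6 * l * P * Rz + Rn)" "b3 \<le> 2 * l * (6 * l * P * Rz + Rn)"
    using bb nn by (intro up up2[of 1, simplified] up2[of 3] pos; simp)+
  have R: "0 \<le> l * (6 * l * P * Rz + Rn)" using l0 P pos by simp
  show bs: "b0 + b1 + b2 + b3 \<le> 16 * l * (6 * l * P * Rz + Rn)" using b R by simp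
  have "P * b3 + Rz \<le> P * (16 * l * (6 * l * P * Rz + Rn)) + Rz"
    using bs pos P by (intro add_mono mult_left_mono) auto
  then have "8 * l * (P * b3 + Rz) \<le> 8 * l * (P * (16 * l * (6 * l * P * Rz + Rn)) + Rz)"
    using l0 by (intro mult_left_mono) auto
  then show "a0 + a1 + a2 + a3 \<le> 8 * l * (P * (16 * l * (6 * l * P * Rz + Rn)) + Rz)" using a by simp
qed

definition em2 :: "real \<Rightarrow> real" where "em2 l = (exp (l * Ximax^2))^2"

lemma IQ_le_weighted:
  assumes "contQ f" "\<And>p. p \<in> cQ \<Longrightarrow> 0 \<le> f p" "0 \<le> l"
  shows "IQ A T f \<le> IQ A T (\<lambda>p. (Ew l p)^2 * f p)"
proof (intro Q.L_mono continuous_intros cont_Ew assms)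
  fix p assume "p \<in> cQ"
  then have "1 * f p \<le> (Ew l p)^2 * f p"
    using Ew_ge[OF assms(3), of p] assms(2) by (intro mult_right_mono one_le_power) auto
  then show "f p \<le> (Ew l p)^2 * f p" by simp
qed

text \<open>\<open>K\<close> must be available before the functions, so all functions are quantified
  inside a predicate of the two constants. The differential inequalities are demanded for every
  \<open>l \<ge> 1\<close>, since the parameter is selected only in \<open>stability_core\<close>;
  \<open>em2 l\<close> is the largest value of the weight and multiplies the data.\<close>

definition core_prop where
  "core_prop C K \<longleftrightarrow> (\<forall>z z1 z2 zt z1t n n1 n2 nt n1t D.
    smooth21 z z1 z2 zt z1t \<and> smooth21 n n1 n2 nt n1t \<and> 0 \<le> D \<and>
    (\<forall>l\<ge>1. IQ A T (\<lambda>p. (Ew l p)^2 * (zt p + lapl z2 p)^2) \<le>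
       C * (IQ A T (\<lambda>p. (Ew l p)^2 * (z p)^2) + IQ A T (\<lambda>p. (Ew l p)^2 * grad2 z1 p) + IQ A T (\<lambda>p. (Ew l p)^2 * (n p)^2)
         + IO A (\<lambda>x. (Ew l (x, 0))^2 * (z (x, 0))^2)) + C * em2 l * D) \<and>
    (\<forall>l\<ge>1. IQ A T (\<lambda>p. (Ew l p)^2 * (nt p - lapl n2 p)^2) \<le>
       C * (IQ A T (\<lambda>p. (Ew l p)^2 * (lapl z2 p)^2) + IQ A T (\<lambda>p. (Ew l p)^2 * grad2 z1 p) + IQ A T (\<lambda>p. (Ew l p)^2 * (z p)^2)
         + IQ A T (\<lambda>p. (Ew l p)^2 * (n p)^2) + IQ A T (\<lambda>p. (Ew l p)^2 * grad2 n1 p)) + C * em2 l * D) \<and>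
    Lat z z1 zt \<le> C * D \<and> Lat n n1 nt \<le> C * D \<and>
    IO A (\<lambda>x. (z (x, T) - z (x, 0))^2 + (\<Sum>k\<in>UNIV. (z1 k (x, T) - z1 k (x, 0))^2)) \<le> C * D \<and>
    IO A (\<lambda>x. (n (x, 0))^2 + grad2 n1 (x, 0)) \<le> C * D \<and> IO A (\<lambda>x. (n (x, T))^2 + grad2 n1 (x, T)) \<le> C * D
    \<longrightarrow> IQ A T (\<lambda>p. (zt p)^2 + (lapl z2 p)^2 + grad2 z1 p + (z p)^2) \<le> K * D \<and>
        IQ A T (\<lambda>p. (nt p)^2 + (lapl n2 p)^2 + grad2 n1 p + (n p)^2) \<le> K * D)"

lemma core_prop_mono: "core_prop C K \<Longrightarrow> K \<le> K' \<Longrightarrow> core_prop C K'"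
  unfolding core_prop_def[of C K']
proof (intro allI impI, goal_cases)
  case (1 z z1 z2 zt z1t n n1 n2 nt n1t D)
  have "K * D \<le> K' * D" using 1(3) by (intro mult_right_mono 1(2)) (elim conjE)
  with 1(1)[unfolded core_prop_def, rule_format, OF 1(3)] show ?case by linarith
qed

text \<open>The order of the choices matters: \<open>l\<close> depends on \<open>C\<close> and
  \<open>T\<close> and fixes all exponential factors; afterwards \<open>\<epsilon>\<close> is taken
  so small that the trace of \<open>z\<close> at \<open>t = 0\<close>, which enters with the factor
  \<open>b * c0 * tbd l * \<epsilon> * K3\<close>, costs at most half of \<open>Z\<close>.\<close>

lemma stability_core:
  assumes C: "1 \<le> C"
  shows "\<exists>K. core_prop C K"
proof -
  define c0 where "c0 = 14 * Ximax^2"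
  define P where "P = c0 * C"
  define l where "l = 5 * P * (2 + 1 / T) + 1"
  define W where "W = fbd l * wbd l"
  define b where "b = 8 * l * (P * (16 * l * (6 * l * P + 1)) + 1)"
  define K3 where "K3 = 1 / T + 2"
  define \<epsilon> where "\<epsilon> = 1 / (2 * (b * c0 * tbd l * K3 + 1))"
  define Kr where "Kr = c0 * (C * em2 l + W * C)"
  define K4 where "K4 = b * (2 * Kr + c0 * tbd l * ((1 + 1 / \<epsilon>) * C + \<epsilon> * C) + c0 * tbd l * (2 * C))"
  have Y1: "1 \<le> Ximax^2" using Ximax_ge by simp
  have c0: "1 \<le> c0" using Y1 by (simp add: c0_def)
  have P: "1 \<le> P" unfolding P_def using mult_mono[OF c0 C] c0 C by simp
  have T0: "0 \<le> 1 / T" using T_pos by simp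
  have l1: "1 \<le> l" unfolding l_def using P T0 by simp
  have l0: "0 \<le> l" "0 < l" using l1 by auto
  have tb: "0 \<le> tbd l" by (rule tbd_nonneg) (use l1 in simp)
  have W: "0 \<le> W" unfolding W_def using l0 by (intro mult_nonneg_nonneg fbd_nonneg wbd_nonneg)
  have b: "0 \<le> b" unfolding b_def using l1 P by simp
  have K3: "0 \<le> K3" using T0 by (simp add: K3_def)
  have e0: "0 \<le> b * c0 * tbd l * K3" using b c0 tb K3 by simp
  then have \<epsilon>: "0 < \<epsilon>" "b * c0 * tbd l * \<epsilon> * K3 \<le> 1 / 2" by (auto simp: \<epsilon>_def field_simps)
  have em: "0 \<le> em2 l" by (simp add: em2_def)
  have Kr: "0 \<le> Kr" unfolding Kr_def using c0 C em W by simp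
  have bge: "16 * l * (6 * l * P * x + y) \<le> b * (x + y)" "8 * l * (P * (16 * l * (6 * l * P * x + y)) + x) \<le> b * (x + y)"
    if "0 \<le> x" "0 \<le> y" for x y
  proof -
    have q: "6 * l * P * x + y \<le> (6 * l * P + 1) * (x + y)" using that l1 P by (simp add: algebra_simps)
    have q': "0 \<le> (6 * l * P + 1) * (x + y)" using that l1 P by simp
    have 1: "16 * l * (6 * l * P * x + y) \<le> 16 * l * ((6 * l * P + 1) * (x + y))" using q l1 by (intro mult_left_mono) auto
    have "8 * l * (P * (16 * l * (6 * l * P * x + y)) + x) \<le> 8 * l * (P * (16 * l * ((6 * l * P + 1) * (x + y))) + (x + y))"
      using 1 that l1 P by (intro mult_left_mono add_mono) auto
    also have "\<dots> = b * (x + y)" by (simp add: b_def algebra_simps)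
    finally show 2: "8 * l * (P * (16 * l * (6 * l * P * x + y)) + x) \<le> b * (x + y)" .
    have g: "0 \<le> 16 * l * (6 * l * P * x + y)" using that l1 P by simp
    have "1 * (16 * l * (6 * l * P * x + y)) \<le> P * (16 * l * (6 * l * P * x + y))" using g P by (intro mult_right_mono) auto
    then have "1 * (16 * l * (6 * l * P * x + y)) \<le> 8 * l * (P * (16 * l * (6 * l * P * x + y)) + x)"
      using that g l1 P mult_mono[of 1 "8 * l" "16 * l * (6 * l * P * x + y)" "P * (16 * l * (6 * l * P * x + y)) + x"] by linarith
    then show "16 * l * (6 * l * P * x + y) \<le> b * (x + y)" using 2 by linarith
  qed
  show ?thesis unfolding core_prop_def
  \<comment> \<open>The summand \<open>2 * K4\<close> serves the bound of \<open>z\<close>; the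
    other one serves \<open>n\<close> and has this bound of \<open>Z\<close> already
    inserted.\<close>
  proof (intro exI[of _ "2 * K4 + b * (2 * Kr + c0 * tbd l * ((1 + 1 / \<epsilon>) * C + \<epsilon> * (K3 * (2 * K4) + C)) + c0 * tbd l * (2 * C))"] allI impI, elim conjE, goal_cases)
    case (1 z z1 z2 zt z1t n n1 n2 nt n1t D)
    note cz = smooth21D(6-10)[OF 1(1)] and cn = smooth21D(6-10)[OF 1(2)]
    note D0 = 1(3)
    let ?w = "\<lambda>f. IQ A T (\<lambda>p. (Ew l p)^2 * f p)"
    define a0 where "a0 = ?w (\<lambda>p. (zt p)^2)"
    define a1 where "a1 = ?w (\<lambda>p. (lapl z2 p)^2)"
    define a2 where "a2 = ?w (grad2 z1)"
    define a3 where "a3 = ?w (\<lambda>p. (z p)^2)"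
    define b0 where "b0 = ?w (\<lambda>p. (nt p)^2)"
    define b1 where "b1 = ?w (\<lambda>p. (lapl n2 p)^2)"
    define b2 where "b2 = ?w (grad2 n1)"
    define b3 where "b3 = ?w (\<lambda>p. (n p)^2)"
    note defs = a0_def a1_def a2_def a3_def b0_def b1_def b2_def b3_def
    have pos: "0 \<le> a0" "0 \<le> a1" "0 \<le> a2" "0 \<le> a3" "0 \<le> b0" "0 \<le> b1" "0 \<le> b2" "0 \<le> b3"
      unfolding defs by (intro Q.L_nonneg continuous_intros cont_Ew cont_lapl cont_grad2 cz cn mult_nonneg_nonneg grad2_nonneg; simp)+
    have lin: "?w (\<lambda>p. (f0 p + f1 p) / l + l * f2 p + l^3 * f3 p) = (?w f0 + ?w f1) / l + l * ?w f2 + l^3 * ?w f3"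
      if c: "contQ f0" "contQ f1" "contQ f2" "contQ f3" for f0 f1 f2 f3
    proof -
      have cc: "contQ (\<lambda>p. (Ew l p)^2 * f p)" if "contQ f" for f
        using that by (intro continuous_intros cont_Ew)
      have "?w (\<lambda>p. (f0 p + f1 p) / l + l * f2 p + l^3 * f3 p) =
          IQ A T (\<lambda>p. ((1 / l) * ((Ew l p)^2 * f0 p) + (1 / l) * ((Ew l p)^2 * f1 p) + l * ((Ew l p)^2 * f2 p)) + l^3 * ((Ew l p)^2 * f3 p))"
        by (rule arg_cong[where f="IQ A T"]) (auto simp: algebra_simps add_divide_distrib)
      also have "\<dots> = (1 / l) * ?w f0 + (1 / l) * ?w f1 + l * ?w f2 + l^3 * ?w f3"
        using cc[OF c(1)] cc[OF c(2)] cc[OF c(3)] cc[OF c(4)]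
        by (rule Q.L_lin4)
      finally show ?thesis by (simp add: add_divide_distrib)
    qed
    define Tz where "Tz = 1 * (IO A (\<lambda>x. carl_time l (\<lambda>p. Ew l p * z p) (cg1 l z z1) (x, T))
              - IO A (\<lambda>x. carl_time l (\<lambda>p. Ew l p * z p) (cg1 l z z1) (x, 0)))"
    define Tn where "Tn = (-1) * (IO A (\<lambda>x. carl_time l (\<lambda>p. Ew l p * n p) (cg1 l n n1) (x, T))
              - IO A (\<lambda>x. carl_time l (\<lambda>p. Ew l p * n p) (cg1 l n n1) (x, 0)))"
    define Z where "Z = IQ A T (\<lambda>p. (zt p)^2 + (lapl z2 p)^2 + grad2 z1 p + (z p)^2)"
    define N where "N = IQ A T (\<lambda>p. (nt p)^2 + (lapl n2 p)^2 + grad2 n1 p + (n p)^2)"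
    note cct = cont_at_time[OF cont_carl_time[OF smooth21_conj[OF 1(1), of l]], of T l] cont_at_time[OF cont_carl_time[OF smooth21_conj[OF 1(1), of l]], of 0 l]
    note cctn = cont_at_time[OF cont_carl_time[OF smooth21_conj[OF 1(2), of l]], of T l] cont_at_time[OF cont_carl_time[OF smooth21_conj[OF 1(2), of l]], of 0 l]
    have t0: "0 \<in> {0..T}" "T \<in> {0..T}" using T_pos by auto
    have inQ: "(x, 0) \<in> cQ" "(x, T) \<in> cQ" if "x \<in> cOmega A" for x using that T_pos by (auto simp: mem_cQT)
    have cz0: "continuous_on (cOmega A) (\<lambda>x. (z (x, t))^2 + grad2 z1 (x, t))" if "t \<in> {0..T}" for t
      by (rule cont_at_time[OF _ that, of "\<lambda>p. (z p)^2 + grad2 z1 p"]) (intro continuous_intros cont_grad2 cz)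
    have cn0: "continuous_on (cOmega A) (\<lambda>x. (n (x, t))^2 + grad2 n1 (x, t))" if "t \<in> {0..T}" for t
      by (rule cont_at_time[OF _ that, of "\<lambda>p. (n p)^2 + grad2 n1 p"]) (intro continuous_intros cont_grad2 cn)
    have cdz: "continuous_on (cOmega A) (\<lambda>x. (z (x, T) - z (x, 0))^2 + (\<Sum>k\<in>UNIV. (z1 k (x, T) - z1 k (x, 0))^2))"
      by (intro continuous_intros cont_at_time cz t0)
    have Tz: "Tz \<le> tbd l * ((1 + 1 / \<epsilon>) * (C * D) + \<epsilon> * (K3 * Z + C * D))"
    proof -
      have "Tz = IO A (\<lambda>x. carl_time l (\<lambda>p. Ew l p * z p) (cg1 l z z1) (x, T)
              - carl_time l (\<lambda>p. Ew l p * z p) (cg1 l z z1) (x, 0))"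
        unfolding Tz_def using cct t0 by (subst O.L_diff) auto
      also have "\<dots> \<le> IO A (\<lambda>x. tbd l * ((1 + 1 / \<epsilon>) * ((z (x, T) - z (x, 0))^2 + (\<Sum>k\<in>UNIV. (z1 k (x, T) - z1 k (x, 0))^2))
        + \<epsilon> * ((z (x, 0))^2 + grad2 z1 (x, 0))))"
        by (intro O.L_mono continuous_intros cct t0 cz0 cdz order_trans[OF abs_ge_self carl_time_diff_le] inQ l0 \<epsilon>)
      also have "\<dots> = tbd l * ((1 + 1 / \<epsilon>) * IO A (\<lambda>x. (z (x, T) - z (x, 0))^2 + (\<Sum>k\<in>UNIV. (z1 k (x, T) - z1 k (x, 0))^2))
        + \<epsilon> * IO A (\<lambda>x. (z (x, 0))^2 + grad2 z1 (x, 0)))"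
        by (subst O.L_cmult, (intro continuous_intros cz0 cdz t0)[1], subst O.L_add, (intro continuous_intros cz0 cdz t0)+)
           (simp only: O.L_cmult[OF cdz] O.L_cmult[OF cz0[OF t0(1)]])
      also have "\<dots> \<le> tbd l * ((1 + 1 / \<epsilon>) * (C * D) + \<epsilon> * (K3 * Z + C * D))"
      proof (intro mult_left_mono add_mono 1 tb)
        show "IO A (\<lambda>x. (z (x, 0))^2 + grad2 z1 (x, 0)) \<le> K3 * Z + C * D"
          using trace_initial[OF 1(1)] 1(6) unfolding K3_def Z_def by linarith
      qed (use \<epsilon> in auto)
      finally show ?thesis .
    qed
    have Tn: "Tn \<le> tbd l * (2 * C * D)"
    proof -
      have b1: "\<bar>IO A (\<lambda>x. carl_time l (\<lambda>p. Ew l p * n p) (cg1 l n n1) (x, t))\<bar> \<le> tbd l * (C * D)"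
        if "t \<in> {0..T}" "IO A (\<lambda>x. (n (x, t))^2 + grad2 n1 (x, t)) \<le> C * D" for t
      proof -
        have "\<bar>IO A (\<lambda>x. carl_time l (\<lambda>p. Ew l p * n p) (cg1 l n n1) (x, t))\<bar> \<le> IO A (\<lambda>x. tbd l * ((n (x, t))^2 + grad2 n1 (x, t)))"
          using that by (intro O.L_abs_le continuous_intros cn0 carl_time_le l0
             cont_at_time[OF cont_carl_time[OF smooth21_conj[OF 1(2), of l]]]) (auto simp: mem_cQT)
        also have "\<dots> = tbd l * IO A (\<lambda>x. (n (x, t))^2 + grad2 n1 (x, t))" by (rule O.L_cmult[OF cn0[OF that(1)]])
        also have "\<dots> \<le> tbd l * (C * D)" by (intro mult_left_mono that tb)
        finally show ?thesis .
      qed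
      show ?thesis using b1[OF t0(1) 1(9)] b1[OF t0(2) 1(10)] unfolding Tn_def by (simp add: algebra_simps abs_le_iff)
    qed
    \<comment> \<open>The end terms have no sign, whereas \<open>absorption_algebra\<close> requires
      nonnegative remainders; hence \<open>max 0\<close>.\<close>
    define Rz where "Rz = c0 * (C * em2 l * D + W * (C * D) + max 0 Tz)"
    define Rn where "Rn = c0 * (C * em2 l * D + W * (C * D) + max 0 Tn)"
    have CD: "0 \<le> C * D" using C D0 by simp
    have Rp: "0 \<le> Rz" "0 \<le> Rn" unfolding Rz_def Rn_def using c0 CD W em C D0
      by (auto intro!: mult_nonneg_nonneg add_nonneg_nonneg)
    have zineq: "(a0 + a1) / l + l * a2 + l^3 * a3 \<le> P * (a3 + a2 + b3 + ((1 / T + l^2) * a3 + a0 / l^2)) + Rz"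
    proof -
      have "(a0 + a1) / l + l * a2 + l^3 * a3 \<le> c0 * (IQ A T (\<lambda>p. (Ew l p)^2 * (zt p + lapl z2 p)^2) + W * Lat z z1 zt + Tz)"
        using carleman[OF 1(1) l1, of 1]
        unfolding defs lin[OF continuous_on_power[OF cz(4)] continuous_on_power[OF cont_lapl[OF cz(3)]] cont_grad2[OF cz(2)] continuous_on_power[OF cz(1)], symmetric]
        by (simp add: c0_def W_def Tz_def)
      also have "\<dots> \<le> c0 * ((C * (a3 + a2 + b3 + ((1 / T + l^2) * a3 + a0 / l^2)) + C * em2 l * D) + W * (C * D) + max 0 Tz)"
      proof (intro mult_left_mono add_mono 1 W)
        have "IO A (\<lambda>x. (Ew l (x, 0))^2 * (z (x, 0))^2) \<le> (1 / T + l^2) * a3 + a0 / l^2"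
        proof -
          have "IQ A T (\<lambda>p. (Ew l p)^2 * ((1 / T + l^2) * (z p)^2 + (zt p)^2 / l^2)) =
             IQ A T (\<lambda>p. (1 / T + l^2) * ((Ew l p)^2 * (z p)^2) + (1 / l^2) * ((Ew l p)^2 * (zt p)^2))"
            by (rule arg_cong[where f="IQ A T"]) (auto simp: algebra_simps)
          also have "\<dots> = (1 / T + l^2) * a3 + (1 / l^2) * a0"
            unfolding defs by (subst Q.L_add, (intro continuous_intros cont_Ew cz)+, subst Q.L_cmult, (intro continuous_intros cont_Ew cz)+,
              subst Q.L_cmult, (intro continuous_intros cont_Ew cz)+) simp
          finally show ?thesis using trace_weighted[OF 1(1) l0(2)] by simp
        qed
        then have "C * (a3 + a2 + b3 + IO A (\<lambda>x. (Ew l (x, 0))^2 * (z (x, 0))^2)) \<le> C * (a3 + a2 + b3 + ((1 / T + l^2) * a3 + a0 / l^2))"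
          using C by (intro mult_left_mono add_mono) auto
        then show "IQ A T (\<lambda>p. (Ew l p)^2 * (zt p + lapl z2 p)^2) \<le> C * (a3 + a2 + b3 + ((1 / T + l^2) * a3 + a0 / l^2)) + C * em2 l * D"
          using 1(4)[rule_format, OF l1] unfolding defs by linarith
      qed (use c0 in auto)
      also have "\<dots> = P * (a3 + a2 + b3 + ((1 / T + l^2) * a3 + a0 / l^2)) + Rz"
        by (simp add: P_def Rz_def algebra_simps)
      finally show ?thesis .
    qed
    have nineq: "(b0 + b1) / l + l * b2 + l^3 * b3 \<le> P * (a1 + a2 + a3 + b3 + b2) + Rn"
    proof -
      \<comment> \<open>The choice \<open>s = - 1\<close> turns the Carleman inequality into one for
        the forward heat operator; the square hides the overall sign.\<close>
      have sw: "(\<lambda>p. (Ew l p)^2 * (- 1 * nt p + lapl n2 p)^2) = (\<lambda>p. (Ew l p)^2 * (nt p - lapl n2 p)^2)"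
        by (auto simp: power2_eq_square algebra_simps)
      have "(b0 + b1) / l + l * b2 + l^3 * b3 \<le> c0 * (IQ A T (\<lambda>p. (Ew l p)^2 * (nt p - lapl n2 p)^2) + W * Lat n n1 nt + Tn)"
        using carleman[OF 1(2) l1, of "-1", unfolded sw]
        unfolding defs lin[OF continuous_on_power[OF cn(4)] continuous_on_power[OF cont_lapl[OF cn(3)]] cont_grad2[OF cn(2)] continuous_on_power[OF cn(1)], symmetric]
        by (simp add: c0_def W_def Tn_def)
      also have "\<dots> \<le> c0 * ((C * (a1 + a2 + a3 + b3 + b2) + C * em2 l * D) + W * (C * D) + max 0 Tn)"
        using 1(5)[rule_format, OF l1] unfolding defs by (intro mult_left_mono add_mono 1 W) (use c0 in auto)
      also have "\<dots> = P * (a1 + a2 + a3 + b3 + b2) + Rn"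
        by (simp add: P_def Rn_def algebra_simps)
      finally show ?thesis .
    qed
    note alg = absorption_algebra[OF P T0 order_refl[of l, unfolded l_def[of]], folded l_def, OF pos Rp zineq nineq]
    have nb: "b0 + b1 + b2 + b3 \<le> b * (Rz + Rn)" using alg(1) bge(1)[OF Rp] by linarith
    have zb: "a0 + a1 + a2 + a3 \<le> b * (Rz + Rn)" using alg(2) bge(2)[OF Rp] by linarith
    have sumw: "IQ A T (\<lambda>p. f0 p + f1 p + f2 p + f3 p) \<le> ?w f0 + ?w f1 + ?w f2 + ?w f3"
      if c: "contQ f0" "contQ f1" "contQ f2" "contQ f3"
       and nn: "\<And>p. 0 \<le> f0 p" "\<And>p. 0 \<le> f1 p" "\<And>p. 0 \<le> f2 p" "\<And>p. 0 \<le> f3 p" for f0 f1 f2 f3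
    proof -
      have "IQ A T (\<lambda>p. f0 p + f1 p + f2 p + f3 p) = IQ A T f0 + IQ A T f1 + IQ A T f2 + IQ A T f3"
        using c by (simp add: Q.L_add continuous_on_add)
      then show ?thesis using IQ_le_weighted[OF c(1) nn(1) l0(1)] IQ_le_weighted[OF c(2) nn(2) l0(1)]
         IQ_le_weighted[OF c(3) nn(3) l0(1)] IQ_le_weighted[OF c(4) nn(4) l0(1)] by linarith
    qed
    have Zb: "Z \<le> b * (Rz + Rn)"
    proof -
      have "Z \<le> a0 + a1 + a2 + a3" unfolding Z_def defs
        by (intro sumw continuous_intros cont_lapl cont_grad2 cz grad2_nonneg) auto
      then show ?thesis using zb by linarith
    qed
    have Nb: "N \<le> b * (Rz + Rn)"
    proof -
      have "N \<le> b0 + b1 + b2 + b3" unfolding N_def defs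
        by (intro sumw continuous_intros cont_lapl cont_grad2 cn grad2_nonneg) auto
      then show ?thesis using nb by linarith
    qed
    have Z0: "0 \<le> Z" unfolding Z_def
      by (intro Q.L_nonneg continuous_intros cont_lapl cont_grad2 cz add_nonneg_nonneg grad2_nonneg) auto
    have RR: "Rz + Rn \<le> 2 * Kr * D + c0 * (tbd l * ((1 + 1 / \<epsilon>) * (C * D) + \<epsilon> * (K3 * Z + C * D))) + c0 * (tbd l * (2 * C * D))"
    proof -
      have m1: "max 0 Tz \<le> tbd l * ((1 + 1 / \<epsilon>) * (C * D) + \<epsilon> * (K3 * Z + C * D))"
        using Tz tb \<epsilon> CD K3 Z0 by (intro max.boundedI) auto
      have m2: "max 0 Tn \<le> tbd l * (2 * C * D)" using Tn tb CD by (intro max.boundedI) (auto simp: mult.assoc)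
      have "Rz + Rn = 2 * Kr * D + c0 * max 0 Tz + c0 * max 0 Tn"
        unfolding Rz_def Rn_def Kr_def by (simp add: algebra_simps)
      then show ?thesis using mult_left_mono[OF m1, of c0] mult_left_mono[OF m2, of c0] c0 by linarith
    qed
    have Zf: "Z \<le> 2 * K4 * D"
    proof -
      have "b * (Rz + Rn) \<le> b * (2 * Kr * D + c0 * (tbd l * ((1 + 1 / \<epsilon>) * (C * D) + \<epsilon> * (K3 * Z + C * D))) + c0 * (tbd l * (2 * C * D)))"
        using RR b by (intro mult_left_mono)
      also have "\<dots> = K4 * D + (b * c0 * tbd l * \<epsilon> * K3) * Z" by (simp add: K4_def algebra_simps)
      also have "\<dots> \<le> K4 * D + 1 / 2 * Z" by (rule add_left_mono[OF mult_right_mono[OF \<epsilon>(2) Z0]])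
      finally show ?thesis using Zb by simp
    qed
    have K4D: "0 \<le> 2 * K4 * D" using Zf Z0 by linarith
    let ?R = "2 * Kr + c0 * tbd l * ((1 + 1 / \<epsilon>) * C + \<epsilon> * (K3 * (2 * K4) + C)) + c0 * tbd l * (2 * C)"
    have "b * (Rz + Rn) \<le> b * (2 * Kr * D + c0 * (tbd l * ((1 + 1 / \<epsilon>) * (C * D) + \<epsilon> * (K3 * (2 * K4 * D) + C * D))) + c0 * (tbd l * (2 * C * D)))"
    proof (rule mult_left_mono[OF order_trans[OF RR] b])
      show "2 * Kr * D + c0 * (tbd l * ((1 + 1 / \<epsilon>) * (C * D) + \<epsilon> * (K3 * Z + C * D))) + c0 * (tbd l * (2 * C * D))
        \<le> 2 * Kr * D + c0 * (tbd l * ((1 + 1 / \<epsilon>) * (C * D) + \<epsilon> * (K3 * (2 * K4 * D) + C * D))) + c0 * (tbd l * (2 * C * D))"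
        using c0 tb \<epsilon> K3 Zf by (intro order_refl add_mono mult_left_mono) auto
    qed
    also have "\<dots> = b * ?R * D" by (simp add: algebra_simps)
    finally have Nf: "b * (Rz + Rn) \<le> b * ?R * D" .
    have RD: "0 \<le> b * ?R * D" using Nf b Rp by (meson add_nonneg_nonneg mult_nonneg_nonneg order_trans)
    have "Z \<le> (2 * K4 + b * ?R) * D" using Zf RD by (simp add: distrib_right)
    moreover have "N \<le> (2 * K4 + b * ?R) * D"
      unfolding distrib_right[of "2 * K4"] by (rule add_increasing[OF K4D order_trans[OF Nb Nf]])
    ultimately show ?case unfolding Z_def N_def by blast
  qed
qed

end

section \<open>The interaction term\<close>

text \<open>The first coordinate occurs twice in the interaction term: in the kernel and as the
  position of the slice or the lower limit of integration. The sum rule holds as soon as one partial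
  derivative exists at the point and the other is continuous nearby.\<close>

lemma diagonal_derivative:
  fixes F :: "real \<Rightarrow> real \<Rightarrow> real"
  assumes I: "convex I" "s \<in> I"
    and a: "((\<lambda>a. F a s) has_real_derivative Fa) (at s within I)"
    and b: "\<And>a b. a \<in> I \<Longrightarrow> b \<in> I \<Longrightarrow> ((\<lambda>b. F a b) has_real_derivative Fb a b) (at b within I)"
    and c: "continuous_on (I \<times> I) (\<lambda>(a, b). Fb a b)"
  shows "((\<lambda>s. F s s) has_real_derivative Fa + Fb s s) (at s within I)"
proof -
  have "((\<lambda>(a, b). F a b) has_derivative (\<lambda>(ta, tb). (\<lambda>h. h * Fa) ta + blinfun_mult_right (Fb s s) tb))
      (at (s, s) within I \<times> I)"
  proof (rule has_derivative_partialsI[where fy="\<lambda>a b. blinfun_mult_right (Fb a b)"])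
    show "((\<lambda>x. F x s) has_derivative (\<lambda>h. h * Fa)) (at s within I)"
      using a by (simp add: has_field_derivative_def mult.commute[of _ Fa])
    show "((\<lambda>b. F a b) has_derivative blinfun_apply (blinfun_mult_right (Fb a b))) (at b within I)"
      if "a \<in> I" "b \<in> I" for a b
      using b[OF that] by (simp add: has_field_derivative_def)
    have "continuous_on (I \<times> I) (\<lambda>p. blinfun_mult_right ((\<lambda>(a, b). Fb a b) p))"
      by (intro bounded_linear.continuous_on[OF bounded_linear_blinfun_mult_right] c)
    then show "continuous (at (s, s) within I \<times> I) (\<lambda>(a, b). blinfun_mult_right (Fb a b))"
      using I by (auto simp: continuous_on_eq_continuous_within case_prod_unfold)
  qed (use I in auto)
  moreover have "((\<lambda>s. (s, s)) has_derivative (\<lambda>h. (h, h))) (at s within I)"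
    by (auto intro!: derivative_eq_intros)
  moreover have "(\<lambda>s. (s, s)) ` I \<subseteq> I \<times> I" by auto
  ultimately have "((\<lambda>u. (\<lambda>(a, b). F a b) (u, u)) has_derivative (\<lambda>h. (\<lambda>(ta, tb). (\<lambda>h. h * Fa) ta + blinfun_mult_right (Fb s s) tb) (h, h)))
      (at s within I)"
    by (intro has_derivative_in_compose[where g="\<lambda>(a, b). F a b" and f="\<lambda>s. (s, s)"])
       (auto intro: has_derivative_subset)
  moreover have "(\<lambda>h. h * Fa + h * Fb s s) = (*) (Fa + Fb s s)" by (auto simp: algebra_simps)
  ultimately show ?thesis
    by (simp add: has_field_derivative_def mult.commute[of "Fb s s"])
qed

context boxdom
begin

section \<open>The interaction term as integrals over slices\<close>

text \<open>The position \<open>r\<close> of the slice is kept independent of \<open>x\<close>, so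
  that the two dependences can be differentiated separately. The diagonal \<open>SK\<close> belongs
  to the delta kernel and the integral \<open>VK\<close> to the Heaviside kernel.\<close>

definition PhiK where
  "PhiK k g x r t = slice_integral A ix1 r (\<lambda>y. k (x, y) * g (y, t))"
  for k :: "'n rvec \<times> 'n rvec \<Rightarrow> real" and g :: "'n rvec \<times> real \<Rightarrow> real"

definition SK where "SK k g p = PhiK k g (fst p) (fst p $ ix1) (snd p)"

definition VK where "VK k g p = (LINT r:{fst p $ ix1..A $ ix1}|lborel. PhiK k g (fst p) r (snd p))"

abbreviation "cOO \<equiv> cOmega A \<times> cOmega A"
abbreviation "I1 \<equiv> {- A $ ix1..A $ ix1}"

lemma cont_kernel_slice:
  fixes k :: "'n rvec \<times> 'n rvec \<Rightarrow> real" and g :: "'n rvec \<times> real \<Rightarrow> real"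
  assumes "continuous_on cOO k" "contQ g" "x \<in> cOmega A" "t \<in> {0..T}"
  shows "continuous_on (cOmega A) (\<lambda>y. k (x, y) * g (y, t))"
  using assms(3,4)
  by (intro continuous_intros continuous_on_compose2[OF assms(1)] cont_at_time[OF assms(2)]) auto

lemma cOO_bounded:
  fixes k :: "'n rvec \<times> 'n rvec \<Rightarrow> real"
  assumes "continuous_on cOO k"
  obtains C where "\<And>p. p \<in> cOO \<Longrightarrow> \<bar>k p\<bar> \<le> C"
proof -
  have "bounded (k ` cOO)"
    using compact_continuous_image[OF assms compact_Times[OF compact_cOmega compact_cOmega]] by (rule compact_imp_bounded)
  then show ?thesis using that by (auto simp: bounded_iff)
qed

lemma abs_mult_le: "\<bar>a\<bar> \<le> c \<Longrightarrow> \<bar>b\<bar> \<le> d \<Longrightarrow> \<bar>a * b\<bar> \<le> c * (d::real)"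
  unfolding abs_mult by (intro mult_mono) auto

lemma continuous_on_slice_pt:
  assumes "continuous_on S r" shows "continuous_on S (\<lambda>q. slice_pt i (r q) y)"
proof -
  have "(\<lambda>q. slice_pt i (r q) y) = (\<lambda>q. slice_pt i 0 y + r q *\<^sub>R axis i 1)" by (simp add: slice_pt_shift)
  then show ?thesis using assms by (simp only:) (intro continuous_intros)
qed

lemma cont_PhiK:
  assumes k: "continuous_on cOO k" and g: "contQ g"
  shows "continuous_on (cOmega A \<times> I1 \<times> {0..T}) (\<lambda>q. PhiK k g (fst q) (fst (snd q)) (snd (snd q)))"
proof -
  obtain C where C: "\<And>p. p \<in> cOO \<Longrightarrow> \<bar>k p\<bar> \<le> C" using cOO_bounded[OF k] by auto
  obtain D where D: "\<And>p. p \<in> cQ \<Longrightarrow> \<bar>g p\<bar> \<le> D" using cQT_bounded[OF g] by auto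
  interpret finite_measure "slice_measure A ix1" by (rule finite_slice_measure)
  show ?thesis
    unfolding PhiK_def slice_integral_eq
  proof (rule continuous_on_integral_param[where C="C * D"])
    fix y assume y: "y \<in> space (slice_measure A ix1)"
    show "continuous_on (cOmega A \<times> I1 \<times> {0..T})
        (\<lambda>q. k (fst q, slice_pt ix1 (fst (snd q)) y) * g (slice_pt ix1 (fst (snd q)) y, snd (snd q)))"
      by (intro continuous_intros continuous_on_slice_pt continuous_on_compose2[OF k] continuous_on_compose2[OF g])
         (use slice_pt_cOmega[OF _ y] in \<open>auto simp: mem_cQT\<close>)
  next
    fix q assume q: "q \<in> cOmega A \<times> I1 \<times> {0..T}"
    show "(\<lambda>y. k (fst q, slice_pt ix1 (fst (snd q)) y) * g (slice_pt ix1 (fst (snd q)) y, snd (snd q)))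
        \<in> borel_measurable (slice_measure A ix1)"
      using q by (intro measurable_slice[of "\<lambda>y. k (fst q, y) * g (y, snd (snd q))"] cont_kernel_slice k g) auto
    fix y assume y: "y \<in> space (slice_measure A ix1)"
    show "\<bar>k (fst q, slice_pt ix1 (fst (snd q)) y) * g (slice_pt ix1 (fst (snd q)) y, snd (snd q))\<bar> \<le> C * D"
      using q slice_pt_cOmega[OF _ y] by (intro abs_mult_le C D) (auto simp: mem_cQT)
  qed
qed

lemma mem_I1: "x \<in> cOmega A \<Longrightarrow> x $ ix1 \<in> I1"
  by (auto simp: mem_cOmega)

lemma cont_SK:
  assumes k: "continuous_on cOO k" and g: "contQ g"
  shows "contQ (SK k g)"
proof -
  have "contQ (\<lambda>p. (\<lambda>q. PhiK k g (fst q) (fst (snd q)) (snd (snd q))) (fst p, fst p $ ix1, snd p))"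
    by (rule continuous_on_compose2[OF cont_PhiK[OF k g]])
       (auto simp: cQT_eq mem_cOmega intro!: continuous_intros)
  then show ?thesis by (simp add: SK_def[abs_def])
qed

lemma cont_PhiK_r:
  assumes k: "continuous_on cOO k" and g: "contQ g" and "x \<in> cOmega A" "t \<in> {0..T}"
  shows "continuous_on I1 (\<lambda>r. PhiK k g x r t)"
proof -
  have "continuous_on I1 (\<lambda>r. (\<lambda>q. PhiK k g (fst q) (fst (snd q)) (snd (snd q))) (x, r, t))"
    by (rule continuous_on_compose2[OF cont_PhiK[OF k g]])
       (use assms in \<open>auto intro!: continuous_intros\<close>)
  then show ?thesis by simp
qed

definition svol :: real where "svol = measure (slice_measure A ix1) (space (slice_measure A ix1))"

lemma slice_one: "slice_integral A ix1 r (\<lambda>y. c) = c * svol"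
  unfolding slice_integral_eq svol_def by simp

lemma svol_nonneg: "0 \<le> svol" by (simp add: svol_def)

lemma PhiK_bound:
  assumes k: "continuous_on cOO k" and g: "contQ g" and xt: "x \<in> cOmega A" "t \<in> {0..T}" "r \<in> I1"
    and C: "\<And>p. p \<in> cOO \<Longrightarrow> \<bar>k p\<bar> \<le> C" and D: "\<And>y. y \<in> cOmega A \<Longrightarrow> \<bar>g (y, t)\<bar> \<le> D"
  shows "\<bar>PhiK k g x r t\<bar> \<le> C * D * svol"
proof -
  interpret S: posfun "cOmega A" "slice_integral A ix1 r" by (rule posfun_slice[OF xt(3)])
  have "\<bar>PhiK k g x r t\<bar> \<le> slice_integral A ix1 r (\<lambda>y. C * D)"
    unfolding PhiK_def by (intro S.L_abs_le cont_kernel_slice k g xt continuous_intros abs_mult_le C D) (use xt in auto)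
  then show ?thesis by (simp add: slice_one)
qed

text \<open>The moving lower limit is written as an indicator under the integral. The integrands
  converge at every \<open>r\<close> except the limit of the lower ends, which is a null set, and
  they are dominated by a constant on the bounded interval.\<close>

lemma cont_VK:
  assumes k: "continuous_on cOO k" and g: "contQ g"
  shows "contQ (VK k g)"
  unfolding continuous_on_sequentially
proof safe
  fix p :: "nat \<Rightarrow> 'n rvec \<times> real" and a b assume p: "(a, b) \<in> cQ" "\<forall>n. p n \<in> cQ" "p \<longlonglongrightarrow> (a, b)"
  obtain C where C: "\<And>p. p \<in> cOO \<Longrightarrow> \<bar>k p\<bar> \<le> C" using cOO_bounded[OF k] by auto
  obtain D where D: "\<And>p. p \<in> cQ \<Longrightarrow> \<bar>g p\<bar> \<le> D" using cQT_bounded[OF g] by auto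
  let ?f = "\<lambda>p r. indicator {fst p $ ix1..A $ ix1} r * PhiK k g (fst p) r (snd p)"
  have pn: "fst (p n) \<in> cOmega A" "snd (p n) \<in> {0..T}" for n using p(2) by (auto simp: cQT_eq mem_Times_iff)
  have ab: "a \<in> cOmega A" "b \<in> {0..T}" using p(1) by (auto simp: mem_cQT)
  have lim: "(\<lambda>n. fst (p n)) \<longlonglongrightarrow> a" "(\<lambda>n. snd (p n)) \<longlonglongrightarrow> b"
    using tendsto_fst[OF p(3)] tendsto_snd[OF p(3)] by auto
  have lim1: "(\<lambda>n. fst (p n) $ ix1) \<longlonglongrightarrow> a $ ix1" by (intro tendsto_vec_nth lim)
  have "(\<lambda>n. \<integral>r. ?f (p n) r \<partial>lborel) \<longlonglongrightarrow> (\<integral>r. ?f (a, b) r \<partial>lborel)"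
  proof (rule integral_dominated_convergence[where w="\<lambda>r. indicator I1 r * (C * D * svol)"])
    have meas: "?f q \<in> borel_measurable lborel" if "fst q \<in> cOmega A" "snd q \<in> {0..T}" for q
    proof -
      have "continuous_on {fst q $ ix1..A $ ix1} (\<lambda>r. PhiK k g (fst q) r (snd q))"
        by (rule continuous_on_subset[OF cont_PhiK_r[OF k g that]]) (use mem_I1[OF that(1)] in auto)
      from borel_measurable_continuous_on_indicator[OF _ this] show ?thesis by simp
    qed
    show "?f (a, b) \<in> borel_measurable lborel" using ab by (intro meas) auto
    show "?f (p n) \<in> borel_measurable lborel" for n using pn by (intro meas) auto
    show "integrable lborel (\<lambda>r. indicator I1 r * (C * D * svol))"
      using emeasure_bounded_finite[of I1] by (intro integrable_mult_left integrable_real_indicator) auto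
    show "AE r in lborel. norm (?f (p n) r) \<le> indicator I1 r * (C * D * svol)" for n
    proof (rule AE_I2)
      fix r show "norm (?f (p n) r) \<le> indicator I1 r * (C * D * svol)"
        using PhiK_bound[OF k g pn(1)[of n] pn(2)[of n], of r C D] C D pn[of n] mem_I1[OF pn(1), of n]
        by (auto simp: indicator_def mem_cQT)
    qed
    show "AE r in lborel. (\<lambda>n. ?f (p n) r) \<longlonglongrightarrow> ?f (a, b) r"
      using AE_lborel_singleton[of "a $ ix1"]
    proof (rule AE_mp, intro AE_I2 impI)
      fix r :: real assume r: "r \<noteq> a $ ix1"
      show "(\<lambda>n. ?f (p n) r) \<longlonglongrightarrow> ?f (a, b) r"
      proof (cases "r \<in> I1")
        case True
        have "(\<lambda>n. (\<lambda>q. PhiK k g (fst q) (fst (snd q)) (snd (snd q))) (fst (p n), r, snd (p n))) \<longlonglongrightarrow>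
           (\<lambda>q. PhiK k g (fst q) (fst (snd q)) (snd (snd q))) (a, r, b)"
          by (rule continuous_on_tendsto_compose[OF cont_PhiK[OF k g]])
             (use True pn ab in \<open>auto intro!: tendsto_intros lim\<close>)
        then have P: "(\<lambda>n. PhiK k g (fst (p n)) r (snd (p n))) \<longlonglongrightarrow> PhiK k g a r b" by simp
        show ?thesis
        proof (cases "r < a $ ix1")
          case True
          have "eventually (\<lambda>n. r < fst (p n) $ ix1) sequentially" using lim1 True by (rule order_tendstoD)
          then have "eventually (\<lambda>n. ?f (p n) r = ?f (a, b) r) sequentially"
            by eventually_elim (use True in \<open>auto simp: indicator_def\<close>)
          then show ?thesis by (rule tendsto_eventually)
        next
          case False
          then have lt: "a $ ix1 < r" using r by simp
          have "eventually (\<lambda>n. fst (p n) $ ix1 < r) sequentially" using lim1 lt by (rule order_tendstoD)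
          then have "eventually (\<lambda>n. PhiK k g (fst (p n)) r (snd (p n)) = ?f (p n) r) sequentially"
            by eventually_elim (use \<open>r \<in> I1\<close> in \<open>auto simp: indicator_def\<close>)
          then have "(\<lambda>n. ?f (p n) r) \<longlonglongrightarrow> PhiK k g a r b" by (rule Lim_transform_eventually[OF P])
          moreover have "?f (a, b) r = PhiK k g a r b" using lt \<open>r \<in> I1\<close> by (auto simp: indicator_def)
          ultimately show ?thesis by (simp only:)
        qed
      next
        case False
        then have "?f (p n) r = 0" for n using mem_I1[OF pn(1), of n] by (auto simp: indicator_def)
        moreover have "?f (a, b) r = 0" using False mem_I1[OF ab(1)] by (auto simp: indicator_def)
        ultimately show ?thesis by (simp only: tendsto_const)
      qed
    qed
  qed
  then show "(VK k g \<circ> p) \<longlonglongrightarrow> VK k g (a, b)"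
    by (simp add: o_def VK_def set_lebesgue_integral_def)
qed

section \<open>Derivatives of the interaction term\<close>

text \<open>Derivatives in all components of \<open>x\<close>, but only in the first component of
  \<open>y\<close>: a slice can only be moved along \<open>y_1\<close>, the other components are
  integrated out.\<close>

definition kern1 :: "('n rvec \<times> 'n rvec \<Rightarrow> real) \<Rightarrow> ('n \<Rightarrow> 'n rvec \<times> 'n rvec \<Rightarrow> real) \<Rightarrow> ('n rvec \<times> 'n rvec \<Rightarrow> real) \<Rightarrow> bool" where
  "kern1 k kx ky \<longleftrightarrow> continuous_on cOO k \<and> (\<forall>i. continuous_on cOO (kx i)) \<and> continuous_on cOO ky \<and>
     (\<forall>i. hpd cOO (axis i 1, 0) k (kx i)) \<and> hpd cOO (0, axis ix1 1) k ky"

lemma kern1D: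
  assumes "kern1 k kx ky"
  shows "continuous_on cOO k" "continuous_on cOO (kx i)" "continuous_on cOO ky"
    "hpd cOO (axis i 1, 0) k (kx i)" "hpd cOO (0, axis ix1 1) k ky"
  using assms by (auto simp: kern1_def)

lemma PhiK_deriv_x:
  assumes k: "kern1 k kx ky" and g: "contQ g" and t: "t \<in> {0..T}" and r: "r \<in> I1"
    and I: "convex I" "s \<in> I" "\<And>s. s \<in> I \<Longrightarrow> x + s *\<^sub>R axis i 1 \<in> cOmega A"
  shows "((\<lambda>s. PhiK k g (x + s *\<^sub>R axis i 1) r t) has_real_derivative PhiK (kx i) g (x + s *\<^sub>R axis i 1) r t) (at s within I)"
proof -
  note kD = kern1D[OF k]
  obtain C where C: "\<And>p. p \<in> cOO \<Longrightarrow> \<bar>k p\<bar> \<le> C" using cOO_bounded[OF kD(1)] by auto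
  obtain C' where C': "\<And>p. p \<in> cOO \<Longrightarrow> \<bar>kx i p\<bar> \<le> C'" using cOO_bounded[OF kD(2)] by auto
  obtain D where D: "\<And>p. p \<in> cQ \<Longrightarrow> \<bar>g p\<bar> \<le> D" using cQT_bounded[OF g] by auto
  interpret finite_measure "slice_measure A ix1" by (rule finite_slice_measure)
  show ?thesis
    unfolding PhiK_def slice_integral_eq
  proof (rule has_real_derivative_integral_param[where C="C' * D" and ?C0.0="C * D", OF _ I(1,2)])
    fix s y assume s: "s \<in> I" and y: "y \<in> space (slice_measure A ix1)"
    let ?y = "slice_pt ix1 r y"
    have yc: "?y \<in> cOmega A" by (rule slice_pt_cOmega[OF r y])
    have "((\<lambda>s. k ((x, ?y) + s *\<^sub>R (axis i 1, 0))) has_real_derivative kx i ((x, ?y) + s *\<^sub>R (axis i 1, 0))) (at s within I)"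
      by (rule hpd_line[OF kD(4)]) (use I s yc in auto)
    then have "((\<lambda>s. k (x + s *\<^sub>R axis i 1, ?y)) has_real_derivative kx i (x + s *\<^sub>R axis i 1, ?y)) (at s within I)" by simp
    from DERIV_cmult_right[OF this]
    show "((\<lambda>s. k (x + s *\<^sub>R axis i 1, ?y) * g (?y, t)) has_real_derivative
        kx i (x + s *\<^sub>R axis i 1, ?y) * g (?y, t)) (at s within I)" by simp
    show "\<bar>k (x + s *\<^sub>R axis i 1, ?y) * g (?y, t)\<bar> \<le> C * D"
      using I(3)[OF s] yc t by (intro abs_mult_le C D) (auto simp: mem_cQT)
    show "\<bar>kx i (x + s *\<^sub>R axis i 1, ?y) * g (?y, t)\<bar> \<le> C' * D"
      using I(3)[OF s] yc t by (intro abs_mult_le C' D) (auto simp: mem_cQT)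
  next
    fix s assume s: "s \<in> I"
    show "(\<lambda>y. k (x + s *\<^sub>R axis i 1, slice_pt ix1 r y) * g (slice_pt ix1 r y, t)) \<in> borel_measurable (slice_measure A ix1)"
      by (rule measurable_slice[OF cont_kernel_slice[OF kD(1) g I(3)[OF s] t] r])
  next
    show "(\<lambda>y. kx i (x + s *\<^sub>R axis i 1, slice_pt ix1 r y) * g (slice_pt ix1 r y, t)) \<in> borel_measurable (slice_measure A ix1)"
      by (rule measurable_slice[OF cont_kernel_slice[OF kD(2) g I(3)[OF I(2)] t] r])
  qed
qed

lemma PhiK_deriv_t:
  assumes k: "continuous_on cOO k" and g: "contQ g" "contQ gt" "hpdQ e_time g gt"
    and x: "x \<in> cOmega A" and r: "r \<in> I1" and t: "t \<in> {0..T}"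
  shows "((\<lambda>t. PhiK k g x r t) has_real_derivative PhiK k gt x r t) (at t within {0..T})"
proof -
  obtain C where C: "\<And>p. p \<in> cOO \<Longrightarrow> \<bar>k p\<bar> \<le> C" using cOO_bounded[OF k] by auto
  obtain D where D: "\<And>p. p \<in> cQ \<Longrightarrow> \<bar>g p\<bar> \<le> D" using cQT_bounded[OF g(1)] by auto
  obtain D' where D': "\<And>p. p \<in> cQ \<Longrightarrow> \<bar>gt p\<bar> \<le> D'" using cQT_bounded[OF g(2)] by auto
  interpret finite_measure "slice_measure A ix1" by (rule finite_slice_measure)
  show ?thesis
    unfolding PhiK_def slice_integral_eq
  proof (rule has_real_derivative_integral_param[where C="C * D'" and ?C0.0="C * D", OF _ _ t])
    show "convex {0..T}" by simp
    fix s y assume s: "s \<in> {0..T}" and y: "y \<in> space (slice_measure A ix1)"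
    let ?y = "slice_pt ix1 r y"
    have yc: "?y \<in> cOmega A" by (rule slice_pt_cOmega[OF r y])
    have "((\<lambda>s. g ((?y, 0) + s *\<^sub>R e_time)) has_real_derivative gt ((?y, 0) + s *\<^sub>R e_time)) (at s within {0..T})"
      by (rule hpd_line[OF g(3)]) (use s yc in \<open>auto simp: e_time_shift mem_cQT\<close>)
    then have "((\<lambda>s. g (?y, s)) has_real_derivative gt (?y, s)) (at s within {0..T})" by (simp add: e_time_shift)
    from DERIV_cmult[OF this]
    show "((\<lambda>s. k (x, ?y) * g (?y, s)) has_real_derivative k (x, ?y) * gt (?y, s)) (at s within {0..T})" .
    show "\<bar>k (x, ?y) * g (?y, s)\<bar> \<le> C * D" "\<bar>k (x, ?y) * gt (?y, s)\<bar> \<le> C * D'"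
      using x yc s by (auto intro!: abs_mult_le C D D' simp: mem_cQT)
  next
    fix s assume s: "s \<in> {0..T}"
    show "(\<lambda>y. k (x, slice_pt ix1 r y) * g (slice_pt ix1 r y, s)) \<in> borel_measurable (slice_measure A ix1)"
      by (rule measurable_slice[OF cont_kernel_slice[OF k g(1) x s] r])
  next
    show "(\<lambda>y. k (x, slice_pt ix1 r y) * gt (slice_pt ix1 r y, t)) \<in> borel_measurable (slice_measure A ix1)"
      by (rule measurable_slice[OF cont_kernel_slice[OF k g(2) x t] r])
  qed
qed

lemma PhiK_deriv_r:
  assumes k: "kern1 k kx ky" and g: "contQ g" "contQ g1" "hpdQ (es ix1) g g1"
    and x: "x \<in> cOmega A" and r: "r \<in> I1" and t: "t \<in> {0..T}"
  shows "((\<lambda>r. PhiK k g x r t) has_real_derivative PhiK ky g x r t + PhiK k g1 x r t) (at r within I1)"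
proof -
  note kD = kern1D[OF k]
  obtain C where C: "\<And>p. p \<in> cOO \<Longrightarrow> \<bar>k p\<bar> \<le> C" using cOO_bounded[OF kD(1)] by auto
  obtain C' where C': "\<And>p. p \<in> cOO \<Longrightarrow> \<bar>ky p\<bar> \<le> C'" using cOO_bounded[OF kD(3)] by auto
  obtain D where D: "\<And>p. p \<in> cQ \<Longrightarrow> \<bar>g p\<bar> \<le> D" using cQT_bounded[OF g(1)] by auto
  obtain D' where D': "\<And>p. p \<in> cQ \<Longrightarrow> \<bar>g1 p\<bar> \<le> D'" using cQT_bounded[OF g(2)] by auto
  interpret finite_measure "slice_measure A ix1" by (rule finite_slice_measure)
  interpret S: posfun "cOmega A" "slice_integral A ix1 r" by (rule posfun_slice[OF r])
  let ?H' = "\<lambda>r y. ky (x, slice_pt ix1 r y) * g (slice_pt ix1 r y, t) + k (x, slice_pt ix1 r y) * g1 (slice_pt ix1 r y, t)"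
  have "((\<lambda>r. PhiK k g x r t) has_real_derivative (\<integral>y. ?H' r y \<partial>slice_measure A ix1)) (at r within I1)"
    unfolding PhiK_def slice_integral_eq
  proof (rule has_real_derivative_integral_param[where C="C' * D + C * D'" and ?C0.0="C * D", OF _ _ r])
    show "convex I1" by simp
    fix s y assume s: "s \<in> I1" and y: "y \<in> space (slice_measure A ix1)"
    let ?y = "slice_pt ix1 s y" and ?o = "slice_pt ix1 0 y"
    have yc: "slice_pt ix1 r y \<in> cOmega A" if "r \<in> I1" for r by (rule slice_pt_cOmega[OF that y])
    have "((\<lambda>s. g ((?o, t) + s *\<^sub>R es ix1)) has_real_derivative g1 ((?o, t) + s *\<^sub>R es ix1)) (at s within I1)"
      by (rule hpd_line[OF g(3)]) (use s yc t in \<open>auto simp: e_space_shift slice_pt_shift mem_cQT\<close>)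
    then have 1: "((\<lambda>s. g (slice_pt ix1 s y, t)) has_real_derivative g1 (?y, t)) (at s within I1)"
      by (simp add: e_space_shift slice_pt_shift)
    have "((\<lambda>s. k ((x, ?o) + s *\<^sub>R (0, axis ix1 1))) has_real_derivative ky ((x, ?o) + s *\<^sub>R (0, axis ix1 1))) (at s within I1)"
      by (rule hpd_line[OF kD(5)]) (use s yc x in \<open>auto simp: slice_pt_shift\<close>)
    then have 2: "((\<lambda>s. k (x, slice_pt ix1 s y)) has_real_derivative ky (x, ?y)) (at s within I1)"
      by (simp add: slice_pt_shift)
    from DERIV_mult'[OF 2 1]
    show "((\<lambda>s. k (x, slice_pt ix1 s y) * g (slice_pt ix1 s y, t)) has_real_derivative ?H' s y) (at s within I1)"
      by (simp add: algebra_simps)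
    show "\<bar>k (x, ?y) * g (?y, t)\<bar> \<le> C * D" using x yc[OF s] t by (auto intro!: abs_mult_le C D simp: mem_cQT)
    have "\<bar>ky (x, ?y) * g (?y, t)\<bar> \<le> C' * D" "\<bar>k (x, ?y) * g1 (?y, t)\<bar> \<le> C * D'"
      using x yc[OF s] t by (auto intro!: abs_mult_le C C' D D' simp: mem_cQT)
    then show "\<bar>?H' s y\<bar> \<le> C' * D + C * D'" by linarith
  next
    fix s assume s: "s \<in> I1"
    show "(\<lambda>y. k (x, slice_pt ix1 s y) * g (slice_pt ix1 s y, t)) \<in> borel_measurable (slice_measure A ix1)"
      by (rule measurable_slice[OF cont_kernel_slice[OF kD(1) g(1) x t] s])
  next
    show "?H' r \<in> borel_measurable (slice_measure A ix1)"
      by (intro borel_measurable_add measurable_slice[OF cont_kernel_slice[OF kD(3) g(1) x t] r]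
           measurable_slice[OF cont_kernel_slice[OF kD(1) g(2) x t] r])
  qed
  also have "(\<integral>y. ?H' r y \<partial>slice_measure A ix1) = PhiK ky g x r t + PhiK k g1 x r t"
    unfolding PhiK_def
    using S.L_add[OF cont_kernel_slice[OF kD(3) g(1) x t] cont_kernel_slice[OF kD(1) g(2) x t]]
    by (simp add: slice_integral_eq)
  finally show ?thesis .
qed

lemma line_set:
  assumes "(x, t) \<in> cQ"
  shows "{h. (x, t) + h *\<^sub>R es i \<in> cQ} = {h. x + h *\<^sub>R axis i 1 \<in> cOmega A}"
    "convex {h. x + h *\<^sub>R axis i 1 \<in> cOmega A}" "0 \<in> {h. x + h *\<^sub>R axis i 1 \<in> cOmega A}"
proof -
  show "{h. (x, t) + h *\<^sub>R es i \<in> cQ} = {h. x + h *\<^sub>R axis i 1 \<in> cOmega A}"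
    using assms by (auto simp: e_space_shift mem_cQT)
  have cv: "convex (cOmega A)" by (simp add: cOmega_cbox convex_box)
  show "convex {h. x + h *\<^sub>R axis i 1 \<in> cOmega A}"
  proof (rule convexI, safe)
    fix a b u v :: real assume h: "x + a *\<^sub>R axis i 1 \<in> cOmega A" "x + b *\<^sub>R axis i 1 \<in> cOmega A" "0 \<le> u" "0 \<le> v" "u + v = 1"
    have "u *\<^sub>R (x + a *\<^sub>R axis i 1) + v *\<^sub>R (x + b *\<^sub>R axis i 1) = (u + v) *\<^sub>R x + (u * a + v * b) *\<^sub>R axis i 1"
      by (simp add: algebra_simps)
    with convexD[OF cv h] h(5) show "x + (u *\<^sub>R a + v *\<^sub>R b) *\<^sub>R axis i 1 \<in> cOmega A" by simp
  qed
  show "0 \<in> {h. x + h *\<^sub>R axis i 1 \<in> cOmega A}" using assms by (simp add: mem_cQT)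
qed

lemma hpd_SK_time:
  assumes k: "continuous_on cOO k" and g: "contQ g" "contQ gt" "hpdQ e_time g gt"
  shows "hpdQ e_time (SK k g) (SK k gt)"
  unfolding hpd_def
proof safe
  fix x t assume p: "(x, t) \<in> cQ"
  then have x: "x \<in> cOmega A" "x $ ix1 \<in> I1" and t: "t \<in> {0..T}" using mem_I1 by (auto simp: mem_cQT)
  have S: "{h. (x, t) + h *\<^sub>R e_time \<in> cQ} = {- t..T - t}"
    using x by (auto simp: e_time_shift mem_cQT)
  have "((\<lambda>t. PhiK k g x (x $ ix1) t) has_real_derivative PhiK k gt x (x $ ix1) t) (at (t + 0) within (+) t ` {- t..T - t})"
    using PhiK_deriv_t[OF k g x t] by (simp add: image_add_atLeastAtMost)
  moreover have "((+) t has_real_derivative 1) (at 0 within {- t..T - t})"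
    by (auto intro!: derivative_eq_intros)
  ultimately have "((\<lambda>t. PhiK k g x (x $ ix1) t) \<circ> (+) t has_real_derivative PhiK k gt x (x $ ix1) t * 1) (at 0 within {- t..T - t})"
    by (rule DERIV_image_chain)
  then show "((\<lambda>h. SK k g ((x, t) + h *\<^sub>R e_time)) has_real_derivative SK k gt (x, t))
      (at 0 within {h. (x, t) + h *\<^sub>R e_time \<in> cQ})"
    unfolding S by (simp add: SK_def e_time_shift o_def)
qed

lemma finite_measure_Icc: "finite_measure (restrict_space lborel {a..b::real})"
  using emeasure_bounded_finite[of "{a..b}"]
  by (intro finite_measureI) (simp add: emeasure_restrict_space space_restrict_space)

lemma set_integral_Icc_restrict: "(LINT r:{a..b}|lborel. f r) = (\<integral>r. f r \<partial>restrict_space lborel {a..b::real})"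
  for f :: "real \<Rightarrow> real"
  unfolding set_lebesgue_integral_def by (subst integral_restrict_space) auto

lemma measurable_Icc_restrict:
  fixes f :: "real \<Rightarrow> real"
  assumes "continuous_on {a..b} f"
  shows "f \<in> borel_measurable (restrict_space lborel {a..b})"
  using borel_measurable_continuous_on_restrict[OF assms] by (simp add: measurable_def space_restrict_space sets_restrict_space)

text \<open>A common form for motion in time and motion of \<open>x\<close> along a line, with the
  lower limit \<open>a\<close> held fixed.\<close>

lemma VK_deriv_param:
  assumes k: "continuous_on cOO k" and g: "contQ g"
    and k': "continuous_on cOO k'" and g': "contQ g'"
    and I: "convex I" "s \<in> I" and a: "a \<in> I1"
    and xt: "\<And>s. s \<in> I \<Longrightarrow> x s \<in> cOmega A" "\<And>s. s \<in> I \<Longrightarrow> t s \<in> {0..T}"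
    and d: "\<And>s r. s \<in> I \<Longrightarrow> r \<in> I1 \<Longrightarrow> ((\<lambda>s. PhiK k g (x s) r (t s)) has_real_derivative PhiK k' g' (x s) r (t s)) (at s within I)"
  shows "((\<lambda>s. LINT r:{a..A $ ix1}|lborel. PhiK k g (x s) r (t s)) has_real_derivative
     (LINT r:{a..A $ ix1}|lborel. PhiK k' g' (x s) r (t s))) (at s within I)"
proof -
  obtain C where C: "\<And>p. p \<in> cOO \<Longrightarrow> \<bar>k p\<bar> \<le> C" using cOO_bounded[OF k] by auto
  obtain D where D: "\<And>p. p \<in> cQ \<Longrightarrow> \<bar>g p\<bar> \<le> D" using cQT_bounded[OF g] by auto
  obtain C' where C': "\<And>p. p \<in> cOO \<Longrightarrow> \<bar>k' p\<bar> \<le> C'" using cOO_bounded[OF k'] by auto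
  obtain D' where D': "\<And>p. p \<in> cQ \<Longrightarrow> \<bar>g' p\<bar> \<le> D'" using cQT_bounded[OF g'] by auto
  interpret finite_measure "restrict_space lborel {a..A $ ix1}" by (rule finite_measure_Icc)
  have r: "r \<in> I1" if "r \<in> space (restrict_space lborel {a..A $ ix1})" for r
    using that a by (auto simp: space_restrict_space)
  have sub: "{a..A $ ix1} \<subseteq> I1" using a by auto
  show ?thesis unfolding set_integral_Icc_restrict
  proof (rule has_real_derivative_integral_param[where C="C' * D' * svol" and ?C0.0="C * D * svol", OF _ I])
    fix s assume s: "s \<in> I"
    show "(\<lambda>r. PhiK k g (x s) r (t s)) \<in> borel_measurable (restrict_space lborel {a..A $ ix1})"
      by (intro measurable_Icc_restrict continuous_on_subset[OF cont_PhiK_r[OF k g xt[OF s]] sub])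
    fix y assume y: "y \<in> space (restrict_space lborel {a..A $ ix1})"
    show "\<bar>PhiK k g (x s) y (t s)\<bar> \<le> C * D * svol" "\<bar>PhiK k' g' (x s) y (t s)\<bar> \<le> C' * D' * svol"
      using xt[OF s] r[OF y] by (auto intro!: PhiK_bound k g k' g' C C' D D' simp: mem_cQT)
  next
    show "(\<lambda>r. PhiK k' g' (x s) r (t s)) \<in> borel_measurable (restrict_space lborel {a..A $ ix1})"
      by (intro measurable_Icc_restrict continuous_on_subset[OF cont_PhiK_r[OF k' g' xt[OF I(2)]] sub])
  qed (use d r in auto)
qed

lemma hpd_VK_time:
  assumes k: "continuous_on cOO k" and g: "contQ g" "contQ gt" "hpdQ e_time g gt"
  shows "hpdQ e_time (VK k g) (VK k gt)"
  unfolding hpd_def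
proof safe
  fix x t assume p: "(x, t) \<in> cQ"
  then have x: "x \<in> cOmega A" "x $ ix1 \<in> I1" and t: "t \<in> {0..T}" using mem_I1 by (auto simp: mem_cQT)
  have S: "{h. (x, t) + h *\<^sub>R e_time \<in> cQ} = {- t..T - t}"
    using x by (auto simp: e_time_shift mem_cQT)
  have "((\<lambda>t. LINT r:{x $ ix1..A $ ix1}|lborel. PhiK k g x r t) has_real_derivative
      (LINT r:{x $ ix1..A $ ix1}|lborel. PhiK k gt x r t)) (at (t + 0) within (+) t ` {- t..T - t})"
    using VK_deriv_param[OF k g(1) k g(2) _ t x(2), where x="\<lambda>_. x" and t="\<lambda>t. t"] PhiK_deriv_t[OF k g x(1)] x
    by (simp add: image_add_atLeastAtMost)
  moreover have "((+) t has_real_derivative 1) (at 0 within {- t..T - t})"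
    by (auto intro!: derivative_eq_intros)
  ultimately have "((\<lambda>t. LINT r:{x $ ix1..A $ ix1}|lborel. PhiK k g x r t) \<circ> (+) t has_real_derivative
      (LINT r:{x $ ix1..A $ ix1}|lborel. PhiK k gt x r t) * 1) (at 0 within {- t..T - t})"
    by (rule DERIV_image_chain)
  then show "((\<lambda>h. VK k g ((x, t) + h *\<^sub>R e_time)) has_real_derivative VK k gt (x, t))
      (at 0 within {h. (x, t) + h *\<^sub>R e_time \<in> cQ})"
    unfolding S by (simp add: VK_def e_time_shift o_def)
qed

lemma first_coord_line: "(x + h *\<^sub>R axis i 1) $ ix1 = x $ ix1 + h * del1 i" for x :: "'n rvec"
  by (auto simp: del1_def axis_def)

lemma cont_PhiK_ab:
  assumes k: "continuous_on cOO k" and g: "contQ g" and t: "t \<in> {0..T}"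
    and I: "\<And>s. s \<in> I \<Longrightarrow> x + s *\<^sub>R axis ix1 1 \<in> cOmega A"
  shows "continuous_on (I \<times> I) (\<lambda>(a, b). PhiK k g (x + a *\<^sub>R axis ix1 1) (x $ ix1 + b) t)"
proof -
  have r: "x $ ix1 + b \<in> I1" if "b \<in> I" for b
    using mem_I1[OF I[OF that]] by (simp add: first_coord_line del1_def)
  have "continuous_on (I \<times> I) (\<lambda>p. (\<lambda>q. PhiK k g (fst q) (fst (snd q)) (snd (snd q))) (x + fst p *\<^sub>R axis ix1 1, x $ ix1 + snd p, t))"
    by (rule continuous_on_compose2[OF cont_PhiK[OF k g]])
       (use t I r in \<open>auto intro!: continuous_intros\<close>)
  then show ?thesis by (simp add: case_prod_unfold)
qed

text \<open>In the direction \<open>ix1\<close> the kernel argument and the slice move together, and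
  \<open>diagonal_derivative\<close> adds the two contributions; in the other directions only the
  kernel is differentiated.\<close>

lemma hpd_SK:
  assumes k: "kern1 k kx ky" and g: "contQ g" "contQ g1" "hpdQ (es ix1) g g1"
  shows "hpdQ (es i) (SK k g) (\<lambda>p. SK (kx i) g p + del1 i * (SK ky g p + SK k g1 p))"
  unfolding hpd_def
proof safe
  fix x t assume p: "(x, t) \<in> cQ"
  then have x: "x \<in> cOmega A" and t: "t \<in> {0..T}" by (auto simp: mem_cQT)
  define I where "I = {h. x + h *\<^sub>R axis i 1 \<in> cOmega A}"
  note I = line_set[OF p, of i, folded I_def]
  have Ix: "x + h *\<^sub>R axis i 1 \<in> cOmega A" if "h \<in> I" for h using that by (simp add: I_def)
  have r: "x $ ix1 + h * del1 i \<in> I1" if "h \<in> I" for h using mem_I1[OF Ix[OF that]] by (simp only: first_coord_line)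
  note kD = kern1D[OF k]
  have "((\<lambda>h. PhiK k g (x + h *\<^sub>R axis i 1) (x $ ix1 + h * del1 i) t) has_real_derivative
      PhiK (kx i) g x (x $ ix1) t + del1 i * (PhiK ky g x (x $ ix1) t + PhiK k g1 x (x $ ix1) t)) (at 0 within I)"
  proof (cases "i = ix1")
    case False
    then show ?thesis
      using PhiK_deriv_x[OF k g(1) t mem_I1[OF x] I(2,3) Ix] by (simp add: del1_def)
  next
    case True
    have d: "del1 i = 1" by (simp add: True del1_def)
    have "((\<lambda>s. (\<lambda>a b. PhiK k g (x + a *\<^sub>R axis i 1) (x $ ix1 + b) t) s s) has_real_derivative
       PhiK (kx i) g x (x $ ix1) t + (\<lambda>a b. PhiK ky g (x + a *\<^sub>R axis i 1) (x $ ix1 + b) t + PhiK k g1 (x + a *\<^sub>R axis i 1) (x $ ix1 + b) t) 0 0) (at 0 within I)"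
    proof (rule diagonal_derivative[OF I(2,3),
        where F="\<lambda>a b. PhiK k g (x + a *\<^sub>R axis i 1) (x $ ix1 + b) t"
          and Fb="\<lambda>a b. PhiK ky g (x + a *\<^sub>R axis i 1) (x $ ix1 + b) t + PhiK k g1 (x + a *\<^sub>R axis i 1) (x $ ix1 + b) t"])
      show "((\<lambda>a. PhiK k g (x + a *\<^sub>R axis i 1) (x $ ix1 + 0) t) has_real_derivative PhiK (kx i) g x (x $ ix1) t) (at 0 within I)"
        using PhiK_deriv_x[OF k g(1) t mem_I1[OF x] I(2,3) Ix] by simp
      show "((\<lambda>b. PhiK k g (x + a *\<^sub>R axis i 1) (x $ ix1 + b) t) has_real_derivative
          PhiK ky g (x + a *\<^sub>R axis i 1) (x $ ix1 + b) t + PhiK k g1 (x + a *\<^sub>R axis i 1) (x $ ix1 + b) t) (at b within I)"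
        if ab: "a \<in> I" "b \<in> I" for a b
      proof -
        have "((\<lambda>r. PhiK k g (x + a *\<^sub>R axis i 1) r t) has_real_derivative
          PhiK ky g (x + a *\<^sub>R axis i 1) (x $ ix1 + b) t + PhiK k g1 (x + a *\<^sub>R axis i 1) (x $ ix1 + b) t) (at (x $ ix1 + b) within (+) (x $ ix1) ` I)"
          by (rule has_field_derivative_subset[OF PhiK_deriv_r[OF k g Ix[OF ab(1)] _ t]]) (use r ab d in auto)
        moreover have "((+) (x $ ix1) has_real_derivative 1) (at b within I)" by (auto intro!: derivative_eq_intros)
        ultimately have "((\<lambda>r. PhiK k g (x + a *\<^sub>R axis i 1) r t) \<circ> (+) (x $ ix1) has_real_derivative
          (PhiK ky g (x + a *\<^sub>R axis i 1) (x $ ix1 + b) t + PhiK k g1 (x + a *\<^sub>R axis i 1) (x $ ix1 + b) t) * 1) (at b within I)"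
          by (rule DERIV_image_chain)
        then show ?thesis by (simp add: o_def)
      qed
      have c: "continuous_on (I \<times> I) (\<lambda>p. (\<lambda>(a, b). PhiK ky g (x + a *\<^sub>R axis i 1) (x $ ix1 + b) t) p
          + (\<lambda>(a, b). PhiK k g1 (x + a *\<^sub>R axis i 1) (x $ ix1 + b) t) p)"
        unfolding True using Ix by (intro continuous_on_add cont_PhiK_ab kD g t) (auto simp: True)
      show "continuous_on (I \<times> I) (\<lambda>(a, b). PhiK ky g (x + a *\<^sub>R axis i 1) (x $ ix1 + b) t + PhiK k g1 (x + a *\<^sub>R axis i 1) (x $ ix1 + b) t)"
        using c by (simp add: case_prod_unfold)
    qed
    then show ?thesis by (simp add: d)
  qed
  then show "((\<lambda>h. SK k g ((x, t) + h *\<^sub>R es i)) has_real_derivative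
      SK (kx i) g (x, t) + del1 i * (SK ky g (x, t) + SK k g1 (x, t)))
      (at 0 within {h. (x, t) + h *\<^sub>R es i \<in> cQ})"
    unfolding I(1) by (simp only: SK_def e_space_shift fst_conv snd_conv first_coord_line)
qed

lemma hpd_VK:
  assumes k: "kern1 k kx ky" and g: "contQ g"
  shows "hpdQ (es i) (VK k g) (\<lambda>p. VK (kx i) g p - del1 i * SK k g p)"
  unfolding hpd_def
proof safe
  fix x t assume p: "(x, t) \<in> cQ"
  then have x: "x \<in> cOmega A" and t: "t \<in> {0..T}" by (auto simp: mem_cQT)
  define I where "I = {h. x + h *\<^sub>R axis i 1 \<in> cOmega A}"
  note I = line_set[OF p, of i, folded I_def]
  have Ix: "x + h *\<^sub>R axis i 1 \<in> cOmega A" if "h \<in> I" for h using that by (simp add: I_def)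
  have r: "x $ ix1 + h * del1 i \<in> I1" if "h \<in> I" for h using mem_I1[OF Ix[OF that]] by (simp only: first_coord_line)
  note kD = kern1D[OF k]
  let ?V = "\<lambda>k x a. LINT r:{a..A $ ix1}|lborel. PhiK k g x r t"
  have dx: "((\<lambda>h. ?V k (x + h *\<^sub>R axis i 1) (x $ ix1)) has_real_derivative ?V (kx i) x (x $ ix1)) (at 0 within I)"
    using VK_deriv_param[OF kD(1) g kD(2) g I(2,3) mem_I1[OF x], where x="\<lambda>h. x + h *\<^sub>R axis i 1" and t="\<lambda>_. t"]
      PhiK_deriv_x[OF k g t _ I(2) _ Ix] Ix t by simp
  have "((\<lambda>h. ?V k (x + h *\<^sub>R axis i 1) (x $ ix1 + h * del1 i)) has_real_derivative
      ?V (kx i) x (x $ ix1) - del1 i * PhiK k g x (x $ ix1) t) (at 0 within I)"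
  proof (cases "i = ix1")
    case False
    then show ?thesis using dx by (simp add: del1_def)
  next
    case True
    have d: "del1 i = 1" by (simp add: True del1_def)
    have "((\<lambda>s. (\<lambda>a b. ?V k (x + a *\<^sub>R axis i 1) (x $ ix1 + b)) s s) has_real_derivative
       ?V (kx i) x (x $ ix1) + (\<lambda>a b. - PhiK k g (x + a *\<^sub>R axis i 1) (x $ ix1 + b) t) 0 0) (at 0 within I)"
    proof (rule diagonal_derivative[OF I(2,3),
        where F="\<lambda>a b. ?V k (x + a *\<^sub>R axis i 1) (x $ ix1 + b)"
          and Fb="\<lambda>a b. - PhiK k g (x + a *\<^sub>R axis i 1) (x $ ix1 + b) t"])
      show "((\<lambda>a. ?V k (x + a *\<^sub>R axis i 1) (x $ ix1 + 0)) has_real_derivative ?V (kx i) x (x $ ix1)) (at 0 within I)"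
        using dx by simp
      show "((\<lambda>b. ?V k (x + a *\<^sub>R axis i 1) (x $ ix1 + b)) has_real_derivative
          - PhiK k g (x + a *\<^sub>R axis i 1) (x $ ix1 + b) t) (at b within I)"
        if ab: "a \<in> I" "b \<in> I" for a b
      proof -
        note cP = cont_PhiK_r[OF kD(1) g Ix[OF ab(1)] t]
        have eq: "?V k (x + a *\<^sub>R axis i 1) c = integral {c..A $ ix1} (\<lambda>r. PhiK k g (x + a *\<^sub>R axis i 1) r t)" if "c \<in> I1" for c
        proof (rule set_borel_integral_eq_integral(2)[OF set_integrable_compact_open[where K=I1]])
          show "continuous_on I1 (\<lambda>r. PhiK k g (x + a *\<^sub>R axis i 1) r t)" by (rule cP)
        qed (use that in auto)
        have "((\<lambda>c. integral {c..A $ ix1} (\<lambda>r. PhiK k g (x + a *\<^sub>R axis i 1) r t)) has_real_derivative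
          - PhiK k g (x + a *\<^sub>R axis i 1) (x $ ix1 + b) t) (at (x $ ix1 + b) within I1)"
          by (rule integral_has_real_derivative'[OF cP]) (use r ab d in auto)
        then have "((\<lambda>c. ?V k (x + a *\<^sub>R axis i 1) c) has_real_derivative
          - PhiK k g (x + a *\<^sub>R axis i 1) (x $ ix1 + b) t) (at (x $ ix1 + b) within I1)"
          unfolding has_field_derivative_def
          by (rule has_derivative_transform[rotated 2]) (use r[OF ab(2)] d eq in auto)
        then have "((\<lambda>c. ?V k (x + a *\<^sub>R axis i 1) c) has_real_derivative
          - PhiK k g (x + a *\<^sub>R axis i 1) (x $ ix1 + b) t) (at (x $ ix1 + b) within (+) (x $ ix1) ` I)"
          by (rule has_field_derivative_subset) (use r d in auto)
        moreover have "((+) (x $ ix1) has_real_derivative 1) (at b within I)" by (auto intro!: derivative_eq_intros)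
        ultimately have "((\<lambda>c. ?V k (x + a *\<^sub>R axis i 1) c) \<circ> (+) (x $ ix1) has_real_derivative
          - PhiK k g (x + a *\<^sub>R axis i 1) (x $ ix1 + b) t * 1) (at b within I)"
          by (rule DERIV_image_chain)
        then show ?thesis by (simp add: o_def)
      qed
      have c: "continuous_on (I \<times> I) (\<lambda>p. - (\<lambda>(a, b). PhiK k g (x + a *\<^sub>R axis i 1) (x $ ix1 + b) t) p)"
        unfolding True using Ix by (intro continuous_on_minus cont_PhiK_ab kD g t) (auto simp: True)
      show "continuous_on (I \<times> I) (\<lambda>(a, b). - PhiK k g (x + a *\<^sub>R axis i 1) (x $ ix1 + b) t)"
        using c by (simp add: case_prod_unfold)
    qed
    then show ?thesis by (simp add: d)
  qed
  then show "((\<lambda>h. VK k g ((x, t) + h *\<^sub>R es i)) has_real_derivative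
      VK (kx i) g (x, t) - del1 i * SK k g (x, t))
      (at 0 within {h. (x, t) + h *\<^sub>R es i \<in> cQ})"
    unfolding I(1) by (simp only: SK_def VK_def e_space_shift fst_conv snd_conv first_coord_line)
qed

section \<open>Weighted square norms of the interaction term\<close>

definition ew1 :: "real \<Rightarrow> real \<Rightarrow> real" where "ew1 l r = exp (l * (r + A $ ix1 + 1)^2)"

lemma Ew_ew1: "Ew l (x, t) = ew1 l (x $ ix1)" by (simp add: Ew_def Xi_def ew1_def)

lemma cont_ew1: "continuous_on S (ew1 l)" unfolding ew1_def by (intro continuous_intros)

lemma ew1_mono: "- A $ ix1 \<le> r \<Longrightarrow> r \<le> r' \<Longrightarrow> 0 \<le> l \<Longrightarrow> ew1 l r \<le> ew1 l r'"
  unfolding ew1_def by (auto intro!: mult_left_mono power_mono)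

lemma slice_first_coord: "slice_integral A ix1 r (\<lambda>x. h (x $ ix1) * f x) = h r * slice_integral A ix1 r f"
  by (simp add: slice_integral_eq)

text \<open>The squared norm on a slice, written as \<open>PhiK\<close> with kernel 1 in order to
  inherit its continuity; the point 0 is a dummy.\<close>

definition GK where "GK g t r = PhiK (\<lambda>_. 1) (\<lambda>p. (g p)^2) 0 r t"

lemma GK_eq: "GK g t r = slice_integral A ix1 r (\<lambda>y. (g (y, t))^2)" by (simp add: GK_def PhiK_def)

lemma zero_cOmega: "0 \<in> cOmega A" using A_pos by (auto simp: mem_cOmega less_imp_le)

lemma cont_GK:
  assumes "contQ g" "t \<in> {0..T}"
  shows "continuous_on I1 (GK g t)"
  unfolding GK_def[abs_def] by (intro cont_PhiK_r continuous_intros assms zero_cOmega)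

lemma GK_nonneg:
  assumes g: "contQ g" and t: "t \<in> {0..T}" and r: "r \<in> I1"
  shows "0 \<le> GK g t r"
proof -
  interpret S: posfun "cOmega A" "slice_integral A ix1 r" by (rule posfun_slice[OF r])
  show ?thesis unfolding GK_eq by (intro S.L_nonneg continuous_intros cont_at_time g t) auto
qed

lemma PhiK_square_le:
  assumes k: "continuous_on cOO k" and g: "contQ g" and xt: "x \<in> cOmega A" "t \<in> {0..T}" "r \<in> I1"
    and C: "\<And>p. p \<in> cOO \<Longrightarrow> \<bar>k p\<bar> \<le> C"
  shows "(PhiK k g x r t)^2 \<le> svol * C^2 * GK g t r"
proof -
  interpret S: posfun "cOmega A" "slice_integral A ix1 r" by (rule posfun_slice[OF xt(3)])
  note ck = cont_kernel_slice[OF k g xt(1,2)]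
  have "(PhiK k g x r t)^2 \<le> slice_integral A ix1 r (\<lambda>x. 1) * slice_integral A ix1 r (\<lambda>y. (k (x, y) * g (y, t))^2)"
    unfolding PhiK_def by (rule S.L_square_le[OF ck])
  also have "\<dots> \<le> svol * slice_integral A ix1 r (\<lambda>y. C^2 * (g (y, t))^2)"
    unfolding slice_one mult_1
  proof (intro mult_left_mono S.L_mono svol_nonneg)
    show "continuous_on (cOmega A) (\<lambda>y. (k (x, y) * g (y, t))^2)" by (rule continuous_on_power[OF ck])
    show "continuous_on (cOmega A) (\<lambda>y. C^2 * (g (y, t))^2)" by (intro continuous_intros cont_at_time g xt)
    fix y assume y: "y \<in> cOmega A"
    have "(k (x, y))^2 \<le> C^2" using C[of "(x, y)"] xt y by (intro power2_le_iff_abs_le[THEN iffD2]) auto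
    then show "(k (x, y) * g (y, t))^2 \<le> C^2 * (g (y, t))^2"
      unfolding power_mult_distrib by (intro mult_right_mono) auto
  qed
  also have "slice_integral A ix1 r (\<lambda>y. C^2 * (g (y, t))^2) = C^2 * GK g t r"
    unfolding GK_eq by (intro S.L_cmult continuous_intros cont_at_time g xt)
  finally show ?thesis by (simp add: mult.assoc)
qed

lemma IO_weighted_eq:
  assumes g: "contQ g" and t: "t \<in> {0..T}"
  shows "IO A (\<lambda>x. (Ew l (x, t))^2 * (g (x, t))^2) = (LINT r:{- A $ ix1<..<A $ ix1}|lborel. (ew1 l r)^2 * GK g t r)"
proof -
  have "continuous_on (cOmega A) (\<lambda>x. (\<lambda>p. (Ew l p)^2 * (g p)^2) (x, t))"
    by (intro cont_at_time continuous_intros cont_Ew g t)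
  then have "IO A (\<lambda>x. (Ew l (x, t))^2 * (g (x, t))^2) =
      (LINT r:{- A $ ix1<..<A $ ix1}|lborel. slice_integral A ix1 r (\<lambda>x. (Ew l (x, t))^2 * (g (x, t))^2))"
    by (intro IO_eq_slices) simp
  then show ?thesis
    unfolding Ew_ew1 using slice_first_coord[of _ "\<lambda>r. (ew1 l r)^2" "\<lambda>x. (g (x, t))^2"] by (simp add: GK_eq)
qed

text \<open>The weight is constant on slices and passes through the slice integral. One factor
  \<open>svol\<close> comes from the Cauchy-Schwarz inequality, the other from integrating a
  function of \<open>x_1\<close> alone over the slice.\<close>

lemma SK_L2:
  assumes k: "continuous_on cOO k" and g: "contQ g" and t: "t \<in> {0..T}"
    and C: "\<And>p. p \<in> cOO \<Longrightarrow> \<bar>k p\<bar> \<le> C"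
  shows "IO A (\<lambda>x. (Ew l (x, t))^2 * (SK k g (x, t))^2) \<le> svol^2 * C^2 * IO A (\<lambda>x. (Ew l (x, t))^2 * (g (x, t))^2)"
proof -
  have cG: "continuous_on (cOmega A) (\<lambda>x. GK g t (x $ ix1))"
    by (intro continuous_on_compose2[OF cont_GK[OF g t]] continuous_intros) (auto simp: mem_cOmega)
  have cE: "continuous_on (cOmega A) (\<lambda>x. Ew l (x, t))" unfolding Ew_ew1
    by (intro continuous_on_compose2[OF cont_ew1[of UNIV]] continuous_intros) auto
  have cS: "continuous_on (cOmega A) (\<lambda>x. SK k g (x, t))" by (rule cont_at_time[OF cont_SK[OF k g] t])
  have "IO A (\<lambda>x. (Ew l (x, t))^2 * (SK k g (x, t))^2) \<le> IO A (\<lambda>x. (svol * C^2) * ((Ew l (x, t))^2 * GK g t (x $ ix1)))"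
  proof (intro O.L_mono continuous_intros cE cS cG)
    fix x assume x: "x \<in> cOmega A"
    have "(SK k g (x, t))^2 \<le> svol * C^2 * GK g t (x $ ix1)"
      unfolding SK_def using PhiK_square_le[OF k g x t mem_I1[OF x] C] by simp
    then have "(Ew l (x, t))^2 * (SK k g (x, t))^2 \<le> (Ew l (x, t))^2 * (svol * C^2 * GK g t (x $ ix1))"
      by (intro mult_left_mono) auto
    then show "(Ew l (x, t))^2 * (SK k g (x, t))^2 \<le> (svol * C^2) * ((Ew l (x, t))^2 * GK g t (x $ ix1))"
      by (simp add: mult_ac)
  qed
  also have "\<dots> = svol * C^2 * IO A (\<lambda>x. (Ew l (x, t))^2 * GK g t (x $ ix1))"
    by (intro O.L_cmult continuous_intros cE cG)
  also have "IO A (\<lambda>x. (Ew l (x, t))^2 * GK g t (x $ ix1)) =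
      (LINT r:{- A $ ix1<..<A $ ix1}|lborel. slice_integral A ix1 r (\<lambda>x. ((ew1 l (x $ ix1))^2 * GK g t (x $ ix1)) * 1))"
    unfolding Ew_ew1[symmetric, of l _ t] by (subst IO_eq_slices[of _ ix1]) (auto intro!: continuous_intros cE cG)
  also have "\<dots> = (LINT r:{- A $ ix1<..<A $ ix1}|lborel. svol * ((ew1 l r)^2 * GK g t r))"
    unfolding slice_first_coord[of _ "\<lambda>r. (ew1 l r)^2 * GK g t r" "\<lambda>_. 1"] slice_one by (simp add: mult_ac)
  also have "\<dots> = svol * IO A (\<lambda>x. (Ew l (x, t))^2 * (g (x, t))^2)"
    unfolding IO_weighted_eq[OF g t] by simp
  finally show ?thesis by (simp add: power2_eq_square mult_ac)
qed

text \<open>The integration runs over \<open>r \<ge> x_1\<close>, where the weight is at least its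
  value at \<open>x_1\<close>. It can therefore be moved under the integral, which makes the
  constant independent of \<open>l\<close>.\<close>

lemma VK_L2:
  assumes k: "continuous_on cOO k" and g: "contQ g" and t: "t \<in> {0..T}" and l: "0 \<le> l"
    and C: "\<And>p. p \<in> cOO \<Longrightarrow> \<bar>k p\<bar> \<le> C"
  shows "IO A (\<lambda>x. (Ew l (x, t))^2 * (VK k g (x, t))^2)
    \<le> (2 * A $ ix1 * svol * IO A (\<lambda>x. 1)) * C^2 * IO A (\<lambda>x. (Ew l (x, t))^2 * (g (x, t))^2)"
proof -
  let ?W = "IO A (\<lambda>x. (Ew l (x, t))^2 * (g (x, t))^2)"
  have cE: "continuous_on (cOmega A) (\<lambda>x. Ew l (x, t))" unfolding Ew_ew1
    by (intro continuous_on_compose2[OF cont_ew1[of UNIV]] continuous_intros) auto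
  have cV: "continuous_on (cOmega A) (\<lambda>x. VK k g (x, t))" by (rule cont_at_time[OF cont_VK[OF k g] t])
  have W: "?W = (LINT r:I1|lborel. (ew1 l r)^2 * GK g t r)"
    unfolding IO_weighted_eq[OF g t]
    by (intro set_integral_discrete_difference[where X="{- A $ ix1, A $ ix1}"]) auto
  have cGr: "continuous_on I1 (\<lambda>r. (ew1 l r)^2 * GK g t r)" by (intro continuous_intros cont_ew1 cont_GK g t)
  have pw: "(Ew l (x, t))^2 * (VK k g (x, t))^2 \<le> 2 * A $ ix1 * svol * C^2 * ?W" if x: "x \<in> cOmega A" for x
  proof -
    let ?J = "{x $ ix1..A $ ix1}"
    have J: "?J \<subseteq> I1" "x $ ix1 \<in> I1" using mem_I1[OF x] by auto
    interpret L: posfun ?J "\<lambda>f. LINT r:?J|lborel. f r" by (rule posfun_set_integral) auto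
    have cP: "continuous_on ?J (\<lambda>r. PhiK k g x r t)" by (rule continuous_on_subset[OF cont_PhiK_r[OF k g x t] J(1)])
    have cG: "continuous_on ?J (GK g t)" by (rule continuous_on_subset[OF cont_GK[OF g t] J(1)])
    have one: "(LINT r:?J|lborel. 1) = A $ ix1 - x $ ix1" using J by (simp add: set_lebesgue_integral_def)
    have "(VK k g (x, t))^2 \<le> (LINT r:?J|lborel. 1) * (LINT r:?J|lborel. (PhiK k g x r t)^2)"
      unfolding VK_def fst_conv snd_conv by (rule L.L_square_le[OF cP])
    also have "\<dots> \<le> (2 * A $ ix1) * (LINT r:?J|lborel. (svol * C^2) * GK g t r)"
    proof (intro mult_mono L.L_mono L.L_nonneg continuous_intros cP cG)
      show "(LINT r:?J|lborel. 1) \<le> 2 * A $ ix1" using J by (simp add: one)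
      show "(PhiK k g x r t)^2 \<le> svol * C^2 * GK g t r" if "r \<in> ?J" for r
        using J that by (intro PhiK_square_le k g x t C) auto
    qed (use A_pos[of ix1] in auto)
    also have "(LINT r:?J|lborel. (svol * C^2) * GK g t r) = (svol * C^2) * (LINT r:?J|lborel. GK g t r)"
      by (rule L.L_cmult[OF cG])
    finally have v: "(VK k g (x, t))^2 \<le> (2 * A $ ix1 * svol * C^2) * (LINT r:?J|lborel. GK g t r)" by (simp add: mult_ac)
    have "(Ew l (x, t))^2 * (LINT r:?J|lborel. GK g t r) = (LINT r:?J|lborel. (ew1 l (x $ ix1))^2 * GK g t r)"
      by (simp add: L.L_cmult[OF cG] Ew_ew1)
    also have "\<dots> \<le> (LINT r:?J|lborel. (ew1 l r)^2 * GK g t r)"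
    proof (intro L.L_mono continuous_intros cG cont_ew1 mult_right_mono power_mono)
      fix r assume r: "r \<in> ?J"
      show "ew1 l (x $ ix1) \<le> ew1 l r" using r J l by (intro ew1_mono) auto
      show "0 \<le> ew1 l (x $ ix1)" by (simp add: ew1_def)
      show "0 \<le> GK g t r" using J r by (intro GK_nonneg g t) auto
    qed
    also have "\<dots> \<le> (LINT r:I1|lborel. (ew1 l r)^2 * GK g t r)"
      unfolding set_lebesgue_integral_def
    proof (rule integral_mono)
      show "integrable lborel (\<lambda>r. indicat_real ?J r *\<^sub>R ((ew1 l r)^2 * GK g t r))"
        using set_integrable_compact_open[OF _ cGr J(1)] by (simp add: set_integrable_def)
      show "integrable lborel (\<lambda>r. indicat_real I1 r *\<^sub>R ((ew1 l r)^2 * GK g t r))"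
        using set_integrable_compact_open[OF _ cGr order_refl] by (simp add: set_integrable_def)
      fix r show "indicat_real ?J r *\<^sub>R ((ew1 l r)^2 * GK g t r) \<le> indicat_real I1 r *\<^sub>R ((ew1 l r)^2 * GK g t r)"
        using J GK_nonneg[OF g t, of r] by (auto simp: indicator_def)
    qed
    finally have e: "(Ew l (x, t))^2 * (LINT r:?J|lborel. GK g t r) \<le> ?W" by (simp add: W)
    have "(Ew l (x, t))^2 * (VK k g (x, t))^2 \<le> (Ew l (x, t))^2 * ((2 * A $ ix1 * svol * C^2) * (LINT r:?J|lborel. GK g t r))"
      by (intro mult_left_mono v) auto
    also have "\<dots> = (2 * A $ ix1 * svol * C^2) * ((Ew l (x, t))^2 * (LINT r:?J|lborel. GK g t r))" by (simp add: mult_ac)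
    also have "\<dots> \<le> (2 * A $ ix1 * svol * C^2) * ?W"
      using A_pos[of ix1] svol_nonneg by (intro mult_left_mono e) auto
    finally show ?thesis .
  qed
  have "IO A (\<lambda>x. (Ew l (x, t))^2 * (VK k g (x, t))^2) \<le> IO A (\<lambda>x. 2 * A $ ix1 * svol * C^2 * ?W)"
    by (intro O.L_mono pw continuous_intros cE cV)
  also have "\<dots> = (2 * A $ ix1 * svol * C^2 * ?W) * IO A (\<lambda>x. 1)" by (rule O.L_const)
  finally show ?thesis by (simp add: mult_ac)
qed

lemma SK_bound:
  assumes "continuous_on cOO k" "contQ g"
    "\<And>p. p \<in> cOO \<Longrightarrow> \<bar>k p\<bar> \<le> C" "\<And>p. p \<in> cQ \<Longrightarrow> \<bar>g p\<bar> \<le> D" "p \<in> cQ"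
  shows "\<bar>SK k g p\<bar> \<le> C * D * svol"
  using assms(5) unfolding SK_def
  by (cases p) (auto intro!: PhiK_bound assms simp: mem_cQT mem_cOmega)

lemma VK_bound:
  assumes k: "continuous_on cOO k" and g: "contQ g"
    and C: "\<And>p. p \<in> cOO \<Longrightarrow> \<bar>k p\<bar> \<le> C" and D: "\<And>p. p \<in> cQ \<Longrightarrow> \<bar>g p\<bar> \<le> D" and p: "p \<in> cQ"
  shows "\<bar>VK k g p\<bar> \<le> 2 * A $ ix1 * (C * D * svol)"
proof -
  obtain x t where xt: "p = (x, t)" by (cases p)
  have x: "x \<in> cOmega A" and t: "t \<in> {0..T}" using p by (auto simp: xt mem_cQT)
  let ?J = "{x $ ix1..A $ ix1}"
  have J: "?J \<subseteq> I1" "x $ ix1 \<in> I1" using mem_I1[OF x] by auto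
  interpret L: posfun ?J "\<lambda>f. LINT r:?J|lborel. f r" by (rule posfun_set_integral) auto
  have cP: "continuous_on ?J (\<lambda>r. PhiK k g x r t)" by (rule continuous_on_subset[OF cont_PhiK_r[OF k g x t] J(1)])
  have one: "(LINT r:?J|lborel. 1) = A $ ix1 - x $ ix1" using J by (simp add: set_lebesgue_integral_def)
  have "\<bar>VK k g p\<bar> \<le> (LINT r:?J|lborel. C * D * svol)"
    unfolding VK_def xt fst_conv snd_conv
    by (intro L.L_abs_le cP continuous_intros PhiK_bound k g x t C D) (use J x t in \<open>auto simp: mem_cQT\<close>)
  also have "\<dots> = C * D * svol * (A $ ix1 - x $ ix1)" by (subst L.L_const) (simp only: one)
  also have "\<dots> \<le> C * D * svol * (2 * A $ ix1)"
  proof (intro mult_left_mono)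
    show "0 \<le> C * D * svol"
      using C[of "(0, 0)"] D[of "(0, 0)"] zero_cOmega T_pos svol_nonneg by (auto simp: mem_cQT intro!: mult_nonneg_nonneg)
  qed (use J in auto)
  finally show ?thesis by (simp add: mult_ac)
qed

section \<open>The interaction term as a function with two spatial derivatives\<close>

definition kern2 where
  "kern2 k kx ky kxx kxy kyx kyy \<longleftrightarrow> kern1 k kx ky \<and> (\<forall>i. kern1 (kx i) (kxx i) (kxy i)) \<and> kern1 ky kyx kyy"
  for kx :: "'n \<Rightarrow> 'n rvec \<times> 'n rvec \<Rightarrow> real"

definition kern2_le where
  "kern2_le M k kx ky kxx kxy kyx kyy \<longleftrightarrow> (\<forall>p\<in>cOO. \<bar>k p\<bar> \<le> M \<and> (\<forall>i. \<bar>kx i p\<bar> \<le> M) \<and> \<bar>ky p\<bar> \<le> M \<and>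
     (\<forall>i j. \<bar>kxx i j p\<bar> \<le> M) \<and> (\<forall>i. \<bar>kxy i p\<bar> \<le> M) \<and> (\<forall>i. \<bar>kyx i p\<bar> \<le> M) \<and> \<bar>kyy p\<bar> \<le> (M::real))"
  for kx :: "'n \<Rightarrow> 'n rvec \<times> 'n rvec \<Rightarrow> real"

definition Inter where "Inter k1 k2 g p = SK k1 g p + VK k2 g p"

text \<open>The derivative of \<open>Inter\<close> in direction \<open>i\<close>, with
  \<open>g1\<close> the derivative of \<open>g\<close> in \<open>x_1\<close>; the last term comes
  from the moving lower limit.\<close>

definition Inter1 where
  "Inter1 k1x k1y k1 k2x k2 g g1 i p =
    (SK (k1x i) g p + del1 i * (SK k1y g p + SK k1 g1 p)) + (VK (k2x i) g p - del1 i * SK k2 g p)"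
  for k1x k2x :: "'n \<Rightarrow> 'n rvec \<times> 'n rvec \<Rightarrow> real"

lemma hpd_Inter:
  assumes "kern1 k1 k1x k1y" "kern1 k2 k2x k2y" "contQ g" "contQ g1"
    "hpdQ (es ix1) g g1"
  shows "hpdQ (es i) (Inter k1 k2 g) (Inter1 k1x k1y k1 k2x k2 g g1 i)"
  unfolding Inter_def[abs_def] Inter1_def[abs_def]
  by (intro hpd_add hpd_SK[OF assms(1,3,4,5)] hpd_VK[OF assms(2,3)])

lemma hpd_Inter_time:
  assumes "continuous_on cOO k1" "continuous_on cOO k2" "contQ g" "contQ gt"
    "hpdQ e_time g gt"
  shows "hpdQ e_time (Inter k1 k2 g) (Inter k1 k2 gt)"
  unfolding Inter_def[abs_def]
  by (intro hpd_add hpd_SK_time hpd_VK_time assms)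

lemma cont_Inter:
  assumes "continuous_on cOO k1" "continuous_on cOO k2" "contQ g"
  shows "contQ (Inter k1 k2 g)"
  unfolding Inter_def[abs_def] by (intro continuous_intros cont_SK cont_VK assms)

lemma cont_Inter1:
  assumes "kern1 k1 k1x k1y" "kern1 k2 k2x k2y" "contQ g" "contQ g1"
  shows "contQ (Inter1 k1x k1y k1 k2x k2 g g1 i)"
  unfolding Inter1_def[abs_def] by (intro continuous_intros cont_SK cont_VK assms kern1D[OF assms(1)] kern1D[OF assms(2)])

definition ibd :: real where "ibd = svol + 2 * A $ ix1 * svol"

lemma ibd_nonneg: "0 \<le> ibd" unfolding ibd_def using svol_nonneg A_pos[of ix1] by simp

lemma SVK_bound:
  assumes "continuous_on cOO k" "contQ g"
    "\<And>p. p \<in> cOO \<Longrightarrow> \<bar>k p\<bar> \<le> C" "\<And>p. p \<in> cQ \<Longrightarrow> \<bar>g p\<bar> \<le> D" "p \<in> cQ" "0 \<le> C" "0 \<le> D"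
  shows "\<bar>SK k g p\<bar> \<le> ibd * (C * D)" "\<bar>VK k g p\<bar> \<le> ibd * (C * D)"
proof -
  have n: "0 \<le> C * D * svol" "0 \<le> A $ ix1 * (C * D * svol)"
    using assms(6,7) svol_nonneg A_pos[of ix1] by auto
  show "\<bar>SK k g p\<bar> \<le> ibd * (C * D)" "\<bar>VK k g p\<bar> \<le> ibd * (C * D)"
    using SK_bound[OF assms(1-5)] VK_bound[OF assms(1-5)] n by (auto simp: ibd_def algebra_simps)
qed

lemma del1_cases: "del1 i = 0 \<or> del1 i = 1" by (simp add: del1_def)

text \<open>The factor 14 is the number of terms in \<open>J2\<close>, each bounded by
  \<open>ibd * M^2\<close>. Spatial derivatives of \<open>m\<close> are taken in the direction
  \<open>ix1\<close> only, because moving \<open>x\<close> moves the slice in no other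
  direction.\<close>

lemma Inter_smooth:
  assumes k1: "kern2 k1 k1x k1y k1xx k1xy k1yx k1yy" and k1le: "kern2_le M k1 k1x k1y k1xx k1xy k1yx k1yy"
    and k2: "kern2 k2 k2x k2y k2xx k2xy k2yx k2yy" and k2le: "kern2_le M k2 k2x k2y k2xx k2xy k2yx k2yy"
    and m: "smooth21 m m1 m2 mt m1t" and M: "0 \<le> M"
    and mle: "\<And>p. p \<in> cQ \<Longrightarrow> \<bar>m p\<bar> \<le> M \<and> \<bar>m1 ix1 p\<bar> \<le> M \<and> \<bar>m2 ix1 ix1 p\<bar> \<le> M \<and> \<bar>mt p\<bar> \<le> M \<and> \<bar>m1t ix1 p\<bar> \<le> M"
  shows "\<exists>J2 J1t. smooth21 (Inter k1 k2 m) (Inter1 k1x k1y k1 k2x k2 m (m1 ix1)) J2 (Inter k1 k2 mt) J1t \<and>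
     (\<forall>p\<in>cQ. \<bar>Inter k1 k2 m p\<bar> \<le> 14 * ibd * M^2 \<and> (\<forall>i. \<bar>Inter1 k1x k1y k1 k2x k2 m (m1 ix1) i p\<bar> \<le> 14 * ibd * M^2) \<and>
        (\<forall>i j. \<bar>J2 i j p\<bar> \<le> 14 * ibd * M^2) \<and> \<bar>Inter k1 k2 mt p\<bar> \<le> 14 * ibd * M^2)"
proof -
  have K1: "kern1 k1 k1x k1y" "\<And>i. kern1 (k1x i) (k1xx i) (k1xy i)" "kern1 k1y k1yx k1yy" using k1 by (auto simp: kern2_def)
  have K2: "kern1 k2 k2x k2y" "\<And>i. kern1 (k2x i) (k2xx i) (k2xy i)" "kern1 k2y k2yx k2yy" using k2 by (auto simp: kern2_def)
  note c1 = kern1D(1-3)[OF K1(1)] kern1D(2,3)[OF K1(2)] kern1D(2,3)[OF K1(3)]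
  note c2 = kern1D(1-3)[OF K2(1)] kern1D(2,3)[OF K2(2)] kern1D(2,3)[OF K2(3)]
  note D = smooth21D[OF m] and cm = smooth21D(6-10)[OF m]
  note hS = hpd_SK[OF K1(1)] hpd_SK[OF K1(2)] hpd_SK[OF K1(3)] hpd_SK[OF K2(1)]
  define J2 where "J2 i j p =
     (SK (k1xx i j) m p + del1 j * (SK (k1xy i) m p + SK (k1x i) (m1 ix1) p)
      + del1 i * ((SK (k1yx j) m p + del1 j * (SK k1yy m p + SK k1y (m1 ix1) p))
                + (SK (k1x j) (m1 ix1) p + del1 j * (SK k1y (m1 ix1) p + SK k1 (m2 ix1 ix1) p))))
     + ((VK (k2xx i j) m p - del1 j * SK (k2x i) m p)
      - del1 i * (SK (k2x j) m p + del1 j * (SK k2y m p + SK k2 (m1 ix1) p)))" for i j p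
  define J1t where "J1t = Inter1 k1x k1y k1 k2x k2 mt (m1t ix1)"
  have sm: "smooth21 (Inter k1 k2 m) (Inter1 k1x k1y k1 k2x k2 m (m1 ix1)) J2 (Inter k1 k2 mt) J1t"
  proof (rule smooth21I[where ?zt1.0=J1t])
    show "hpdQ (es i) (Inter k1 k2 m) (Inter1 k1x k1y k1 k2x k2 m (m1 ix1) i)" for i
      by (rule hpd_Inter[OF K1(1) K2(1) cm(1,2) D(1)])
    show "hpdQ e_time (Inter k1 k2 m) (Inter k1 k2 mt)"
      by (rule hpd_Inter_time[OF c1(1) c2(1) cm(1,4) D(2)])
    show "hpdQ (es i) (Inter k1 k2 mt) (J1t i)" for i
      unfolding J1t_def by (rule hpd_Inter[OF K1(1) K2(1) cm(4,5) D(5)])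
    show "hpdQ e_time (Inter1 k1x k1y k1 k2x k2 m (m1 ix1) i) (J1t i)" for i
      unfolding J1t_def Inter1_def[abs_def]
      by (intro hpd_add hpd_diff hpd_cmult hpd_SK_time hpd_VK_time c1 c2 cm D(2,4))
    show "hpdQ (es j) (Inter1 k1x k1y k1 k2x k2 m (m1 ix1) i) (J2 i j)" for i j
      unfolding J2_def[abs_def] Inter1_def[abs_def]
      by (intro hpd_add hpd_diff hpd_cmult hpd_SK[OF K1(1) cm(2,3) D(3)] hpd_SK[OF K1(2) cm(1,2) D(1)] hpd_SK[OF K1(3) cm(1,2) D(1)]
           hpd_SK[OF K2(1) cm(1,2) D(1)] hpd_VK[OF K2(2) cm(1)])
    show "contQ (Inter k1 k2 m)" "contQ (Inter k1 k2 mt)"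
      by (intro cont_Inter c1 c2 cm)+
    show "contQ (Inter1 k1x k1y k1 k2x k2 m (m1 ix1) i)" for i
      by (intro cont_Inter1[OF K1(1) K2(1)] cm)
    show "contQ (J1t i)" "contQ (J1t i)" for i
      unfolding J1t_def by (intro cont_Inter1[OF K1(1) K2(1)] cm)+
    show "contQ (J2 i j)" for i j
      unfolding J2_def[abs_def] by (intro continuous_intros cont_SK cont_VK c1 c2 cm)
  qed
  have kle: "\<bar>k1 q\<bar> \<le> M" "\<bar>k1x i q\<bar> \<le> M" "\<bar>k1y q\<bar> \<le> M" "\<bar>k1xx i j q\<bar> \<le> M" "\<bar>k1xy i q\<bar> \<le> M" "\<bar>k1yx i q\<bar> \<le> M" "\<bar>k1yy q\<bar> \<le> M"
     "\<bar>k2 q\<bar> \<le> M" "\<bar>k2x i q\<bar> \<le> M" "\<bar>k2y q\<bar> \<le> M" "\<bar>k2xx i j q\<bar> \<le> M" if "q \<in> cOO" for i j q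
    using k1le k2le that unfolding kern2_le_def by auto
  have ml: "\<bar>m p\<bar> \<le> M" "\<bar>m1 ix1 p\<bar> \<le> M" "\<bar>m2 ix1 ix1 p\<bar> \<le> M" "\<bar>mt p\<bar> \<le> M" "\<bar>m1t ix1 p\<bar> \<le> M" if "p \<in> cQ" for p
    using mle[OF that] by auto
  define b where "b = ibd * (M * M)"
  have b0: "0 \<le> b" using ibd_nonneg M by (simp add: b_def)
  have bb: "14 * ibd * M^2 = 14 * b" by (simp add: b_def power2_eq_square)
  have "\<bar>Inter k1 k2 m p\<bar> \<le> 14 * b" "\<bar>Inter1 k1x k1y k1 k2x k2 m (m1 ix1) i p\<bar> \<le> 14 * b" "\<bar>J2 i j p\<bar> \<le> 14 * b" "\<bar>Inter k1 k2 mt p\<bar> \<le> 14 * b"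
    if p: "p \<in> cQ" for i j p
  proof -
    have S: "\<bar>SK k g p\<bar> \<le> b" "\<bar>VK k g p\<bar> \<le> b"
      if "continuous_on cOO k" "contQ g" "\<And>q. q \<in> cOO \<Longrightarrow> \<bar>k q\<bar> \<le> M" "\<And>q. q \<in> cQ \<Longrightarrow> \<bar>g q\<bar> \<le> M" for k g
      unfolding b_def by (rule SVK_bound[OF that p M M]; assumption)+
    have s: "\<bar>SK k1 m p\<bar> \<le> b" "\<bar>VK k2 m p\<bar> \<le> b" "\<bar>SK k1 mt p\<bar> \<le> b" "\<bar>VK k2 mt p\<bar> \<le> b"
      "\<bar>SK (k1x i) m p\<bar> \<le> b" "\<bar>SK k1y m p\<bar> \<le> b" "\<bar>SK k1 (m1 ix1) p\<bar> \<le> b" "\<bar>VK (k2x i) m p\<bar> \<le> b" "\<bar>SK k2 m p\<bar> \<le> b"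
      "\<bar>SK (k1xx i j) m p\<bar> \<le> b" "\<bar>SK (k1xy i) m p\<bar> \<le> b" "\<bar>SK (k1x i) (m1 ix1) p\<bar> \<le> b" "\<bar>SK (k1yx j) m p\<bar> \<le> b"
      "\<bar>SK k1yy m p\<bar> \<le> b" "\<bar>SK k1y (m1 ix1) p\<bar> \<le> b" "\<bar>SK (k1x j) (m1 ix1) p\<bar> \<le> b" "\<bar>SK k1 (m2 ix1 ix1) p\<bar> \<le> b"
      "\<bar>VK (k2xx i j) m p\<bar> \<le> b" "\<bar>SK (k2x i) m p\<bar> \<le> b" "\<bar>SK (k2x j) m p\<bar> \<le> b" "\<bar>SK k2y m p\<bar> \<le> b" "\<bar>SK k2 (m1 ix1) p\<bar> \<le> b"
      by (intro S c1 c2 cm kle ml; assumption)+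
    show "\<bar>Inter k1 k2 m p\<bar> \<le> 14 * b" "\<bar>Inter k1 k2 mt p\<bar> \<le> 14 * b"
      unfolding Inter_def using s(1-4)[THEN abs_le_D1] s(1-4)[THEN abs_le_D2] b0 by (auto intro!: abs_leI)
    show "\<bar>Inter1 k1x k1y k1 k2x k2 m (m1 ix1) i p\<bar> \<le> 14 * b"
      unfolding Inter1_def using del1_cases[of i] s(5-9)[THEN abs_le_D1] s(5-9)[THEN abs_le_D2] b0
      by (elim disjE; simp only: mult_zero_left mult_1; intro abs_leI; linarith)
    show "\<bar>J2 i j p\<bar> \<le> 14 * b"
      unfolding J2_def using del1_cases[of i] del1_cases[of j] s(10-22)[THEN abs_le_D1] s(10-22)[THEN abs_le_D2] b0
      by (elim disjE; simp only: mult_zero_left mult_1; intro abs_leI; linarith)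
  qed
  then show ?thesis using sm unfolding bb by blast
qed

lemma sum_sq_le2: "(a + b)^2 \<le> 2 * a^2 + 2 * (b::real)^2"
  using zero_le_power2[of "a - b"] by (simp add: power2_eq_square algebra_simps)

definition il2 :: real where "il2 = svol^2 + 2 * A $ ix1 * svol * IO A (\<lambda>x. 1)"

lemma il2_nonneg: "0 \<le> il2"
  unfolding il2_def using svol_nonneg A_pos[of ix1] by (intro add_nonneg_nonneg mult_nonneg_nonneg O.L_nonneg) auto

lemma SVK_L2:
  assumes k: "continuous_on cOO k" and g: "contQ g" and t: "t \<in> {0..T}" and l: "0 \<le> l"
    and C: "\<And>p. p \<in> cOO \<Longrightarrow> \<bar>k p\<bar> \<le> C"
  shows "IO A (\<lambda>x. (Ew l (x, t))^2 * (SK k g (x, t))^2) \<le> il2 * C^2 * IO A (\<lambda>x. (Ew l (x, t))^2 * (g (x, t))^2)"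
    and "IO A (\<lambda>x. (Ew l (x, t))^2 * (VK k g (x, t))^2) \<le> il2 * C^2 * IO A (\<lambda>x. (Ew l (x, t))^2 * (g (x, t))^2)"
proof -
  have "continuous_on (cOmega A) (\<lambda>x. (\<lambda>p. (Ew l p)^2 * (g p)^2) (x, t))"
    by (intro cont_at_time continuous_intros cont_Ew g t)
  then have W: "0 \<le> IO A (\<lambda>x. (Ew l (x, t))^2 * (g (x, t))^2)" by (intro O.L_nonneg) auto
  have "0 \<le> IO A (\<lambda>x. 1)" by (intro O.L_nonneg) auto
  then have n: "svol^2 \<le> il2" "2 * A $ ix1 * svol * IO A (\<lambda>x. 1) \<le> il2"
    unfolding il2_def using svol_nonneg A_pos[of ix1] by auto
  have "svol^2 * C^2 * IO A (\<lambda>x. (Ew l (x, t))^2 * (g (x, t))^2) \<le> il2 * C^2 * IO A (\<lambda>x. (Ew l (x, t))^2 * (g (x, t))^2)"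
    by (intro mult_right_mono n W) auto
  with SK_L2[OF k g t, of C l] C show "IO A (\<lambda>x. (Ew l (x, t))^2 * (SK k g (x, t))^2) \<le> il2 * C^2 * IO A (\<lambda>x. (Ew l (x, t))^2 * (g (x, t))^2)"
    by (meson order_trans)
  have "2 * A $ ix1 * svol * IO A (\<lambda>x. 1) * C^2 * IO A (\<lambda>x. (Ew l (x, t))^2 * (g (x, t))^2) \<le> il2 * C^2 * IO A (\<lambda>x. (Ew l (x, t))^2 * (g (x, t))^2)"
    by (intro mult_right_mono n W) auto
  with VK_L2[OF k g t l, of C] C show "IO A (\<lambda>x. (Ew l (x, t))^2 * (VK k g (x, t))^2) \<le> il2 * C^2 * IO A (\<lambda>x. (Ew l (x, t))^2 * (g (x, t))^2)"
    by (meson order_trans)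
qed

lemma cont_Ewt:
  assumes "contQ f" "t \<in> {0..T}"
  shows "continuous_on (cOmega A) (\<lambda>x. (Ew l (x, t))^2 * (f (x, t))^2)"
  by (rule cont_at_time[OF continuous_on_mult[OF continuous_on_power[OF cont_Ew] continuous_on_power[OF assms(1)]] assms(2)])

lemma Inter_L2:
  assumes k1: "continuous_on cOO k1" and k2: "continuous_on cOO k2" and g: "contQ g"
    and t: "t \<in> {0..T}" and l: "0 \<le> l"
    and C: "\<And>p. p \<in> cOO \<Longrightarrow> \<bar>k1 p\<bar> \<le> C" "\<And>p. p \<in> cOO \<Longrightarrow> \<bar>k2 p\<bar> \<le> C"
  shows "IO A (\<lambda>x. (Ew l (x, t))^2 * (Inter k1 k2 g (x, t))^2) \<le> 4 * il2 * C^2 * IO A (\<lambda>x. (Ew l (x, t))^2 * (g (x, t))^2)"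
proof -
  note c = cont_Ewt[OF cont_SK[OF k1 g] t, of l] cont_Ewt[OF cont_VK[OF k2 g] t, of l] cont_Ewt[OF cont_Inter[OF k1 k2 g] t, of l]
  have "IO A (\<lambda>x. (Ew l (x, t))^2 * (Inter k1 k2 g (x, t))^2)
    \<le> IO A (\<lambda>x. 2 * ((Ew l (x, t))^2 * (SK k1 g (x, t))^2) + 2 * ((Ew l (x, t))^2 * (VK k2 g (x, t))^2))"
  proof (intro O.L_mono c continuous_on_add continuous_on_mult_left)
    fix x
    have "(Ew l (x, t))^2 * (Inter k1 k2 g (x, t))^2 \<le> (Ew l (x, t))^2 * (2 * (SK k1 g (x, t))^2 + 2 * (VK k2 g (x, t))^2)"
      unfolding Inter_def by (intro mult_left_mono sum_sq_le2) auto
    then show "(Ew l (x, t))^2 * (Inter k1 k2 g (x, t))^2 \<le> 2 * ((Ew l (x, t))^2 * (SK k1 g (x, t))^2) + 2 * ((Ew l (x, t))^2 * (VK k2 g (x, t))^2)"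
      by (simp add: algebra_simps)
  qed
  also have "\<dots> = 2 * IO A (\<lambda>x. (Ew l (x, t))^2 * (SK k1 g (x, t))^2) + 2 * IO A (\<lambda>x. (Ew l (x, t))^2 * (VK k2 g (x, t))^2)"
    using c by (simp only: O.L_add O.L_cmult continuous_on_mult_left)
  also have "\<dots> \<le> 2 * (il2 * C^2 * IO A (\<lambda>x. (Ew l (x, t))^2 * (g (x, t))^2)) + 2 * (il2 * C^2 * IO A (\<lambda>x. (Ew l (x, t))^2 * (g (x, t))^2))"
    by (intro add_mono mult_left_mono SVK_L2 k1 k2 g t l C) auto
  finally show ?thesis by simp
qed

end

section \<open>Derivatives of functions of the parabolic classes\<close>

lemma pds_Cons: "pds S (v # vs) f = pd S v (pds S vs f)" by (simp add: pds_def)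

lemma pds_Nil: "pds S [] f = f" by (simp add: pds_def)

lemma Ck_on_hpd:
  assumes "Ck_on S V w k f" "v # vs \<in> dir_lists V w k"
  shows "hpd S v (pds S vs f) (pds S (v # vs) f)"
  unfolding hpd_def
proof
  fix x assume "x \<in> S"
  then have "(\<lambda>h. pds S vs f (x + h *\<^sub>R v)) differentiable (at 0 within {h. x + h *\<^sub>R v \<in> S})"
    using assms unfolding Ck_on_def by blast
  then show "((\<lambda>h. pds S vs f (x + h *\<^sub>R v)) has_real_derivative pds S (v # vs) f x) (at 0 within {h. x + h *\<^sub>R v \<in> S})"
    unfolding vector_derivative_works pds_Cons pd_def has_real_derivative_iff_has_vector_derivative .
qed

lemma Ck_on_cont: "Ck_on S V w k f \<Longrightarrow> vs \<in> dir_lists V w k \<Longrightarrow> continuous_on S (pds S vs f)"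
  by (simp add: Ck_on_def)

lemma finite_dir_lists:
  assumes "finite V" "\<And>v. v \<in> V \<Longrightarrow> 1 \<le> w v"
  shows "finite (dir_lists V w k)"
proof -
  have "length vs \<le> sum_list (map w vs)" if "set vs \<subseteq> V" for vs
    using that
  proof (induction vs)
    case (Cons v vs)
    then have "1 \<le> w v" "length vs \<le> sum_list (map w vs)" using assms(2) by auto
    then show ?case by simp
  qed simp
  then have "dir_lists V w k \<subseteq> {vs. set vs \<subseteq> V \<and> length vs \<le> k}"
    by (auto simp: dir_lists_def intro: order_trans)
  then show ?thesis using finite_lists_length_le[OF assms(1)] finite_subset by blast
qed

text \<open>The supremum is taken over a bounded set: there are finitely many lists of directions,
  as every direction has weight at least 1, and each derivative is bounded on the compact
  set.\<close>

lemma Ck_norm_ge: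
  assumes C: "Ck_on S V w k f" and S: "compact S" and V: "finite V" "\<And>v. v \<in> V \<Longrightarrow> 1 \<le> w v"
    and vs: "vs \<in> dir_lists V w k" and x: "x \<in> S"
  shows "\<bar>pds S vs f x\<bar> \<le> Ck_norm S V w k f"
proof -
  have "\<exists>B. \<forall>x\<in>S. \<bar>pds S vs f x\<bar> \<le> B" if "vs \<in> dir_lists V w k" for vs
  proof -
    have "bounded (pds S vs f ` S)"
      using compact_continuous_image[OF Ck_on_cont[OF C that] S] by (rule compact_imp_bounded)
    then show ?thesis by (auto simp: bounded_iff)
  qed
  then obtain B where B: "\<And>vs x. vs \<in> dir_lists V w k \<Longrightarrow> x \<in> S \<Longrightarrow> \<bar>pds S vs f x\<bar> \<le> B vs" by metis
  have fin: "finite (dir_lists V w k)" by (rule finite_dir_lists[OF V])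
  have "bdd_above ((\<lambda>(vs, x). \<bar>pds S vs f x\<bar>) ` (dir_lists V w k \<times> S))"
  proof (rule bdd_aboveI2[where M="\<Sum>vs\<in>dir_lists V w k. \<bar>B vs\<bar>"], clarify)
    fix vs x assume vx: "vs \<in> dir_lists V w k" "x \<in> S"
    have "\<bar>pds S vs f x\<bar> \<le> \<bar>B vs\<bar>" using B[OF vx] by simp
    also have "\<dots> \<le> (\<Sum>vs\<in>dir_lists V w k. \<bar>B vs\<bar>)" by (rule member_le_sum) (use vx fin in auto)
    finally show "\<bar>pds S vs f x\<bar> \<le> (\<Sum>vs\<in>dir_lists V w k. \<bar>B vs\<bar>)" .
  qed
  from cSUP_upper[OF _ this, of "(vs, x)"] show ?thesis using vs x by (simp add: Ck_norm_def)
qed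

lemma e_space_ne_time [simp]: "e_space i \<noteq> e_time" "e_time \<noteq> e_space i"
  by (auto simp: e_space_def e_time_def)

lemma par_weight_simps [simp]: "par_weight e_time = 2" "par_weight (e_space i) = 1"
  by (simp_all add: par_weight_def)

lemma finite_par_dirs: "finite par_dirs" by (simp add: par_dirs_def)

lemma par_weight_ge: "1 \<le> par_weight v" by (simp add: par_weight_def)

lemma mset_mi_list: "count (mset (mi_list \<alpha>)) i = \<alpha> i"
proof -
  have "count (mset (concat (map (\<lambda>i. replicate (\<alpha> i) i) xs))) i = (if i \<in> set xs then \<alpha> i else 0)"
    if "distinct xs" for xs :: "'a list"
    using that by (induction xs) auto
  from this[of "sorted_list_of_set UNIV"] show ?thesis by (simp add: mi_list_def)
qed

lemma length_mi_list: "length (mi_list \<alpha>) = sum \<alpha> UNIV"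
proof -
  have "length (mi_list \<alpha>) = size (mset (mi_list \<alpha>))" by simp
  also have "\<dots> = (\<Sum>i\<in>set_mset (mset (mi_list \<alpha>)). count (mset (mi_list \<alpha>)) i)" by (rule size_multiset_overloaded_eq)
  also have "\<dots> = (\<Sum>i\<in>UNIV. count (mset (mi_list \<alpha>)) i)"
    by (rule sum.mono_neutral_left) (auto simp: count_eq_zero_iff)
  finally show ?thesis by (simp add: mset_mi_list)
qed

text \<open>Each list of directions is a rearrangement of the sorted list of a multi-index. This
  links the lists of the classical norms to the multi-indices of the Sobolev norms.\<close>

lemma mi_list_of_list:
  obtains \<alpha> where "mset (mi_list \<alpha>) = mset is" "sum \<alpha> UNIV = length is"
proof -
  have 1: "mset (mi_list (count (mset is))) = mset is" by (rule multiset_eqI) (simp add: mset_mi_list)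
  then have "length (mi_list (count (mset is))) = length is" by (metis size_mset)
  with 1 show ?thesis using that[of "count (mset is)"] by (simp add: length_mi_list)
qed

lemma finite_multiindices: "finite {\<alpha> :: 'n::finite \<Rightarrow> nat. sum \<alpha> UNIV \<le> k}"
proof (rule finite_subset)
  show "{\<alpha> :: 'n \<Rightarrow> nat. sum \<alpha> UNIV \<le> k} \<subseteq> Pi\<^sub>E UNIV (\<lambda>_. {..k})"
    by (auto simp: PiE_iff intro: order_trans[OF member_le_sum[of _ UNIV]])
  show "finite (Pi\<^sub>E (UNIV::'n set) (\<lambda>_. {..k}))" by (intro finite_PiE) auto
qed

context boxdom
begin

section \<open>Rearranging the order of differentiation\<close>

abbreviation "dd \<equiv> pds cQ"
abbreviation "dl \<equiv> dir_lists par_dirs par_weight"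

lemma C_par_cont: "C_par A T k u \<Longrightarrow> vs \<in> dl (2 * k) \<Longrightarrow> contQ (dd vs u)"
  unfolding C_par_def by (rule Ck_on_cont)

lemma C_par_hpd: "C_par A T k u \<Longrightarrow> v # vs \<in> dl (2 * k) \<Longrightarrow> hpdQ v (dd vs u) (dd (v # vs) u)"
  unfolding C_par_def by (rule Ck_on_hpd)

lemma C_par_bound: "C_par A T k u \<Longrightarrow> vs \<in> dl (2 * k) \<Longrightarrow> p \<in> cQ \<Longrightarrow> \<bar>dd vs u p\<bar> \<le> C_par_norm A T k u"
  unfolding C_par_def C_par_norm_def
  by (rule Ck_norm_ge[OF _ compact_cQT finite_par_dirs par_weight_ge])

lemma C_par_dirs: "v # vs \<in> dl k \<Longrightarrow> v \<in> par_dirs \<and> vs \<in> dl k"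
  by (auto simp: dir_lists_def)

lemma dl_tl: "v # vs \<in> dl k \<Longrightarrow> vs \<in> dl k"
  by (auto simp: dir_lists_def)

lemma dd_swap:
  assumes u: "C_par A T k u" and l: "a # b # vs \<in> dl (2 * k)" and z: "z \<in> cQ"
  shows "dd (a # b # vs) u z = dd (b # a # vs) u z"
proof -
  have l': "b # a # vs \<in> dl (2 * k)" and ab: "a \<in> par_dirs" "b \<in> par_dirs" using l by (auto simp: dir_lists_def)
  note t = dl_tl[OF l] dl_tl[OF l']
  show ?thesis
    by (rule hpd_commute_cQT[OF C_par_hpd[OF u t(1)] C_par_hpd[OF u t(2)] C_par_hpd[OF u l] C_par_hpd[OF u l']
          C_par_cont[OF u l] C_par_cont[OF u l'] z ab(2,1)])
qed

lemma dl_mset: "mset vs = mset vs' \<Longrightarrow> vs \<in> dl k \<longleftrightarrow> vs' \<in> dl k"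
proof -
  assume m: "mset vs = mset vs'"
  then have "sum_list (map par_weight vs) = sum_list (map par_weight vs')"
    by (metis mset_map sum_mset_sum_list)
  moreover have "set vs = set vs'" using m by (rule mset_eq_setD)
  ultimately show ?thesis by (simp add: dir_lists_def)
qed

text \<open>The head of a list is the outermost derivative. A direction travels to the head by
  successive swaps; below an outer derivative the swap is justified by \<open>pd_cong\<close>, since
  it holds on the whole closed cylinder.\<close>

lemma dd_move_front:
  assumes u: "C_par A T k u"
  shows "xs @ a # ys \<in> dl (2 * k) \<Longrightarrow> z \<in> cQ \<Longrightarrow> dd (xs @ a # ys) u z = dd (a # xs @ ys) u z"
proof (induction xs arbitrary: z)
  case (Cons x xs)
  have "xs @ a # ys \<in> dl (2 * k)" using Cons.prems(1) dl_tl[of x "xs @ a # ys" "2 * k"] by simp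
  then have "dd (x # xs @ a # ys) u z = dd (x # a # xs @ ys) u z"
    unfolding pds_Cons[of _ x] using Cons by (intro pd_cong) auto
  also have "\<dots> = dd (a # x # xs @ ys) u z"
    by (rule dd_swap[OF u _ Cons.prems(2)])
       (use Cons.prems(1) dl_mset[of "(x # xs) @ a # ys" "x # a # xs @ ys"] in auto)
  finally show ?case by simp
qed simp

lemma dd_perm:
  assumes u: "C_par A T k u"
  shows "vs \<in> dl (2 * k) \<Longrightarrow> mset vs = mset vs' \<Longrightarrow> z \<in> cQ \<Longrightarrow> dd vs u z = dd vs' u z"
proof (induction vs arbitrary: vs' z)
  case (Cons v vs)
  have "v \<in> set vs'" using Cons.prems(2) by (metis list.set_intros(1) mset_eq_setD)
  then obtain xs ys where vs': "vs' = xs @ v # ys" by (meson split_list)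
  have m: "mset vs = mset (xs @ ys)" using Cons.prems(2) by (simp add: vs')
  have "dd (v # vs) u z = dd (v # xs @ ys) u z"
    unfolding pds_Cons by (rule pd_cong[OF Cons.IH[OF dl_tl[OF Cons.prems(1)] m] Cons.prems(3)])
  also have "\<dots> = dd vs' u z"
    unfolding vs' using dd_move_front[OF u, of xs v ys z] dl_mset[OF Cons.prems(2)] Cons.prems by (simp add: vs')
  finally show ?case .
qed simp

lemma dd_diff:
  assumes u: "C_par A T k u" "C_par A T k u'"
  shows "vs @ us \<in> dl (2 * k) \<Longrightarrow> z \<in> cQ \<Longrightarrow> dd vs (\<lambda>z. dd us u z - dd us u' z) z = dd (vs @ us) u z - dd (vs @ us) u' z"
proof (induction vs arbitrary: z)
  case (Cons v vs)
  have l: "v # vs @ us \<in> dl (2 * k)" using Cons.prems by simp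
  have "dd (v # vs) (\<lambda>z. dd us u z - dd us u' z) z = pd cQ v (\<lambda>z. dd (vs @ us) u z - dd (vs @ us) u' z) z"
    unfolding pds_Cons using Cons dl_tl[OF l] by (intro pd_cong) auto
  also have "\<dots> = dd (v # vs @ us) u z - dd (v # vs @ us) u' z"
    by (rule pd_eq[OF hpd_diff[OF C_par_hpd[OF u(1) l] C_par_hpd[OF u(2) l]] Cons.prems(2)])
       (use cQT_thick Cons.prems C_par_dirs[OF l] in auto)
  finally show ?case by simp
qed (simp add: pds_Nil)

section \<open>Sobolev norms in terms of classical derivatives\<close>

lemma Omega_thick:
  assumes "x \<in> Omega A" shows "at 0 within {h. x + h *\<^sub>R axis i 1 \<in> Omega A} \<noteq> bot"
proof -
  have "open ((\<lambda>h. x + h *\<^sub>R axis i 1) -` Omega A)"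
    by (intro open_vimage open_Omega continuous_intros)
  then have "open {h. x + h *\<^sub>R axis i 1 \<in> Omega A}" by (simp add: vimage_def)
  moreover have "0 \<in> {h. x + h *\<^sub>R axis i 1 \<in> Omega A}" using assms by simp
  ultimately have "at 0 within {h. x + h *\<^sub>R axis i 1 \<in> Omega A} = at 0" by (metis at_within_open)
  then show ?thesis by simp
qed

text \<open>Initial and terminal data are given on the open box only. At a point of it the steps
  admissible in the open box form a subset of those admissible in the closed cylinder and still
  accumulate at 0, so both notions of derivative agree.\<close>

lemma pds_Omega:
  assumes u: "C_par A T k u" "C_par A T k u'" and t: "t \<in> {0..T}"
    and p: "\<And>x. x \<in> Omega A \<Longrightarrow> p x = u (x, t) - u' (x, t)"
  shows "length is \<le> 2 * k \<Longrightarrow> x \<in> Omega A \<Longrightarrow>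
     pds (Omega A) (map (\<lambda>i. axis i 1) is) p x = dd (map es is) u (x, t) - dd (map es is) u' (x, t)"
proof (induction "is" arbitrary: x)
  case (Cons i "is")
  let ?F = "\<lambda>is z. dd (map es is) u z - dd (map es is) u' z"
  have l: "es i # map es is \<in> dl (2 * k)"
    using Cons.prems by (auto simp: dir_lists_def par_dirs_def o_def sum_list_triv)
  have h: "hpdQ (es i) (?F is) (?F (i # is))"
    using hpd_diff[OF C_par_hpd[OF u(1) l] C_par_hpd[OF u(2) l]] by simp
  have "hpd (Omega A) (axis i 1) (\<lambda>x. ?F is (x, t)) (\<lambda>x. ?F (i # is) (x, t))"
    unfolding hpd_def
  proof
    fix x assume x: "x \<in> Omega A"
    then have xt: "(x, t) \<in> cQ" using Omega_sub t by (auto simp: mem_cQT)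
    have "((\<lambda>h. ?F is ((x, t) + h *\<^sub>R es i)) has_real_derivative ?F (i # is) (x, t))
       (at 0 within {h. (x, t) + h *\<^sub>R es i \<in> cQ})"
      using h xt unfolding hpd_def by blast
    then show "((\<lambda>h. ?F is (x + h *\<^sub>R axis i 1, t)) has_real_derivative ?F (i # is) (x, t)) (at 0 within {h. x + h *\<^sub>R axis i 1 \<in> Omega A})"
      unfolding e_space_shift
      by (rule has_field_derivative_subset) (use Omega_sub t in \<open>auto simp: mem_cQT\<close>)
  qed
  then have "pd (Omega A) (axis i 1) (\<lambda>x. ?F is (x, t)) x = ?F (i # is) (x, t)"
    by (rule pd_eq[OF _ Cons.prems(2) Omega_thick[OF Cons.prems(2)]])
  moreover have "pd (Omega A) (axis i 1) (pds (Omega A) (map (\<lambda>i. axis i 1) is) p) x = pd (Omega A) (axis i 1) (\<lambda>x. ?F is (x, t)) x"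
    using Cons by (intro pd_cong) auto
  ultimately show ?case by (simp add: pds_Cons)
qed (simp add: pds_Nil p)

lemma L2_Omega_sq: "(L2_Omega A f)^2 = IO A (\<lambda>x. (f x)^2)"
proof -
  have "0 \<le> (LINT x:Omega A|lborel. (f x)^2)" unfolding set_lebesgue_integral_def by (intro integral_nonneg_AE) auto
  then show ?thesis by (simp add: L2_Omega_def IO_def)
qed

lemma IO_cong: "(\<And>x. x \<in> Omega A \<Longrightarrow> f x = g x) \<Longrightarrow> IO A f = IO A g"
  unfolding IO_def by (intro set_lebesgue_integral_cong) auto

lemma H_Omega_ge:
  assumes u: "C_par A T 3 u" "C_par A T 3 u'" and t: "t \<in> {0..T}"
    and p: "\<And>x. x \<in> Omega A \<Longrightarrow> p x = u (x, t) - u' (x, t)" and l: "length is \<le> 4"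
  shows "IO A (\<lambda>x. (dd (map es is) u (x, t) - dd (map es is) u' (x, t))^2) \<le> (H_Omega A 4 p)^2"
proof -
  obtain \<alpha> where \<alpha>: "mset (mi_list \<alpha>) = mset is" "sum \<alpha> UNIV = length is" by (rule mi_list_of_list)
  let ?g = "\<lambda>\<alpha>. (L2_Omega A (pds (Omega A) (map (\<lambda>i. axis i 1) (mi_list \<alpha>)) p))^2"
  have len: "length (mi_list \<alpha>) \<le> 2 * 3" using \<alpha> l by (simp add: length_mi_list)
  have "IO A (\<lambda>x. (dd (map es is) u (x, t) - dd (map es is) u' (x, t))^2) = ?g \<alpha>"
    unfolding L2_Omega_sq
  proof (rule IO_cong)
    fix x assume x: "x \<in> Omega A"
    then have xt: "(x, t) \<in> cQ" using Omega_sub t by (auto simp: mem_cQT)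
    have "map es is \<in> dl (2 * 3)" using l by (auto simp: dir_lists_def par_dirs_def o_def sum_list_triv)
    moreover have "mset (map es is) = mset (map es (mi_list \<alpha>))" using \<alpha> by (simp only: mset_map)
    ultimately have "dd (map es is) v (x, t) = dd (map es (mi_list \<alpha>)) v (x, t)" if "C_par A T 3 v" for v
      by (rule dd_perm[OF that _ _ xt])
    then show "(dd (map es is) u (x, t) - dd (map es is) u' (x, t))^2 = (pds (Omega A) (map (\<lambda>i. axis i 1) (mi_list \<alpha>)) p x)^2"
      using pds_Omega[OF u t p len x] u by simp
  qed
  also have "\<dots> \<le> (\<Sum>\<alpha> \<in> {\<alpha> :: 'n \<Rightarrow> nat. sum \<alpha> UNIV \<le> 4}. ?g \<alpha>)"
    by (rule member_le_sum) (use \<alpha> l finite_multiindices in auto)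
  also have "\<dots> = (H_Omega A 4 p)^2"
    unfolding H_Omega_def by (subst real_sqrt_pow2) (auto intro!: sum_nonneg)
  finally show ?thesis .
qed

lemma H_Omega_nonneg: "0 \<le> H_Omega A k p"
  unfolding H_Omega_def by (auto intro!: sum_nonneg)

lemma L2_QT_sq: "(L2_QT A T f)^2 = IQ A T (\<lambda>x. (f x)^2)"
proof -
  have "0 \<le> (LINT z:QT A T|lborel. (f z)^2)" unfolding set_lebesgue_integral_def by (intro integral_nonneg_AE) auto
  then show ?thesis by (simp add: L2_QT_def IQ_def)
qed

lemma IQ_cong: "(\<And>z. z \<in> cQ \<Longrightarrow> f z = g z) \<Longrightarrow> IQ A T f = IQ A T g"
  unfolding IQ_def using QT_sub by (intro set_lebesgue_integral_cong) (auto intro: borel_open open_QT)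

definition hp_card :: real where
  "hp_card = real (card {(\<alpha> :: 'n \<Rightarrow> nat, m::nat). sum \<alpha> UNIV + 2 * m \<le> 2 * 1})"

lemma H_par_le:
  assumes sp: "\<And>is. length is \<le> 2 \<Longrightarrow> IQ A T (\<lambda>z. (dd (map es is) f z)^2) \<le> B"
    and ti: "IQ A T (\<lambda>z. (dd [e_time] f z)^2) \<le> B"
  shows "H_par A T 1 f \<le> sqrt (hp_card * B)"
proof -
  let ?S = "{(\<alpha> :: 'n \<Rightarrow> nat, m::nat). sum \<alpha> UNIV + 2 * m \<le> 2 * 1}"
  have "(\<Sum>(\<alpha>, m) \<in> ?S. (L2_QT A T (dd (map es (mi_list \<alpha>) @ replicate m e_time) f))^2) \<le> real (card ?S) * B"
  proof (rule sum_bounded_above, clarify)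
    fix \<alpha> :: "'n \<Rightarrow> nat" and m :: nat assume am: "sum \<alpha> UNIV + 2 * m \<le> 2 * 1"
    \<comment> \<open>A time derivative has weight 2 and uses up the whole order; otherwise at most
      two spatial derivatives remain.\<close>
    then consider "m = 0" "sum \<alpha> UNIV \<le> 2" | "m = 1" "sum \<alpha> UNIV = 0" by linarith
    then show "(L2_QT A T (dd (map es (mi_list \<alpha>) @ replicate m e_time) f))^2 \<le> B"
    proof cases
      case 1 then show ?thesis using sp[of "mi_list \<alpha>"] by (simp add: L2_QT_sq length_mi_list)
    next
      case 2 then have "mi_list \<alpha> = []" using length_mi_list[of \<alpha>] by simp
      then show ?thesis using 2 ti by (simp add: L2_QT_sq)
    qed
  qed
  then show ?thesis unfolding H_par_def hp_card_def by (rule real_sqrt_le_mono)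
qed

lemma IB_cong:
  assumes "\<And>x t. x \<in> face A i \<sigma> \<Longrightarrow> t \<in> {0<..<T} \<Longrightarrow> f (x, t) = g (x, t)"
  shows "IB A T i \<sigma> f = IB A T i \<sigma> g"
  unfolding IB_def slice_integral_eq
proof (intro set_lebesgue_integral_cong allI impI Bochner_Integration.integral_cong refl)
  fix t y assume t: "t \<in> {0<..<T}" and y: "y \<in> space (slice_measure A i)"
  have "slice_pt i (\<sigma> * A $ i) y \<in> face A i \<sigma>"
    using y by (auto simp: face_def space_slice_measure PiE_iff)
  then show "f (slice_pt i (\<sigma> * A $ i) y, t) = g (slice_pt i (\<sigma> * A $ i) y, t)" using assms t by blast
qed auto

lemma L2_face_sq: "(L2_face A T i \<sigma> f)^2 = IB A T i \<sigma> (\<lambda>z. (f z)^2)"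
proof -
  have "0 \<le> (LINT t:{0<..<T}|lborel. slice_integral A i (\<sigma> * A $ i) (\<lambda>x. (f (x, t))^2))"
    unfolding set_lebesgue_integral_def slice_integral_eq by (intro integral_nonneg_AE AE_I2) (auto intro!: mult_nonneg_nonneg)
  then show ?thesis by (simp add: L2_face_def IB_def)
qed

lemma face_sub: "\<sigma> \<in> {-1, 1} \<Longrightarrow> x \<in> face A i \<sigma> \<Longrightarrow> x \<in> cOmega A"
  unfolding face_def mem_cOmega using A_pos by (auto simp: less_imp_le) (metis less_imp_le minus_le_iff neg_le_0_iff_le order_trans order_refl)+

lemma face_frontier:
  assumes "\<sigma> \<in> {-1, 1}" "x \<in> face A i \<sigma>" shows "x \<in> frontier (Omega A)"
proof -
  have "x \<in> cOmega A" by (rule face_sub[OF assms])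
  moreover have "x \<notin> Omega A" using assms by (auto simp: face_def Omega_def intro!: exI[of _ i])
  ultimately show ?thesis unfolding frontier_def by (simp add: cOmega_def interior_open)
qed

end

context boxdom
begin

section \<open>Integration in time and full Hessians from Laplacians\<close>

text \<open>Integrating the time derivative of \<open>(1 - t / T) (Ew f)^2\<close> produces
  \<open>(Ew f)^2 / T\<close>, the initial value and a mixed term that Young's inequality absorbs.
  As the weight does not depend on time, the constants do not depend on \<open>l\<close>.\<close>

lemma IQ_time_integral:
  assumes f: "hpdQ e_time f ft" "contQ f" "contQ ft"
  shows "IQ A T (\<lambda>p. (Ew l p)^2 * (f p)^2)
    \<le> 2 * T * IO A (\<lambda>x. (Ew l (x, 0))^2 * (f (x, 0))^2) + 4 * T^2 * IQ A T (\<lambda>p. (Ew l p)^2 * (ft p)^2)"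
proof -
  let ?g = "\<lambda>p. Ew l p * f p" and ?gt = "\<lambda>p. Ew l p * ft p"
  let ?\<theta> = "\<lambda>p :: 'n rvec \<times> real. 1 - snd p / T"
  have c\<theta>: "continuous_on K ?\<theta>" for K using T_pos by (intro continuous_intros) auto
  have hg: "hpdQ e_time ?g ?gt"
    by (rule hpd_mult_cong[OF hpd_Ew_time f(1)]) auto
  have cg: "contQ ?g" "contQ ?gt"
    by (intro continuous_intros cont_Ew f)+
  define F where "F p = ?\<theta> p * (?g p)^2" for p
  define F' where "F' p = - 1 / T * (?g p)^2 + ?\<theta> p * (2 * (?g p * ?gt p))" for p
  have cF: "contQ F" "contQ F'"
    unfolding F_def F'_def by (intro continuous_intros c\<theta> cont_Ew f)+
  have hF: "hpdQ e_time F F'"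
    unfolding F_def F'_def by (rule hpd_mult[OF hpd_theta hpd_square[OF hg]])
  have e: "IQ A T F' = - IO A (\<lambda>x. (?g (x, 0))^2)"
    using IQ_div_time[OF hF cF] T_pos by (simp add: F_def O.L_zero)
  have "IQ A T (\<lambda>p. (?g p)^2) \<le> IQ A T (\<lambda>p. - 2 * T * F' p + 4 * T^2 * (?gt p)^2)"
  proof (intro Q.L_mono continuous_intros cF f cont_Ew)
    fix p assume p: "p \<in> cQ"
    have th: "0 \<le> ?\<theta> p" "?\<theta> p \<le> 1" using theta_bounds[OF p] by auto
    have "\<bar>?\<theta> p * (?g p * ?gt p)\<bar> \<le> 1 * \<bar>?g p * ?gt p\<bar>"
      unfolding abs_mult[of "?\<theta> p"] using th by (intro mult_right_mono) auto
    then have "4 * T * (?\<theta> p * (?g p * ?gt p)) \<le> 4 * T * \<bar>?g p * ?gt p\<bar>"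
      using T_pos by (intro mult_left_mono) auto
    also have "\<dots> \<le> (?g p)^2 + 4 * T^2 * (?gt p)^2"
    proof -
      have "0 \<le> (\<bar>?g p\<bar> - 2 * T * \<bar>?gt p\<bar>)^2" by simp
      then show ?thesis by (simp add: power2_diff power_mult_distrib abs_mult algebra_simps)
    qed
    finally have "4 * T * (?\<theta> p * (?g p * ?gt p)) \<le> (?g p)^2 + 4 * T^2 * (?gt p)^2" .
    moreover have "- 2 * T * F' p = 2 * (?g p)^2 - 4 * T * (?\<theta> p * (?g p * ?gt p))"
      unfolding F'_def using T_pos by (simp add: algebra_simps)
    ultimately show "(?g p)^2 \<le> - 2 * T * F' p + 4 * T^2 * (?gt p)^2" by linarith
  qed
  also have "\<dots> = IQ A T (\<lambda>p. (- 2 * T) * F' p) + IQ A T (\<lambda>p. 4 * T^2 * (?gt p)^2)"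
    by (intro Q.L_add continuous_intros cF f cont_Ew)
  also have "IQ A T (\<lambda>p. (- 2 * T) * F' p) = (- 2 * T) * IQ A T F'" by (rule Q.L_cmult[OF cF(2)])
  also have "IQ A T (\<lambda>p. 4 * T^2 * (?gt p)^2) = 4 * T^2 * IQ A T (\<lambda>p. (?gt p)^2)"
    by (intro Q.L_cmult continuous_intros f cont_Ew)
  finally show ?thesis by (simp add: e power_mult_distrib)
qed

text \<open>The density on the faces with normal direction \<open>i\<close>: all first derivatives
  and all second ones except the pure normal one, which the \<open>H^{2,1}\<close> norm of a face
  does not contain.\<close>

definition e2dens where
  "e2dens w1 w2 i p = grad2 w1 p + (\<Sum>(j, s)\<in>UNIV - {(i, i)}. (w2 j s p)^2)"
  for w1 :: "'n \<Rightarrow> 'n rvec \<times> real \<Rightarrow> real" and w2 :: "'n \<Rightarrow> 'n \<Rightarrow> 'n rvec \<times> real \<Rightarrow> real"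

lemma e2dens_ge:
  assumes "(j, s) \<noteq> (i, i)"
  shows "(w1 m p)^2 + (w2 j s p)^2 \<le> e2dens w1 w2 i p"
proof -
  have "(\<lambda>(j, s). (w2 j s p)^2) (j, s) \<le> (\<Sum>(j, s)\<in>UNIV - {(i, i)}. (w2 j s p)^2)"
    by (rule member_le_sum) (use assms in auto)
  then show ?thesis unfolding e2dens_def using grad2_ge[of w1 m p] by simp
qed

text \<open>The difference of \<open>w2 i j ^ 2\<close> and \<open>w2 i i * w2 j j\<close> is a
  divergence, with the fluxes \<open>F i j\<close> in direction \<open>j\<close> and
  \<open>G i j\<close> in direction \<open>i\<close>. For \<open>i = j\<close> the two terms cancel;
  for \<open>i \<noteq> j\<close> the flux on a face contains a mixed or a tangential second
  derivative, never the pure normal one.\<close>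

lemma second_derivs_L2:
  assumes h2: "\<And>i j. hpdQ (es j) (w1 i) (w2 i j)"
    and h3: "\<And>i j k. hpdQ (es k) (w2 i j) (w3 i j k)"
    and c: "\<And>i. contQ (w1 i)" "\<And>i j. contQ (w2 i j)" "\<And>i j k. contQ (w3 i j k)"
    and sym: "\<And>i j p. p \<in> cQ \<Longrightarrow> w3 j j i p = w3 i j j p"
  shows "IQ A T (\<lambda>p. \<Sum>i\<in>UNIV. \<Sum>j\<in>UNIV. (w2 i j p)^2) \<le> IQ A T (\<lambda>p. (lapl w2 p)^2)
     + 2 * real CARD('n) * (\<Sum>i\<in>UNIV. IB A T i 1 (e2dens w1 w2 i) + IB A T i (-1) (e2dens w1 w2 i))"
proof -
  define F where "F i j p = w1 i p * w2 i j p" for i j p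
  define F' where "F' i j p = w2 i j p * w2 i j p + w1 i p * w3 i j j p" for i j p
  define G where "G i j p = w1 i p * w2 j j p" for i j p
  define G' where "G' i j p = w2 i i p * w2 j j p + w1 i p * w3 j j i p" for i j p
  define b where "b i = IB A T i 1 (e2dens w1 w2 i) + IB A T i (-1) (e2dens w1 w2 i)" for i
  have cc: "contQ (F i j)" "contQ (F' i j)"
    "contQ (G i j)" "contQ (G' i j)" for i j
    unfolding F_def F'_def G_def G'_def by (intro continuous_intros c)+
  have ce: "contQ (e2dens w1 w2 i)" for i
    unfolding e2dens_def case_prod_unfold by (intro continuous_intros cont_grad2 c)
  have hF: "hpdQ (es j) (F i j) (F' i j)" for i j
    unfolding F_def F'_def by (rule hpd_mult[OF h2 h3])
  have hG: "hpdQ (es i) (G i j) (G' i j)" for i j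
    unfolding G_def G'_def by (rule hpd_mult[OF h2 h3])
  have e0: "0 \<le> e2dens w1 w2 i p" for i p
    unfolding e2dens_def by (intro add_nonneg_nonneg grad2_nonneg sum_nonneg) auto
  have b0: "0 \<le> b i" for i
    unfolding b_def by (intro add_nonneg_nonneg posfun.L_nonneg[OF posfun_IB] ce e0) auto
  have pr: "\<bar>x * y\<bar> \<le> x^2 + y^2" for x y :: real
  proof -
    have "2 * \<bar>x * y\<bar> \<le> x^2 + y^2" using sum_squares_bound[of "\<bar>x\<bar>" "\<bar>y\<bar>"] by (simp add: abs_mult mult.assoc)
    then show ?thesis using abs_ge_zero[of "x * y"] by linarith
  qed
  have bF: "\<bar>IB A T j \<sigma> (F i j)\<bar> \<le> IB A T j \<sigma> (e2dens w1 w2 j)" if "i \<noteq> j" "\<sigma> \<in> {-1, 1}" for i j \<sigma>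
    using that by (intro posfun.L_abs_le[OF posfun_IB] cc ce) (auto simp: F_def intro!: order_trans[OF pr e2dens_ge])
  have bG: "\<bar>IB A T i \<sigma> (G i j)\<bar> \<le> IB A T i \<sigma> (e2dens w1 w2 i)" if "i \<noteq> j" "\<sigma> \<in> {-1, 1}" for i j \<sigma>
    using that by (intro posfun.L_abs_le[OF posfun_IB] cc ce) (auto simp: G_def intro!: order_trans[OF pr e2dens_ge])
  have ij: "IQ A T (F' i j) - IQ A T (G' i j) \<le> b i + b j" for i j
  proof (cases "i = j")
    case True
    then show ?thesis using b0[of i] b0[of j] by (simp add: F'_def[abs_def] G'_def[abs_def])
  next
    case False
    have "IQ A T (F' i j) = IB A T j 1 (F i j) - IB A T j (-1) (F i j)" by (rule IQ_div_space[OF hF cc(1,2)])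
    moreover have "IQ A T (G' i j) = IB A T i 1 (G i j) - IB A T i (-1) (G i j)" by (rule IQ_div_space[OF hG cc(3,4)])
    ultimately show ?thesis
      using bF[OF False, of 1] bF[OF False, of "-1"] bG[OF False, of 1] bG[OF False, of "-1"] by (simp add: b_def abs_le_iff)
  qed
  have "IQ A T (\<lambda>p. \<Sum>i\<in>UNIV. \<Sum>j\<in>UNIV. (w2 i j p)^2) = IQ A T (\<lambda>p. (lapl w2 p)^2 + (\<Sum>i\<in>UNIV. \<Sum>j\<in>UNIV. F' i j p - G' i j p))"
  proof (intro Q.L_cong continuous_intros c)
    fix p assume p: "p \<in> cQ"
    have "(\<Sum>i\<in>UNIV. \<Sum>j\<in>UNIV. F' i j p - G' i j p) = (\<Sum>i\<in>UNIV. \<Sum>j\<in>UNIV. (w2 i j p)^2 - w2 i i p * w2 j j p)"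
      unfolding F'_def G'_def using sym[OF p] by (intro sum.cong refl) (simp add: power2_eq_square)
    also have "\<dots> = (\<Sum>i\<in>UNIV. \<Sum>j\<in>UNIV. (w2 i j p)^2) - (lapl w2 p)^2"
      by (simp add: sum_subtractf lapl_def power2_eq_square sum_product)
    finally show "(\<Sum>i\<in>UNIV. \<Sum>j\<in>UNIV. (w2 i j p)^2) = (lapl w2 p)^2 + (\<Sum>i\<in>UNIV. \<Sum>j\<in>UNIV. F' i j p - G' i j p)" by simp
  qed
  also have "\<dots> = IQ A T (\<lambda>p. (lapl w2 p)^2) + IQ A T (\<lambda>p. \<Sum>i\<in>UNIV. \<Sum>j\<in>UNIV. F' i j p - G' i j p)"
    by (intro Q.L_add continuous_intros cont_lapl c cc)
  also have "IQ A T (\<lambda>p. \<Sum>i\<in>UNIV. \<Sum>j\<in>UNIV. F' i j p - G' i j p) = (\<Sum>i\<in>UNIV. IQ A T (\<lambda>p. \<Sum>j\<in>UNIV. F' i j p - G' i j p))"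
    by (intro Q.L_sum continuous_intros cc) auto
  also have "\<dots> = (\<Sum>i\<in>UNIV. \<Sum>j\<in>UNIV. IQ A T (\<lambda>p. F' i j p - G' i j p))"
    by (intro sum.cong refl Q.L_sum continuous_intros cc) auto
  also have "\<dots> = (\<Sum>i\<in>UNIV. \<Sum>j\<in>UNIV. IQ A T (F' i j) - IQ A T (G' i j))"
    by (intro sum.cong refl Q.L_diff cc)
  also have "\<dots> \<le> (\<Sum>i\<in>UNIV. \<Sum>j\<in>UNIV. b i + b j)" by (intro sum_mono ij)
  also have "\<dots> = 2 * real CARD('n) * (\<Sum>i\<in>UNIV. b i)" by (simp add: sum.distrib sum_distrib_left mult.assoc)
  finally show ?thesis unfolding b_def by simp
qed

section \<open>Kernels and coefficients as functions on the common domain\<close>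

lemma dir_lists_one: "vs \<in> dir_lists V (\<lambda>_. 1) k \<longleftrightarrow> set vs \<subseteq> V \<and> length vs \<le> k"
  by (simp add: dir_lists_def sum_list_triv)

lemma kern2_Omega2:
  assumes k: "C_Omega2 A 4 k" and M: "C_Omega2_norm A 4 k < M"
  defines "D \<equiv> \<lambda>vs. pds cOO vs k"
  defines "X \<equiv> \<lambda>i. (axis i 1 :: 'n rvec, 0 :: 'n rvec)" and "Y \<equiv> (0 :: 'n rvec, axis ix1 1 :: 'n rvec)"
  shows "kern2 k (\<lambda>i. D [X i]) (D [Y]) (\<lambda>i j. D [X j, X i]) (\<lambda>i. D [Y, X i]) (\<lambda>i. D [X i, Y]) (D [Y, Y])"
    and "kern2_le M k (\<lambda>i. D [X i]) (D [Y]) (\<lambda>i j. D [X j, X i]) (\<lambda>i. D [Y, X i]) (\<lambda>i. D [X i, Y]) (D [Y, Y])"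
proof -
  have B: "X i \<in> Basis" "Y \<in> Basis" for i by (auto simp: X_def Y_def Basis_prod_def axis_in_Basis_iff)
  have C: "Ck_on cOO Basis (\<lambda>_. 1) 4 k" using k by (simp add: C_Omega2_def)
  have l: "vs \<in> dir_lists Basis (\<lambda>_. 1) 4" if "set vs \<subseteq> range X \<union> {Y}" "length vs \<le> 2" for vs
    using that B unfolding dir_lists_one by auto
  have c: "continuous_on cOO (D vs)" if "set vs \<subseteq> range X \<union> {Y}" "length vs \<le> 2" for vs
    unfolding D_def by (rule Ck_on_cont[OF C l[OF that]])
  have h: "hpd cOO v (D vs) (D (v # vs))" if "set (v # vs) \<subseteq> range X \<union> {Y}" "length (v # vs) \<le> 2" for v vs
    unfolding D_def by (rule Ck_on_hpd[OF C l[OF that]])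
  have b: "\<bar>D vs p\<bar> \<le> M" if "set vs \<subseteq> range X \<union> {Y}" "length vs \<le> 2" "p \<in> cOO" for vs p
    using Ck_norm_ge[OF C _ finite_Basis _ l[OF that(1,2)] that(3)] M compact_Times[OF compact_cOmega compact_cOmega]
    unfolding D_def C_Omega2_norm_def by force
  have k0: "k = D []" by (simp add: D_def pds_Nil)
  have Xs: "(axis i 1, 0) = X i" for i by (simp add: X_def)
  show "kern2 k (\<lambda>i. D [X i]) (D [Y]) (\<lambda>i j. D [X j, X i]) (\<lambda>i. D [Y, X i]) (\<lambda>i. D [X i, Y]) (D [Y, Y])"
    unfolding kern2_def kern1_def Xs Y_def[symmetric] k0
    by (auto intro!: c h)
  show "kern2_le M k (\<lambda>i. D [X i]) (D [Y]) (\<lambda>i j. D [X j, X i]) (\<lambda>i. D [Y, X i]) (\<lambda>i. D [X i, Y]) (D [Y, Y])"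
    unfolding kern2_le_def k0 by (auto intro!: b)
qed

abbreviation "cPP \<equiv> cOmega' A \<times> cOmega' A"

lemma bar_cOmega': "x \<in> cOmega A \<Longrightarrow> bar x \<in> cOmega' A"
  by (auto simp: mem_cOmega bar_def cOmega'_def)

lemma bar_shift: "i \<noteq> ix1 \<Longrightarrow> bar (x + h *\<^sub>R axis i 1) = bar x + h *\<^sub>R axis i 1"
  "bar (x + h *\<^sub>R axis ix1 1) = bar x"
  by (auto simp: bar_def vec_eq_iff axis_def)

lemma continuous_on_bar: "continuous_on S bar" for S :: "'n rvec set"
proof -
  have "bar = (\<lambda>x :: 'n rvec. x - (x $ ix1) *\<^sub>R axis ix1 1)" by (auto simp: bar_def vec_eq_iff axis_def fun_eq_iff)
  then show ?thesis by (rule ssubst[where P="continuous_on S"]) (intro continuous_intros)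
qed

lemma compact_cOmega': "compact (cOmega' A)"
proof -
  have "cOmega' A = bar ` cOmega A"
  proof (rule set_eqI, rule iffI)
    fix x assume "x \<in> cOmega' A"
    then have x: "x $ ix1 = 0" "i \<noteq> ix1 \<Longrightarrow> - A $ i \<le> x $ i \<and> x $ i \<le> A $ i" for i by (auto simp: cOmega'_def)
    have "- A $ i \<le> x $ i \<and> x $ i \<le> A $ i" for i
      using x A_pos[of ix1] by (cases "i = ix1") auto
    then have "x \<in> cOmega A" "bar x = x" using x(1) by (auto simp: mem_cOmega bar_def vec_eq_iff)
    then show "x \<in> bar ` cOmega A" by (metis image_eqI)
  qed (auto simp: bar_cOmega')
  then show ?thesis using compact_continuous_image[OF continuous_on_bar compact_cOmega] by simp
qed

text \<open>Lifts a kernel of barred vectors to full vectors, constant in \<open>x_1\<close> and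
  \<open>y_1\<close>, so that both kernels are covered by the same estimates.\<close>

definition kbar where "kbar K p = K (bar (fst p), bar (snd p))" for K :: "'n rvec \<times> 'n rvec \<Rightarrow> real"

lemma hpd_kbar:
  assumes "i \<noteq> ix1" "hpd cPP (axis i 1, 0) K K'"
  shows "hpd cOO (axis i 1, 0) (kbar K) (kbar K')"
  unfolding hpd_def
proof safe
  fix x y assume xy: "x \<in> cOmega A" "y \<in> cOmega A"
  have "((\<lambda>h. K ((bar x, bar y) + h *\<^sub>R (axis i 1, 0))) has_real_derivative K' (bar x, bar y))
     (at 0 within {h. (bar x, bar y) + h *\<^sub>R (axis i 1, 0) \<in> cPP})"
    using assms(2) xy bar_cOmega' unfolding hpd_def by blast
  moreover have "{h. (x, y) + h *\<^sub>R (axis i 1, 0) \<in> cOO} \<subseteq> {h. (bar x, bar y) + h *\<^sub>R (axis i 1, 0) \<in> cPP}"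
  proof (rule subsetI, unfold mem_Collect_eq)
    fix h assume "(x, y) + h *\<^sub>R (axis i 1, 0) \<in> cOO"
    then have "x + h *\<^sub>R axis i 1 \<in> cOmega A" by simp
    from bar_cOmega'[OF this] show "(bar x, bar y) + h *\<^sub>R (axis i 1, 0) \<in> cPP"
      using bar_cOmega'[OF xy(2)] by (simp add: bar_shift assms(1))
  qed
  ultimately have "((\<lambda>h. K ((bar x, bar y) + h *\<^sub>R (axis i 1, 0))) has_real_derivative K' (bar x, bar y))
     (at 0 within {h. (x, y) + h *\<^sub>R (axis i 1, 0) \<in> cOO})"
    by (rule has_field_derivative_subset)
  then show "((\<lambda>h. kbar K ((x, y) + h *\<^sub>R (axis i 1, 0))) has_real_derivative kbar K' (x, y))
     (at 0 within {h. (x, y) + h *\<^sub>R (axis i 1, 0) \<in> cOO})"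
    by (simp add: kbar_def bar_shift assms(1))
qed

lemma hpd_kbar_0:
  "hpd cOO (axis ix1 1, 0) (kbar K) (\<lambda>p. 0)" "hpd cOO (0, axis ix1 1) (kbar K) (\<lambda>p. 0)"
  unfolding hpd_def by (auto simp: kbar_def bar_shift)

lemma cont_kbar: "continuous_on cPP K \<Longrightarrow> continuous_on cOO (kbar K)"
  unfolding kbar_def
  by (rule continuous_on_compose2[of cPP K])
     (auto intro!: continuous_intros continuous_on_compose2[OF continuous_on_bar[of UNIV]] simp: bar_cOmega')

text \<open>The direction \<open>ix1\<close> is not among those in which \<open>K\<close> is
  differentiated, but the lifted kernel is constant along it; hence the case distinctions with zero
  derivatives.\<close>

lemma kern2_Omega'2:
  assumes k: "C_Omega'2 A 4 K" and M: "C_Omega'2_norm A 4 K < M"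
  defines "D \<equiv> \<lambda>vs. kbar (pds cPP vs K)"
  defines "X \<equiv> \<lambda>i. (axis i 1 :: 'n rvec, 0 :: 'n rvec)"
  shows "kern2 (kbar K) (\<lambda>i. if i = ix1 then (\<lambda>_. 0) else D [X i]) (\<lambda>_. 0)
      (\<lambda>i j. if i = ix1 \<or> j = ix1 then (\<lambda>_. 0) else D [X j, X i]) (\<lambda>_ _. 0) (\<lambda>_ _. 0) (\<lambda>_. 0)"
    and "kern2_le M (kbar K) (\<lambda>i. if i = ix1 then (\<lambda>_. 0) else D [X i]) (\<lambda>_. 0)
      (\<lambda>i j. if i = ix1 \<or> j = ix1 then (\<lambda>_. 0) else D [X j, X i]) (\<lambda>_ _. 0) (\<lambda>_ _. 0) (\<lambda>_. 0)"
proof -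
  have B: "X i \<in> bar_dirs2" if "i \<noteq> ix1" for i using that by (auto simp: X_def bar_dirs2_def)
  have fb: "finite (bar_dirs2 :: ('n rvec \<times> 'n rvec) set)" by (simp add: bar_dirs2_def)
  have C: "Ck_on cPP bar_dirs2 (\<lambda>_. 1) 4 K" using k by (simp add: C_Omega'2_def)
  have l: "vs \<in> dir_lists bar_dirs2 (\<lambda>_. 1) 4" if "set vs \<subseteq> X ` (UNIV - {ix1})" "length vs \<le> 2" for vs
  proof -
    have "set vs \<subseteq> bar_dirs2" using that(1) B by blast
    then show ?thesis using that(2) unfolding dir_lists_one by simp
  qed
  have c: "continuous_on cOO (D vs)" if "set vs \<subseteq> X ` (UNIV - {ix1})" "length vs \<le> 2" for vs
    unfolding D_def by (rule cont_kbar[OF Ck_on_cont[OF C l[OF that]]])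
  have h: "hpd cOO (X i) (D vs) (D (X i # vs))" if "i \<noteq> ix1" "set vs \<subseteq> X ` (UNIV - {ix1})" "length vs \<le> 1" for i vs
  proof -
    have "hpd cPP (X i) (pds cPP vs K) (pds cPP (X i # vs) K)"
      by (rule Ck_on_hpd[OF C l]) (use that in auto)
    from hpd_kbar[OF that(1) this[unfolded X_def]] show ?thesis by (simp add: D_def X_def)
  qed
  have b: "\<bar>D vs p\<bar> \<le> M" if "set vs \<subseteq> X ` (UNIV - {ix1})" "length vs \<le> 2" "p \<in> cOO" for vs p
  proof -
    have "(bar (fst p), bar (snd p)) \<in> cPP" using that(3) by (auto intro: bar_cOmega')
    from Ck_norm_ge[OF C compact_Times[OF compact_cOmega' compact_cOmega'] fb _ l[OF that(1,2)] this] M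
    show ?thesis unfolding D_def kbar_def C_Omega'2_norm_def by force
  qed
  have k0: "kbar K = D []" by (simp add: D_def pds_Nil)
  have M0: "0 \<le> M" using b[of "[]" "(0, 0)"] zero_cOmega by (auto intro: order_trans[OF abs_ge_zero])
  have h0: "hpd cOO (axis ix1 1, 0) (D vs) (\<lambda>_. 0)" "hpd cOO (0, axis ix1 1) (D vs) (\<lambda>_. 0)" for vs
    unfolding D_def by (rule hpd_kbar_0)+
  show "kern2 (kbar K) (\<lambda>i. if i = ix1 then (\<lambda>_. 0) else D [X i]) (\<lambda>_. 0)
      (\<lambda>i j. if i = ix1 \<or> j = ix1 then (\<lambda>_. 0) else D [X j, X i]) (\<lambda>_ _. 0) (\<lambda>_ _. 0) (\<lambda>_. 0)"
  proof -
    have "hpd cOO (axis i 1, 0) (D vs) (if i = ix1 then (\<lambda>_. 0) else D (X i # vs))"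
      if "set vs \<subseteq> X ` (UNIV - {ix1})" "length vs \<le> 1" for i vs
      using h[OF _ that, of i] h0 by (auto simp: X_def)
    note h'' = this
    have hN: "hpd cOO (axis i 1, 0) (D []) (D [X i])" if "i \<noteq> ix1" for i
      using h''[of "[]" i] that by simp
    show ?thesis
      unfolding kern2_def kern1_def k0
    proof (intro conjI allI)
      fix i j
      show "hpd cOO (axis j 1, 0) (if i = ix1 then (\<lambda>_. 0) else D [X i]) (if i = ix1 \<or> j = ix1 then (\<lambda>_. 0) else D [X j, X i])"
        using h''[of "[X i]" j] by (auto simp: hpd_const)
    qed (auto intro!: c h0 hN hpd_const)
  qed
  show "kern2_le M (kbar K) (\<lambda>i. if i = ix1 then (\<lambda>_. 0) else D [X i]) (\<lambda>_. 0)
      (\<lambda>i j. if i = ix1 \<or> j = ix1 then (\<lambda>_. 0) else D [X j, X i]) (\<lambda>_ _. 0) (\<lambda>_ _. 0) (\<lambda>_. 0)"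
    unfolding kern2_le_def k0 using M0 by (auto intro!: b)
qed

text \<open>Coefficients of \<open>x\<close> alone become functions on the cylinder with vanishing
  time derivative, which is what lets them be handled together with \<open>s\<close>.\<close>

lemma coeff_lift:
  assumes a: "C_Omega A k a" and M: "C_Omega_norm A k a < M" and l: "length is \<le> k"
  defines "D \<equiv> \<lambda>is z. pds (cOmega A) (map (\<lambda>i. axis i 1) is) a (fst z)"
  shows "contQ (D is)" "p \<in> cQ \<Longrightarrow> \<bar>D is p\<bar> \<le> M"
    "is = i # js \<Longrightarrow> hpdQ (es i) (D js) (D is)" "hpdQ e_time (D is) (\<lambda>_. 0)"
proof -
  have C: "Ck_on (cOmega A) Basis (\<lambda>_. 1) k a" using a by (simp add: C_Omega_def)
  have dl: "map (\<lambda>i. axis i (1::real)) is \<in> dir_lists Basis (\<lambda>_. 1) k"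
    using l unfolding dir_lists_one by (auto simp: axis_in_Basis_iff Basis_real_def)
  show "contQ (D is)"
    unfolding D_def by (rule continuous_on_compose2[OF Ck_on_cont[OF C dl]]) (auto simp: mem_cQT intro!: continuous_intros)
  show "\<bar>D is p\<bar> \<le> M" if "p \<in> cQ"
    using Ck_norm_ge[OF C compact_cOmega finite_Basis _ dl, of "fst p"] M that
    unfolding D_def C_Omega_norm_def by (cases p) (force simp: mem_cQT)
  show "hpdQ e_time (D is) (\<lambda>_. 0)"
    unfolding hpd_def D_def by (auto simp: e_time_def)
  show "hpdQ (es i) (D js) (D is)" if "is = i # js"
    unfolding hpd_def
  proof safe
    fix x t assume p: "(x, t) \<in> cQ"
    then have x: "x \<in> cOmega A" by (simp add: mem_cQT)
    have "hpd (cOmega A) (axis i 1) (pds (cOmega A) (map (\<lambda>i. axis i 1) js) a) (pds (cOmega A) (map (\<lambda>i. axis i 1) is) a)"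
      using Ck_on_hpd[OF C, of "axis i 1" "map (\<lambda>i. axis i 1) js"] dl that by simp
    then have "((\<lambda>h. pds (cOmega A) (map (\<lambda>i. axis i 1) js) a (x + h *\<^sub>R axis i 1)) has_real_derivative D is (x, t))
       (at 0 within {h. x + h *\<^sub>R axis i 1 \<in> cOmega A})"
      using x unfolding hpd_def D_def by simp
    then show "((\<lambda>h. D js ((x, t) + h *\<^sub>R es i)) has_real_derivative D is (x, t)) (at 0 within {h. (x, t) + h *\<^sub>R es i \<in> cQ})"
      unfolding line_set(1)[OF p] by (simp add: D_def e_space_shift)
  qed
qed

text \<open>The Neumann data are known on the lateral boundary only, but a motion in time stays
  there. On a face without its edges their time derivative is therefore \<open>\<sigma>\<close>
  times the mixed derivative of \<open>u\<close>.\<close>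

lemma pd_ST_time:
  assumes u: "C_par A T 3 u" and \<sigma>: "\<sigma> \<in> {-1, 1}"
    and f: "\<And>z. z \<in> face A i \<sigma> \<times> {0<..<T} \<Longrightarrow> \<sigma> * Dx A T i u z = f1 z"
    and x: "x \<in> face A i \<sigma>" and t: "t \<in> {0<..<T}"
  shows "pd (ST A T) e_time f1 (x, t) = \<sigma> * dd [e_time, es i] u (x, t)"
  unfolding pd_def
proof (rule vector_derivative_within)
  have S: "{h. (x, t) + h *\<^sub>R e_time \<in> ST A T} = {- t<..<T - t}"
    using face_frontier[OF \<sigma> x] by (auto simp: ST_def e_time_shift)
  show "at 0 within {h. (x, t) + h *\<^sub>R e_time \<in> ST A T} \<noteq> bot"
    unfolding S using t by (subst at_within_open) auto
  have xt: "(x, t) \<in> cQ" using face_sub[OF \<sigma> x] t by (auto simp: mem_cQT)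
  have "hpdQ e_time (dd [es i] u) (dd [e_time, es i] u)"
    by (rule C_par_hpd[OF u]) (auto simp: dir_lists_def)
  then have "((\<lambda>h. dd [es i] u (x, t + h)) has_real_derivative dd [e_time, es i] u (x, t)) (at 0 within {h. (x, t) + h *\<^sub>R e_time \<in> cQ})"
    using xt unfolding hpd_def by (force simp: e_time_shift)
  then have "((\<lambda>h. dd [es i] u (x, t + h)) has_real_derivative dd [e_time, es i] u (x, t)) (at 0 within {- t<..<T - t})"
    by (rule has_field_derivative_subset) (use face_sub[OF \<sigma> x] in \<open>auto simp: e_time_shift mem_cQT\<close>)
  from DERIV_cmult[OF this, of \<sigma>]
  have "((\<lambda>h. f1 ((x, t) + h *\<^sub>R e_time)) has_real_derivative \<sigma> * dd [e_time, es i] u (x, t)) (at 0 within {- t<..<T - t})"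
    unfolding has_field_derivative_def
    by (rule has_derivative_transform[rotated 2])
       (use t x f in \<open>auto simp: e_time_shift Dx_def pds_Cons pds_Nil\<close>)
  then show "((\<lambda>h. f1 ((x, t) + h *\<^sub>R e_time)) has_vector_derivative \<sigma> * dd [e_time, es i] u (x, t))
      (at 0 within {h. (x, t) + h *\<^sub>R e_time \<in> ST A T})"
    unfolding S by (simp add: has_real_derivative_iff_has_vector_derivative)
qed

end

section \<open>The differences of two solutions\<close>

context boxdom
begin

section \<open>Quotients, and the system differentiated in time and space\<close>

text \<open>The Leibniz rule for \<open>w = J * z\<close>, solved for the derivatives of
  \<open>z\<close>. Gradient and time derivative are explicit because estimates refer to them; the
  second derivatives enter later only through the relation for the Laplacian.\<close>

lemma smooth21_divide:
  assumes w: "smooth21 w w1 w2 wt w1t" and J: "smooth21 J J1 J2 Jt J1t" and nz: "\<And>p. p \<in> cQ \<Longrightarrow> J p \<noteq> 0"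
  defines "z \<equiv> \<lambda>p. w p / J p"
  defines "z1 \<equiv> \<lambda>i p. (w1 i p - z p * J1 i p) / J p" and "zt \<equiv> \<lambda>p. (wt p - z p * Jt p) / J p"
  shows "\<exists>z2 z1t. smooth21 z z1 z2 zt z1t \<and>
    (\<forall>p\<in>cQ. w p = J p * z p \<and> wt p = J p * zt p + Jt p * z p \<and> (\<forall>i. w1 i p = J p * z1 i p + J1 i p * z p) \<and>
      lapl w2 p = J p * lapl z2 p + 2 * (\<Sum>i\<in>UNIV. J1 i p * z1 i p) + lapl J2 p * z p)"
proof -
  note W = smooth21D[OF w] and D = smooth21D[OF J]
  note cW = smooth21D(6-10)[OF w] and cJ = smooth21D(6-10)[OF J]
  define z2 where "z2 i j p = ((w2 i j p - (z1 j p * J1 i p + z p * J2 i j p)) - z1 i p * J1 j p) / J p" for i j p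
  define z1t where "z1t i p = ((w1t i p - (zt p * J1 i p + z p * J1t i p)) - z1 i p * Jt p) / J p" for i p
  define zt1 where "zt1 i p = ((w1t i p - (z1 i p * Jt p + z p * J1t i p)) - zt p * J1 i p) / J p" for i p
  have W3: "hpdQ (es j) (w1 i) (w2 i j)" and D3: "hpdQ (es j) (J1 i) (J2 i j)"
    and W4: "hpdQ e_time (w1 i) (w1t i)" and D4: "hpdQ e_time (J1 i) (J1t i)"
    and W5: "hpdQ (es i) wt (w1t i)" and D5: "hpdQ (es i) Jt (J1t i)"
    and D1: "hpdQ (es i) J (J1 i)" for i j
    by (rule W D)+
  have cz: "contQ z" unfolding z_def by (intro continuous_intros cW cJ ballI nz)
  have cz1: "contQ (z1 i)" for i unfolding z1_def by (intro continuous_intros cW cJ cz ballI nz)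
  have czt: "contQ zt" unfolding zt_def by (intro continuous_intros cW cJ cz ballI nz)
  have h1: "hpdQ (es i) z (z1 i)" for i
    unfolding z_def z1_def by (rule hpd_divide[OF W(1) D(1) nz])
  have ht: "hpdQ e_time z zt"
    unfolding z_def zt_def by (rule hpd_divide[OF W(2) D(2) nz])
  have sm: "smooth21 z z1 z2 zt z1t"
  proof (rule smooth21I[where ?zt1.0=zt1])
    show "hpdQ (es j) (z1 i) (z2 i j)" for i j
      by (rule hpd_cong[OF hpd_divide[OF hpd_diff[OF W3[of j i] hpd_mult[OF h1[of j] D3[of j i]]] D1[of j] nz]])
         (auto simp: z1_def z2_def)
    show "hpdQ e_time (z1 i) (z1t i)" for i
      by (rule hpd_cong[OF hpd_divide[OF hpd_diff[OF W4[of i] hpd_mult[OF ht D4[of i]]] D(2) nz]])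
         (auto simp: z1_def z1t_def)
    show "hpdQ (es i) zt (zt1 i)" for i
      by (rule hpd_cong[OF hpd_divide[OF hpd_diff[OF W5[of i] hpd_mult[OF h1[of i] D5[of i]]] D1[of i] nz]])
         (auto simp: zt_def zt1_def)
    show "contQ (z2 i j)" for i j
      unfolding z2_def by (intro continuous_intros cW cJ cz cz1 ballI nz)
    show "contQ (z1t i)" for i
      unfolding z1t_def by (intro continuous_intros cW cJ cz cz1 czt ballI nz)
    show "contQ (zt1 i)" for i
      unfolding zt1_def by (intro continuous_intros cW cJ cz cz1 czt ballI nz)
  qed (intro h1 ht cz cz1 czt)+
  have "w p = J p * z p \<and> wt p = J p * zt p + Jt p * z p \<and> (\<forall>i. w1 i p = J p * z1 i p + J1 i p * z p) \<and>
      lapl w2 p = J p * lapl z2 p + 2 * (\<Sum>i\<in>UNIV. J1 i p * z1 i p) + lapl J2 p * z p" if p: "p \<in> cQ" for p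
  proof -
    have j: "J p \<noteq> 0" by (rule nz[OF p])
    have "w2 i i p = J p * z2 i i p + 2 * (J1 i p * z1 i p) + J2 i i p * z p" for i
    proof -
      have "J p * z2 i i p = (w2 i i p - (z1 i p * J1 i p + z p * J2 i i p)) - z1 i p * J1 i p"
        using j by (simp add: z2_def)
      then show ?thesis by (simp add: algebra_simps)
    qed
    then have "lapl w2 p = J p * lapl z2 p + 2 * (\<Sum>i\<in>UNIV. J1 i p * z1 i p) + lapl J2 p * z p"
      by (simp add: lapl_def sum.distrib sum_distrib_left sum_distrib_right)
    then show ?thesis using j by (simp add: z_def z1_def zt_def)
  qed
  with sm show ?thesis by blast
qed

lemma hpd_zero:
  assumes "hpdQ v f f'" "\<And>p. p \<in> cQ \<Longrightarrow> f p = 0" "p \<in> cQ" "v \<in> par_dirs"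
  shows "f' p = 0"
  using hpd_unique_cQT[OF assms(1) hpd_const, of 0] assms by simp

text \<open>Differentiating in time puts \<open>e_time\<close> at the head of the list. For spatial
  derivatives of the time derivative it is wanted at the end, where it is applied before all others;
  the derivatives commute.\<close>

lemma C_par_hpd_time:
  assumes u: "C_par A T 3 u" and l: "vs @ [e_time] \<in> dl 6"
  shows "hpdQ e_time (dd vs u) (dd (vs @ [e_time]) u)"
proof (rule hpd_cong)
  have l': "e_time # vs \<in> dl 6" using dl_mset[of "vs @ [e_time]" "e_time # vs"] l by simp
  then show "hpdQ e_time (dd vs u) (dd (e_time # vs) u)" using C_par_hpd[OF u] by simp
  show "dd (e_time # vs) u p = dd (vs @ [e_time]) u p" if "p \<in> cQ" for p
    by (rule dd_perm[OF u _ _ that]) (use l' in auto)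
qed simp

text \<open>The system on the closed cylinder with the divergence expanded by the product rule and
  \<open>a1\<close> for the gradient of \<open>a0\<close>: a form that can be differentiated term by
  term up to the boundary.\<close>

definition sol where
  "sol \<kappa>1 \<kappa>2 a0 a1 s0 b u m \<longleftrightarrow> (\<forall>p\<in>cQ.
     dd [e_time] u p + (\<Sum>i\<in>UNIV. dd [es i, es i] u p) - a0 p / 2 * (\<Sum>i\<in>UNIV. (dd [es i] u p)^2)
       + b p * Inter \<kappa>1 \<kappa>2 m p + s0 p * m p = 0 \<and>
     dd [e_time] m p - (\<Sum>i\<in>UNIV. dd [es i, es i] m p)
       - ((\<Sum>i\<in>UNIV. a1 i p * (m p * dd [es i] u p) + a0 p * (dd [es i] m p * dd [es i] u p))
          + a0 p * (m p * (\<Sum>i\<in>UNIV. dd [es i, es i] u p))) = 0)"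
  for a1 :: "'n \<Rightarrow> 'n rvec \<times> real \<Rightarrow> real"

text \<open>The residuals vanish on the whole closed cylinder, so their time derivatives, computed
  by the calculus rules, vanish as well because a directional derivative there is unique.\<close>

lemma sol_time:
  assumes S: "sol \<kappa>1 \<kappa>2 a0 a1 s0 b u m" and u: "C_par A T 3 u" and m: "C_par A T 3 m"
    and \<kappa>: "continuous_on cOO \<kappa>1" "continuous_on cOO \<kappa>2"
    and a: "hpdQ e_time a0 (\<lambda>_. 0)" "\<And>i. hpdQ e_time (a1 i) (\<lambda>_. 0)"
    and b: "hpdQ e_time b (\<lambda>_. 0)" and s: "hpdQ e_time s0 st" and p: "p \<in> cQ"
  shows "dd [e_time, e_time] u p + (\<Sum>i\<in>UNIV. dd [es i, es i, e_time] u p)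
       - a0 p * (\<Sum>i\<in>UNIV. dd [es i] u p * dd [es i, e_time] u p)
       + b p * Inter \<kappa>1 \<kappa>2 (dd [e_time] m) p + (st p * m p + s0 p * dd [e_time] m p) = 0" (is ?U)
    and "dd [e_time, e_time] m p - (\<Sum>i\<in>UNIV. dd [es i, es i, e_time] m p)
       - ((\<Sum>i\<in>UNIV. a1 i p * (dd [e_time] m p * dd [es i] u p + m p * dd [es i, e_time] u p)
             + a0 p * (dd [es i, e_time] m p * dd [es i] u p + dd [es i] m p * dd [es i, e_time] u p))
          + a0 p * (dd [e_time] m p * (\<Sum>i\<in>UNIV. dd [es i, es i] u p) + m p * (\<Sum>i\<in>UNIV. dd [es i, es i, e_time] u p))) = 0" (is ?M)
proof -
  have dt: "hpdQ e_time (dd vs v) (dd (vs @ [e_time]) v)" if "C_par A T 3 v" "set vs \<subseteq> insert e_time (range es)" "sum_list (map par_weight vs) \<le> 4" for v vs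
    by (rule C_par_hpd_time[OF that(1)]) (use that in \<open>auto simp: dir_lists_def par_dirs_def\<close>)
  have t: "hpdQ e_time (dd [e_time] v) (dd [e_time, e_time] v)"
    "hpdQ e_time (dd [es i] v) (dd [es i, e_time] v)"
    "hpdQ e_time (dd [es i, es i] v) (dd [es i, es i, e_time] v)"
    "hpdQ e_time v (dd [e_time] v)" if "C_par A T 3 v" for v i
    using dt[OF that, of "[e_time]"] dt[OF that, of "[es i]"] dt[OF that, of "[es i, es i]"] dt[OF that, of "[]"]
    by (auto simp: pds_Nil)
  have c: "contQ v" "contQ (dd [e_time] v)" if "C_par A T 3 v" for v
    using C_par_cont[OF that, of "[]"] C_par_cont[OF that, of "[e_time]"] by (auto simp: dir_lists_def pds_Nil)
  have "hpdQ e_time (\<lambda>p. dd [e_time] u p + (\<Sum>i\<in>UNIV. dd [es i, es i] u p) - a0 p * ((1/2) * (\<Sum>i\<in>UNIV. (dd [es i] u p)^2))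
       + b p * Inter \<kappa>1 \<kappa>2 m p + s0 p * m p)
    (\<lambda>p. dd [e_time, e_time] u p + (\<Sum>i\<in>UNIV. dd [es i, es i, e_time] u p)
       - (0 * ((1/2) * (\<Sum>i\<in>UNIV. (dd [es i] u p)^2)) + a0 p * ((1/2) * (\<Sum>i\<in>UNIV. 2 * (dd [es i] u p * dd [es i, e_time] u p))))
       + (0 * Inter \<kappa>1 \<kappa>2 m p + b p * Inter \<kappa>1 \<kappa>2 (dd [e_time] m) p) + (st p * m p + s0 p * dd [e_time] m p))"
    by (rule hpd_add[OF hpd_add[OF hpd_diff[OF hpd_add[OF t(1)[OF u] hpd_sum[OF t(3)[OF u]]]
          hpd_mult[OF a(1) hpd_cmult[OF hpd_sum[OF hpd_square[OF t(2)[OF u]]]]]]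
          hpd_mult[OF b hpd_Inter_time[OF \<kappa> c(1)[OF m] c(2)[OF m] t(4)[OF m]]]] hpd_mult[OF s t(4)[OF m]]])
  from hpd_zero[OF this _ p] S show ?U unfolding sol_def by (simp add: sum_distrib_left)
  have "hpdQ e_time (\<lambda>p. dd [e_time] m p - (\<Sum>i\<in>UNIV. dd [es i, es i] m p)
       - ((\<Sum>i\<in>UNIV. a1 i p * (m p * dd [es i] u p) + a0 p * (dd [es i] m p * dd [es i] u p))
          + a0 p * (m p * (\<Sum>i\<in>UNIV. dd [es i, es i] u p))))
    (\<lambda>p. dd [e_time, e_time] m p - (\<Sum>i\<in>UNIV. dd [es i, es i, e_time] m p)
       - ((\<Sum>i\<in>UNIV. (0 * (m p * dd [es i] u p) + a1 i p * (dd [e_time] m p * dd [es i] u p + m p * dd [es i, e_time] u p))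
            + (0 * (dd [es i] m p * dd [es i] u p) + a0 p * (dd [es i, e_time] m p * dd [es i] u p + dd [es i] m p * dd [es i, e_time] u p)))
          + (0 * (m p * (\<Sum>i\<in>UNIV. dd [es i, es i] u p)) + a0 p * (dd [e_time] m p * (\<Sum>i\<in>UNIV. dd [es i, es i] u p) + m p * (\<Sum>i\<in>UNIV. dd [es i, es i, e_time] u p)))))"
    by (rule hpd_diff[OF hpd_diff[OF t(1)[OF m] hpd_sum[OF t(3)[OF m]]]
          hpd_add[OF hpd_sum[OF hpd_add[OF hpd_mult[OF a(2) hpd_mult[OF t(4)[OF m] t(2)[OF u]]] hpd_mult[OF a(1) hpd_mult[OF t(2)[OF m] t(2)[OF u]]]]]
            hpd_mult[OF a(1) hpd_mult[OF t(4)[OF m] hpd_sum[OF t(3)[OF u]]]]]])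
  from hpd_zero[OF this _ p] S show ?M unfolding sol_def by simp
qed

text \<open>Serves at the times 0 and \<open>T\<close>, where the gradient of the time derivative of
  \<open>m\<close> has to be expressed by spatial derivatives of the data.\<close>

lemma sol_space_m:
  assumes S: "sol \<kappa>1 \<kappa>2 a0 a1 s0 b u m" and u: "C_par A T 3 u" and m: "C_par A T 3 m"
    and a: "\<And>j. hpdQ (es j) a0 (a1 j)" "\<And>i j. hpdQ (es j) (a1 i) (a2 i j)" and p: "p \<in> cQ"
  shows "dd [es j, e_time] m p - (\<Sum>i\<in>UNIV. dd [es j, es i, es i] m p)
       - ((\<Sum>i\<in>UNIV. (a2 i j p * (m p * dd [es i] u p) + a1 i p * (dd [es j] m p * dd [es i] u p + m p * dd [es j, es i] u p))
             + (a1 j p * (dd [es i] m p * dd [es i] u p) + a0 p * (dd [es j, es i] m p * dd [es i] u p + dd [es i] m p * dd [es j, es i] u p)))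
          + (a1 j p * (m p * (\<Sum>i\<in>UNIV. dd [es i, es i] u p))
            + a0 p * (dd [es j] m p * (\<Sum>i\<in>UNIV. dd [es i, es i] u p) + m p * (\<Sum>i\<in>UNIV. dd [es j, es i, es i] u p)))) = 0"
proof -
  have h: "hpdQ (es j) (dd vs v) (dd (es j # vs) v)" if "C_par A T 3 v" "set vs \<subseteq> insert e_time (range es)" "sum_list (map par_weight vs) \<le> 4" for v vs
    by (rule C_par_hpd[OF that(1)]) (use that in \<open>auto simp: dir_lists_def par_dirs_def\<close>)
  have t: "hpdQ (es j) (dd [e_time] v) (dd [es j, e_time] v)"
    "hpdQ (es j) (dd [es i] v) (dd [es j, es i] v)"
    "hpdQ (es j) (dd [es i, es i] v) (dd [es j, es i, es i] v)"
    "hpdQ (es j) v (dd [es j] v)" if "C_par A T 3 v" for v i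
    using h[OF that, of "[e_time]"] h[OF that, of "[es i]"] h[OF that, of "[es i, es i]"] h[OF that, of "[]"]
    by (auto simp: pds_Nil)
  note hh = hpd_diff[OF hpd_diff[OF t(1)[OF m] hpd_sum[OF t(3)[OF m]]]
          hpd_add[OF hpd_sum[OF hpd_add[OF hpd_mult[OF a(2) hpd_mult[OF t(4)[OF m] t(2)[OF u]]] hpd_mult[OF a(1) hpd_mult[OF t(2)[OF m] t(2)[OF u]]]]]
            hpd_mult[OF a(1) hpd_mult[OF t(4)[OF m] hpd_sum[OF t(3)[OF u]]]]]]
  show ?thesis
    by (rule hpd_zero[OF hh _ p]) (use S in \<open>auto simp: sol_def\<close>)
qed

end

text \<open>The number \<open>k\<close> bounds the coefficients, the kernels, the solutions with their derivatives, and the size of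
  the domain. All constants below are powers of \<open>k\<close>; as \<open>1000 \<le> k\<close>, numerical factors cost one more power.
  Here \<open>\<kappa>1x\<close>, \<open>\<kappa>1y\<close>, \<open>J1\<close>, \<open>Jt\<close>, \<open>bd1\<close> etc. are derivatives of \<open>\<kappa>1\<close>, \<open>J\<close>, \<open>b1\<close>.\<close>

locale mfg_pair = boxdom A T for A :: "'n::{finite,wellorder} rvec" and T :: real +
  fixes k M :: real
    and \<kappa>1 \<kappa>1y \<kappa>2 \<kappa>2y :: "'n rvec \<times> 'n rvec \<Rightarrow> real" and \<kappa>1x \<kappa>2x :: "'n \<Rightarrow> 'n rvec \<times> 'n rvec \<Rightarrow> real"
    and u1 u2 m1 m2 a0 b1 b2 s0 st J Jt :: "'n rvec \<times> real \<Rightarrow> real"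
    and a1 bd1 bd2 s1 J1 J1t :: "'n \<Rightarrow> 'n rvec \<times> real \<Rightarrow> real" and a2 J2 :: "'n \<Rightarrow> 'n \<Rightarrow> 'n rvec \<times> real \<Rightarrow> real"
  assumes kbig: "1000 \<le> k" and M_le: "0 \<le> M" and card_le: "real CARD('n) \<le> k" and T_le: "T \<le> k"
    and il2_le: "4 * il2 * M^2 \<le> k"
    and cls: "C_par A T 3 u1" "C_par A T 3 u2" "C_par A T 3 m1" "C_par A T 3 m2"
    and bnd: "\<And>vs p. vs \<in> dl 6 \<Longrightarrow> p \<in> cQ \<Longrightarrow> \<bar>dd vs u1 p\<bar> \<le> k \<and> \<bar>dd vs u2 p\<bar> \<le> k \<and> \<bar>dd vs m1 p\<bar> \<le> k \<and> \<bar>dd vs m2 p\<bar> \<le> k"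
    and ker: "kern1 \<kappa>1 \<kappa>1x \<kappa>1y" "kern1 \<kappa>2 \<kappa>2x \<kappa>2y"
    and ker_le: "\<And>q. q \<in> cOO \<Longrightarrow> \<bar>\<kappa>1 q\<bar> \<le> M \<and> (\<forall>i. \<bar>\<kappa>1x i q\<bar> \<le> M) \<and> \<bar>\<kappa>1y q\<bar> \<le> M \<and> \<bar>\<kappa>2 q\<bar> \<le> M \<and> (\<forall>i. \<bar>\<kappa>2x i q\<bar> \<le> M)"
    and J_eq: "J = Inter \<kappa>1 \<kappa>2 m2" "Jt = Inter \<kappa>1 \<kappa>2 (dd [e_time] m2)"
    and J_smooth: "smooth21 J J1 J2 Jt J1t"
    and J_le: "\<And>p. p \<in> cQ \<Longrightarrow> \<bar>J p\<bar> \<le> k \<and> (\<forall>i. \<bar>J1 i p\<bar> \<le> k) \<and> (\<forall>i j. \<bar>J2 i j p\<bar> \<le> k) \<and> \<bar>Jt p\<bar> \<le> k"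
    and J_low: "\<And>p. p \<in> cQ \<Longrightarrow> 1 \<le> k * \<bar>J p\<bar>"
    and a_hpd: "\<And>j. hpdQ (es j) a0 (a1 j)" "\<And>i j. hpdQ (es j) (a1 i) (a2 i j)"
      "hpdQ e_time a0 (\<lambda>_. 0)" "\<And>i. hpdQ e_time (a1 i) (\<lambda>_. 0)"
    and a_cont: "contQ a0" "\<And>i. contQ (a1 i)"
    and a_le: "\<And>p i j. p \<in> cQ \<Longrightarrow> \<bar>a0 p\<bar> \<le> k \<and> \<bar>a1 i p\<bar> \<le> k \<and> \<bar>a2 i j p\<bar> \<le> k"
    and b_hpd: "\<And>j. hpdQ (es j) b1 (bd1 j)" "\<And>j. hpdQ (es j) b2 (bd2 j)"
      "hpdQ e_time b1 (\<lambda>_. 0)" "hpdQ e_time b2 (\<lambda>_. 0)"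
    and b_cont: "contQ b1" "contQ b2" "\<And>i. contQ (bd1 i)"
    and b_space: "\<And>x t t'. b1 (x, t) = b1 (x, t') \<and> b2 (x, t) = b2 (x, t') \<and> bd1 i (x, t) = bd1 i (x, t') \<and> bd2 i (x, t) = bd2 i (x, t')"
    and b_le: "\<And>p i. p \<in> cQ \<Longrightarrow> \<bar>b1 p\<bar> \<le> k \<and> \<bar>bd1 i p\<bar> \<le> k"
    and s_hpd: "hpdQ e_time s0 st" "\<And>j. hpdQ (es j) s0 (s1 j)"
    and s_cont: "contQ s0" "contQ st" "\<And>i. contQ (s1 i)"
    and s_le: "\<And>p i. p \<in> cQ \<Longrightarrow> \<bar>s0 p\<bar> \<le> k \<and> \<bar>st p\<bar> \<le> k \<and> \<bar>s1 i p\<bar> \<le> k"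
    and sols: "sol \<kappa>1 \<kappa>2 a0 a1 s0 b1 u1 m1" "sol \<kappa>1 \<kappa>2 a0 a1 s0 b2 u2 m2"
begin

section \<open>Differences of the two solutions and the quotient by the interaction term\<close>

definition U where "U vs p = dd vs u1 p - dd vs u2 p"
definition N where "N vs p = dd vs m1 p - dd vs m2 p"

abbreviation "e \<equiv> es"
abbreviation "et \<equiv> e_time :: 'n rvec \<times> real"

lemma cont_UN: "vs \<in> dl 6 \<Longrightarrow> contQ (U vs)" "vs \<in> dl 6 \<Longrightarrow> contQ (N vs)"
  unfolding U_def N_def using C_par_cont[OF cls(1), of vs] C_par_cont[OF cls(2), of vs] C_par_cont[OF cls(3), of vs] C_par_cont[OF cls(4), of vs]
  by (auto intro!: continuous_intros)

lemma hpd_UN: "v # vs \<in> dl 6 \<Longrightarrow> hpdQ v (U vs) (U (v # vs))" "v # vs \<in> dl 6 \<Longrightarrow> hpdQ v (N vs) (N (v # vs))"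
  unfolding U_def N_def using C_par_hpd[OF cls(1), of v vs] C_par_hpd[OF cls(2), of v vs] C_par_hpd[OF cls(3), of v vs] C_par_hpd[OF cls(4), of v vs]
  by (auto intro!: hpd_diff)

lemma hpd_UN_time: "vs @ [et] \<in> dl 6 \<Longrightarrow> hpdQ et (U vs) (U (vs @ [et]))" "vs @ [et] \<in> dl 6 \<Longrightarrow> hpdQ et (N vs) (N (vs @ [et]))"
  unfolding U_def N_def using C_par_hpd_time[OF cls(1), of vs] C_par_hpd_time[OF cls(2), of vs] C_par_hpd_time[OF cls(3), of vs] C_par_hpd_time[OF cls(4), of vs]
  by (auto intro!: hpd_diff)

lemma UN_perm: "vs \<in> dl 6 \<Longrightarrow> mset vs = mset vs' \<Longrightarrow> p \<in> cQ \<Longrightarrow> U vs p = U vs' p \<and> N vs p = N vs' p"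
  unfolding U_def N_def using dd_perm[OF cls(1), of vs vs' p] dd_perm[OF cls(2), of vs vs' p] dd_perm[OF cls(3), of vs vs' p] dd_perm[OF cls(4), of vs vs' p]
  by simp

lemma in_dl: "set vs \<subseteq> par_dirs \<Longrightarrow> sum_list (map par_weight vs) \<le> 6 \<Longrightarrow> vs \<in> dl 6"
  by (simp add: dir_lists_def)

lemma smooth21_UN:
  "smooth21 (U [et]) (\<lambda>i. U [e i, et]) (\<lambda>i j. U [e j, e i, et]) (U [et, et]) (\<lambda>i. U [et, e i, et])"
  "smooth21 (N [et]) (\<lambda>i. N [e i, et]) (\<lambda>i j. N [e j, e i, et]) (N [et, et]) (\<lambda>i. N [et, e i, et])"
proof -
  show "smooth21 (U [et]) (\<lambda>i. U [e i, et]) (\<lambda>i j. U [e j, e i, et]) (U [et, et]) (\<lambda>i. U [et, e i, et])"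
    by (rule smooth21I[where ?zt1.0="\<lambda>i. U [e i, et, et]"]) (intro hpd_UN cont_UN in_dl; simp)+
  show "smooth21 (N [et]) (\<lambda>i. N [e i, et]) (\<lambda>i j. N [e j, e i, et]) (N [et, et]) (\<lambda>i. N [et, e i, et])"
    by (rule smooth21I[where ?zt1.0="\<lambda>i. N [e i, et, et]"]) (intro hpd_UN cont_UN in_dl; simp)+
qed

lemma J_nz: "p \<in> cQ \<Longrightarrow> J p \<noteq> 0" using J_low[of p] by auto

definition z where "z p = U [et] p / J p"
definition z1 where "z1 i p = (U [e i, et] p - z p * J1 i p) / J p"
definition zt where "zt p = (U [et, et] p - z p * Jt p) / J p"

lemma z_smooth:
  obtains z2 z1t where "smooth21 z z1 z2 zt z1t"
    "\<And>p. p \<in> cQ \<Longrightarrow> U [et] p = J p * z p"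
    "\<And>p. p \<in> cQ \<Longrightarrow> U [et, et] p = J p * zt p + Jt p * z p"
    "\<And>p i. p \<in> cQ \<Longrightarrow> U [e i, et] p = J p * z1 i p + J1 i p * z p"
    "\<And>p. p \<in> cQ \<Longrightarrow> (\<Sum>i\<in>UNIV. U [e i, e i, et] p) = J p * lapl z2 p + 2 * (\<Sum>i\<in>UNIV. J1 i p * z1 i p) + lapl J2 p * z p"
proof -
  have e: "z = (\<lambda>p. U [et] p / J p)" "z1 = (\<lambda>i p. (U [e i, et] p - U [et] p / J p * J1 i p) / J p)"
    "zt = (\<lambda>p. (U [et, et] p - U [et] p / J p * Jt p) / J p)"
    by (auto simp: z_def z1_def zt_def fun_eq_iff)
  show ?thesis
  proof -
    have "\<exists>z2 z1t. smooth21 z z1 z2 zt z1t \<and>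
    (\<forall>p\<in>cQ. U [et] p = J p * z p \<and> U [et, et] p = J p * zt p + Jt p * z p \<and> (\<forall>i. U [e i, et] p = J p * z1 i p + J1 i p * z p) \<and>
      lapl (\<lambda>i j. U [e j, e i, et]) p = J p * lapl z2 p + 2 * (\<Sum>i\<in>UNIV. J1 i p * z1 i p) + lapl J2 p * z p)"
      unfolding e by (rule smooth21_divide[OF smooth21_UN(1) J_smooth J_nz])
    then obtain z2 z1t where s: "smooth21 z z1 z2 zt z1t" and h:
     "\<And>p. p \<in> cQ \<Longrightarrow> U [et] p = J p * z p \<and> U [et, et] p = J p * zt p + Jt p * z p \<and> (\<forall>i. U [e i, et] p = J p * z1 i p + J1 i p * z p) \<and>
      lapl (\<lambda>i j. U [e j, e i, et]) p = J p * lapl z2 p + 2 * (\<Sum>i\<in>UNIV. J1 i p * z1 i p) + lapl J2 p * z p" by blast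
    show ?thesis by (rule that[OF s]) (use h in \<open>auto simp: lapl_def[of "\<lambda>i j. U [e j, e i, et]"]\<close>)
  qed
qed

lemma prod_diff_le:
  fixes x1 x2 y1 y2 :: real
  assumes "\<bar>x1\<bar> \<le> B" "\<bar>y2\<bar> \<le> B'"
  shows "\<bar>x1 * y1 - x2 * y2\<bar> \<le> B * \<bar>y1 - y2\<bar> + B' * \<bar>x1 - x2\<bar>"
proof -
  have "x1 * y1 - x2 * y2 = x1 * (y1 - y2) + (x1 - x2) * y2" by (simp add: algebra_simps)
  then have "\<bar>x1 * y1 - x2 * y2\<bar> \<le> \<bar>x1\<bar> * \<bar>y1 - y2\<bar> + \<bar>x1 - x2\<bar> * \<bar>y2\<bar>"
    by (metis abs_mult abs_triangle_ineq)
  also have "\<dots> \<le> B * \<bar>y1 - y2\<bar> + \<bar>x1 - x2\<bar> * B'" using assms by (intro add_mono mult_mono) auto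
  finally show ?thesis by (simp add: mult.commute)
qed

text \<open>Linearity of the interaction. It is what allows the interactions of \<open>m1\<close>
  and of its time derivative to be written as that of the difference plus \<open>J\<close> or
  \<open>Jt\<close>.\<close>

lemma Inter_diff:
  assumes "contQ f" "contQ g" "p \<in> cQ"
  shows "Inter \<kappa>1 \<kappa>2 (\<lambda>p. f p - g p) p = Inter \<kappa>1 \<kappa>2 f p - Inter \<kappa>1 \<kappa>2 g p"
proof -
  obtain x t where xt: "p = (x, t)" by (cases p)
  have x: "x \<in> cOmega A" and t: "t \<in> {0..T}" using assms(3) by (auto simp: xt mem_cQT)
  have P: "PhiK \<kappa> (\<lambda>p. f p - g p) x r t = PhiK \<kappa> f x r t - PhiK \<kappa> g x r t" if "r \<in> I1" "continuous_on cOO \<kappa>" for r \<kappa>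
  proof -
    interpret S: posfun "cOmega A" "slice_integral A ix1 r" by (rule posfun_slice[OF that(1)])
    show ?thesis unfolding PhiK_def right_diff_distrib
      by (rule S.L_diff[OF cont_kernel_slice[OF that(2) assms(1) x t] cont_kernel_slice[OF that(2) assms(2) x t]])
  qed
  have "VK \<kappa>2 (\<lambda>p. f p - g p) p = VK \<kappa>2 f p - VK \<kappa>2 g p"
  proof -
    let ?K = "{x $ ix1..A $ ix1}"
    have K: "?K \<subseteq> I1" using mem_I1[OF x] by auto
    interpret L: posfun ?K "\<lambda>f. LINT r:?K|lborel. f r" by (rule posfun_set_integral) auto
    have c: "continuous_on ?K (\<lambda>r. PhiK \<kappa>2 h x r t)" if "contQ h" for h
      by (rule continuous_on_subset[OF cont_PhiK_r[OF kern1D(1)[OF ker(2)] that x t] K])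
    have "VK \<kappa>2 (\<lambda>p. f p - g p) p = (LINT r:?K|lborel. PhiK \<kappa>2 f x r t - PhiK \<kappa>2 g x r t)"
      unfolding VK_def xt fst_conv snd_conv
      by (intro set_lebesgue_integral_cong) (use P K kern1D(1)[OF ker(2)] in auto)
    also have "\<dots> = VK \<kappa>2 f p - VK \<kappa>2 g p"
      unfolding VK_def xt fst_conv snd_conv by (rule L.L_diff[OF c c]) (rule assms)+
    finally show ?thesis .
  qed
  then show ?thesis
    unfolding Inter_def SK_def xt fst_conv snd_conv using P[OF mem_I1[OF x] kern1D(1)[OF ker(1)]] by simp
qed

lemma k_ge: "1 \<le> k" using kbig by simp

lemma kpow: "0 \<le> x \<Longrightarrow> i \<le> j \<Longrightarrow> k ^ i * x \<le> k ^ j * x"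
  using k_ge by (intro mult_right_mono power_increasing) auto

lemma k0: "0 \<le> k" using k_ge by simp

lemma sum_sq_card: "(\<Sum>i\<in>UNIV. \<bar>f i\<bar>)^2 \<le> k * (\<Sum>i\<in>UNIV. (f i)^2)" for f :: "'n \<Rightarrow> real"
proof -
  have "(\<Sum>i\<in>UNIV. \<bar>f i\<bar>)^2 \<le> real CARD('n) * (\<Sum>i\<in>UNIV. \<bar>f i\<bar>^2)"
    using sum_squared_le_sum_of_squares[where f="\<lambda>i. \<bar>f i\<bar>" and I=UNIV] by (simp add: mult.commute)
  also have "\<dots> \<le> k * (\<Sum>i\<in>UNIV. \<bar>f i\<bar>^2)" by (intro mult_right_mono card_le sum_nonneg) auto
  finally show ?thesis by simp
qed

lemma sum_const_le: "\<bar>\<Sum>i\<in>UNIV. f i\<bar> \<le> k * B" if "\<And>i. \<bar>f i\<bar> \<le> B" for f :: "'n \<Rightarrow> real"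
proof -
  have B: "0 \<le> B" using that[of ix1] by (rule order_trans[OF abs_ge_zero])
  have "\<bar>\<Sum>i\<in>UNIV. f i\<bar> \<le> (\<Sum>i\<in>(UNIV::'n set). B)" by (rule order_trans[OF sum_abs sum_mono]) (rule that)
  also have "\<dots> \<le> k * B" using mult_right_mono[OF card_le B] by simp
  finally show ?thesis .
qed

end

context mfg_pair
begin

abbreviation "Nf \<equiv> N []"
abbreviation "In \<equiv> Inter \<kappa>1 \<kappa>2 (N [et])"
abbreviation "IN \<equiv> Inter \<kappa>1 \<kappa>2 (N [])"
definition IN1 where "IN1 = Inter1 \<kappa>1x \<kappa>1y \<kappa>1 \<kappa>2x \<kappa>2 (N []) (N [e ix1])"
definition be where "be p = b1 p - b2 p"
definition sU where "sU p = (\<Sum>i\<in>UNIV. \<bar>U [e i] p\<bar>)"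
definition sN where "sN p = (\<Sum>i\<in>UNIV. \<bar>N [e i] p\<bar>)"
definition sz where "sz p = (\<Sum>i\<in>UNIV. \<bar>z1 i p\<bar>)"
definition sn where "sn p = (\<Sum>i\<in>UNIV. \<bar>N [e i, et] p\<bar>)"
definition LU where "LU p = (\<Sum>i\<in>UNIV. U [e i, e i] p)"
definition Lw where "Lw p = (\<Sum>i\<in>UNIV. U [e i, e i, et] p)"
definition Ln where "Ln p = (\<Sum>i\<in>UNIV. N [e i, e i, et] p)"
definition gn where "gn = grad2 (\<lambda>i. N [e i, et])"

lemma UN_eq: "U [] p = u1 p - u2 p" "N [] p = m1 p - m2 p" by (simp_all add: U_def N_def pds_Nil)

lemma bnds:
  assumes "vs \<in> dl 6" "p \<in> cQ"
  shows "\<bar>dd vs u1 p\<bar> \<le> k" "\<bar>dd vs u2 p\<bar> \<le> k" "\<bar>dd vs m1 p\<bar> \<le> k" "\<bar>dd vs m2 p\<bar> \<le> k"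
  using bnd[OF assms] by auto

lemma dls: "[et] \<in> dl 6" "[e i] \<in> dl 6" "[e i, et] \<in> dl 6" "[e i, e j] \<in> dl 6" "[e i, e j, et] \<in> dl 6" "[et, et] \<in> dl 6" "[e i, e j, e l] \<in> dl 6" "[] \<in> dl 6" "[e i, e j, e l, et] \<in> dl 6"
  by (auto simp: dir_lists_def)

lemma cont_mm: "contQ m1" "contQ m2"
  "contQ (dd [et] m1)" "contQ (dd [et] m2)"
  using C_par_cont[OF cls(3), of "[]"] C_par_cont[OF cls(4), of "[]"] C_par_cont[OF cls(3), of "[et]"] C_par_cont[OF cls(4), of "[et]"] dls
  by (auto simp: pds_Nil)

lemma In_eq: "p \<in> cQ \<Longrightarrow> Inter \<kappa>1 \<kappa>2 (dd [et] m1) p = In p + Jt p"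
  using Inter_diff[OF cont_mm(3,4), of p] by (simp add: J_eq N_def[abs_def])

lemma IN_eq: "p \<in> cQ \<Longrightarrow> Inter \<kappa>1 \<kappa>2 m1 p = IN p + J p"
  using Inter_diff[OF cont_mm(1,2), of p] by (simp add: J_eq N_def[abs_def] pds_Nil)

section \<open>A calculus of pointwise bounds by powers of \<open>k\<close>\<close>

lemma numk: "c \<le> 1000 \<Longrightarrow> c * k ^ n \<le> k ^ (n + 1)"
  using kbig by (simp add: mult_right_mono)

lemma numkZ: "c \<le> 1000 \<Longrightarrow> 0 \<le> Z \<Longrightarrow> c * (k ^ n * Z) \<le> k ^ (n + 1) * Z"
  using mult_right_mono[OF numk[of c n]] by (simp add: mult.assoc)

text \<open>\<open>sm\<close> bounds an expression that is small with the differences,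
  \<open>dif\<close> a pair of bounded values with small difference. Products of pairs are again
  such pairs, since \<open>x x' - y y'\<close> is linear in the differences up to bounded factors.
  Exponents are added without regard to sharpness, so that the sums of ones in later proofs mirror
  the syntax of the expression being bounded.\<close>

definition dif where "dif c S x y \<longleftrightarrow> \<bar>x\<bar> \<le> k ^ c \<and> \<bar>y\<bar> \<le> k ^ c \<and> \<bar>x - y\<bar> \<le> k ^ c * S" for S x y :: real
definition sm where "sm c S x \<longleftrightarrow> \<bar>x\<bar> \<le> k ^ c * S" for S x :: real

lemma two_pow: "a \<le> k ^ c * S \<Longrightarrow> b \<le> k ^ d * S \<Longrightarrow> 0 \<le> S \<Longrightarrow> a + b \<le> k ^ (c + d + 1) * S"
proof -
  assume a: "a \<le> k ^ c * S" "b \<le> k ^ d * S" "0 \<le> S"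
  have "k ^ c * S \<le> k ^ (c + d) * S" "k ^ d * S \<le> k ^ (c + d) * S" by (intro kpow a; simp)+
  then have "a + b \<le> 2 * (k ^ (c + d) * S)" using a by linarith
  also have "\<dots> \<le> k ^ (c + d + 1) * S" by (rule numkZ) (use a in auto)
  finally show ?thesis .
qed

lemma sm_add: "sm c S x \<Longrightarrow> sm d S y \<Longrightarrow> 0 \<le> S \<Longrightarrow> sm (c + d + 1) S (x + y)"
  and sm_diff: "sm c S x \<Longrightarrow> sm d S y \<Longrightarrow> 0 \<le> S \<Longrightarrow> sm (c + d + 1) S (x - y)"
  unfolding sm_def using two_pow[of "\<bar>x\<bar>" c S "\<bar>y\<bar>" d] by linarith+

lemma sm_mult: "\<bar>a\<bar> \<le> k \<Longrightarrow> sm c S x \<Longrightarrow> sm (c + 1) S (a * x)"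
  unfolding sm_def using mult_mono[of "\<bar>a\<bar>" k "\<bar>x\<bar>" "k ^ c * S"] k0 by (simp add: abs_mult mult.assoc)

lemma sm_sum: "(\<And>i. sm c S (f i)) \<Longrightarrow> sm (c + 1) S (\<Sum>i\<in>UNIV. f i)" for f :: "'n \<Rightarrow> real"
  unfolding sm_def using sum_const_le[of f "k ^ c * S"] by (simp add: mult.assoc)

lemma dif_sm: "dif c S x y \<Longrightarrow> 0 \<le> S \<Longrightarrow> c \<le> n \<Longrightarrow> sm n S (x - y)"
  unfolding dif_def sm_def using kpow[of S c n] by linarith

lemma sm_up: "sm c S x \<Longrightarrow> 0 \<le> S \<Longrightarrow> c \<le> n \<Longrightarrow> sm n S x"
  unfolding sm_def using kpow[of S c n] by linarith

lemma dif_const: "\<bar>a\<bar> \<le> k \<Longrightarrow> 0 \<le> S \<Longrightarrow> dif 1 S a a"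
  using k0 by (simp add: dif_def)

lemma dif_add: "dif c S x y \<Longrightarrow> dif d S x' y' \<Longrightarrow> 0 \<le> S \<Longrightarrow> dif (c + d + 1) S (x + x') (y + y')"
  unfolding dif_def
  using two_pow[of "\<bar>x\<bar>" c 1 "\<bar>x'\<bar>" d] two_pow[of "\<bar>y\<bar>" c 1 "\<bar>y'\<bar>" d] two_pow[of "\<bar>x - y\<bar>" c S "\<bar>x' - y'\<bar>" d]
  by (intro conjI) linarith+

lemma dif_mult:
  assumes a: "dif c S x y" "dif d S x' y'" "0 \<le> S"
  shows "dif (c + d + 1) S (x * x') (y * y')"
proof -
  have B: "\<bar>u * u'\<bar> \<le> k ^ (c + d + 1)" if "\<bar>u\<bar> \<le> k ^ c" "\<bar>u'\<bar> \<le> k ^ d" for u u'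
  proof -
    have "\<bar>u * u'\<bar> \<le> k ^ c * k ^ d" unfolding abs_mult using that k0 by (intro mult_mono) auto
    also have "\<dots> \<le> k ^ (c + d + 1)" unfolding power_add[symmetric] by (rule power_increasing[OF _ k_ge]) simp
    finally show ?thesis .
  qed
  have "\<bar>x * x' - y * y'\<bar> \<le> k ^ c * \<bar>x' - y'\<bar> + k ^ d * \<bar>x - y\<bar>"
    by (rule prod_diff_le) (use a in \<open>auto simp: dif_def\<close>)
  also have "\<dots> \<le> k ^ c * (k ^ d * S) + k ^ d * (k ^ c * S)"
    using a k0 by (intro add_mono mult_left_mono) (auto simp: dif_def)
  also have "\<dots> = 2 * (k ^ (c + d) * S)" by (simp add: power_add algebra_simps)
  also have "\<dots> \<le> k ^ (c + d + 1) * S" by (rule numkZ) (use a in auto)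
  finally show ?thesis using a B[of x x'] B[of y y'] by (auto simp: dif_def)
qed

lemma dif_sum: "(\<And>i. dif c S (f i) (g i)) \<Longrightarrow> dif (c + 1) S (\<Sum>i\<in>UNIV. f i) (\<Sum>i\<in>UNIV. g i)" for f g :: "'n \<Rightarrow> real"
  unfolding dif_def
  using sum_const_le[of f "k ^ c"] sum_const_le[of g "k ^ c"] sum_const_le[of "\<lambda>i. f i - g i" "k ^ c * S"]
  by (simp add: sum_subtractf mult.assoc)

lemma sm_0: "\<bar>x\<bar> \<le> S \<Longrightarrow> sm 0 S x" by (simp add: sm_def)

lemma dif_bnd:
  assumes v: "vs \<in> dl 6" and p: "p \<in> cQ" and c: "1 \<le> c"
  shows "sm c S (U vs p) \<Longrightarrow> dif c S (dd vs u1 p) (dd vs u2 p)" "sm c S (N vs p) \<Longrightarrow> dif c S (dd vs m1 p) (dd vs m2 p)"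
proof -
  have "k \<le> k ^ c" using c k_ge by (simp add: self_le_power)
  then show "sm c S (U vs p) \<Longrightarrow> dif c S (dd vs u1 p) (dd vs u2 p)" "sm c S (N vs p) \<Longrightarrow> dif c S (dd vs m1 p) (dd vs m2 p)"
    using bnds[OF v p] by (auto simp: dif_def sm_def U_def N_def)
qed

lemma s_ge: "\<bar>z1 i p\<bar> \<le> \<bar>sz p\<bar>" "\<bar>U [e i] p\<bar> \<le> \<bar>sU p\<bar>" "\<bar>N [e i] p\<bar> \<le> \<bar>sN p\<bar>" "\<bar>N [e i, et] p\<bar> \<le> \<bar>sn p\<bar>"
proof -
  have "\<bar>f i\<bar> \<le> \<bar>\<Sum>i\<in>UNIV. \<bar>f i\<bar>\<bar>" for f :: "'n \<Rightarrow> real"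
    by (rule order_trans[OF member_le_sum[of i UNIV "\<lambda>i. \<bar>f i\<bar>"] abs_ge_self]) auto
  from this[of "\<lambda>i. z1 i p"] this[of "\<lambda>i. U [e i] p"] this[of "\<lambda>i. N [e i] p"] this[of "\<lambda>i. N [e i, et] p"] show "\<bar>z1 i p\<bar> \<le> \<bar>sz p\<bar>" "\<bar>U [e i] p\<bar> \<le> \<bar>sU p\<bar>" "\<bar>N [e i] p\<bar> \<le> \<bar>sN p\<bar>" "\<bar>N [e i, et] p\<bar> \<le> \<bar>sn p\<bar>"
    unfolding sz_def sU_def sN_def sn_def by simp_all
qed

lemma divJ: "p \<in> cQ \<Longrightarrow> \<bar>x / J p\<bar> \<le> k * \<bar>x\<bar>"
proof -
  assume p: "p \<in> cQ"
  have "\<bar>x / J p\<bar> = 1 * (\<bar>x\<bar> / \<bar>J p\<bar>)" by simp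
  also have "\<dots> \<le> k * \<bar>J p\<bar> * (\<bar>x\<bar> / \<bar>J p\<bar>)" by (intro mult_right_mono J_low p) auto
  also have "\<dots> = k * \<bar>x\<bar>" using J_nz[OF p] by simp
  finally show ?thesis .
qed

lemma J_sm:
  assumes p: "p \<in> cQ" and x: "sm c S x"
  shows "sm (c + 1) S (J p * x)" "sm (c + 1) S (J1 i p * x)" "sm (c + 1) S (J2 i j p * x)" "sm (c + 1) S (Jt p * x)" "sm (c + 1) S (x / J p)"
proof -
  show "sm (c + 1) S (J p * x)" "sm (c + 1) S (J1 i p * x)" "sm (c + 1) S (J2 i j p * x)" "sm (c + 1) S (Jt p * x)"
    using J_le[OF p] by (intro sm_mult[OF _ x]; simp)+
  show "sm (c + 1) S (x / J p)"
    unfolding sm_def using divJ[OF p, of x] mult_left_mono[OF x[unfolded sm_def] k0] by (simp add: mult.assoc)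
qed

section \<open>Pointwise bounds of the two heat operators by lower order terms\<close>

lemma w_sm:
  assumes p: "p \<in> cQ" and S: "\<bar>z p\<bar> \<le> S" "\<And>i. \<bar>z1 i p\<bar> \<le> S"
  shows "sm 3 S (U [e i, et] p)"
proof -
  have S0: "0 \<le> S" using S(1) by linarith
  have "U [e i, et] p = J p * z1 i p + J1 i p * z p" using J_nz[OF p] by (simp add: z1_def)
  moreover have "sm (0 + 1 + (0 + 1) + 1) S (J p * z1 i p + J1 i p * z p)" by (intro sm_add J_sm p sm_0 S S0)
  ultimately show ?thesis by (simp add: numeral_3_eq_3)
qed

lemma Lw_sm:
  assumes p: "p \<in> cQ" and S: "\<bar>z p\<bar> \<le> S" "\<And>i. \<bar>z1 i p\<bar> \<le> S" "\<bar>lapl z2 p\<bar> \<le> S"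
    and rel: "(\<Sum>i\<in>UNIV. U [e i, e i, et] p) = J p * lapl z2 p + 2 * (\<Sum>i\<in>UNIV. J1 i p * z1 i p) + lapl J2 p * z p"
  shows "sm 8 S (Lw p)"
proof -
  have S0: "0 \<le> S" using S(1) by linarith
  have 2: "\<bar>2\<bar> \<le> k" using kbig by simp
  have "sm (0 + 1 + (0 + 1 + 1 + 1) + 1 + (0 + 1 + 1) + 1) S (J p * lapl z2 p + 2 * (\<Sum>i\<in>UNIV. J1 i p * z1 i p) + (\<Sum>i\<in>UNIV. J2 i i p * z p))"
    by (intro sm_add sm_mult[OF 2] sm_sum J_sm p sm_0 S S0)
  then show ?thesis unfolding Lw_def rel lapl_def[of J2] sum_distrib_right by (rule sm_up[OF _ S0]) simp
qed

text \<open>The difference of the time-differentiated first equations. The difference of the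
  interaction terms is \<open>b1 * In + be * Jt\<close>, so the unknown coefficient remains,
  undifferentiated, among the lower order terms; it is treated as one of the quantities bounded by
  \<open>S\<close>.\<close>

lemma heat_z_sm:
  assumes p: "p \<in> cQ" and S: "\<bar>z p\<bar> \<le> S" "\<And>i. \<bar>z1 i p\<bar> \<le> S" "\<And>i. \<bar>U [e i] p\<bar> \<le> S" "\<bar>In p\<bar> \<le> S" "\<bar>be p\<bar> \<le> S"
      "\<bar>Nf p\<bar> \<le> S" "\<bar>N [et] p\<bar> \<le> S"
    and zz: "U [et, et] p = J p * zt p + Jt p * z p"
      "(\<Sum>i\<in>UNIV. U [e i, e i, et] p) = J p * lapl z2 p + 2 * (\<Sum>i\<in>UNIV. J1 i p * z1 i p) + lapl J2 p * z p"
  shows "sm 25 S (zt p + lapl z2 p)"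
proof -
  have S0: "0 \<le> S" using S(1) by linarith
  have 2: "\<bar>2\<bar> \<le> k" using kbig by simp
  let ?X = "\<lambda>u i. dd [e i] u p * dd [e i, et] u p"
  let ?R = "a0 p * ((\<Sum>i\<in>UNIV. ?X u1 i) - (\<Sum>i\<in>UNIV. ?X u2 i)) - b1 p * In p - Jt p * be p - st p * Nf p - s0 p * N [et] p
    - Jt p * z p - 2 * (\<Sum>i\<in>UNIV. J1 i p * z1 i p) - (\<Sum>i\<in>UNIV. J2 i i p * z p)"
  note E = sol_time(1)[OF _ _ _ kern1D(1)[OF ker(1)] kern1D(1)[OF ker(2)] a_hpd(3,4) _ s_hpd(1) p]
  have "U [et, et] p + (\<Sum>i\<in>UNIV. U [e i, e i, et] p) = ?R + Jt p * z p + 2 * (\<Sum>i\<in>UNIV. J1 i p * z1 i p) + lapl J2 p * z p"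
    using E[OF sols(1) cls(1,3) b_hpd(3)] E[OF sols(2) cls(2,4) b_hpd(4)] unfolding In_eq[OF p] UN_eq J_eq(2)[symmetric]
    by (simp add: U_def N_def be_def lapl_def sum_distrib_right sum_subtractf algebra_simps)
  then have eq: "zt p + lapl z2 p = ?R / J p" unfolding zz using J_nz[OF p] by (simp add: field_simps)
  have u: "dif 1 S (dd [e i] u1 p) (dd [e i] u2 p)" "dif 3 S (dd [e i, et] u1 p) (dd [e i, et] u2 p)" for i
    by (rule dif_bnd(1)[OF dls(2) p _ sm_up[OF sm_0[OF S(3)] S0]]; simp) (rule dif_bnd(1)[OF dls(3) p _ w_sm[OF p S(1,2)]], simp)
  have c: "\<bar>a0 p\<bar> \<le> k" "\<bar>b1 p\<bar> \<le> k" "\<bar>st p\<bar> \<le> k" "\<bar>s0 p\<bar> \<le> k" using a_le[OF p] b_le[OF p] s_le[OF p] by auto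
  have q: "sm 6 S ((\<Sum>i\<in>UNIV. ?X u1 i) - (\<Sum>i\<in>UNIV. ?X u2 i))"
    by (rule dif_sm[OF dif_sum[OF dif_mult[OF u S0]] S0]) simp
  have "sm (6 + 1 + (0 + 1) + 1 + (0 + 1) + 1 + (0 + 1) + 1 + (0 + 1) + 1 + (0 + 1) + 1 + (0 + 1 + 1 + 1) + 1 + (0 + 1 + 1) + 1 + 1) S (?R / J p)"
    by (intro J_sm p sm_diff sm_mult[OF c(1)] q sm_mult[OF c(2)] sm_mult[OF c(3)] sm_mult[OF c(4)] sm_mult[OF 2] sm_sum sm_0 S S0)
  then show ?thesis unfolding eq by (rule sm_up[OF _ S0]) simp
qed

definition Y where
  "Y p = LU p - a0 p * (\<Sum>i\<in>UNIV. (1/2) * ((dd [e i] u1 p)^2 - (dd [e i] u2 p)^2)) + b1 p * IN p + s0 p * Nf p"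

text \<open>The difference of the interaction terms is \<open>b1\<close> times the interaction of
  \<open>N\<close> plus \<open>be * J\<close>. Hence the unknown coefficient appears with the factor
  \<open>J\<close> only, and division by \<open>J\<close> leaves it bare.\<close>

lemma Y_eq:
  assumes p: "p \<in> cQ"
  shows "z p + be p + Y p / J p = 0"
proof -
  have "U [et] p + Y p + be p * J p = 0"
  proof -
    let ?S = "\<lambda>u. \<Sum>i\<in>UNIV. dd [e i, e i] u p" and ?Q = "\<lambda>u. \<Sum>i\<in>UNIV. (dd [e i] u p)^2"
    have E1: "dd [et] u1 p + ?S u1 - a0 p / 2 * ?Q u1 + b1 p * (IN p + J p) + s0 p * m1 p = 0"
      using sols(1)[unfolded sol_def, rule_format, OF p] unfolding IN_eq[OF p] by simp
    have E2: "dd [et] u2 p + ?S u2 - a0 p / 2 * ?Q u2 + b2 p * J p + s0 p * m2 p = 0"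
      using sols(2)[unfolded sol_def, rule_format, OF p] unfolding J_eq(1)[symmetric] by simp
    have Q: "(\<Sum>i\<in>UNIV. (1/2) * ((dd [e i] u1 p)^2 - (dd [e i] u2 p)^2)) = (1/2) * (?Q u1 - ?Q u2)"
      by (simp only: sum_distrib_left[symmetric] sum_subtractf)
    have L: "LU p = ?S u1 - ?S u2" by (simp add: LU_def U_def sum_subtractf)
    have "U [et] p + Y p + be p * J p =
        (dd [et] u1 p + ?S u1 - a0 p / 2 * ?Q u1 + b1 p * (IN p + J p) + s0 p * m1 p)
      - (dd [et] u2 p + ?S u2 - a0 p / 2 * ?Q u2 + b2 p * J p + s0 p * m2 p)"
      unfolding Y_def Q L be_def UN_eq(2) U_def by (simp add: algebra_simps)
    then show ?thesis unfolding E1 E2 by simp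
  qed
  then have "(U [et] p + Y p + be p * J p) / J p = 0" by simp
  then show ?thesis using J_nz[OF p] by (simp add: z_def add_divide_distrib)
qed

lemma Y_sm:
  assumes p: "p \<in> cQ" and S: "\<bar>LU p\<bar> \<le> S" "\<And>i. \<bar>U [e i] p\<bar> \<le> S" "\<bar>IN p\<bar> \<le> S" "\<bar>Nf p\<bar> \<le> S"
  shows "sm 12 S (Y p)"
proof -
  have S0: "0 \<le> S" using S(1) by linarith
  have c: "\<bar>a0 p\<bar> \<le> k" "\<bar>b1 p\<bar> \<le> k" "\<bar>s0 p\<bar> \<le> k" "\<bar>1/2\<bar> \<le> k" using a_le[OF p] b_le[OF p] s_le[OF p] kbig by auto
  have u: "dif 1 S (dd [e i] u1 p) (dd [e i] u2 p)" for i
    by (rule dif_bnd(1)[OF dls(2) p _ sm_up[OF sm_0[OF S(2)] S0]]; simp)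
  have q: "sm 3 S ((dd [e i] u1 p)^2 - (dd [e i] u2 p)^2)" for i
    unfolding power2_eq_square by (rule dif_sm[OF dif_mult[OF u u S0] S0]) simp
  have "sm (0 + (3 + 1 + 1 + 1) + 1 + (0 + 1) + 1 + (0 + 1) + 1) S (Y p)"
    unfolding Y_def by (intro sm_add sm_diff sm_mult c sm_sum q sm_0 S S0)
  then show ?thesis by (rule sm_up[OF _ S0]) simp
qed

lemma be_sm:
  assumes p: "p \<in> cQ" and S: "\<bar>z p\<bar> \<le> S" "\<bar>LU p\<bar> \<le> S" "\<And>i. \<bar>U [e i] p\<bar> \<le> S" "\<bar>IN p\<bar> \<le> S" "\<bar>Nf p\<bar> \<le> S"
  shows "sm 14 S (be p)"
proof -
  have S0: "0 \<le> S" using S(1) by linarith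
  have "be p = - z p - Y p / J p" using Y_eq[OF p] by linarith
  moreover have "sm (0 + (12 + 1) + 1) S (- z p - Y p / J p)" by (intro sm_diff J_sm p Y_sm sm_0 S S0) (use S in simp)
  ultimately show ?thesis by simp
qed

text \<open>The term \<open>a0 * m\<close> times the Laplacian of \<open>u\<close> in the expanded
  divergence contributes \<open>Lw\<close>, the Laplacian of the time derivative of
  \<open>U\<close>. Its bound is the separate premise \<open>lw\<close>; all other terms are
  products handled by \<open>dif\<close>.\<close>

lemma heat_n_sm:
  assumes p: "p \<in> cQ" and S: "\<bar>z p\<bar> \<le> S" "\<And>i. \<bar>z1 i p\<bar> \<le> S" "\<And>i. \<bar>U [e i] p\<bar> \<le> S" "\<bar>LU p\<bar> \<le> S" "\<bar>Nf p\<bar> \<le> S"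
      "\<bar>N [et] p\<bar> \<le> S" "\<And>i. \<bar>N [e i] p\<bar> \<le> S" "\<And>i. \<bar>N [e i, et] p\<bar> \<le> S"
    and lw: "sm 8 S (Lw p)"
  shows "sm 42 S (N [et, et] p - Ln p)"
proof -
  have S0: "0 \<le> S" using S(1) by linarith
  note E = sol_time(2)[OF _ _ _ kern1D(1)[OF ker(1)] kern1D(1)[OF ker(2)] a_hpd(3,4) _ s_hpd(1) p]
  have kk: "k * k \<le> k ^ 2" "k * k \<le> k ^ 8"
    using power_increasing[of 2 8 k] k_ge by (simp_all add: power2_eq_square)
  let ?R = "\<lambda>u m. (\<Sum>i\<in>UNIV. a1 i p * (dd [et] m p * dd [e i] u p + m p * dd [e i, et] u p)
             + a0 p * (dd [e i, et] m p * dd [e i] u p + dd [e i] m p * dd [e i, et] u p))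
          + a0 p * (dd [et] m p * (\<Sum>i\<in>UNIV. dd [e i, e i] u p) + m p * (\<Sum>i\<in>UNIV. dd [e i, e i, et] u p))"
  have eq: "N [et, et] p - Ln p = ?R u1 m1 - ?R u2 m2"
    using E[OF sols(1) cls(1,3) b_hpd(3)] E[OF sols(2) cls(2,4) b_hpd(4)] by (simp add: Ln_def N_def sum_subtractf)
  have a: "dif 1 S (a0 p) (a0 p)" "dif 1 S (a1 i p) (a1 i p)" for i using a_le[OF p] by (intro dif_const S0; simp)+
  have 1: "sm 1 S x" if "\<bar>x\<bar> \<le> S" for x by (rule sm_up[OF sm_0[OF that] S0]) simp
  have u: "dif 1 S (dd [e i] u1 p) (dd [e i] u2 p)" "dif 3 S (dd [e i, et] u1 p) (dd [e i, et] u2 p)"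
    "dif 1 S (dd [et] m1 p) (dd [et] m2 p)" "dif 1 S (dd [e i] m1 p) (dd [e i] m2 p)" "dif 1 S (dd [e i, et] m1 p) (dd [e i, et] m2 p)" for i
    using dif_bnd(1)[OF dls(2) p _ 1[OF S(3)]] dif_bnd(1)[OF dls(3) p _ w_sm[OF p S(1,2)]] dif_bnd(2)[OF dls(1) p _ 1[OF S(6)]]
      dif_bnd(2)[OF dls(2) p _ 1[OF S(7)]] dif_bnd(2)[OF dls(3) p _ 1[OF S(8)]] by simp_all
  have m: "dif 1 S (m1 p) (m2 p)" using dif_bnd(2)[OF dls(8) p _ 1[OF S(5)]] by (simp add: pds_Nil)
  have b: "\<bar>\<Sum>i\<in>UNIV. dd [e i, e i] v p\<bar> \<le> k * k" "\<bar>\<Sum>i\<in>UNIV. dd [e i, e i, et] v p\<bar> \<le> k * k" if "v \<in> {u1, u2}" for v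
    using that by (auto intro!: sum_const_le bnds dls p)
  have "sm 2 S (LU p)" by (rule sm_up[OF sm_0[OF S(4)] S0]) simp
  then have L: "dif 2 S (\<Sum>i\<in>UNIV. dd [e i, e i] u1 p) (\<Sum>i\<in>UNIV. dd [e i, e i] u2 p)"
    using order_trans[OF b(1) kk(1), of u1] order_trans[OF b(1) kk(1), of u2] by (simp add: dif_def sm_def LU_def U_def sum_subtractf)
  have Lt: "dif 8 S (\<Sum>i\<in>UNIV. dd [e i, e i, et] u1 p) (\<Sum>i\<in>UNIV. dd [e i, e i, et] u2 p)"
    using lw order_trans[OF b(2) kk(2), of u1] order_trans[OF b(2) kk(2), of u2] by (simp add: dif_def sm_def Lw_def U_def sum_subtractf)
  have "dif (1 + ((1 + 1 + 1) + (1 + 3 + 1) + 1) + 1 + (1 + ((1 + 1 + 1) + (1 + 3 + 1) + 1) + 1) + 1 + 1 + (1 + ((1 + 2 + 1) + (1 + 8 + 1) + 1) + 1) + 1) S (?R u1 m1) (?R u2 m2)"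
    by (intro dif_add dif_mult dif_sum a u m L Lt S0)
  then show ?thesis unfolding eq by (rule dif_sm[OF _ S0]) simp
qed

end

section \<open>Estimates up to powers of a common constant\<close>

text \<open>A bound for the square norm given by the functional \<open>L\<close>, measured in powers
  of \<open>k\<close> against a reference quantity \<open>Z\<close>. Data and Carleman integrals can
  both take the role of \<open>Z\<close>.\<close>

definition kd :: "real \<Rightarrow> 'a::topological_space set \<Rightarrow> (('a \<Rightarrow> real) \<Rightarrow> real) \<Rightarrow> real \<Rightarrow> nat \<Rightarrow> ('a \<Rightarrow> real) \<Rightarrow> bool" where
  "kd k K L Z n f \<longleftrightarrow> continuous_on K f \<and> L (\<lambda>x. (f x)^2) \<le> k ^ n * Z"

lemma kdD: "kd k K L Z n f \<Longrightarrow> continuous_on K f" "kd k K L Z n f \<Longrightarrow> L (\<lambda>x. (f x)^2) \<le> k ^ n * Z"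
  by (simp_all add: kd_def)

lemma pow_up: "1 \<le> k \<Longrightarrow> m \<le> n \<Longrightarrow> 0 \<le> Z \<Longrightarrow> x \<le> k ^ m * Z \<Longrightarrow> x \<le> k ^ n * (Z::real)"
  by (rule order_trans, assumption) (intro mult_right_mono power_increasing)

lemma kd_up: "kd k K L Z m f \<Longrightarrow> 1 \<le> k \<Longrightarrow> 0 \<le> Z \<Longrightarrow> m \<le> n \<Longrightarrow> kd k K L Z n f"
  unfolding kd_def using pow_up[of k m n Z] by blast

context posfun
begin

text \<open>Squaring doubles \<open>c\<close>; one further power of \<open>k\<close> is the
  cardinality in the Cauchy-Schwarz inequality, and one is the number of summands
  afterwards.\<close>

lemma kd_comb_set:
  assumes k: "1 \<le> k" "real (card I) \<le> k" and I: "finite I" and g: "\<And>i. i \<in> I \<Longrightarrow> kd k K L Z n (g i)"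
    and f: "continuous_on K f" "\<And>x. x \<in> K \<Longrightarrow> \<bar>f x\<bar> \<le> k ^ c * (\<Sum>i\<in>I. \<bar>g i x\<bar>)" and Z: "0 \<le> Z"
  shows "kd k K L Z (2 * c + 2 + n) f"
  unfolding kd_def
proof
  have cg: "continuous_on K (\<lambda>x. (g i x)^2)" if "i \<in> I" for i
    using g[OF that] by (auto simp: kd_def intro!: continuous_intros)
  then have cs: "continuous_on K (\<lambda>x. \<Sum>i\<in>I. (g i x)^2)" by (rule continuous_on_sum)
  have p: "(f x)^2 \<le> k ^ (2 * c + 1) * (\<Sum>i\<in>I. (g i x)^2)" if "x \<in> K" for x
  proof -
    have "(f x)^2 \<le> (k ^ c * (\<Sum>i\<in>I. \<bar>g i x\<bar>))^2" using f(2)[OF that] by (metis abs_ge_zero abs_le_square_iff abs_of_nonneg order_trans)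
    also have "\<dots> = k ^ (2 * c) * (\<Sum>i\<in>I. \<bar>g i x\<bar>)^2" by (simp add: power_mult_distrib power_mult[symmetric] mult.commute)
    also have "(\<Sum>i\<in>I. \<bar>g i x\<bar>)^2 \<le> real (card I) * (\<Sum>i\<in>I. \<bar>g i x\<bar>^2)"
      using sum_squared_le_sum_of_squares[where f="\<lambda>i. \<bar>g i x\<bar>" and I=I] by (simp add: mult.commute)
    also have "\<dots> \<le> k * (\<Sum>i\<in>I. (g i x)^2)" using k by (auto intro!: mult_right_mono sum_nonneg)
    finally show ?thesis using k by (simp add: mult_ac)
  qed
  have "L (\<lambda>x. (f x)^2) \<le> L (\<lambda>x. k ^ (2 * c + 1) * (\<Sum>i\<in>I. (g i x)^2))"
    by (rule L_mono) (intro continuous_intros f(1) cs p | assumption)+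
  also have "\<dots> = k ^ (2 * c + 1) * (\<Sum>i\<in>I. L (\<lambda>x. (g i x)^2))"
    by (simp add: L_cmult[OF cs] L_sum[OF I cg])
  also have "(\<Sum>i\<in>I. L (\<lambda>x. (g i x)^2)) \<le> (\<Sum>i\<in>I. k ^ n * Z)" by (rule sum_mono) (use g in \<open>auto simp: kd_def\<close>)
  also have "\<dots> \<le> k * (k ^ n * Z)" using k Z by (simp add: mult_right_mono)
  also have "k ^ (2 * c + 1) * (k * (k ^ n * Z)) = k ^ (2 * c + 2 + n) * Z" by (simp add: power_add power2_eq_square)
  finally show "L (\<lambda>x. (f x)^2) \<le> k ^ (2 * c + 2 + n) * Z" using k by simp
qed (rule f)

lemma kd_comb:
  assumes k: "1 \<le> k" "real (length gs) \<le> k" and g: "\<And>g. g \<in> set gs \<Longrightarrow> kd k K L Z n g"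
    and f: "continuous_on K f" "\<And>x. x \<in> K \<Longrightarrow> \<bar>f x\<bar> \<le> k ^ c * (\<Sum>g\<leftarrow>gs. \<bar>g x\<bar>)" and Z: "0 \<le> Z"
  shows "kd k K L Z (2 * c + 2 + n) f"
proof (rule kd_comb_set[where I="{..<length gs}" and g="\<lambda>i. gs ! i"])
  show "\<bar>f x\<bar> \<le> k ^ c * (\<Sum>i<length gs. \<bar>(gs ! i) x\<bar>)" if "x \<in> K" for x
    using f(2)[OF that] by (simp add: sum_list_sum_nth atLeast0LessThan)
qed (use assms in auto)

end

context boxdom
begin

section \<open>Weighted integrals as positive functionals\<close>

definition "wq l f = IQ A T (\<lambda>p. (Ew l p)^2 * f p)"
definition "wo l f = IO A (\<lambda>x. (Ew l (x, 0))^2 * f (x, 0))"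

lemma cont_wo: "contQ f \<Longrightarrow> continuous_on (cOmega A) (\<lambda>x. (Ew l (x, 0))^2 * f (x, 0))"
  using T_pos by (intro continuous_intros cont_at_time cont_Ew) auto

lemma posfun_wq: "posfun cQ (wq l)"
proof
  show "wq l (\<lambda>x. f x + g x) = wq l f + wq l g" if "contQ f" "contQ g" for f g
    unfolding wq_def distrib_left by (intro Q.L_add continuous_intros cont_Ew that)
  show "wq l (\<lambda>x. c * f x) = c * wq l f" if "contQ f" for f c
    unfolding wq_def mult.left_commute[of _ c] by (intro Q.L_cmult continuous_intros cont_Ew that)
  show "wq l f \<le> wq l g" if "contQ f" "contQ g" "\<And>x. x \<in> cQ \<Longrightarrow> f x \<le> g x" for f g
    unfolding wq_def by (intro Q.L_mono continuous_intros cont_Ew that mult_left_mono) auto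
qed

lemma posfun_IO: assumes t: "t \<in> {0..T}" shows "posfun cQ (\<lambda>f. IO A (\<lambda>x. f (x, t)))"
proof
  note c = cont_at_time[OF _ t]
  show "IO A (\<lambda>x. f (x, t) + g (x, t)) = IO A (\<lambda>x. f (x, t)) + IO A (\<lambda>x. g (x, t))" if "contQ f" "contQ g" for f g
    by (intro O.L_add c that)
  show "IO A (\<lambda>x. a * f (x, t)) = a * IO A (\<lambda>x. f (x, t))" if "contQ f" for f a
    by (intro O.L_cmult c that)
  show "IO A (\<lambda>x. f (x, t)) \<le> IO A (\<lambda>x. g (x, t))" if "contQ f" "contQ g" "\<And>x. x \<in> cQ \<Longrightarrow> f x \<le> g x" for f g
    by (intro O.L_mono c that) (use t in \<open>auto simp: mem_cQT\<close>)
qed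

lemma posfun_wo: "posfun cQ (wo l)"
proof
  show "wo l (\<lambda>x. f x + g x) = wo l f + wo l g" if "contQ f" "contQ g" for f g
    unfolding wo_def distrib_left by (intro O.L_add cont_wo that)
  show "wo l (\<lambda>x. c * f x) = c * wo l f" if "contQ f" for f c
    unfolding wo_def mult.left_commute[of _ c] by (intro O.L_cmult cont_wo that)
  show "wo l f \<le> wo l g" if "contQ f" "contQ g" "\<And>x. x \<in> cQ \<Longrightarrow> f x \<le> g x" for f g
    unfolding wo_def by (intro O.L_mono cont_wo that mult_left_mono) (use T_pos in \<open>auto simp: mem_cQT\<close>)
qed

lemma em2_ge: "0 \<le> l \<Longrightarrow> 1 \<le> em2 l" unfolding em2_def using one_le_power[of "exp (l * Ximax^2)" 2] by simp

lemma wo_le: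
  assumes l: "0 \<le> l" and f: "contQ f" "\<And>p. p \<in> cQ \<Longrightarrow> 0 \<le> f p"
  shows "wo l f \<le> em2 l * IO A (\<lambda>x. f (x, 0))"
proof -
  have t: "0 \<in> {0..T}" using T_pos by simp
  have "wo l f \<le> IO A (\<lambda>x. em2 l * f (x, 0))"
    unfolding wo_def
  proof (rule O.L_mono)
    fix x assume x: "x \<in> cOmega A"
    then have p: "(x, 0) \<in> cQ" using T_pos by (simp add: mem_cQT)
    have "(Ew l (x, 0))^2 \<le> em2 l" unfolding em2_def by (rule power_mono[OF Ew_le[OF p l]]) (simp add: Ew_pos less_imp_le)
    then show "(Ew l (x, 0))^2 * f (x, 0) \<le> em2 l * f (x, 0)" by (rule mult_right_mono) (rule f(2)[OF p])
  qed (intro cont_wo f continuous_intros cont_at_time[OF _ t])+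
  also have "\<dots> = em2 l * IO A (\<lambda>x. f (x, 0))" by (intro O.L_cmult cont_at_time[OF _ t] f)
  finally show ?thesis .
qed

text \<open>The constants of the time integration satisfy
  \<open>2 T + 4 T^2 \<le> 6 k^2 \<le> k^3\<close>; this is the 3 added to the exponent.\<close>

lemma kd_wq_time:
  assumes h: "hpdQ e_time f ft" and f: "contQ f" and ft: "kd k cQ (wq l) Z n ft"
    and o: "wo l (\<lambda>p. (f p)^2) \<le> k ^ n * Z" and k: "6 \<le> k" "T \<le> k" and Z: "0 \<le> Z"
  shows "kd k cQ (wq l) Z (n + 3) f"
  unfolding kd_def
proof
  let ?X = "k ^ n * Z"
  interpret W: posfun "cQ" "wo l" by (rule posfun_wo)
  interpret V: posfun "cQ" "wq l" by (rule posfun_wq)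
  note c = kdD(1)[OF ft]
  have X: "0 \<le> ?X" using k Z by simp
  have o0: "0 \<le> wo l (\<lambda>p. (f p)^2)" by (rule W.L_nonneg) (auto intro!: continuous_intros f)
  have "wq l (\<lambda>p. (f p)^2) \<le> 2 * T * wo l (\<lambda>p. (f p)^2) + 4 * T^2 * wq l (\<lambda>p. (ft p)^2)"
    unfolding wq_def wo_def by (rule IQ_time_integral[OF h f c])
  also have "\<dots> \<le> 2 * T * ?X + 4 * T^2 * ?X"
    using T_pos by (intro add_mono mult_left_mono o kdD(2)[OF ft]) auto
  also have "\<dots> \<le> 2 * k^2 * ?X + 4 * k^2 * ?X"
  proof (intro add_mono mult_right_mono X)
    have "k * 1 \<le> k * k" using k by (intro mult_left_mono) auto
    then have "T \<le> k^2" unfolding power2_eq_square using k(2) by linarith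
    then show "2 * T \<le> 2 * k^2" by simp
    show "4 * T^2 \<le> 4 * k^2" using k T_pos by (simp add: power_mono)
  qed
  also have "\<dots> = 6 * (k^2 * ?X)" by simp
  also have "\<dots> \<le> k * (k^2 * ?X)" using k X by (intro mult_right_mono) auto
  also have "\<dots> = k ^ (n + 3) * Z" by (simp add: power_add eval_nat_numeral)
  finally show "wq l (\<lambda>p. (f p)^2) \<le> k ^ (n + 3) * Z" .
qed (rule f)

end

section \<open>Bounds of the data and the estimates following from them\<close>

text \<open>\<open>D\<close> is the squared size of the data. At the ends spatial derivatives up to
  order three are available, as required by the gradients of \<open>N [et]\<close> and of
  \<open>Y\<close> there. On the faces \<open>DL2\<close> omits the pure normal second derivative,
  in accordance with \<open>e2dens\<close>.\<close>

locale mfg_data = mfg_pair +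
  fixes D :: real
  assumes D0: "0 \<le> D" and T_ge: "1 \<le> k * T"
    and card3_le: "real (card {is :: 'a list. length is \<le> 3}) \<le> k"
    and DI: "\<And>is t. length is \<le> 3 \<Longrightarrow> t \<in> {0, T} \<Longrightarrow> IO A (\<lambda>x. (U (map e is) (x, t))^2) \<le> D \<and> IO A (\<lambda>x. (N (map e is) (x, t))^2) \<le> D"
    and DL: "\<And>j \<sigma> vs. \<sigma> \<in> {-1, 1} \<Longrightarrow> vs \<in> {[et], [et, et]} \<union> range (\<lambda>i. [e i, et]) \<Longrightarrow>
        IB A T j \<sigma> (\<lambda>p. (U vs p)^2) \<le> D \<and> IB A T j \<sigma> (\<lambda>p. (N vs p)^2) \<le> D"
    and DL2: "\<And>j \<sigma> i s. \<sigma> \<in> {-1, 1} \<Longrightarrow> (i, s) \<noteq> (j, j) \<Longrightarrow>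
        IB A T j \<sigma> (\<lambda>p. (U [e s, e i, et] p)^2) \<le> D \<and> IB A T j \<sigma> (\<lambda>p. (N [e s, e i, et] p)^2) \<le> D"
begin

lemma abs_le_add:
  "x \<le> \<bar>y\<bar> \<Longrightarrow> 0 \<le> v \<Longrightarrow> x \<le> \<bar>y\<bar> + v" "x \<le> v \<Longrightarrow> x \<le> \<bar>y\<bar> + v" for x y v :: real by simp_all

lemma contz: "contQ z" "contQ (z1 i)" "contQ zt"
  by (rule z_smooth, metis smooth21D(6), rule z_smooth, metis smooth21D(7), rule z_smooth, metis smooth21D(9))

lemma conts [simp]:
  "contQ (U [et])" "contQ (N [et])" "contQ (U [et, et])" "contQ (N [et, et])"
  "contQ (U [e i, et])" "contQ (N [e i, et])"
  "contQ (U [e i])" "contQ (N [e i])"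
  "contQ (U [e i, e j])" "contQ (N [e i, e j])"
  "contQ (U [e i, e j, et])" "contQ (N [e i, e j, et])"
  "contQ (U [e i, e j, e m])" "contQ (N [e i, e j, e m])"
  "contQ (U [e i, e j, e m, et])" "contQ (N [e i, e j, e m, et])"
  "contQ (N [])" "contQ (U [])"
  by (intro cont_UN in_dl; simp)+

lemma conts2 [simp]:
  "contQ z" "contQ (z1 i)" "contQ zt"
  "contQ sU" "contQ sN" "contQ sz"
  "contQ sn" "contQ LU" "contQ Lw"
  "contQ Ln"
  "contQ (grad2 z1)" "contQ gn"
  "contQ In" "contQ IN" "contQ be"
  unfolding sU_def[abs_def] sN_def[abs_def] sz_def[abs_def] sn_def[abs_def] LU_def[abs_def]
    Lw_def[abs_def] Ln_def[abs_def] be_def[abs_def] grad2_def[abs_def] gn_def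
  by (intro contz conts b_cont continuous_intros cont_Inter kern1D(1)[OF ker(1)] kern1D(1)[OF ker(2)])+

lemma kd_sum_sq:
  assumes L: "posfun cQ L" and g: "\<And>i. contQ (g i)" and s: "\<And>p. s p = (\<Sum>i\<in>UNIV. \<bar>g i p\<bar>)"
    and b: "L (grad2 g) \<le> k ^ n * Z" and Z: "0 \<le> Z"
  shows "kd k cQ L Z (n + 1) s"
  unfolding kd_def
proof
  interpret L: posfun "cQ" L by (rule L)
  have cg: "contQ (grad2 g)" unfolding grad2_def[abs_def] by (intro continuous_intros g)
  show cs: "contQ s" unfolding s by (intro continuous_intros g)
  have "L (\<lambda>p. (s p)^2) \<le> L (\<lambda>p. k * grad2 g p)"
    by (rule L.L_mono) (intro continuous_intros cs cg | use sum_sq_card in \<open>simp add: s grad2_def\<close>)+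
  also have "\<dots> = k * L (grad2 g)" by (rule L.L_cmult[OF cg])
  also have "\<dots> \<le> k * (k ^ n * Z)" using b k0 by (rule mult_left_mono)
  finally show "L (\<lambda>p. (s p)^2) \<le> k ^ (n + 1) * Z" by (simp add: mult.assoc)
qed

lemma kd_sum:
  assumes L: "posfun cQ L" and g: "\<And>i. kd k cQ L Z n (g i)" and Z: "0 \<le> Z"
  shows "kd k cQ L Z (n + 2) (\<lambda>p. \<Sum>i\<in>(UNIV :: 'a set). g i p)"
    and "kd k cQ L Z (n + 2) (\<lambda>p. \<Sum>i\<in>(UNIV :: 'a set). \<bar>g i p\<bar>)"
proof -
  note c = kdD(1)[OF g]
  note P = posfun.kd_comb_set[OF L k_ge card_le finite_class.finite_UNIV _ _ _ Z, where c=0 and g=g and n=n, OF g]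
  have "kd k cQ L Z (2 * 0 + 2 + n) (\<lambda>p. \<Sum>i\<in>(UNIV :: 'a set). g i p)"
    by (rule P) (intro continuous_intros c, simp add: sum_abs)
  then show "kd k cQ L Z (n + 2) (\<lambda>p. \<Sum>i\<in>(UNIV :: 'a set). g i p)" by (simp add: add.commute)
  have "kd k cQ L Z (2 * 0 + 2 + n) (\<lambda>p. \<Sum>i\<in>(UNIV :: 'a set). \<bar>g i p\<bar>)"
    by (rule P) (intro continuous_intros c, simp add: sum_nonneg)
  then show "kd k cQ L Z (n + 2) (\<lambda>p. \<Sum>i\<in>(UNIV :: 'a set). \<bar>g i p\<bar>)" by (simp add: add.commute)
qed

lemma kd_comp_le:
  assumes L: "posfun cQ L" and s: "kd k cQ L Z n s" and f: "contQ f"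
    and le: "\<And>p. p \<in> cQ \<Longrightarrow> \<bar>f p\<bar> \<le> \<bar>s p\<bar>"
  shows "kd k cQ L Z n f"
  unfolding kd_def
proof
  interpret L: posfun "cQ" L by (rule L)
  have "L (\<lambda>p. (f p)^2) \<le> L (\<lambda>p. (s p)^2)"
    by (rule L.L_mono) (auto intro!: continuous_intros f kdD(1)[OF s] simp: le abs_le_square_iff[symmetric])
  then show "L (\<lambda>p. (f p)^2) \<le> k ^ n * Z" using kdD(2)[OF s] by simp
qed (rule f)

lemma kd_Inter:
  assumes l: "0 \<le> l" and g: "kd k cQ (wq l) Z n g" and Z: "0 \<le> Z"
  shows "kd k cQ (wq l) Z (n + 1) (Inter \<kappa>1 \<kappa>2 g)"
  unfolding kd_def
proof
  note K = kern1D(1)[OF ker(1)] kern1D(1)[OF ker(2)]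
  note c = kdD(1)[OF g]
  show cI: "contQ (Inter \<kappa>1 \<kappa>2 g)" by (rule cont_Inter[OF K c])
  have c1: "contQ (\<lambda>p. (Ew l p)^2 * (f p)^2)" if "contQ f" for f
    by (intro continuous_intros cont_Ew that)
  have "wq l (\<lambda>p. (Inter \<kappa>1 \<kappa>2 g p)^2) \<le> IQ A T (\<lambda>p. k * ((Ew l p)^2 * (g p)^2))"
    unfolding wq_def
  proof (rule IQ_mono_time[OF c1[OF cI] continuous_on_mult_left[OF c1[OF c]]])
    fix t assume t: "t \<in> {0..T}"
    have "IO A (\<lambda>x. (Ew l (x, t))^2 * (Inter \<kappa>1 \<kappa>2 g (x, t))^2) \<le> 4 * il2 * M^2 * IO A (\<lambda>x. (Ew l (x, t))^2 * (g (x, t))^2)"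
      by (rule Inter_L2[OF K c t l]) (use ker_le in auto)
    also have "\<dots> \<le> k * IO A (\<lambda>x. (Ew l (x, t))^2 * (g (x, t))^2)"
      by (intro mult_right_mono il2_le O.L_nonneg cont_Ewt[OF c t]) auto
    also have "\<dots> = IO A (\<lambda>x. k * ((Ew l (x, t))^2 * (g (x, t))^2))"
      by (rule O.L_cmult[symmetric, OF cont_Ewt[OF c t]])
    finally show "IO A (\<lambda>x. (Ew l (x, t))^2 * (Inter \<kappa>1 \<kappa>2 g (x, t))^2) \<le> IO A (\<lambda>x. k * ((Ew l (x, t))^2 * (g (x, t))^2))" .
  qed
  also have "\<dots> = k * wq l (\<lambda>p. (g p)^2)" unfolding wq_def by (rule Q.L_cmult[OF c1[OF c]])
  also have "\<dots> \<le> k * (k ^ n * Z)" using kdD(2)[OF g] k0 by (rule mult_left_mono)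
  finally show "wq l (\<lambda>p. (Inter \<kappa>1 \<kappa>2 g p)^2) \<le> k ^ (n + 1) * Z" by (simp add: mult.assoc)
qed

lemma kd_Inter_IO:
  assumes t: "t \<in> {0..T}" and g: "kd k cQ (\<lambda>f. IO A (\<lambda>x. f (x, t))) Z n g"
  shows "kd k cQ (\<lambda>f. IO A (\<lambda>x. f (x, t))) Z (n + 1) (Inter \<kappa>1 \<kappa>2 g)"
  unfolding kd_def
proof
  note K = kern1D(1)[OF ker(1)] kern1D(1)[OF ker(2)]
  note c = kdD(1)[OF g]
  show "contQ (Inter \<kappa>1 \<kappa>2 g)" by (rule cont_Inter[OF K c])
  \<comment> \<open>For \<open>l = 0\<close> the weight is identically 1, so the weighted bound
    contains the plain one.\<close>
  have "IO A (\<lambda>x. (Ew 0 (x, t))^2 * (Inter \<kappa>1 \<kappa>2 g (x, t))^2) \<le> 4 * il2 * M^2 * IO A (\<lambda>x. (Ew 0 (x, t))^2 * (g (x, t))^2)"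
    by (rule Inter_L2[OF K c t]) (use ker_le in auto)
  also have "\<dots> \<le> k * IO A (\<lambda>x. (Ew 0 (x, t))^2 * (g (x, t))^2)"
    by (intro mult_right_mono il2_le O.L_nonneg cont_Ewt[OF c t]) auto
  also have "\<dots> \<le> k * (k ^ n * Z)" using kdD(2)[OF g] k0 by (intro mult_left_mono) (auto simp: Ew_def)
  finally show "IO A (\<lambda>x. (Inter \<kappa>1 \<kappa>2 g (x, t))^2) \<le> k ^ (n + 1) * Z" by (simp add: Ew_def mult.assoc)
qed

context
  fixes l Z :: real
  assumes l: "0 \<le> l" and Z: "em2 l * D \<le> Z"
begin

lemma Z0: "0 \<le> Z"
  using Z mult_nonneg_nonneg[OF order_trans[OF zero_le_one em2_ge[OF l]] D0] by linarith

abbreviation "kq \<equiv> kd k cQ (wq l) Z"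

lemma wo_data:
  assumes "contQ f" "IO A (\<lambda>x. (f (x, 0))^2) \<le> k ^ m * D"
  shows "wo l (\<lambda>p. (f p)^2) \<le> k ^ m * Z"
proof -
  have "wo l (\<lambda>p. (f p)^2) \<le> em2 l * IO A (\<lambda>x. (f (x, 0))^2)" by (rule wo_le[OF l]) (auto intro!: continuous_intros assms)
  also have "\<dots> \<le> em2 l * (k ^ m * D)" using em2_ge[OF l] by (intro mult_left_mono assms) auto
  also have "\<dots> \<le> k ^ m * Z" using mult_left_mono[OF Z, of "k ^ m"] k0 by (simp add: mult.left_commute)
  finally show ?thesis .
qed

lemma kq_time:
  assumes "hpdQ et f ft" "kq n ft" "contQ f" "IO A (\<lambda>x. (f (x, 0))^2) \<le> k ^ m * D" "m \<le> n"
  shows "kq (n + 3) f"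
  by (rule kd_wq_time[OF assms(1,3,2)])
     (use pow_up[OF k_ge assms(5) Z0 wo_data[OF assms(3,4)]] kbig T_le Z0 in auto)

lemma kq_up: "kq m f \<Longrightarrow> m \<le> n \<Longrightarrow> kq n f" by (rule kd_up[OF _ k_ge Z0])

lemma kq_comb:
  assumes "\<And>g. g \<in> set gs \<Longrightarrow> kq n g" "contQ f"
    "\<And>p. p \<in> cQ \<Longrightarrow> \<bar>f p\<bar> \<le> k ^ c * (\<Sum>g\<leftarrow>gs. \<bar>g p\<bar>)" "length gs \<le> 1000"
  shows "kq (2 * c + 2 + n) f"
  by (rule posfun.kd_comb[OF posfun_wq k_ge _ assms(1-3) Z0]) (use assms(4) kbig in auto)

context
  assumes z: "wq l (\<lambda>p. (z p)^2) \<le> Z" and z1: "wq l (grad2 z1) \<le> Z" and n: "wq l (\<lambda>p. (N [et] p)^2) \<le> Z"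
begin

lemma kq_basic: "kq 0 z" "kq 1 sz" "kq 0 (N [et])" "kq 3 Nf"
proof -
  show "kq 0 z" "kq 0 (N [et])" using z n by (auto simp: kd_def)
  show "kq 1 sz" using kd_sum_sq[where g=z1 and n=0, OF posfun_wq _ sz_def] z1 Z0 by simp
  have "kq (0 + 3) Nf"
    by (rule kq_time[OF hpd_UN_time(2)[where vs="[]", simplified], where m=0]) (use n DI[of "[]" 0] in \<open>auto simp: kd_def in_dl\<close>)
  then show "kq 3 Nf" by simp
qed

text \<open>The gradient of \<open>U\<close> itself is no Carleman quantity. The gradient of its
  time derivative is bounded through \<open>z\<close> and \<open>z1\<close>, and integration in time
  starts from data at \<open>t = 0\<close>.\<close>

lemma kq_sU: "kq 14 sU"
proof -
  have "kq (9 + 3) (U [e i])" for i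
  proof (rule kq_time[OF hpd_UN_time(1)[where vs="[e i]", simplified], where m=0])
    have "kq (2 * 3 + 2 + 1) (U [e i, et])"
    proof (rule kq_comb[where gs="[sz, z]"])
      fix p assume p: "p \<in> cQ"
      show "\<bar>U [e i, et] p\<bar> \<le> k ^ 3 * (\<Sum>g\<leftarrow>[sz, z]. \<bar>g p\<bar>)"
        by (rule w_sm[OF p, unfolded sm_def]) (use s_ge(1)[of _ p] in \<open>simp_all add: abs_le_add\<close>)
    qed (use kq_basic(2) kq_up[OF kq_basic(1), of 1] in auto)
    then show "kq 9 (U [e i, et])" by simp
  qed (use DI[of "[i]" 0] in \<open>auto simp: in_dl\<close>)
  then have "kq (12 + 2) sU" unfolding sU_def[abs_def] by (intro kd_sum posfun_wq Z0) simp
  then show ?thesis by simp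
qed

lemma kq_In: "kq 1 In" "kq 4 IN"
  using kd_Inter[OF l kq_basic(3) Z0] kd_Inter[OF l kq_basic(4) Z0] by simp_all

text \<open>\<open>be\<close> does not depend on time and is estimated at \<open>t = 0\<close>,
  where all terms of \<open>Y\<close> are data and only the trace of \<open>z\<close> remains. As
  the weight is independent of time too, the bound extends to the cylinder with the factor
  \<open>T\<close>.\<close>

lemma kq_z_eq:
  assumes o: "wo l (\<lambda>p. (z p)^2) \<le> Z" and rel: "\<And>p. p \<in> cQ \<Longrightarrow> U [et, et] p = J p * zt p + Jt p * z p"
     "\<And>p. p \<in> cQ \<Longrightarrow> (\<Sum>i\<in>UNIV. U [e i, e i, et] p) = J p * lapl z2 p + 2 * (\<Sum>i\<in>UNIV. J1 i p * z1 i p) + lapl J2 p * z p"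
    and c2: "contQ (lapl z2)"
  shows "kq 85 (\<lambda>p. zt p + lapl z2 p)"
proof -
  have oD: "kd k cQ (wo l) Z 0 f" if "contQ f" "IO A (\<lambda>x. (f (x, 0))^2) \<le> D" for f
    unfolding kd_def using wo_data[of f 0] that by simp
  note up = kd_up[OF _ k_ge Z0]
  have "kd k cQ (wo l) Z 0 (U [e i])" "kd k cQ (wo l) Z 0 (U [e i, e i])" for i
    using oD[of "U [e i]"] oD[of "U [e i, e i]"] DI[of "[i]" 0] DI[of "[i, i]" 0] by auto
  note oUL = this
  have oU: "kd k cQ (wo l) Z (0 + 2) sU" unfolding sU_def[abs_def] by (rule kd_sum(2)[OF posfun_wo oUL(1) Z0])
  have oL: "kd k cQ (wo l) Z (0 + 2) LU" unfolding LU_def[abs_def] by (rule kd_sum(1)[OF posfun_wo oUL(2) Z0])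
  have t0: "0 \<in> {0..T}" using T_pos by simp
  have IOIN: "IO A (\<lambda>x. (IN (x, 0))^2) \<le> k * D"
    using kdD(2)[OF kd_Inter_IO[OF t0, of D 0 Nf]] DI[of "[]" 0] by (simp add: kd_def)
  have "wo l (\<lambda>p. (IN p)^2) \<le> em2 l * (k * D)"
    by (rule order_trans[OF wo_le[OF l]]) (use IOIN em2_ge[OF l] in \<open>auto intro!: continuous_intros mult_left_mono\<close>)
  also have "\<dots> \<le> k * Z" using mult_left_mono[OF Z k0] by (simp add: mult.left_commute)
  finally have oI: "kd k cQ (wo l) Z 1 IN" by (simp add: kd_def)
  have ob: "kd k cQ (wo l) Z (2 * 14 + 2 + 2) be"
  proof (rule posfun.kd_comb[OF posfun_wo k_ge, where gs="[z, LU, sU, IN, Nf]"])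
    fix p assume p: "p \<in> cQ"
    show "\<bar>be p\<bar> \<le> k ^ 14 * (\<Sum>g\<leftarrow>[z, LU, sU, IN, Nf]. \<bar>g p\<bar>)"
      by (rule be_sm[OF p, unfolded sm_def]) (use s_ge(2)[of _ p] in \<open>simp_all add: abs_le_add\<close>)
  next
    fix g assume "g \<in> set [z, LU, sU, IN, Nf]"
    then consider "g = z" | "g = LU" | "g = sU" | "g = IN" | "g = Nf" by auto
    then show "kd k cQ (wo l) Z 2 g"
    proof cases
      case 1 show ?thesis unfolding 1 by (rule up[where m=0]) (use o in \<open>auto simp: kd_def\<close>)
    next case 5 show ?thesis unfolding 5 by (rule up[OF oD]) (use DI[of "[]" 0] in auto)
    next case 2 show ?thesis unfolding 2 by (rule up[OF oL]) simp
    next case 3 show ?thesis unfolding 3 by (rule up[OF oU]) simp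
    next case 4 show ?thesis unfolding 4 by (rule up[OF oI]) simp
    qed
  qed (use kbig Z0 in auto)
  have tb: "be p = be (fst p, 0)" for p unfolding be_def using b_space[of "fst p" "snd p" 0] by simp
  have te: "Ew l p = Ew l (fst p, 0)" for p by (simp add: Ew_def Xi_def)
  have "kq 33 be" unfolding kd_def
  proof
    have "wq l (\<lambda>p. (be p)^2) = IQ A T (\<lambda>p. (Ew l (fst p, 0))^2 * (be (fst p, 0))^2)"
      unfolding wq_def by (subst te, subst tb) (rule refl)
    also have "\<dots> = T * wo l (\<lambda>p. (be p)^2)" unfolding wo_def
      by (rule IQ_space_only) (rule cont_wo, intro continuous_intros conts2)
    also have "\<dots> \<le> k * (k ^ 32 * Z)" using kdD(2)[OF ob] T_le k0 T_pos Z0 by (intro mult_mono) (auto intro!: posfun.L_nonneg[OF posfun_wo] continuous_intros)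
    finally show "wq l (\<lambda>p. (be p)^2) \<le> k ^ 33 * Z" by (simp add: eval_nat_numeral mult.assoc)
  qed simp
  note bb = this
  have "kq (2 * 25 + 2 + 33) (\<lambda>p. zt p + lapl z2 p)"
  proof (rule kq_comb[where gs="[sz, z, sU, In, be, Nf, N [et]]"])
    show "contQ (\<lambda>p. zt p + lapl z2 p)" by (intro continuous_intros c2 conts2)
    fix g assume "g \<in> set [sz, z, sU, In, be, Nf, N [et]]"
    then show "kq 33 g" using kq_basic[THEN kq_up] kq_In[THEN kq_up] kq_sU[THEN kq_up] bb by auto
  next
    fix p assume p: "p \<in> cQ"
    show "\<bar>zt p + lapl z2 p\<bar> \<le> k ^ 25 * (\<Sum>g\<leftarrow>[sz, z, sU, In, be, Nf, N [et]]. \<bar>g p\<bar>)"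
      by (rule heat_z_sm[OF p _ _ _ _ _ _ _ rel[OF p], unfolded sm_def]) (use s_ge(1,2)[of _ p] in \<open>simp_all add: abs_le_add\<close>)
  qed simp
  then show ?thesis by simp
qed

lemma kq_Lw:
  assumes L: "wq l (\<lambda>p. (lapl z2 p)^2) \<le> Z"
    and rel: "\<And>p. p \<in> cQ \<Longrightarrow> (\<Sum>i\<in>UNIV. U [e i, e i, et] p) = J p * lapl z2 p + 2 * (\<Sum>i\<in>UNIV. J1 i p * z1 i p) + lapl J2 p * z p"
    and c2: "contQ (lapl z2)"
  shows "kq (2 * 8 + 2 + 1) Lw"
proof (rule kq_comb[where gs="[lapl z2, sz, z]"])
  have kl: "kq 0 (lapl z2)" using L c2 by (simp add: kd_def)
  show "kq 1 g" if "g \<in> set [lapl z2, sz, z]" for g using that kq_basic[THEN kq_up] kl[THEN kq_up] by auto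
  fix p assume p: "p \<in> cQ"
  show "\<bar>Lw p\<bar> \<le> k ^ 8 * (\<Sum>g\<leftarrow>[lapl z2, sz, z]. \<bar>g p\<bar>)"
    by (rule Lw_sm[OF p _ _ _ rel[OF p], unfolded sm_def]) (use s_ge(1)[of _ p] in \<open>simp_all add: abs_le_add\<close>)
qed simp_all

lemma kq_n_eq:
  assumes L: "wq l (\<lambda>p. (lapl z2 p)^2) \<le> Z" and gn: "wq l gn \<le> Z" and rel: "\<And>p. p \<in> cQ \<Longrightarrow> U [et, et] p = J p * zt p + Jt p * z p"
     "\<And>p. p \<in> cQ \<Longrightarrow> (\<Sum>i\<in>UNIV. U [e i, e i, et] p) = J p * lapl z2 p + 2 * (\<Sum>i\<in>UNIV. J1 i p * z1 i p) + lapl J2 p * z p"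
    and c2: "contQ (lapl z2)"
  shows "kq 108 (\<lambda>p. N [et, et] p - Ln p)"
proof -
  have kl: "kq 0 (lapl z2)" using L c2 by (simp add: kd_def)
  have sn1: "kq 1 sn" using kd_sum_sq[where g="\<lambda>i. N [e i, et]" and n=0, OF posfun_wq _ sn_def] gn Z0 by (simp add: gn_def)
  have "kq (1 + 3) (N [e i])" for i
  proof (rule kq_time[OF hpd_UN_time(2)[where vs="[e i]", simplified], where m=0])
    have "\<bar>N [e i, et] p\<bar> \<le> \<bar>sn p\<bar>" for p
      unfolding sn_def by (rule order_trans[OF _ abs_ge_self]) (rule member_le_sum, auto)
    then show "kq 1 (N [e i, et])" by (intro kd_comp_le[OF posfun_wq sn1]) auto
  qed (use DI[of "[i]" 0] in \<open>auto simp: in_dl\<close>)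
  then have "kq (4 + 2) sN" unfolding sN_def[abs_def] by (intro kd_sum posfun_wq Z0) simp
  note sN1 = this[simplified]
  note Lw1 = kq_Lw[OF L rel(2) c2]
  have "kq (19 + 3) LU"
  proof (rule kq_time[OF _ Lw1[simplified], where m=2])
    show "hpdQ et LU Lw" unfolding LU_def[abs_def] Lw_def[abs_def]
      by (rule hpd_sum) (rule hpd_UN_time(1)[where vs="[e i, e i]" for i, simplified], auto simp: in_dl)
    have t0: "0 \<in> {0..T}" using T_pos by simp
    have "kd k cQ (\<lambda>f. IO A (\<lambda>x. f (x, 0))) D 0 (U [e i, e i])" for i
      using DI[of "[i, i]" 0] by (simp add: kd_def)
    from kdD(2)[OF kd_sum(1)[OF posfun_IO[OF t0] this D0]]
    have "IO A (\<lambda>x. (\<Sum>i\<in>UNIV. U [e i, e i] (x, 0))^2) \<le> k ^ (0 + 2) * D" .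
    then show "IO A (\<lambda>x. (LU (x, 0))^2) \<le> k ^ 2 * D" unfolding LU_def add_0 .
  qed simp_all
  note LU1 = this[simplified]
  have "kq (2 * 42 + 2 + 22) (\<lambda>p. N [et, et] p - Ln p)"
  proof (rule kq_comb[where gs="[N [et], Nf, sU, sz, z, sn, sN, LU, lapl z2]"])
    show "contQ (\<lambda>p. N [et, et] p - Ln p)" by (intro continuous_intros conts conts2)
    fix g assume "g \<in> set [N [et], Nf, sU, sz, z, sn, sN, LU, lapl z2]"
    then show "kq 22 g" using kq_basic[THEN kq_up] kl[THEN kq_up] kq_sU[THEN kq_up] sn1[THEN kq_up] sN1[THEN kq_up] LU1 by auto
  next
    fix p assume p: "p \<in> cQ"
    let ?S = "\<Sum>g\<leftarrow>[N [et], Nf, sU, sz, z, sn, sN, LU, lapl z2]. \<bar>g p\<bar>"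
    note s = s_ge[of _ p]
    have "sm 8 ?S (Lw p)" by (rule Lw_sm[OF p _ _ _ rel(2)[OF p]]) (use s in \<open>simp_all add: abs_le_add\<close>)
    note h = this
    show "\<bar>N [et, et] p - Ln p\<bar> \<le> k ^ 42 * ?S"
      by (rule heat_n_sm[OF p _ _ _ _ _ _ _ _ h, unfolded sm_def]) (use s in \<open>simp_all add: abs_le_add\<close>)
  qed simp
  then show ?thesis by simp
qed

end
end
end

context mfg_data
begin

section \<open>Lateral terms and values at the ends of the time interval\<close>

lemma sum_UNIV_le: "0 \<le> x \<Longrightarrow> (\<Sum>j\<in>(UNIV :: 'a set). x) \<le> k * x"
  using mult_right_mono[OF card_le, of x] by simp

lemma kd_sq_sum:
  assumes L: "posfun cQ L" and f: "kd k cQ L D n f" and g: "\<And>i. kd k cQ L D n (g i)"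
    and h: "kd k cQ L D n h"
  shows "L (\<lambda>p. (f p)^2 + grad2 g p + (h p)^2) \<le> k ^ (n + 2) * D"
proof -
  interpret L: posfun "cQ" L by (rule L)
  note c = kdD(1)[OF f] kdD(1)[OF g] kdD(1)[OF h]
  have cg: "contQ (grad2 g)" unfolding grad2_def[abs_def] by (intro continuous_intros c)
  have X: "0 \<le> k ^ n * D" using k0 D0 by simp
  have G: "L (grad2 g) \<le> k * (k ^ n * D)"
  proof -
    have "L (grad2 g) = (\<Sum>i\<in>UNIV. L (\<lambda>p. (g i p)^2))" unfolding grad2_def[abs_def]
      by (rule L.L_sum) (auto intro!: continuous_intros c)
    also have "\<dots> \<le> (\<Sum>i\<in>(UNIV :: 'a set). k ^ n * D)" by (intro sum_mono kdD(2)[OF g])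
    also have "\<dots> \<le> k * (k ^ n * D)" by (rule sum_UNIV_le[OF X])
    finally show ?thesis .
  qed
  have "L (\<lambda>p. (f p)^2 + grad2 g p + (h p)^2) = L (\<lambda>p. (f p)^2) + L (grad2 g) + L (\<lambda>p. (h p)^2)"
    by (simp add: L.L_add c cg continuous_intros)
  also have "\<dots> \<le> k ^ n * D + k * (k ^ n * D) + k ^ n * D" by (intro add_mono kdD(2)[OF f] kdD(2)[OF h] G)
  also have "\<dots> \<le> 3 * (k * (k ^ n * D))"
  proof -
    have "x + k * x + x \<le> 3 * (k * x)" if "0 \<le> x" for x using mult_right_mono[OF k_ge that] by simp
    then show ?thesis using X .
  qed
  also have "\<dots> \<le> k * (k * (k ^ n * D))" using kbig X by (intro mult_right_mono) auto
  finally show ?thesis by simp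
qed

lemma Lat_le:
  assumes "\<And>j \<sigma>. \<sigma> \<in> {-1, 1} \<Longrightarrow> IB A T j \<sigma> (bdens f f1 ft) \<le> k ^ n * D"
  shows "Lat f f1 ft \<le> k ^ (n + 2) * D"
proof -
  have X: "0 \<le> k ^ n * D" using k0 D0 by simp
  have "Lat f f1 ft \<le> (\<Sum>j\<in>(UNIV :: 'a set). k ^ n * D + k ^ n * D)"
    unfolding Lat_def by (intro sum_mono add_mono assms) auto
  also have "\<dots> \<le> k * (2 * (k ^ n * D))" unfolding mult_2 using X by (intro sum_UNIV_le add_nonneg_nonneg)
  also have "\<dots> \<le> k * (k * (k ^ n * D))" using kbig X k0 by (intro mult_left_mono mult_right_mono) auto
  finally show ?thesis by simp
qed

text \<open>Valid for any positive functional, in particular for the integral over a face, where the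
  time derivative of \<open>U\<close> and its derivatives are data: the quotient rule only needs the
  bounds of \<open>J\<close> and its derivatives and the lower bound of \<open>J\<close>.\<close>

lemma kd_z:
  assumes L: "posfun cQ L" and U: "kd k cQ L D 0 (U [et])" "\<And>i. kd k cQ L D 0 (U [e i, et])" "kd k cQ L D 0 (U [et, et])"
  shows "kd k cQ L D 10 z" "kd k cQ L D 10 (z1 i)" "kd k cQ L D 10 zt"
proof -
  note comb = posfun.kd_comb[OF L k_ge _ _ _ _ D0]
  have zb: "\<bar>z p\<bar> \<le> k * \<bar>U [et] p\<bar>" if "p \<in> cQ" for p unfolding z_def by (rule divJ[OF that])
  have "kd k cQ L D (2 * 1 + 2 + 0) z"
    by (rule comb[where gs="[U [et]]"]) (use zb kbig U in auto)
  then have z4: "kd k cQ L D 4 z" by simp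
  show "kd k cQ L D 10 z" by (rule kd_up[OF z4 k_ge D0]) simp
  have b: "\<bar>(w - z p * j) / J p\<bar> \<le> k ^ 2 * (\<bar>w\<bar> + \<bar>z p\<bar>)" if p: "p \<in> cQ" and j: "\<bar>j\<bar> \<le> k" for w p j
  proof -
    have "\<bar>z p * j\<bar> \<le> k * \<bar>z p\<bar>" using j by (simp add: abs_mult mult.commute mult_right_mono)
    then have "\<bar>w - z p * j\<bar> \<le> k * \<bar>w\<bar> + k * \<bar>z p\<bar>" using mult_right_mono[OF k_ge, of "\<bar>w\<bar>"] by linarith
    then have "k * \<bar>w - z p * j\<bar> \<le> k * (k * \<bar>w\<bar> + k * \<bar>z p\<bar>)" using k0 by (rule mult_left_mono)
    then show ?thesis using divJ[OF p, of "w - z p * j"] by (simp add: power2_eq_square algebra_simps)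
  qed
  have b1: "\<bar>z1 i p\<bar> \<le> k ^ 2 * (\<bar>U [e i, et] p\<bar> + \<bar>z p\<bar>)" and b2: "\<bar>zt p\<bar> \<le> k ^ 2 * (\<bar>U [et, et] p\<bar> + \<bar>z p\<bar>)"
    if "p \<in> cQ" for p i
    unfolding z1_def zt_def using J_le[OF that] by (intro b[OF that]; simp)+
  have "kd k cQ L D (2 * 2 + 2 + 4) (z1 i)"
    by (rule comb[where gs="[U [e i, et], z]"]) (use b1 kbig kd_up[OF U(2) k_ge D0] z4 in auto)
  then show "kd k cQ L D 10 (z1 i)" by simp
  have "kd k cQ L D (2 * 2 + 2 + 4) zt"
    by (rule comb[where gs="[U [et, et], z]"]) (use b2 kbig kd_up[OF U(3) k_ge D0] z4 in auto)
  then show "kd k cQ L D 10 zt" by simp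
qed

lemma Lat_z: "Lat z z1 zt \<le> k ^ 14 * D" and Lat_N: "Lat (N [et]) (\<lambda>i. N [e i, et]) (N [et, et]) \<le> k ^ 4 * D"
proof -
  have "Lat z z1 zt \<le> k ^ (12 + 2) * D"
  proof (rule Lat_le)
    fix j and \<sigma> :: real assume s: "\<sigma> \<in> {-1, 1}"
    have "IB A T j \<sigma> (\<lambda>p. (z p)^2 + grad2 z1 p + (zt p)^2) \<le> k ^ (10 + 2) * D"
      by (intro kd_sq_sum[OF posfun_IB[OF s]] kd_z[OF posfun_IB[OF s]]) (use DL[OF s] in \<open>auto simp: kd_def\<close>)
    then show "IB A T j \<sigma> (bdens z z1 zt) \<le> k ^ 12 * D" by (simp add: bdens_def[abs_def])
  qed
  then show "Lat z z1 zt \<le> k ^ 14 * D" by simp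
  have "Lat (N [et]) (\<lambda>i. N [e i, et]) (N [et, et]) \<le> k ^ (2 + 2) * D"
  proof (rule Lat_le)
    fix j and \<sigma> :: real assume s: "\<sigma> \<in> {-1, 1}"
    have "IB A T j \<sigma> (\<lambda>p. (N [et] p)^2 + grad2 (\<lambda>i. N [e i, et]) p + (N [et, et] p)^2) \<le> k ^ (0 + 2) * D"
      by (intro kd_sq_sum[OF posfun_IB[OF s]]) (use DL[OF s] in \<open>auto simp: kd_def\<close>)
    then show "IB A T j \<sigma> (bdens (N [et]) (\<lambda>i. N [e i, et]) (N [et, et])) \<le> k ^ 2 * D" by (simp add: bdens_def[abs_def] power2_eq_square)
  qed
  then show "Lat (N [et]) (\<lambda>i. N [e i, et]) (N [et, et]) \<le> k ^ 4 * D" by simp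
qed

text \<open>\<open>Xs\<close> adds up all differences that are data at the times 0 and
  \<open>T\<close>: spatial derivatives up to order three of both unknowns, and the interaction of
  \<open>N\<close> with its gradient. Pointwise bounds relative to \<open>Xs\<close> hold at all
  times, but are integrated only at the ends.\<close>

definition XU where "XU p = (\<Sum>is\<in>{is. length is \<le> 3}. \<bar>U (map e is) p\<bar>)"
definition XN where "XN p = (\<Sum>is\<in>{is. length is \<le> 3}. \<bar>N (map e is) p\<bar>)"
definition X1 where "X1 p = (\<Sum>i\<in>UNIV. \<bar>IN1 i p\<bar>)"
definition Xs where "Xs p = XU p + XN p + \<bar>IN p\<bar> + X1 p"

lemma fin3: "finite {is :: 'a list. length is \<le> 3}"
  using finite_lists_length_le[of "UNIV :: 'a set" 3] by simp

lemma mape_dl: "length is \<le> 6 \<Longrightarrow> map e is \<in> dl 6"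
  by (intro in_dl) (auto simp: comp_def sum_list_triv)

lemma cont_mape: "length is \<le> 3 \<Longrightarrow> contQ (U (map e is)) \<and> contQ (N (map e is))"
  using mape_dl[of "is"] by (auto intro!: cont_UN)

lemma X_nonneg: "0 \<le> XU p" "0 \<le> XN p" "0 \<le> X1 p"
  by (auto simp: XU_def XN_def X1_def intro!: sum_nonneg)

lemma Xs_ge: "length is \<le> 3 \<Longrightarrow> \<bar>U (map e is) p\<bar> \<le> Xs p" "length is \<le> 3 \<Longrightarrow> \<bar>N (map e is) p\<bar> \<le> Xs p"
  "\<bar>IN p\<bar> \<le> Xs p" "\<bar>IN1 j p\<bar> \<le> Xs p"
proof -
  have "\<bar>U (map e is) p\<bar> \<le> XU p" "\<bar>N (map e is) p\<bar> \<le> XN p" if "length is \<le> 3"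
    unfolding XU_def XN_def using that by (intro member_le_sum[of "is"] fin3; simp)+
  moreover have "\<bar>IN1 j p\<bar> \<le> X1 p" unfolding X1_def by (rule member_le_sum) auto
  ultimately show "length is \<le> 3 \<Longrightarrow> \<bar>U (map e is) p\<bar> \<le> Xs p" "length is \<le> 3 \<Longrightarrow> \<bar>N (map e is) p\<bar> \<le> Xs p"
    "\<bar>IN p\<bar> \<le> Xs p" "\<bar>IN1 j p\<bar> \<le> Xs p"
    unfolding Xs_def using X_nonneg[of p] by linarith+
qed

lemma Xs_nonneg: "0 \<le> Xs p" using Xs_ge(3)[of p] by linarith

lemma hpd_IN: "hpdQ (e j) IN (IN1 j)"
  unfolding IN1_def by (rule hpd_Inter[OF ker conts(17) conts(8) hpd_UN(2)[where vs="[]"]]) (simp add: in_dl)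

lemma cont_IN1: "contQ (IN1 j)"
  unfolding IN1_def by (rule cont_Inter1[OF ker conts(17) conts(8)])

abbreviation "kt t \<equiv> kd k cQ (\<lambda>f. IO A (\<lambda>x. f (x, t))) D"

lemma kt_comb:
  assumes "t \<in> {0, T}" "\<And>g. g \<in> set gs \<Longrightarrow> kt t n g" "contQ f"
    "\<And>p. p \<in> cQ \<Longrightarrow> \<bar>f p\<bar> \<le> k ^ c * (\<Sum>g\<leftarrow>gs. \<bar>g p\<bar>)" "length gs \<le> 1000"
  shows "kt t (2 * c + 2 + n) f"
  by (rule posfun.kd_comb[OF posfun_IO k_ge _ assms(2-4) D0]) (use assms(1,5) kbig T_pos in auto)

lemma kt_Xs:
  assumes t: "t \<in> {0, T}"
  shows "kt t 7 Xs"
proof -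
  have t': "t \<in> {0..T}" using t T_pos by auto
  note P = posfun_IO[OF t']
  note up = kd_up[OF _ k_ge D0]
  have a: "kt t 0 (N (map e is))" "kt t 0 (U (map e is))" if "length is \<le> 3" for "is"
    using DI[OF that t] cont_mape[OF that] by (auto simp: kd_def)
  have cX: "contQ XU" "contQ XN"
    unfolding XU_def[abs_def] XN_def[abs_def] by (intro continuous_intros; simp add: cont_mape)+
  have XU: "kt t (2 * 0 + 2 + 0) XU"
    by (rule posfun.kd_comb_set[OF P k_ge card3_le fin3 _ cX(1) _ D0, where g="\<lambda>is. U (map e is)"])
       (use a(2) X_nonneg in \<open>auto simp: XU_def\<close>)
  have XN: "kt t (2 * 0 + 2 + 0) XN"
    by (rule posfun.kd_comb_set[OF P k_ge card3_le fin3 _ cX(2) _ D0, where g="\<lambda>is. N (map e is)"])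
       (use a(1) X_nonneg in \<open>auto simp: XN_def\<close>)
  have n0: "kt t 0 Nf" and n1: "kt t 0 (N [e ix1])" using a(1)[of "[]"] a(1)[of "[ix1]"] by auto
  have IN: "kt t 1 IN" using kd_Inter_IO[OF t' n0] by simp
  have ilk: "il2 * M^2 \<le> k" using il2_le mult_nonneg_nonneg[OF il2_nonneg, of "M^2"] by simp
  have SV: "kt t 1 (SK \<kappa> g)" "kt t 1 (VK \<kappa> g)" if c: "continuous_on cOO \<kappa>" and b: "\<And>q. q \<in> cOO \<Longrightarrow> \<bar>\<kappa> q\<bar> \<le> M" and g: "kt t 0 g" for \<kappa> g
  proof -
    note cg = kdD(1)[OF g]
    have "il2 * M^2 * IO A (\<lambda>x. (g (x, t))^2) \<le> k * D"
      using kdD(2)[OF g] k0 by (intro mult_mono ilk) (auto intro!: O.L_nonneg continuous_intros cont_at_time[OF cg t'])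
    then show "kt t 1 (SK \<kappa> g)" "kt t 1 (VK \<kappa> g)"
      using SVK_L2[OF c cg t' order_refl b] cont_SK[OF c cg] cont_VK[OF c cg] by (auto simp: kd_def Ew_def)
  qed
  have I1: "kt t (2 * 0 + 2 + 1) (IN1 i)" for i
  proof (rule kt_comb[OF t, where gs="[SK (\<kappa>1x i) Nf, SK \<kappa>1y Nf, SK \<kappa>1 (N [e ix1]), VK (\<kappa>2x i) Nf, SK \<kappa>2 Nf]"])
    show "kt t 1 g" if "g \<in> set [SK (\<kappa>1x i) Nf, SK \<kappa>1y Nf, SK \<kappa>1 (N [e ix1]), VK (\<kappa>2x i) Nf, SK \<kappa>2 Nf]" for g
      using that SV kern1D[OF ker(1)] kern1D[OF ker(2)] ker_le n0 n1 by auto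
    show "\<bar>IN1 i p\<bar> \<le> k ^ 0 * (\<Sum>g\<leftarrow>[SK (\<kappa>1x i) Nf, SK \<kappa>1y Nf, SK \<kappa>1 (N [e ix1]), VK (\<kappa>2x i) Nf, SK \<kappa>2 Nf]. \<bar>g p\<bar>)" for p
      using del1_cases[of i] by (auto simp: IN1_def Inter1_def)
  qed (auto intro: cont_IN1)
  have X1: "kt t (3 + 2) X1" unfolding X1_def[abs_def]
    by (rule kd_sum(2)[OF P up[OF I1] D0]) simp
  have "kt t (2 * 0 + 2 + 5) Xs"
  proof (rule kt_comb[OF t, where gs="[XU, XN, IN, X1]"])
    show "kt t 5 g" if "g \<in> set [XU, XN, IN, X1]" for g using that XU[THEN up] XN[THEN up] IN[THEN up] X1 by auto
    show "contQ Xs" unfolding Xs_def[abs_def]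
      by (intro continuous_intros kdD(1)[OF XU] kdD(1)[OF XN] kdD(1)[OF X1] conts2)
  qed (use X_nonneg in \<open>auto simp: Xs_def\<close>)
  then show ?thesis by simp
qed

lemma dif_UN:
  assumes p: "p \<in> cQ" and l: "length is \<le> 3"
  shows "dif 1 (Xs p) (dd (map e is) u1 p) (dd (map e is) u2 p)" "dif 1 (Xs p) (dd (map e is) m1 p) (dd (map e is) m2 p)"
proof -
  have v: "map e is \<in> dl 6" using l by (intro mape_dl) simp
  note s = sm_up[OF sm_0 Xs_nonneg, of _ p 1]
  show "dif 1 (Xs p) (dd (map e is) u1 p) (dd (map e is) u2 p)" "dif 1 (Xs p) (dd (map e is) m1 p) (dd (map e is) m2 p)"
    using Xs_ge(1,2)[OF l, of p] by (intro dif_bnd[OF v p] s; simp)+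
qed

lemma dif_UNs:
  assumes p: "p \<in> cQ"
  shows "dif 1 (Xs p) (m1 p) (m2 p)" "dif 1 (Xs p) (dd [e i] u1 p) (dd [e i] u2 p)" "dif 1 (Xs p) (dd [e i] m1 p) (dd [e i] m2 p)"
    "dif 1 (Xs p) (dd [e i, e j] u1 p) (dd [e i, e j] u2 p)" "dif 1 (Xs p) (dd [e i, e j] m1 p) (dd [e i, e j] m2 p)"
    "dif 1 (Xs p) (dd [e i, e j, e l] u1 p) (dd [e i, e j, e l] u2 p)" "dif 1 (Xs p) (dd [e i, e j, e l] m1 p) (dd [e i, e j, e l] m2 p)"
  using dif_UN[OF p, of "[]"] dif_UN[OF p, of "[i]"] dif_UN[OF p, of "[i, j]"] dif_UN[OF p, of "[i, j, l]"]
  by (simp_all add: pds_Nil)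

text \<open>The second equation, solved for the time derivative of \<open>m\<close>, contains
  spatial derivatives of \<open>u\<close> and \<open>m\<close> of order at most two and not the
  coefficient \<open>b\<close>; both solutions are then compared factor by factor.\<close>

lemma N_time_sm:
  assumes p: "p \<in> cQ"
  shows "sm 22 (Xs p) (N [et] p)"
proof -
  note S = Xs_nonneg[of p]
  have a: "dif 1 (Xs p) (a0 p) (a0 p)" "dif 1 (Xs p) (a1 i p) (a1 i p)" for i
    using a_le[OF p] by (intro dif_const S; simp)+
  note dm = dif_mult[OF _ _ S] and da = dif_add[OF _ _ S]
  have "dif (1 + 1 + (1 + (1 + 1 + 1) + 1 + (1 + (1 + 1 + 1) + 1) + 1 + 1 + (1 + (1 + (1 + 1) + 1) + 1) + 1) + 1) (Xs p) (dd [et] m1 p) (dd [et] m2 p)"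
  proof -
    have eq: "dd [et] m p = (\<Sum>i\<in>UNIV. dd [e i, e i] m p) + ((\<Sum>i\<in>UNIV. a1 i p * (m p * dd [e i] u p) + a0 p * (dd [e i] m p * dd [e i] u p))
          + a0 p * (m p * (\<Sum>i\<in>UNIV. dd [e i, e i] u p)))" if "sol \<kappa>1 \<kappa>2 a0 a1 s0 b u m" for b u m
      using that p unfolding sol_def by (metis (no_types, lifting) add_diff_cancel_left' add.commute diff_add_cancel eq_iff_diff_eq_0)
    show ?thesis unfolding eq[OF sols(1)] eq[OF sols(2)]
      by (intro da dm dif_sum a dif_UNs[OF p])
  qed
  then show ?thesis unfolding N_def by (rule dif_sm[OF _ S]) simp
qed

text \<open>The same with the second equation differentiated in \<open>x_j\<close>. The third
  derivatives come from the Laplacians of \<open>m\<close> and of \<open>u\<close>, the latter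
  through the divergence term.\<close>

lemma N_space_time_sm:
  assumes p: "p \<in> cQ"
  shows "sm 54 (Xs p) (N [e j, et] p)"
proof -
  note S = Xs_nonneg[of p]
  have a: "dif 1 (Xs p) (a0 p) (a0 p)" "dif 1 (Xs p) (a1 i p) (a1 i p)" "dif 1 (Xs p) (a2 i j p) (a2 i j p)" for i j
    using a_le[OF p] by (intro dif_const S; simp)+
  note dm = dif_mult[OF _ _ S] and da = dif_add[OF _ _ S]
  have eq: "dd [e j, et] m p = (\<Sum>i\<in>UNIV. dd [e j, e i, e i] m p)
       + ((\<Sum>i\<in>UNIV. (a2 i j p * (m p * dd [e i] u p) + a1 i p * (dd [e j] m p * dd [e i] u p + m p * dd [e j, e i] u p))
             + (a1 j p * (dd [e i] m p * dd [e i] u p) + a0 p * (dd [e j, e i] m p * dd [e i] u p + dd [e i] m p * dd [e j, e i] u p)))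
          + (a1 j p * (m p * (\<Sum>i\<in>UNIV. dd [e i, e i] u p))
            + a0 p * (dd [e j] m p * (\<Sum>i\<in>UNIV. dd [e i, e i] u p) + m p * (\<Sum>i\<in>UNIV. dd [e j, e i, e i] u p))))"
    if "sol \<kappa>1 \<kappa>2 a0 a1 s0 b u m" "C_par A T 3 u" "C_par A T 3 m" for b u m
    using sol_space_m[OF that a_hpd(1,2) p, of j] by linarith
  have "dif (1 + 1 + (((1 + (1 + 1 + 1) + 1) + (1 + ((1 + 1 + 1) + (1 + 1 + 1) + 1) + 1) + 1)
     + ((1 + (1 + 1 + 1) + 1) + (1 + ((1 + 1 + 1) + (1 + 1 + 1) + 1) + 1) + 1) + 1 + 1
     + ((1 + (1 + (1 + 1) + 1) + 1) + (1 + ((1 + (1 + 1) + 1) + (1 + (1 + 1) + 1) + 1) + 1) + 1) + 1) + 1) (Xs p) (dd [e j, et] m1 p) (dd [e j, et] m2 p)"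
    unfolding eq[OF sols(1) cls(1,3)] eq[OF sols(2) cls(2,4)]
    by (intro da dm dif_sum a dif_UNs[OF p])
  then show ?thesis unfolding N_def by (rule dif_sm[OF _ S]) simp
qed

end

context mfg_data
begin

section \<open>The jump of the quotient between the two ends, and application of the core
  estimate\<close>

definition Yd where
  "Yd j p = (\<Sum>i\<in>UNIV. U [e j, e i, e i] p)
     - (a1 j p * (\<Sum>i\<in>UNIV. (1/2) * ((dd [e i] u1 p)^2 - (dd [e i] u2 p)^2))
        + a0 p * (\<Sum>i\<in>UNIV. (1/2) * (2 * (dd [e i] u1 p * dd [e j, e i] u1 p) - 2 * (dd [e i] u2 p * dd [e j, e i] u2 p))))
     + (bd1 j p * IN p + b1 p * IN1 j p) + (s1 j p * Nf p + s0 p * N [e j] p)"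

lemma dd_hpd:
  assumes "C_par A T 3 u"
  shows "hpdQ (e j) (dd [e i] u) (dd [e j, e i] u)" "contQ (dd [e i] u)" "contQ (dd [e i, e j] u)"
  using C_par_hpd[OF assms, of "e j" "[e i]"] C_par_cont[OF assms, of "[e i]"] C_par_cont[OF assms, of "[e i, e j]"] by (auto simp: in_dl)

lemma hpd_Y: "hpdQ (e j) Y (Yd j)"
proof -
  have "hpdQ (e j) (\<lambda>p. \<Sum>i\<in>UNIV. U [e i, e i] p) (\<lambda>p. \<Sum>i\<in>UNIV. U [e j, e i, e i] p)"
    by (rule hpd_sum) (simp add: hpd_UN in_dl)
  note L = this
  have "hpdQ (e j) (N []) (N [e j])" by (rule hpd_UN) (simp add: in_dl)
  note nn = this
  show ?thesis
    unfolding Y_def[abs_def] Yd_def[abs_def] LU_def[abs_def]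
    by (rule hpd_add[OF hpd_add[OF hpd_diff[OF L hpd_mult[OF a_hpd(1) hpd_sum[OF hpd_cmult[OF
          hpd_diff[OF hpd_square[OF dd_hpd(1)[OF cls(1)]] hpd_square[OF dd_hpd(1)[OF cls(2)]]]]]]]
          hpd_mult[OF b_hpd(1) hpd_IN]] hpd_mult[OF s_hpd(2) nn]])
qed

lemma cont_Y: "contQ Y" "contQ (Yd j)"
  unfolding Y_def[abs_def] Yd_def[abs_def]
  by (intro continuous_intros dd_hpd cls conts conts2 a_cont b_cont s_cont cont_IN1)+

lemma Yd_sm:
  assumes p: "p \<in> cQ"
  shows "sm 12 (Xs p) (Y p)" "sm 22 (Xs p) (Yd j p)"
proof -
  note S = Xs_nonneg[of p]
  note sa = sm_add[OF _ _ S] and sd = sm_diff[OF _ _ S] and D = dif_UNs[OF p]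
  have s0: "sm 0 (Xs p) x" if "\<bar>x\<bar> \<le> Xs p" for x using that by (simp add: sm_def)
  have sU: "sm 0 (Xs p) (U [e i, e i] p)" "sm 0 (Xs p) (U [e j, e i, e i] p)" "sm 0 (Xs p) (N [e i] p)" "sm 0 (Xs p) (Nf p)"
    "sm 0 (Xs p) (IN p)" "sm 0 (Xs p) (IN1 i p)" for i
    using Xs_ge(1)[of "[i, i]" p] Xs_ge(1)[of "[j, i, i]" p] Xs_ge(2)[of "[i]" p] Xs_ge(2)[of "[]" p] Xs_ge(3)[of p] Xs_ge(4)[of i p]
    by (auto intro!: s0)
  have d3: "sm (1 + 1 + 1) (Xs p) (dd [e i] u1 p * dd [e i] u1 p - dd [e i] u2 p * dd [e i] u2 p)"
    "sm (1 + 1 + 1) (Xs p) (dd [e i] u1 p * dd [e j, e i] u1 p - dd [e i] u2 p * dd [e j, e i] u2 p)" for i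
    by (intro dif_sm[OF dif_mult[OF D(2) D(2) S] S] dif_sm[OF dif_mult[OF D(2) D(4) S] S]; simp)+
  have half: "\<bar>1/2\<bar> \<le> k" using k_ge by simp
  have q1: "sm (1 + 1 + 1 + 1) (Xs p) ((1/2) * ((dd [e i] u1 p)^2 - (dd [e i] u2 p)^2))" for i
    unfolding power2_eq_square by (rule sm_mult[OF half d3(1)])
  have q2: "sm (1 + 1 + 1) (Xs p) ((1/2) * (2 * (dd [e i] u1 p * dd [e j, e i] u1 p) - 2 * (dd [e i] u2 p * dd [e j, e i] u2 p)))" for i
  proof -
    have "(1/2) * (2 * a - 2 * b) = a - b" for a b :: real by simp
    then show ?thesis using d3(2)[of i] by (simp only:)
  qed
  have c: "\<bar>a0 p\<bar> \<le> k" "\<bar>a1 j p\<bar> \<le> k" "\<bar>b1 p\<bar> \<le> k" "\<bar>bd1 j p\<bar> \<le> k" "\<bar>s0 p\<bar> \<le> k" "\<bar>s1 j p\<bar> \<le> k"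
    using a_le[OF p] b_le[OF p] s_le[OF p] by auto
  have "sm (0 + 1 + (1 + 1 + 1 + 1 + 1 + 1) + 1 + (0 + 1) + 1 + (0 + 1) + 1) (Xs p) (Y p)"
    unfolding Y_def LU_def by (intro sa sd sm_sum sm_mult c q1 sU)
  then show "sm 12 (Xs p) (Y p)" by (rule sm_up[OF _ S]) simp
  have "sm (0 + 1 + ((1 + 1 + 1 + 1 + 1 + 1) + (1 + 1 + 1 + 1 + 1) + 1) + 1 + ((0 + 1) + (0 + 1) + 1) + 1 + ((0 + 1) + (0 + 1) + 1) + 1) (Xs p) (Yd j p)"
    unfolding Yd_def by (intro sa sd sm_sum sm_mult c q1 q2 sU)
  then show "sm 22 (Xs p) (Yd j p)" by (rule sm_up[OF _ S]) simp
qed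

definition y where "y p = Y p / J p"
definition y1 where "y1 j p = (Yd j p - Y p / J p * J1 j p) / J p"

lemma y_sm:
  assumes p: "p \<in> cQ"
  shows "sm 13 (Xs p) (y p)" "sm 38 (Xs p) (y1 j p)"
proof -
  note S = Xs_nonneg[of p]
  have dv: "sm (c + 1) (Xs p) (x / J p)" if "sm c (Xs p) x" for c x
    unfolding sm_def using divJ[OF p, of x] mult_left_mono[OF that[unfolded sm_def] k0] by (simp add: mult.assoc)
  have "sm (12 + 1) (Xs p) (Y p / J p)" by (rule dv[OF Yd_sm(1)[OF p]])
  then show "sm 13 (Xs p) (y p)" by (simp add: y_def)
  note y13 = this
  have j: "\<bar>J1 j p\<bar> \<le> k" using J_le[OF p] by simp
  have "sm (22 + (13 + 1) + 1 + 1) (Xs p) ((Yd j p - J1 j p * y p) / J p)"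
    by (intro dv sm_diff[OF _ _ S] Yd_sm(2)[OF p] sm_mult[OF j] y13)
  then show "sm 38 (Xs p) (y1 j p)" by (simp add: y1_def y_def mult.commute)
qed

lemma cont_y: "contQ y" "contQ (y1 j)"
  unfolding y_def[abs_def] y1_def[abs_def]
  by (intro continuous_intros cont_Y smooth21D[OF J_smooth] ballI J_nz; assumption)+

lemma kt_sm:
  assumes t: "t \<in> {0, T}" and f: "contQ f" "\<And>p. p \<in> cQ \<Longrightarrow> sm c (Xs p) (f p)"
  shows "kt t (2 * c + 9) f"
proof -
  have "kt t (2 * c + 2 + 7) f"
    by (rule kt_comb[OF t, where gs="[Xs]"]) (use kt_Xs[OF t] f Xs_nonneg in \<open>auto simp: sm_def\<close>)
  moreover have "2 * c + 2 + 7 = 2 * c + 9" by simp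
  ultimately show ?thesis by (simp only:)
qed

lemma N_at_ends:
  assumes t: "t \<in> {0, T}"
  shows "IO A (\<lambda>x. (N [et] (x, t))^2 + grad2 (\<lambda>i. N [e i, et]) (x, t)) \<le> k ^ 119 * D"
proof -
  have t': "t \<in> {0..T}" using t T_pos by auto
  note up = kd_up[OF _ k_ge D0]
  have a: "kt t 117 (N [et])" "kt t 117 (N [e i, et])" "kt t 117 (\<lambda>_. 0)" for i
  proof -
    show "kt t 117 (N [et])" by (rule up[OF kt_sm[OF t _ N_time_sm]]) simp_all
    have "kt t (2 * 54 + 9) (N [e i, et])" by (rule kt_sm[OF t _ N_space_time_sm]) simp_all
    then show "kt t 117 (N [e i, et])" by simp
    show "kt t 117 (\<lambda>_. 0)" using k0 D0 O.L_zero by (simp add: kd_def)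
  qed
  have "IO A (\<lambda>x. (N [et] (x, t))^2 + grad2 (\<lambda>i. N [e i, et]) (x, t) + 0^2) \<le> k ^ (117 + 2) * D"
    by (rule kd_sq_sum[OF posfun_IO[OF t'] a])
  then show ?thesis by simp
qed

text \<open>Subtracting \<open>z + be + y = 0\<close> at the two times removes \<open>be\<close>.
  For the gradient the identity is differentiated in \<open>x_j\<close> beforehand, and the
  derivative of the coefficient cancels for the same reason; \<open>y\<close> and \<open>y1\<close>
  are data at both ends.\<close>

lemma z_jump:
  assumes zs: "smooth21 z z1 z2 zt z1t"
  shows "IO A (\<lambda>x. (z (x, T) - z (x, 0))^2 + (\<Sum>i\<in>UNIV. (z1 i (x, T) - z1 i (x, 0))^2)) \<le> k ^ 90 * D"
proof -
  have hz: "z1 j p + (bd1 j p - bd2 j p) + y1 j p = 0" if p: "p \<in> cQ" for j p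
  proof -
    have hy: "hpdQ (e j) (\<lambda>p. Y p / J p) (y1 j)" unfolding y1_def[abs_def]
      by (rule hpd_divide[OF hpd_Y smooth21D(1)[OF J_smooth] J_nz])
    have "hpdQ (e j) (\<lambda>p. z p + (b1 p - b2 p) + Y p / J p) (\<lambda>p. z1 j p + (bd1 j p - bd2 j p) + y1 j p)"
      by (intro hpd_add hpd_diff smooth21D(1)[OF zs] b_hpd hy)
    from hpd_zero[OF this _ p] Y_eq show ?thesis by (simp add: be_def)
  qed
  have T: "T \<in> {0, T}" "0 \<in> {0, T}" "T \<in> {0..T}" "0 \<in> {0..T}" using T_pos by auto
  note c = cont_at_time[OF _ T(3)] cont_at_time[OF _ T(4)]
  have eq: "(z (x, T) - z (x, 0))^2 + (\<Sum>i\<in>UNIV. (z1 i (x, T) - z1 i (x, 0))^2)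
     \<le> 2 * ((y (x, T))^2 + grad2 y1 (x, T) + 0^2) + 2 * ((y (x, 0))^2 + grad2 y1 (x, 0) + 0^2)" if x: "x \<in> cOmega A" for x
  proof -
    have p: "(x, T) \<in> cQ" "(x, 0) \<in> cQ" using x T_pos by (auto simp: mem_cQT)
    have sq: "(u - v)^2 \<le> 2 * w^2 + 2 * w'^2" if "u - v = w' - w" for u v w w' :: real
      unfolding that using sum_sq_le2[of w' "- w"] by simp
    have "z (x, T) - z (x, 0) = y (x, 0) - y (x, T)"
      using Y_eq[OF p(1)] Y_eq[OF p(2)] b_space[of x T 0 undefined] unfolding y_def be_def by simp
    note 1 = sq[OF this]
    have "z1 i (x, T) - z1 i (x, 0) = y1 i (x, 0) - y1 i (x, T)" for i
      using hz[OF p(1), of i] hz[OF p(2), of i] b_space[of x T 0 i] by linarith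
    then have "(\<Sum>i\<in>UNIV. (z1 i (x, T) - z1 i (x, 0))^2) \<le> (\<Sum>i\<in>UNIV. 2 * (y1 i (x, T))^2 + 2 * (y1 i (x, 0))^2)"
      by (intro sum_mono sq)
    also have "\<dots> = 2 * grad2 y1 (x, T) + 2 * grad2 y1 (x, 0)" by (simp add: grad2_def sum.distrib sum_distrib_left)
    finally show ?thesis using 1 by simp
  qed
  have b: "IO A (\<lambda>x. (y (x, t))^2 + grad2 y1 (x, t) + 0^2) \<le> k ^ (85 + 2) * D" if t: "t \<in> {0, T}" for t
  proof (rule kd_sq_sum[OF posfun_IO])
    note up = kd_up[OF _ k_ge D0]
    show "t \<in> {0..T}" using t T_pos by auto
    show "kt t 85 y" by (rule up[OF kt_sm[OF t cont_y(1) y_sm(1)]]) simp_all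
    have "kt t (2 * 38 + 9) (y1 i)" for i by (rule kt_sm[OF t cont_y(2) y_sm(2)])
    then show "kt t 85 (y1 i)" for i by simp
    show "kt t 85 (\<lambda>_. 0)" using k0 D0 O.L_zero by (simp add: kd_def)
  qed
  have cy: "contQ (\<lambda>p. (y p)^2 + grad2 y1 p + 0^2)"
    unfolding grad2_def[abs_def] by (intro continuous_intros cont_y)
  have "IO A (\<lambda>x. (z (x, T) - z (x, 0))^2 + (\<Sum>i\<in>UNIV. (z1 i (x, T) - z1 i (x, 0))^2))
     \<le> IO A (\<lambda>x. 2 * ((y (x, T))^2 + grad2 y1 (x, T) + 0^2) + 2 * ((y (x, 0))^2 + grad2 y1 (x, 0) + 0^2))"
    by (rule O.L_mono[OF _ _ eq]) (intro continuous_intros c contz cy; assumption)+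
  also have "\<dots> = 2 * IO A (\<lambda>x. (y (x, T))^2 + grad2 y1 (x, T) + 0^2) + 2 * IO A (\<lambda>x. (y (x, 0))^2 + grad2 y1 (x, 0) + 0^2)"
    by (simp only: O.L_add O.L_cmult c[OF cy] continuous_on_mult_left)
  also have "\<dots> \<le> 4 * (k ^ 87 * D)" using b[OF T(1)] b[OF T(2)] by simp
  also have "\<dots> \<le> k ^ (87 + 1) * D" by (rule numkZ) (use D0 in auto)
  also have "\<dots> \<le> k ^ 90 * D" by (intro mult_right_mono power_increasing k_ge D0) simp
  finally show ?thesis .
qed

text \<open>The exponent 130 exceeds all those collected: 85 and 108 for the two heat operators, 14
  and 4 for the lateral terms, 90 for the jump of \<open>z\<close> and 119 for \<open>N\<close> at
  the ends.\<close>

lemma core_applied: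
  assumes K: "core_prop (k ^ 130) K" and zs: "smooth21 z z1 z2 zt z1t"
    and rel: "\<And>p. p \<in> cQ \<Longrightarrow> U [et, et] p = J p * zt p + Jt p * z p"
     "\<And>p. p \<in> cQ \<Longrightarrow> (\<Sum>i\<in>UNIV. U [e i, e i, et] p) = J p * lapl z2 p + 2 * (\<Sum>i\<in>UNIV. J1 i p * z1 i p) + lapl J2 p * z p"
  shows "IQ A T (\<lambda>p. (zt p)^2 + (lapl z2 p)^2 + grad2 z1 p + (z p)^2) \<le> K * D"
    and "IQ A T (\<lambda>p. (N [et, et] p)^2 + (Ln p)^2 + gn p + (N [et] p)^2) \<le> K * D"
proof -
  have c2: "contQ (lapl z2)" unfolding lapl_def[abs_def] by (intro continuous_intros smooth21D(8)[OF zs])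
  have Ln: "lapl (\<lambda>i j. N [e j, e i, et]) = Ln" by (simp add: lapl_def[abs_def] Ln_def[abs_def])
  have nn: "0 \<le> wq l f" if "contQ f" "\<And>p. 0 \<le> f p" for f l
    by (rule posfun.L_nonneg[OF posfun_wq that(1)]) (rule that(2))
  have nn': "0 \<le> wo l f" if "contQ f" "\<And>p. 0 \<le> f p" for f l
    by (rule posfun.L_nonneg[OF posfun_wo that(1)]) (rule that(2))
  have gnn: "0 \<le> gn p" for p unfolding gn_def by (rule grad2_nonneg)
  have up: "x \<le> k ^ 130 * y + k ^ 130 * em2 l * D" if "x \<le> k ^ n * (y + em2 l * D)" "n \<le> 130" "0 \<le> y" "0 \<le> l" for x y l and n :: nat
  proof -
    have "0 \<le> em2 l * D" using em2_ge[OF that(4)] D0 by simp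
    then have "x \<le> k ^ 130 * (y + em2 l * D)" using that by (intro pow_up[OF k_ge that(2) _ that(1)]) simp
    then show ?thesis by (simp add: algebra_simps)
  qed
  have upD: "x \<le> k ^ 130 * D" if "x \<le> k ^ n * D" "n \<le> 130" for x and n :: nat
    by (rule pow_up[OF k_ge that(2) D0 that(1)])
  have H1: "wq l (\<lambda>p. (zt p + lapl z2 p)^2) \<le> k ^ 130 * (wq l (\<lambda>p. (z p)^2) + wq l (grad2 z1) + wq l (\<lambda>p. (N [et] p)^2) + wo l (\<lambda>p. (z p)^2)) + k ^ 130 * em2 l * D"
    if l: "1 \<le> l" for l
  proof -
    have l0: "0 \<le> l" using l by simp
    let ?y = "wq l (\<lambda>p. (z p)^2) + wq l (grad2 z1) + wq l (\<lambda>p. (N [et] p)^2) + wo l (\<lambda>p. (z p)^2)"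
    have a: "0 \<le> wq l (\<lambda>p. (z p)^2)" "0 \<le> wq l (grad2 z1)" "0 \<le> wq l (\<lambda>p. (N [et] p)^2)" "0 \<le> wo l (\<lambda>p. (z p)^2)"
      by (intro nn nn' continuous_intros conts conts2 zero_le_power2 grad2_nonneg)+
    have e: "0 \<le> em2 l * D" using em2_ge[OF l0] D0 by simp
    have "kq l (?y + em2 l * D) 85 (\<lambda>p. zt p + lapl z2 p)"
      by (rule kq_z_eq[OF l0 _ _ _ _ _ rel c2]) (use a e in linarith)+
    from kdD(2)[OF this] show ?thesis by (rule up) (use a l0 in auto)
  qed
  have H2: "wq l (\<lambda>p. (N [et, et] p - Ln p)^2) \<le> k ^ 130 * (wq l (\<lambda>p. (lapl z2 p)^2) + wq l (grad2 z1) + wq l (\<lambda>p. (z p)^2) + wq l (\<lambda>p. (N [et] p)^2) + wq l gn) + k ^ 130 * em2 l * D"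
    if l: "1 \<le> l" for l
  proof -
    have l0: "0 \<le> l" using l by simp
    let ?y = "wq l (\<lambda>p. (lapl z2 p)^2) + wq l (grad2 z1) + wq l (\<lambda>p. (z p)^2) + wq l (\<lambda>p. (N [et] p)^2) + wq l gn"
    have a: "0 \<le> wq l (\<lambda>p. (lapl z2 p)^2)" "0 \<le> wq l (grad2 z1)" "0 \<le> wq l (\<lambda>p. (z p)^2)" "0 \<le> wq l (\<lambda>p. (N [et] p)^2)" "0 \<le> wq l gn"
      by (intro nn nn' continuous_intros conts conts2 c2 zero_le_power2 grad2_nonneg gnn)+
    have e: "0 \<le> em2 l * D" using em2_ge[OF l0] D0 by simp
    have "kq l (?y + em2 l * D) 108 (\<lambda>p. N [et, et] p - Ln p)"
      by (rule kq_n_eq[OF l0 _ _ _ _ _ _ rel c2]) (use a e in linarith)+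
    from kdD(2)[OF this] show ?thesis by (rule up) (use a l0 in auto)
  qed
  have R: "smooth21 z z1 z2 zt z1t \<and> smooth21 (N [et]) (\<lambda>i. N [e i, et]) (\<lambda>i j. N [e j, e i, et]) (N [et, et]) (\<lambda>i. N [et, e i, et]) \<and> 0 \<le> D"
    using zs smooth21_UN(2) D0 by simp
  have "IQ A T (\<lambda>p. (zt p)^2 + (lapl z2 p)^2 + grad2 z1 p + (z p)^2) \<le> K * D \<and>
        IQ A T (\<lambda>p. (N [et, et] p)^2 + (lapl (\<lambda>i j. N [e j, e i, et]) p)^2 + grad2 (\<lambda>i. N [e i, et]) p + (N [et] p)^2) \<le> K * D"
    by (rule K[unfolded core_prop_def, rule_format, of _ _ _ _ z1t _ _ _ _ "\<lambda>i. N [et, e i, et]"])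
       (use R H1 H2 upD[OF Lat_z] upD[OF Lat_N] upD[OF z_jump[OF zs]] upD[OF N_at_ends[of 0]] upD[OF N_at_ends[of T]]
         in \<open>simp add: Ln wq_def wo_def gn_def[symmetric]\<close>)
  then show "IQ A T (\<lambda>p. (zt p)^2 + (lapl z2 p)^2 + grad2 z1 p + (z p)^2) \<le> K * D"
    and "IQ A T (\<lambda>p. (N [et, et] p)^2 + (Ln p)^2 + gn p + (N [et] p)^2) \<le> K * D"
    by (simp_all add: Ln gn_def)
qed

end

context mfg_data
begin

section \<open>Return from the quotient to the differences and the coefficient\<close>

text \<open>\<open>second_derivs_L2\<close> for the gradient of the time derivative of
  \<open>U\<close> or \<open>N\<close>; its lateral terms are those bounded by \<open>DL\<close> and
  \<open>DL2\<close>. The identification of third derivatives is a rearrangement of the list of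
  directions.\<close>

lemma second_bound:
  assumes W: "W = U \<or> W = N" and L: "IQ A T (\<lambda>p. (\<Sum>i\<in>UNIV. W [e i, e i, et] p)^2) \<le> k ^ n * Z" and Z: "D \<le> Z" and n: "6 \<le> n"
  shows "IQ A T (\<lambda>p. (W [e j, e i, et] p)^2) \<le> k ^ (n + 1) * Z"
proof -
  define w1 where "w1 i = W [e i, et]" for i
  define w2 where "w2 i j = W [e j, e i, et]" for i j
  have c: "contQ (w1 i)" "contQ (w2 i j)" "contQ (W [e m, e j, e i, et])" for i j m
    using W by (auto simp: w1_def w2_def)
  have Z0: "0 \<le> Z" using D0 Z by simp
  have X: "0 \<le> k ^ i * D" for i using k0 D0 by simp
  have e2: "IB A T i \<sigma> (e2dens w1 w2 i) \<le> k ^ 3 * D" if s: "\<sigma> \<in> {-1, 1}" for i \<sigma>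
  proof -
    interpret B: posfun "cQ" "IB A T i \<sigma>" by (rule posfun_IB[OF s])
    have cc: "contQ (\<lambda>p. (w1 j p)^2)" "contQ (\<lambda>p. (w2 j s p)^2)" for j s
      by (intro continuous_intros c)+
    have b1: "IB A T i \<sigma> (\<lambda>p. (w1 j p)^2) \<le> D" for j using W DL[OF s, of "[e j, et]"] by (auto simp: w1_def)
    have b2: "IB A T i \<sigma> (\<lambda>p. (w2 j s p)^2) \<le> D" if "(j, s) \<noteq> (i, i)" for j s using W DL2[OF s that] by (auto simp: w2_def)
    have "IB A T i \<sigma> (e2dens w1 w2 i) = IB A T i \<sigma> (\<lambda>p. (\<Sum>j\<in>UNIV. (w1 j p)^2) + (\<Sum>q\<in>UNIV - {(i, i)}. (w2 (fst q) (snd q) p)^2))"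
      by (simp add: e2dens_def[abs_def] grad2_def split_beta)
    also have "\<dots> = (\<Sum>j\<in>UNIV. IB A T i \<sigma> (\<lambda>p. (w1 j p)^2)) + (\<Sum>q\<in>UNIV - {(i, i)}. IB A T i \<sigma> (\<lambda>p. (w2 (fst q) (snd q) p)^2))"
      by (subst B.L_add) (auto intro!: continuous_intros cc simp: B.L_sum cc)
    also have "\<dots> \<le> (\<Sum>j\<in>(UNIV :: 'a set). D) + (\<Sum>q\<in>UNIV - {(i, i) :: 'a \<times> 'a}. D)"
      by (intro add_mono sum_mono b1 b2) (auto simp: prod_eq_iff)
    also have "(\<Sum>q\<in>UNIV - {(i, i) :: 'a \<times> 'a}. D) \<le> (\<Sum>q\<in>(UNIV :: ('a \<times> 'a) set). D)"
      by (rule sum_mono2) (use D0 in auto)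
    also have "\<dots> = (\<Sum>i\<in>(UNIV :: 'a set). \<Sum>j\<in>(UNIV :: 'a set). D)" by (simp add: sum.cartesian_product)
    also have "(\<Sum>j\<in>(UNIV :: 'a set). D) + \<dots> \<le> k * D + k * (k * D)"
      by (intro add_mono sum_UNIV_le[OF D0] order_trans[OF sum_mono[OF sum_UNIV_le[OF D0]] sum_UNIV_le]) (use D0 k0 in simp)
    also have "\<dots> \<le> k ^ (2 + 1) * D"
    proof -
      have "k ^ 1 * D \<le> k ^ 2 * D" by (intro kpow D0) simp
      moreover have "k ^ 1 * D = k * D" "k ^ 2 * D = k * (k * D)" by (simp_all add: power2_eq_square)
      ultimately have "k * D + k * (k * D) \<le> 2 * (k ^ 2 * D)" by linarith
      then show ?thesis by (rule order_trans) (rule numkZ[OF _ D0], simp)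
    qed
    finally show ?thesis by simp
  qed
  have sym: "W [e i, e j, e j, et] p = W [e j, e j, e i, et] p" if "p \<in> cQ" for i j p
    using W UN_perm[of "[e i, e j, e j, et]" "[e j, e j, e i, et]" p] that by (auto simp: in_dl)
  have "IQ A T (\<lambda>p. \<Sum>i\<in>UNIV. \<Sum>j\<in>UNIV. (w2 i j p)^2) \<le> IQ A T (\<lambda>p. (lapl w2 p)^2)
     + 2 * real CARD('a) * (\<Sum>i\<in>UNIV. IB A T i 1 (e2dens w1 w2 i) + IB A T i (-1) (e2dens w1 w2 i))"
    by (rule second_derivs_L2[where ?w3.0="\<lambda>i j m. W [e m, e j, e i, et]"])
       (use W sym in \<open>auto simp: w1_def w2_def hpd_UN in_dl\<close>)
  also have "lapl w2 = (\<lambda>p. \<Sum>i\<in>UNIV. W [e i, e i, et] p)" by (simp add: lapl_def[abs_def] w2_def)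
  also have "(\<Sum>i\<in>UNIV. IB A T i 1 (e2dens w1 w2 i) + IB A T i (-1) (e2dens w1 w2 i)) \<le> (\<Sum>i\<in>(UNIV :: 'a set). 2 * (k ^ 3 * D))"
    unfolding mult_2 by (intro sum_mono add_mono e2) auto
  also have "\<dots> \<le> k * (2 * (k ^ 3 * D))" by (rule sum_UNIV_le) (use X in simp)
  also have "2 * real CARD('a) * (k * (2 * (k ^ 3 * D))) \<le> 2 * k * (k * (2 * (k ^ 3 * D)))"
    using card_le k0 D0 by (intro mult_right_mono) auto
  also have "2 * k * (k * (2 * (k ^ 3 * D))) = 4 * (k ^ 5 * D)" by (simp add: eval_nat_numeral)
  also have "\<dots> \<le> k ^ (5 + 1) * D" by (rule numkZ) (use D0 in auto)
  also have "\<dots> \<le> k ^ n * Z" using n Z Z0 k0 D0 k_ge by (intro mult_mono power_increasing) auto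
  also have "IQ A T (\<lambda>p. (\<Sum>i\<in>UNIV. W [e i, e i, et] p)^2) + k ^ n * Z \<le> 2 * (k ^ n * Z)" unfolding mult_2 using L by (rule add_right_mono)
  also have "\<dots> \<le> k ^ (n + 1) * Z" by (rule numkZ) (use Z0 in auto)
  finally have "IQ A T (\<lambda>p. \<Sum>i\<in>UNIV. \<Sum>j\<in>UNIV. (w2 i j p)^2) \<le> k ^ (n + 1) * Z" by simp
  moreover have "IQ A T (\<lambda>p. (w2 i j p)^2) \<le> IQ A T (\<lambda>p. \<Sum>i\<in>UNIV. \<Sum>j\<in>UNIV. (w2 i j p)^2)"
  proof (rule Q.L_mono)
    fix p
    have "(w2 i j p)^2 \<le> (\<Sum>j\<in>UNIV. (w2 i j p)^2)" by (rule member_le_sum) auto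
    also have "\<dots> \<le> (\<Sum>i\<in>UNIV. \<Sum>j\<in>UNIV. (w2 i j p)^2)" by (rule member_le_sum) (auto intro!: sum_nonneg)
    finally show "(w2 i j p)^2 \<le> (\<Sum>i\<in>UNIV. \<Sum>j\<in>UNIV. (w2 i j p)^2)" .
  qed (intro continuous_intros c)+
  ultimately show ?thesis by (simp add: w2_def)
qed

text \<open>For \<open>l = 0\<close> the weighted calculus becomes one for plain integrals, now with
  \<open>Z = K * D\<close>. Time derivatives of \<open>U\<close> follow from
  \<open>U [et] = J * z\<close>, the functions themselves by integration from \<open>t = 0\<close>,
  and the coefficient from its pointwise expression in \<open>be_sm\<close>; its integral over the
  cylinder is \<open>T\<close> times the one over the box, and \<open>1 \<le> k * T\<close> removes
  this factor.\<close>

lemma final_bounds: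
  assumes K: "core_prop (k ^ 130) K" "1 \<le> K"
  shows "length is \<le> 2 \<Longrightarrow> IQ A T (\<lambda>p. (U (map e is) p)^2) \<le> k ^ 60 * (K * D) \<and> IQ A T (\<lambda>p. (N (map e is) p)^2) \<le> k ^ 60 * (K * D)"
    and "length is \<le> 2 \<Longrightarrow> IQ A T (\<lambda>p. (U (map e is @ [et]) p)^2) \<le> k ^ 60 * (K * D) \<and> IQ A T (\<lambda>p. (N (map e is @ [et]) p)^2) \<le> k ^ 60 * (K * D)"
    and "IQ A T (\<lambda>p. (U [et, et] p)^2) \<le> k ^ 60 * (K * D) \<and> IQ A T (\<lambda>p. (N [et, et] p)^2) \<le> k ^ 60 * (K * D)"
    and "IO A (\<lambda>x. (be (x, 0))^2) \<le> k ^ 60 * (K * D)"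
proof -
  obtain z2 z1t where zs: "smooth21 z z1 z2 zt z1t" and rel:
    "\<And>p. p \<in> cQ \<Longrightarrow> U [et] p = J p * z p"
    "\<And>p. p \<in> cQ \<Longrightarrow> U [et, et] p = J p * zt p + Jt p * z p"
    "\<And>p i. p \<in> cQ \<Longrightarrow> U [e i, et] p = J p * z1 i p + J1 i p * z p"
    "\<And>p. p \<in> cQ \<Longrightarrow> (\<Sum>i\<in>UNIV. U [e i, e i, et] p) = J p * lapl z2 p + 2 * (\<Sum>i\<in>UNIV. J1 i p * z1 i p) + lapl J2 p * z p"
    by (rule z_smooth) (rule that)
  define Z where "Z = K * D"
  have DZ: "D \<le> Z" using mult_right_mono[OF K(2) D0] by (simp add: Z_def)
  have Z0: "0 \<le> Z" using D0 DZ by simp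
  have E0: "em2 0 = 1" "Ew 0 p = 1" for p by (simp_all add: em2_def Ew_def)
  have wq0: "wq 0 f = IQ A T f" for f by (simp add: wq_def E0)
  have eD: "em2 0 * D \<le> Z" using DZ by (simp add: E0)
  have c2: "contQ (lapl z2)" unfolding lapl_def[abs_def] by (intro continuous_intros smooth21D(8)[OF zs])
  note core = core_applied[OF K(1) zs rel(2,4), folded Z_def]
  have gnn: "0 \<le> grad2 z1 p" "0 \<le> gn p" for p unfolding gn_def by (rule grad2_nonneg)+
  have dom: "IQ A T f \<le> IQ A T g" if "contQ f" "contQ g" "\<And>p. f p \<le> g p" for f g
    by (rule Q.L_mono[OF that])
  have cz: "contQ (\<lambda>p. (zt p)^2 + (lapl z2 p)^2 + grad2 z1 p + (z p)^2)"
    by (intro continuous_intros contz conts2 c2)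
  have cn: "contQ (\<lambda>p. (N [et, et] p)^2 + (Ln p)^2 + gn p + (N [et] p)^2)"
    by (intro continuous_intros conts conts2)
  have s3: "a \<le> b" if "a \<in> {x, y', u, v}" "b = x + y' + u + v" "0 \<le> x" "0 \<le> y'" "0 \<le> u" "0 \<le> v" for a b x y' u v :: real
    using that by auto
  have B: "IQ A T (\<lambda>p. (zt p)^2) \<le> Z" "IQ A T (\<lambda>p. (lapl z2 p)^2) \<le> Z" "IQ A T (grad2 z1) \<le> Z" "IQ A T (\<lambda>p. (z p)^2) \<le> Z"
    by (rule order_trans[OF dom[OF _ cz] core(1)], (intro continuous_intros conts2 c2), rule s3[OF _ refl], auto simp: gnn)+
  have Bn: "IQ A T (\<lambda>p. (N [et, et] p)^2) \<le> Z" "IQ A T (\<lambda>p. (Ln p)^2) \<le> Z" "IQ A T gn \<le> Z" "IQ A T (\<lambda>p. (N [et] p)^2) \<le> Z"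
    by (rule order_trans[OF dom[OF _ cn] core(2)], (intro continuous_intros conts conts2), rule s3[OF _ refl], auto simp: gnn)+
  note up = kq_up[OF order_refl eD] and comb = kq_comb[OF order_refl eD] and time = kq_time[OF order_refl eD, where m=0]
  have q0: "kq 0 Z 0 z" "kq 0 Z 0 zt" "kq 0 Z 0 (lapl z2)" "kq 0 Z 0 (N [et])" "kq 0 Z 0 (N [et, et])" "kq 0 Z 0 Ln"
    using B Bn c2 by (auto simp: kd_def wq0)
  have qz1: "kq 0 Z 0 (z1 i)" and qn1: "kq 0 Z 0 (N [e i, et])" for i
  proof -
    have "(z1 i p)^2 \<le> grad2 z1 p" "(N [e i, et] p)^2 \<le> gn p" for p
      unfolding grad2_def gn_def by (intro member_le_sum; simp)+
    then have "IQ A T (\<lambda>p. (z1 i p)^2) \<le> Z" "IQ A T (\<lambda>p. (N [e i, et] p)^2) \<le> Z"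
      by (intro order_trans[OF dom B(3)] order_trans[OF dom Bn(3)] continuous_intros conts conts2; simp)+
    then show "kq 0 Z 0 (z1 i)" "kq 0 Z 0 (N [e i, et])" by (auto simp: kd_def wq0)
  qed
  have prod: "\<bar>j * f\<bar> \<le> k * \<bar>f\<bar>" if "\<bar>j\<bar> \<le> k" for j f :: real using that by (simp add: abs_mult mult_right_mono)
  have "kq 0 Z (2 * 1 + 2 + 0) (U [et])"
  proof (rule comb[where gs="[z]"])
    fix p assume p: "p \<in> cQ"
    show "\<bar>U [et] p\<bar> \<le> k ^ 1 * (\<Sum>g\<leftarrow>[z]. \<bar>g p\<bar>)" unfolding rel(1)[OF p] using prod[of "J p" "z p"] J_le[OF p] by simp
  qed (use q0 in auto)
  note u1 = this
  have "kq 0 Z (2 * 1 + 2 + 0) (U [e i, et])" for i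
  proof (rule comb[where gs="[z1 i, z]"])
    fix p assume p: "p \<in> cQ"
    have "\<bar>J p * z1 i p\<bar> \<le> k * \<bar>z1 i p\<bar>" "\<bar>J1 i p * z p\<bar> \<le> k * \<bar>z p\<bar>" using J_le[OF p] by (intro prod; simp)+
    then show "\<bar>U [e i, et] p\<bar> \<le> k ^ 1 * (\<Sum>g\<leftarrow>[z1 i, z]. \<bar>g p\<bar>)" unfolding rel(3)[OF p] by (simp add: distrib_left)
  qed (use q0 qz1 in auto)
  note u2 = this
  have u3: "kq 0 Z (2 * 1 + 2 + 0) (U [et, et])"
  proof (rule comb[where gs="[zt, z]"])
    fix p assume p: "p \<in> cQ"
    have "\<bar>J p * zt p\<bar> \<le> k * \<bar>zt p\<bar>" "\<bar>Jt p * z p\<bar> \<le> k * \<bar>z p\<bar>" using J_le[OF p] by (intro prod; simp)+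
    then show "\<bar>U [et, et] p\<bar> \<le> k ^ 1 * (\<Sum>g\<leftarrow>[zt, z]. \<bar>g p\<bar>)" unfolding rel(2)[OF p] by (simp add: distrib_left)
  qed (use q0 in auto)
  have Lw1: "kq 0 Z (2 * 8 + 2 + 1) Lw"
    by (rule kq_Lw[OF order_refl eD _ _ _ _ rel(4) c2]) (use B Bn in \<open>simp_all add: wq0\<close>)
  have u4: "kq 0 Z 20 (U [e j, e i, et])" "kq 0 Z 20 (N [e j, e i, et])" for i j
  proof -
    have "IQ A T (\<lambda>p. (\<Sum>i\<in>UNIV. U [e i, e i, et] p)^2) \<le> k ^ 19 * Z" using kdD(2)[OF Lw1] by (simp add: wq0 Lw_def)
    from second_bound[OF _ this DZ] have 1: "IQ A T (\<lambda>p. (U [e j, e i, et] p)^2) \<le> k ^ 20 * Z" by simp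
    have "kq 0 Z 19 Ln" by (rule up[OF q0(6)]) simp
    then have "IQ A T (\<lambda>p. (\<Sum>i\<in>UNIV. N [e i, e i, et] p)^2) \<le> k ^ 19 * Z" using kdD(2)[of k _ "wq 0" Z 19 Ln] by (simp add: wq0 Ln_def)
    from second_bound[OF _ this DZ] have 2: "IQ A T (\<lambda>p. (N [e j, e i, et] p)^2) \<le> k ^ 20 * Z" by simp
    show "kq 0 Z 20 (U [e j, e i, et])" "kq 0 Z 20 (N [e j, e i, et])" using 1 2 by (auto simp: kd_def wq0)
  qed
  have cases2: "P is" if "length is \<le> 2" "P []" "\<And>i. P [i]" "\<And>i j. P [i, j]" for P :: "'a list \<Rightarrow> bool" and "is"
    using that by (metis One_nat_def Suc_1 le_Suc_eq le_zero_eq length_0_conv length_Suc_conv)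
  have T10: "kq 0 Z 20 (U (map e is @ [et])) \<and> kq 0 Z 20 (N (map e is @ [et]))" if "length is \<le> 2" for "is"
    by (rule cases2[OF that]) (use u1[THEN up] u2[THEN up] u4 q0(4)[THEN up] qn1[THEN up] in auto)
  have T13: "kq 0 Z 23 (U (map e is)) \<and> kq 0 Z 23 (N (map e is))" if l: "length is \<le> 2" for "is"
  proof -
    have d: "map e is @ [et] \<in> dl 6" using l by (intro in_dl) (auto simp: comp_def sum_list_triv)
    have c: "contQ (U (map e is))" "contQ (N (map e is))" using cont_mape[of "is"] l by auto
    have "kq 0 Z (20 + 3) (U (map e is))" "kq 0 Z (20 + 3) (N (map e is))"
      using DI[of "is" 0] l T10[OF l]
      by (intro time[OF hpd_UN_time(1)[OF d] _ c(1)] time[OF hpd_UN_time(2)[OF d] _ c(2)]; simp)+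
    then show ?thesis by simp
  qed
  have fin: "IQ A T (\<lambda>p. (f p)^2) \<le> k ^ 60 * (K * D)" if "kq 0 Z n f" "n \<le> 60" for n f
    using kdD(2)[OF up[OF that]] by (simp add: wq0 Z_def)
  show "length is \<le> 2 \<Longrightarrow> IQ A T (\<lambda>p. (U (map e is) p)^2) \<le> k ^ 60 * (K * D) \<and> IQ A T (\<lambda>p. (N (map e is) p)^2) \<le> k ^ 60 * (K * D)" for "is"
    using T13[of "is"] fin[of 23] by simp
  show "length is \<le> 2 \<Longrightarrow> IQ A T (\<lambda>p. (U (map e is @ [et]) p)^2) \<le> k ^ 60 * (K * D) \<and> IQ A T (\<lambda>p. (N (map e is @ [et]) p)^2) \<le> k ^ 60 * (K * D)" for "is"
    using T10[of "is"] fin[of 20] by simp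
  show "IQ A T (\<lambda>p. (U [et, et] p)^2) \<le> k ^ 60 * (K * D) \<and> IQ A T (\<lambda>p. (N [et, et] p)^2) \<le> k ^ 60 * (K * D)"
    using fin[OF u3] fin[OF q0(5)] by simp
  have "kq 0 Z 23 (U [e i])" "kq 0 Z 23 (U [e i, e i])" for i using T13[of "[i]"] T13[of "[i, i]"] by auto
  note u23 = this
  have sU: "kq 0 Z (23 + 2) sU" unfolding sU_def[abs_def] by (rule kd_sum(2)[OF posfun_wq u23(1) Z0])
  have LU: "kq 0 Z (23 + 2) LU" unfolding LU_def[abs_def] by (rule kd_sum(1)[OF posfun_wq u23(2) Z0])
  have n23: "kq 0 Z 23 Nf" using T13[of "[]"] by simp
  have "kq 0 Z (23 + 1) IN" by (rule kd_Inter[OF order_refl n23 Z0])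
  note IN = this
  have "kq 0 Z (2 * 14 + 2 + 25) be"
  proof (rule comb[where gs="[z, LU, sU, IN, Nf]"])
    fix p assume p: "p \<in> cQ"
    show "\<bar>be p\<bar> \<le> k ^ 14 * (\<Sum>g\<leftarrow>[z, LU, sU, IN, Nf]. \<bar>g p\<bar>)"
      by (rule be_sm[OF p, unfolded sm_def]) (use s_ge(2)[of _ p] in \<open>simp_all add: abs_le_add\<close>)
  qed (use q0(1)[THEN up] LU[THEN up] sU[THEN up] IN[THEN up] n23[THEN up] in auto)
  then have b: "IQ A T (\<lambda>p. (be p)^2) \<le> k ^ 55 * Z" using kdD(2) by (fastforce simp: wq0)
  have tb: "be p = be (fst p, 0)" for p unfolding be_def using b_space[of "fst p" "snd p" 0] by simp
  have cb: "continuous_on (cOmega A) (\<lambda>x. (be (x, 0))^2)"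
    using T_pos by (intro continuous_intros cont_at_time[where f=be] conts2) simp
  have "IQ A T (\<lambda>p. (be p)^2) = IQ A T (\<lambda>p. (be (fst p, 0))^2)" by (subst tb) (rule refl)
  also have "\<dots> = T * IO A (\<lambda>x. (be (x, 0))^2)" by (rule IQ_space_only[OF cb])
  finally have bT: "T * IO A (\<lambda>x. (be (x, 0))^2) \<le> k ^ 55 * Z" using b by simp
  have "IO A (\<lambda>x. (be (x, 0))^2) \<le> k * T * IO A (\<lambda>x. (be (x, 0))^2)"
    using mult_right_mono[OF T_ge O.L_nonneg[OF cb]] by simp
  also have "\<dots> \<le> k * (k ^ 55 * Z)" using mult_left_mono[OF bT k0] by (simp add: mult.assoc)
  also have "\<dots> = k ^ 56 * Z" by (simp add: eval_nat_numeral mult.assoc)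
  also have "\<dots> \<le> k ^ 60 * Z" by (intro mult_right_mono power_increasing k_ge Z0) simp
  finally show "IO A (\<lambda>x. (be (x, 0))^2) \<le> k ^ 60 * (K * D)" by (simp add: Z_def)
qed

end

section \<open>The stability estimate\<close>

context boxdom
begin

lemma interaction_eq: "interaction A K1 K2 m = Inter (kbar K1) K2 m"
  by (rule ext) (auto simp: interaction_def Inter_def SK_def VK_def PhiK_def kbar_def)

lemma zero_on_closure:
  fixes f :: "'n rvec \<times> real \<Rightarrow> real"
  assumes "contQ f" "\<And>z. z \<in> QT A T \<Longrightarrow> f z = 0" "p \<in> cQ"
  shows "f p = 0"
  using continuous_constant_on_closure[of "QT A T" f 0 p] assms by (auto simp: cQT_def)

text \<open>The equations are assumed in the open cylinder only. Both residuals are continuous up to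
  the boundary and extend by density; the values at the ends of the time interval depend on
  this.\<close>

lemma MFGS_sol:
  assumes S: "MFGS A T K1 K2 a s b u m" and u: "C_par A T 3 u" and m: "C_par A T 3 m"
    and a: "\<And>i. hpdQ (es i) (\<lambda>z. a (fst z)) (a1 i)" "contQ (\<lambda>z. a (fst z))" "\<And>i. contQ (a1 i)"
    and b: "contQ (\<lambda>z. b (fst z))" and s: "contQ s"
    and I: "contQ (Inter (kbar K1) K2 m)"
  shows "sol (kbar K1) K2 (\<lambda>z. a (fst z)) a1 s (\<lambda>z. b (fst z)) u m"
  unfolding sol_def
proof (intro ballI conjI)
  fix p assume p: "p \<in> cQ"
  have c: "contQ v" "contQ (dd [e_time] v)" "contQ (dd [es i] v)"
    "contQ (dd [es i, es j] v)" if "C_par A T 3 v" for v i j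
    using C_par_cont[OF that, of "[]"] C_par_cont[OF that, of "[e_time]"] C_par_cont[OF that, of "[es i]"] C_par_cont[OF that, of "[es i, es j]"]
    by (auto simp: dir_lists_def pds_Nil)
  have h: "hpdQ (es i) v (dd [es i] v)" "hpdQ (es i) (dd [es i] v) (dd [es i, es i] v)"
    if "C_par A T 3 v" for v i
    using C_par_hpd[OF that, of "es i" "[]"] C_par_hpd[OF that, of "es i" "[es i]"] by (auto simp: dir_lists_def pds_Nil)
  have D: "Dt A T v = dd [e_time] v" "Dx A T i v = dd [es i] v" "dd [es i] (dd [es i] v) = dd [es i, es i] v" for v i
    by (simp_all add: Dt_def[abs_def] Dx_def[abs_def] pds_Cons pds_Nil)
  show "dd [e_time] u p + (\<Sum>i\<in>UNIV. dd [es i, es i] u p) - a (fst p) / 2 * (\<Sum>i\<in>UNIV. (dd [es i] u p)^2)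
       + b (fst p) * Inter (kbar K1) K2 m p + s p * m p = 0"
  proof (rule zero_on_closure[OF _ _ p])
    show "contQ (\<lambda>p. dd [e_time] u p + (\<Sum>i\<in>UNIV. dd [es i, es i] u p) - a (fst p) / 2 * (\<Sum>i\<in>UNIV. (dd [es i] u p)^2)
       + b (fst p) * Inter (kbar K1) K2 m p + s p * m p)"
      by (intro continuous_intros c u m a b s I) simp
    show "dd [e_time] u z + (\<Sum>i\<in>UNIV. dd [es i, es i] u z) - a (fst z) / 2 * (\<Sum>i\<in>UNIV. (dd [es i] u z)^2)
       + b (fst z) * Inter (kbar K1) K2 m z + s z * m z = 0" if "z \<in> QT A T" for z
      using S that unfolding MFGS_def Lap_def interaction_eq D by (cases z) fastforce
  qed
  show "dd [e_time] m p - (\<Sum>i\<in>UNIV. dd [es i, es i] m p)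
       - ((\<Sum>i\<in>UNIV. a1 i p * (m p * dd [es i] u p) + a (fst p) * (dd [es i] m p * dd [es i] u p))
          + a (fst p) * (m p * (\<Sum>i\<in>UNIV. dd [es i, es i] u p))) = 0"
  proof (rule zero_on_closure[OF _ _ p])
    show "contQ (\<lambda>p. dd [e_time] m p - (\<Sum>i\<in>UNIV. dd [es i, es i] m p)
       - ((\<Sum>i\<in>UNIV. a1 i p * (m p * dd [es i] u p) + a (fst p) * (dd [es i] m p * dd [es i] u p))
          + a (fst p) * (m p * (\<Sum>i\<in>UNIV. dd [es i, es i] u p))))"
      by (intro continuous_intros c u m a)
    fix z assume z: "z \<in> QT A T"
    then have zc: "z \<in> cQ" using QT_sub by auto
    have "Dx A T i (\<lambda>z. a (fst z) * m z * Dx A T i u z) z = (a1 i z * m z + a (fst z) * dd [es i] m z) * dd [es i] u z + a (fst z) * m z * dd [es i, es i] u z" for i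
      unfolding D(2)[of i u] unfolding Dx_def
      by (rule pd_eq[OF hpd_mult[OF hpd_mult[OF a(1) h(1)[OF m]] h(2)[OF u]] zc cQT_thick[OF zc]]) simp
    then have "(\<Sum>i\<in>UNIV. Dx A T i (\<lambda>z. a (fst z) * m z * Dx A T i u z) z) =
       (\<Sum>i\<in>UNIV. a1 i z * (m z * dd [es i] u z) + a (fst z) * (dd [es i] m z * dd [es i] u z))
          + a (fst z) * (m z * (\<Sum>i\<in>UNIV. dd [es i, es i] u z))"
      by (simp add: sum_distrib_left sum.distrib[symmetric] algebra_simps)
    moreover have "dd [e_time] m z - (\<Sum>i\<in>UNIV. dd [es i, es i] m z)
       - (\<Sum>i\<in>UNIV. Dx A T i (\<lambda>z. a (fst z) * m z * Dx A T i u z) z) = 0"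
      using S z unfolding MFGS_def Lap_def D by (cases z) fastforce
    ultimately show "dd [e_time] m z - (\<Sum>i\<in>UNIV. dd [es i, es i] m z)
       - ((\<Sum>i\<in>UNIV. a1 i z * (m z * dd [es i] u z) + a (fst z) * (dd [es i] m z * dd [es i] u z))
          + a (fst z) * (m z * (\<Sum>i\<in>UNIV. dd [es i, es i] u z))) = 0" by simp
  qed
qed

section \<open>Comparison of the data norms with the quantities of the estimates\<close>

lemma H21_face_le:
  assumes "\<sigma> \<in> {-1, 1}"
  shows "(L2_face A T j \<sigma> w)^2 \<le> (H21_ST A T w)^2"
    "(L2_face A T j \<sigma> (dd [e_time] w))^2 \<le> (H21_ST A T w)^2"
    "i \<noteq> j \<Longrightarrow> (L2_face A T j \<sigma> (dd [es i] w))^2 \<le> (H21_ST A T w)^2"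
    "(i, s) \<noteq> (j, j) \<Longrightarrow> (L2_face A T j \<sigma> (dd [es s, es i] w))^2 \<le> (H21_ST A T w)^2"
proof -
  let ?X = "\<Sum>i\<in>UNIV - {j}. (L2_face A T j \<sigma> (pd cQ (es i) w))^2"
  let ?Y = "\<Sum>(i, s)\<in>UNIV - {(j, j)}. (L2_face A T j \<sigma> (dd [es s, es i] w))^2"
  let ?Z = "\<Sum>i\<le>1. (L2_face A T j \<sigma> (dd (replicate i e_time) w))^2"
  have f0: "0 \<le> H21_face_sq A T i \<sigma> w" for i \<sigma>
    unfolding H21_face_sq_def by (intro add_nonneg_nonneg sum_nonneg) auto
  have "H21_face_sq A T j \<sigma> w \<le> (\<Sum>\<sigma>\<in>{-1, 1}. H21_face_sq A T j \<sigma> w)"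
    by (rule member_le_sum) (use assms f0 in auto)
  also have "\<dots> \<le> (\<Sum>i\<in>UNIV. \<Sum>\<sigma>\<in>{-1, 1}. H21_face_sq A T i \<sigma> w)"
    by (rule member_le_sum) (auto intro!: add_nonneg_nonneg f0)
  also have "\<dots> = (H21_ST A T w)^2" unfolding H21_ST_def by (rule real_sqrt_pow2[symmetric]) (intro sum_nonneg f0)
  finally have le: "?X + ?Y + ?Z \<le> (H21_ST A T w)^2" by (simp add: H21_face_sq_def)
  have nn: "0 \<le> ?X" "0 \<le> ?Y" "0 \<le> ?Z" by (auto intro!: sum_nonneg)
  have "?Z = (L2_face A T j \<sigma> w)^2 + (L2_face A T j \<sigma> (dd [e_time] w))^2" by (simp add: pds_Nil)
  then have "(L2_face A T j \<sigma> w)^2 \<le> ?Z" "(L2_face A T j \<sigma> (dd [e_time] w))^2 \<le> ?Z" by simp_all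
  then show "(L2_face A T j \<sigma> w)^2 \<le> (H21_ST A T w)^2" "(L2_face A T j \<sigma> (dd [e_time] w))^2 \<le> (H21_ST A T w)^2"
    using le nn by linarith+
  show "(L2_face A T j \<sigma> (dd [es i] w))^2 \<le> (H21_ST A T w)^2" if "i \<noteq> j"
  proof -
    have "(L2_face A T j \<sigma> (pd cQ (es i) w))^2 \<le> ?X" using that by (intro member_le_sum) auto
    then have "(L2_face A T j \<sigma> (pd cQ (es i) w))^2 \<le> (H21_ST A T w)^2" using le nn by linarith
    then show ?thesis by (simp add: pds_Cons pds_Nil)
  qed
  show "(L2_face A T j \<sigma> (dd [es s, es i] w))^2 \<le> (H21_ST A T w)^2" if "(i, s) \<noteq> (j, j)"
  proof -
    have "(case (i, s) of (i, s) \<Rightarrow> (L2_face A T j \<sigma> (dd [es s, es i] w))^2) \<le> ?Y" using that by (intro member_le_sum) auto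
    then have "(L2_face A T j \<sigma> (dd [es s, es i] w))^2 \<le> ?Y" by (simp only: prod.case)
    then show ?thesis using le nn by linarith
  qed
qed

lemma H10_face_le:
  assumes "\<sigma> \<in> {-1, 1}"
  shows "(L2_face A T j \<sigma> g)^2 \<le> (H10_ST A T g)^2"
proof -
  have f0: "0 \<le> H10_face_sq A T i \<sigma> g" for i \<sigma>
    unfolding H10_face_sq_def by (intro add_nonneg_nonneg sum_nonneg) auto
  have "(L2_face A T j \<sigma> g)^2 \<le> H10_face_sq A T j \<sigma> g" unfolding H10_face_sq_def by (simp add: sum_nonneg)
  also have "\<dots> \<le> (\<Sum>\<sigma>\<in>{-1, 1}. H10_face_sq A T j \<sigma> g)"
    by (rule member_le_sum) (use assms f0 in auto)
  also have "\<dots> \<le> (\<Sum>i\<in>UNIV. \<Sum>\<sigma>\<in>{-1, 1}. H10_face_sq A T i \<sigma> g)"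
    by (rule member_le_sum) (auto intro!: add_nonneg_nonneg f0)
  also have "\<dots> = (H10_ST A T g)^2" unfolding H10_ST_def by (rule real_sqrt_pow2[symmetric]) (intro sum_nonneg f0)
  finally show ?thesis .
qed

lemma ST_norms_nonneg: "0 \<le> H21_ST A T w" "0 \<le> H10_ST A T w"
  unfolding H21_ST_def H10_ST_def H21_face_sq_def H10_face_sq_def
  by (intro real_sqrt_ge_zero sum_nonneg add_nonneg_nonneg; auto)+

text \<open>On a face the norm of the time-differentiated Dirichlet data controls the time
  derivative of \<open>u\<close>, its own time derivative, its tangential derivatives and all its
  second spatial derivatives but the pure normal one. Only the normal first derivative is missing,
  and it is the time derivative of the Neumann data.\<close>

lemma data_bounds:
  assumes u: "C_par A T 3 u" "C_par A T 3 u'" and d: "has_data A T u p F f0 f1" "has_data A T u' p' F' f0' f1'"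
    and S: "H_Omega A 4 (\<lambda>x. p x - p' x) \<le> S" "H_Omega A 4 (\<lambda>x. F x - F' x) \<le> S"
      "H21_ST A T (\<lambda>z. Dt A T u z - Dt A T u' z) \<le> S" "H10_ST A T (\<lambda>z. pd (ST A T) e_time f1 z - pd (ST A T) e_time f1' z) \<le> S"
  shows "length is \<le> 3 \<Longrightarrow> t \<in> {0, T} \<Longrightarrow> IO A (\<lambda>x. (dd (map es is) u (x, t) - dd (map es is) u' (x, t))^2) \<le> S^2"
    and "\<sigma> \<in> {-1, 1} \<Longrightarrow> vs \<in> {[e_time], [e_time, e_time]} \<union> range (\<lambda>i. [es i, e_time]) \<Longrightarrow>
        IB A T j \<sigma> (\<lambda>p. (dd vs u p - dd vs u' p)^2) \<le> S^2"
    and "\<sigma> \<in> {-1, 1} \<Longrightarrow> (i, s) \<noteq> (j, j) \<Longrightarrow> IB A T j \<sigma> (\<lambda>p. (dd [es s, es i, e_time] u p - dd [es s, es i, e_time] u' p)^2) \<le> S^2"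
proof -
  have t: "0 \<in> {0..T}" "T \<in> {0..T}" using T_pos by auto
  show "IO A (\<lambda>x. (dd (map es is) u (x, t) - dd (map es is) u' (x, t))^2) \<le> S^2" if l: "length is \<le> 3" and tt: "t \<in> {0, T}"
  proof (cases "t = 0")
    case True
    have "IO A (\<lambda>x. (dd (map es is) u (x, 0) - dd (map es is) u' (x, 0))^2) \<le> (H_Omega A 4 (\<lambda>x. p x - p' x))^2"
      by (rule H_Omega_ge[OF u t(1)]) (use d l in \<open>auto simp: has_data_def\<close>)
    also have "\<dots> \<le> S^2" using S(1) H_Omega_nonneg by (rule power_mono)
    finally show ?thesis using True by simp
  next
    case False
    have "IO A (\<lambda>x. (dd (map es is) u (x, T) - dd (map es is) u' (x, T))^2) \<le> (H_Omega A 4 (\<lambda>x. F x - F' x))^2"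
      by (rule H_Omega_ge[OF u t(2)]) (use d l in \<open>auto simp: has_data_def\<close>)
    also have "\<dots> \<le> S^2" using S(2) H_Omega_nonneg by (rule power_mono)
    finally show ?thesis using False tt by simp
  qed
  define w where "w = (\<lambda>z. Dt A T u z - Dt A T u' z)"
  have w: "w = (\<lambda>z. dd [e_time] u z - dd [e_time] u' z)" by (simp add: w_def Dt_def pds_Cons pds_Nil)
  have S21: "x \<le> S^2" if "x \<le> (H21_ST A T w)^2" for x
    using that power_mono[OF S(3) ST_norms_nonneg(1), of 2] by (simp add: w_def)
  have L: "(L2_face A T j \<sigma> (dd vs w))^2 = IB A T j \<sigma> (\<lambda>p. (dd (vs @ [e_time]) u p - dd (vs @ [e_time]) u' p)^2)"
    if s: "\<sigma> \<in> {-1, 1}" and l: "vs @ [e_time] \<in> dl 6" for \<sigma> vs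
    unfolding L2_face_sq
  proof (rule IB_cong)
    fix x t assume "x \<in> face A j \<sigma>" "t \<in> {0<..<T}"
    then have "(x, t) \<in> cQ" using face_sub[OF s] by (auto simp: mem_cQT)
    then show "(dd vs w (x, t))^2 = (dd (vs @ [e_time]) u (x, t) - dd (vs @ [e_time]) u' (x, t))^2"
      unfolding w using dd_diff[OF u, of vs "[e_time]"] l by simp
  qed
  have dls: "[e_time :: 'n rvec \<times> real] \<in> dl 6" "[e_time :: 'n rvec \<times> real, e_time] \<in> dl 6" "[es i, e_time] \<in> dl 6" "[es s, es i, e_time] \<in> dl 6" "[e_time, es i] \<in> dl 6" for i s :: 'n
    by (auto simp: dir_lists_def)
  show "IB A T j \<sigma> (\<lambda>p. (dd [es s, es i, e_time] u p - dd [es s, es i, e_time] u' p)^2) \<le> S^2"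
    if s: "\<sigma> \<in> {-1, 1}" and ij: "(i, s) \<noteq> (j, j)"
    using S21[OF H21_face_le(4)[OF s ij]] L[OF s, of "[es s, es i]"] dls by simp
  show "IB A T j \<sigma> (\<lambda>p. (dd vs u p - dd vs u' p)^2) \<le> S^2"
    if s: "\<sigma> \<in> {-1, 1}" and vs: "vs \<in> {[e_time], [e_time, e_time]} \<union> range (\<lambda>i. [es i, e_time])"
  proof -
    consider "vs = [e_time]" | "vs = [e_time, e_time]" | i where "vs = [es i, e_time]" "i \<noteq> j" | "vs = [es j, e_time]"
      using vs by auto
    then show ?thesis
    proof cases
      case 1 then show ?thesis using S21[OF H21_face_le(1)[OF s, where j=j]] L[OF s, of "[]"] dls by (simp add: pds_Nil)
    next
      case 2 then show ?thesis using S21[OF H21_face_le(2)[OF s, where j=j]] L[OF s, of "[e_time]"] dls by simp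
    next
      case 3 then show ?thesis using S21[OF H21_face_le(3)[OF s, where j=j and i=i]] L[OF s, of "[es i]"] dls by simp
    next
      \<comment> \<open>The normal derivative: the orders of time and normal differentiation are
        interchanged, and the sign \<open>\<sigma>\<close> disappears in the square.\<close>
      case 4
      let ?g = "\<lambda>z. pd (ST A T) e_time f1 z - pd (ST A T) e_time f1' z"
      have "IB A T j \<sigma> (\<lambda>p. (dd vs u p - dd vs u' p)^2) = IB A T j \<sigma> (\<lambda>p. (?g p)^2)"
      proof (rule IB_cong)
        fix x t assume x: "x \<in> face A j \<sigma>" and t: "t \<in> {0<..<T}"
        then have p: "(x, t) \<in> cQ" using face_sub[OF s] by (auto simp: mem_cQT)
        have "pd (ST A T) e_time f1 (x, t) = \<sigma> * dd [e_time, es j] u (x, t)"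
          by (rule pd_ST_time[OF u(1) s _ x t]) (use d(1) s in \<open>auto simp: has_data_def\<close>)
        moreover have "pd (ST A T) e_time f1' (x, t) = \<sigma> * dd [e_time, es j] u' (x, t)"
          by (rule pd_ST_time[OF u(2) s _ x t]) (use d(2) s in \<open>auto simp: has_data_def\<close>)
        moreover have "dd [e_time, es j] u (x, t) = dd vs u (x, t)" "dd [e_time, es j] u' (x, t) = dd vs u' (x, t)"
          unfolding 4 by (intro dd_perm[OF u(1) _ _ p] dd_perm[OF u(2) _ _ p]; simp add: dls)+
        ultimately have "?g (x, t) = \<sigma> * (dd vs u (x, t) - dd vs u' (x, t))" by (simp add: right_diff_distrib)
        then show "(dd vs u (x, t) - dd vs u' (x, t))^2 = (?g (x, t))^2" using s by (auto simp: power2_commute)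
      qed
      also have "\<dots> \<le> (H10_ST A T ?g)^2" using H10_face_le[OF s] by (simp add: L2_face_sq)
      also have "\<dots> \<le> S^2" using S(4) ST_norms_nonneg(2) by (rule power_mono)
      finally show ?thesis .
    qed
  qed
qed

lemma H_par_diff_le:
  assumes u: "C_par A T 3 u" "C_par A T 3 u'" and l: "us \<in> {[], [e_time]}"
    and s: "\<And>is. length is \<le> 2 \<Longrightarrow> IQ A T (\<lambda>p. (dd (map es is @ us) u p - dd (map es is @ us) u' p)^2) \<le> B"
    and t: "IQ A T (\<lambda>p. (dd (e_time # us) u p - dd (e_time # us) u' p)^2) \<le> B"
  shows "H_par A T 1 (\<lambda>z. dd us u z - dd us u' z) \<le> sqrt (hp_card * B)"
proof (rule H_par_le)
  have d: "IQ A T (\<lambda>z. (dd vs (\<lambda>z. dd us u z - dd us u' z) z)^2) = IQ A T (\<lambda>p. (dd (vs @ us) u p - dd (vs @ us) u' p)^2)"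
    if "vs @ us \<in> dl 6" for vs
    by (rule IQ_cong) (use dd_diff[OF u, of vs us] that in simp)
  show "IQ A T (\<lambda>z. (dd (map es is) (\<lambda>z. dd us u z - dd us u' z) z)^2) \<le> B" if "length is \<le> 2" for "is"
    using s[OF that] by (subst d) (use that l in \<open>auto simp: dir_lists_def comp_def sum_list_triv\<close>)
  show "IQ A T (\<lambda>z. (dd [e_time] (\<lambda>z. dd us u z - dd us u' z) z)^2) \<le> B"
    using t by (subst d) (use l in \<open>auto simp: dir_lists_def\<close>)
qed

lemma kern_Omega2:
  assumes "C_Omega2 A 4 K" "C_Omega2_norm A 4 K < M"
  obtains kx ky kxx kxy kyx kyy where "kern2 K kx ky kxx kxy kyx kyy" "kern2_le M K kx ky kxx kxy kyx kyy"
  using kern2_Omega2[OF assms] by blast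

lemma kern_Omega'2:
  assumes "C_Omega'2 A 4 K" "C_Omega'2_norm A 4 K < M"
  obtains kx ky kxx kxy kyx kyy where "kern2 (kbar K) kx ky kxx kxy kyx kyy" "kern2_le M (kbar K) kx ky kxx kxy kyx kyy"
  using kern2_Omega'2[OF assms] by blast

lemma smooth21_C_par:
  assumes u: "C_par A T 3 u"
  shows "smooth21 u (\<lambda>i. dd [es i] u) (\<lambda>i j. dd [es j, es i] u) (dd [e_time] u) (\<lambda>i. dd [e_time, es i] u)"
proof (rule smooth21I[where ?zt1.0="\<lambda>i. dd [es i, e_time] u"])
  have h: "hpdQ v (dd vs u) (dd (v # vs) u)" if "v # vs \<in> dl 6" for v vs using C_par_hpd[OF u] that by simp
  have c: "contQ (dd vs u)" if "vs \<in> dl 6" for vs using C_par_cont[OF u] that by simp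
  show "hpdQ (es i) u (dd [es i] u)" for i using h[of "es i" "[]"] by (simp add: pds_Nil dir_lists_def)
  show "hpdQ e_time u (dd [e_time] u)" using h[of "e_time" "[]"] by (simp add: pds_Nil dir_lists_def)
  show "contQ u" using c[of "[]"] by (simp add: pds_Nil dir_lists_def)
qed (rule C_par_hpd[OF u] C_par_cont[OF u], simp add: dir_lists_def)+

end

context boxdom
begin

section \<open>The common constant and the stability estimate\<close>

text \<open>A sum of nonnegative terms, so that it dominates each of them: \<open>1 / c\<close> for
  the lower bound of \<open>J\<close>, \<open>1 / T\<close> for passing from the cylinder to the
  box, the number of lists for the sum \<open>Xs\<close>. It is built from \<open>M\<close>,
  \<open>c\<close>, the box and \<open>T\<close> alone, which gives the final constant its
  uniformity.\<close>

definition kconst :: "real \<Rightarrow> real \<Rightarrow> real" where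
  "kconst M c = 1000 + M + real CARD('n) + T + 4 * il2 * M^2 + 14 * ibd * M^2 + 1 / c
     + real (card {is :: 'n list. length is \<le> 3}) + 1 / T"

lemma kconst_ge:
  assumes "0 < M" "0 < c"
  shows "1000 \<le> kconst M c" "M \<le> kconst M c" "real CARD('n) \<le> kconst M c" "T \<le> kconst M c" "4 * il2 * M^2 \<le> kconst M c"
    "14 * ibd * M^2 \<le> kconst M c" "1 / c \<le> kconst M c" "real (card {is :: 'n list. length is \<le> 3}) \<le> kconst M c" "1 / T \<le> kconst M c"
proof -
  have "0 \<le> M" "0 \<le> T" "0 \<le> 4 * il2 * M^2" "0 \<le> 14 * ibd * M^2" "0 \<le> 1 / c" "0 \<le> 1 / T"
    using assms T_pos il2_nonneg ibd_nonneg by auto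
  then show "1000 \<le> kconst M c" "M \<le> kconst M c" "real CARD('n) \<le> kconst M c" "T \<le> kconst M c" "4 * il2 * M^2 \<le> kconst M c"
    "14 * ibd * M^2 \<le> kconst M c" "1 / c \<le> kconst M c" "real (card {is :: 'n list. length is \<le> 3}) \<le> kconst M c" "1 / T \<le> kconst M c"
    unfolding kconst_def by linarith+
qed

text \<open>Sets up the abstract pair for the given solutions: both kernels on full vectors, the
  coefficients lifted to the cylinder, \<open>J\<close> the interaction of \<open>m2\<close>. The
  data enter only through the common bound \<open>S\<close>, with \<open>D = S^2\<close>.\<close>

lemma stability_squares:
  assumes M: "0 < M" "0 < c" and core: "core_prop (kconst M c ^ 130) K" "1 \<le> K"
    and K1: "C_Omega'2 A 4 K1" "C_Omega'2_norm A 4 K1 < M" and K2: "C_Omega2 A 4 K2" "C_Omega2_norm A 4 K2 < M"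
    and a: "C_Omega A 3 a" "C_Omega_norm A 3 a < M" and s: "C_par A T 1 s" "C_par_norm A T 1 s < M"
    and Y: "(u1, m1) \<in> Y1 A T M" "(u2, m2) \<in> Y1 A T M" "b1 \<in> Y2 A M" "b2 \<in> Y2 A M"
    and mfgs: "MFGS A T K1 K2 a s b1 u1 m1" "MFGS A T K1 K2 a s b2 u2 m2"
    and low: "\<And>z. z \<in> cQ \<Longrightarrow> c \<le> \<bar>interaction A K1 K2 m2 z\<bar>"
    and S: "0 \<le> S"
    and DI: "\<And>is t. length is \<le> 3 \<Longrightarrow> t \<in> {0, T} \<Longrightarrow>
        IO A (\<lambda>x. (dd (map es is) u1 (x, t) - dd (map es is) u2 (x, t))^2) \<le> S^2 \<and>
        IO A (\<lambda>x. (dd (map es is) m1 (x, t) - dd (map es is) m2 (x, t))^2) \<le> S^2"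
    and DL: "\<And>j \<sigma> vs. \<sigma> \<in> {-1, 1} \<Longrightarrow> vs \<in> {[e_time], [e_time, e_time]} \<union> range (\<lambda>i. [es i, e_time]) \<Longrightarrow>
        IB A T j \<sigma> (\<lambda>p. (dd vs u1 p - dd vs u2 p)^2) \<le> S^2 \<and> IB A T j \<sigma> (\<lambda>p. (dd vs m1 p - dd vs m2 p)^2) \<le> S^2"
    and DL2: "\<And>j \<sigma> i s. \<sigma> \<in> {-1, 1} \<Longrightarrow> (i, s) \<noteq> (j, j) \<Longrightarrow>
        IB A T j \<sigma> (\<lambda>p. (dd [es s, es i, e_time] u1 p - dd [es s, es i, e_time] u2 p)^2) \<le> S^2 \<and>
        IB A T j \<sigma> (\<lambda>p. (dd [es s, es i, e_time] m1 p - dd [es s, es i, e_time] m2 p)^2) \<le> S^2"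
  defines "B \<equiv> kconst M c ^ 60 * (K * S^2)"
  shows "us \<in> {[], [e_time]} \<Longrightarrow> H_par A T 1 (\<lambda>z. dd us u1 z - dd us u2 z) \<le> sqrt (hp_card * B)"
    and "us \<in> {[], [e_time]} \<Longrightarrow> H_par A T 1 (\<lambda>z. dd us m1 z - dd us m2 z) \<le> sqrt (hp_card * B)"
    and "(L2_Omega A (\<lambda>x. b1 x - b2 x))^2 \<le> B"
proof -
  let ?k = "kconst M c"
  note kk = kconst_ge[OF M]
  have u: "C_par A T 3 u1" "C_par A T 3 u2" and m: "C_par A T 3 m1" "C_par A T 3 m2"
    and n: "C_par_norm A T 3 u1 < M" "C_par_norm A T 3 u2 < M" "C_par_norm A T 3 m1 < M" "C_par_norm A T 3 m2 < M"
    using Y(1,2) by (auto simp: Y1_def)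
  have b: "C_Omega A 4 b1" "C_Omega A 4 b2" "C_Omega_norm A 4 b1 < M" "C_Omega_norm A 4 b2 < M"
    using Y(3,4) by (auto simp: Y2_def)
  obtain \<kappa>1x \<kappa>1y \<kappa>1xx \<kappa>1xy \<kappa>1yx \<kappa>1yy where k1: "kern2 (kbar K1) \<kappa>1x \<kappa>1y \<kappa>1xx \<kappa>1xy \<kappa>1yx \<kappa>1yy" "kern2_le M (kbar K1) \<kappa>1x \<kappa>1y \<kappa>1xx \<kappa>1xy \<kappa>1yx \<kappa>1yy"
    by (rule kern_Omega'2[OF K1])
  obtain \<kappa>2x \<kappa>2y \<kappa>2xx \<kappa>2xy \<kappa>2yx \<kappa>2yy where k2: "kern2 K2 \<kappa>2x \<kappa>2y \<kappa>2xx \<kappa>2xy \<kappa>2yx \<kappa>2yy" "kern2_le M K2 \<kappa>2x \<kappa>2y \<kappa>2xx \<kappa>2xy \<kappa>2yx \<kappa>2yy"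
    by (rule kern_Omega2[OF K2])
  have ker: "kern1 (kbar K1) \<kappa>1x \<kappa>1y" "kern1 K2 \<kappa>2x \<kappa>2y" using k1 k2 by (auto simp: kern2_def)
  define Da Db1 Db2 where
    "Da = (\<lambda>is (z :: 'n rvec \<times> real). pds (cOmega A) (map (\<lambda>i. axis i 1) is) a (fst z))"
    and "Db1 = (\<lambda>is (z :: 'n rvec \<times> real). pds (cOmega A) (map (\<lambda>i. axis i 1) is) b1 (fst z))"
    and "Db2 = (\<lambda>is (z :: 'n rvec \<times> real). pds (cOmega A) (map (\<lambda>i. axis i 1) is) b2 (fst z))"
  have La: "length is \<le> 3 \<Longrightarrow> contQ (Da is)" "length is \<le> 3 \<Longrightarrow> p \<in> cQ \<Longrightarrow> \<bar>Da is p\<bar> \<le> M"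
    "Suc (length is) \<le> 3 \<Longrightarrow> hpdQ (es i) (Da is) (Da (i # is))" "length is \<le> 3 \<Longrightarrow> hpdQ e_time (Da is) (\<lambda>_. 0)" for "is" p i
    unfolding Da_def using coeff_lift[OF a, of "is"] coeff_lift(3)[OF a, of "i # is" i "is"] by simp_all
  have Lb1: "length is \<le> 4 \<Longrightarrow> contQ (Db1 is)" "length is \<le> 4 \<Longrightarrow> p \<in> cQ \<Longrightarrow> \<bar>Db1 is p\<bar> \<le> M"
    "Suc (length is) \<le> 4 \<Longrightarrow> hpdQ (es i) (Db1 is) (Db1 (i # is))" "length is \<le> 4 \<Longrightarrow> hpdQ e_time (Db1 is) (\<lambda>_. 0)" for "is" p i
    unfolding Db1_def using coeff_lift[OF b(1,3), of "is"] coeff_lift(3)[OF b(1,3), of "i # is" i "is"] by simp_all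
  have Lb2: "length is \<le> 4 \<Longrightarrow> contQ (Db2 is)" "length is \<le> 4 \<Longrightarrow> p \<in> cQ \<Longrightarrow> \<bar>Db2 is p\<bar> \<le> M"
    "Suc (length is) \<le> 4 \<Longrightarrow> hpdQ (es i) (Db2 is) (Db2 (i # is))" "length is \<le> 4 \<Longrightarrow> hpdQ e_time (Db2 is) (\<lambda>_. 0)" for "is" p i
    unfolding Db2_def using coeff_lift[OF b(2,4), of "is"] coeff_lift(3)[OF b(2,4), of "i # is" i "is"] by simp_all
  have nil: "Da [] = (\<lambda>z. a (fst z))" "Db1 [] = (\<lambda>z. b1 (fst z))" "Db2 [] = (\<lambda>z. b2 (fst z))"
    by (simp_all add: Da_def Db1_def Db2_def pds_Nil)
  have sh: "hpdQ v s (dd [v] s)" "contQ (dd [v] s)" "p \<in> cQ \<Longrightarrow> \<bar>dd [v] s p\<bar> \<le> M" if "v \<in> par_dirs" for v p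
  proof -
    have l: "[v] \<in> dl (2 * 1)" using that by (simp add: dir_lists_def par_weight_def)
    show "hpdQ v s (dd [v] s)" using C_par_hpd[OF s(1) l] by (simp add: pds_Nil)
    show "contQ (dd [v] s)" by (rule C_par_cont[OF s(1) l])
    show "\<bar>dd [v] s p\<bar> \<le> M" if "p \<in> cQ" using C_par_bound[OF s(1) l that] s(2) by linarith
  qed
  have s0: "contQ s" "p \<in> cQ \<Longrightarrow> \<bar>s p\<bar> \<le> M" for p
    using C_par_cont[OF s(1), of "[]"] C_par_bound[OF s(1), of "[]" p] s(2) by (auto simp: dir_lists_def pds_Nil)
  have mb: "\<bar>dd vs v p\<bar> \<le> M" if "v \<in> {u1, u2, m1, m2}" "vs \<in> dl 6" "p \<in> cQ" for vs v p
    using C_par_bound[OF u(1), of vs p] C_par_bound[OF u(2), of vs p] C_par_bound[OF m(1), of vs p] C_par_bound[OF m(2), of vs p] n that by auto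
  have "\<bar>m2 p\<bar> \<le> M \<and> \<bar>dd [es ix1] m2 p\<bar> \<le> M \<and> \<bar>dd [es ix1, es ix1] m2 p\<bar> \<le> M \<and> \<bar>dd [e_time] m2 p\<bar> \<le> M \<and> \<bar>dd [e_time, es ix1] m2 p\<bar> \<le> M"
    if "p \<in> cQ" for p
    using mb[of m2 "[]" p] mb[of m2 "[es ix1]" p] mb[of m2 "[es ix1, es ix1]" p] mb[of m2 "[e_time]" p] mb[of m2 "[e_time, es ix1]" p] that
    by (simp add: dir_lists_def pds_Nil)
  from Inter_smooth[OF k1 k2 smooth21_C_par[OF m(2)] less_imp_le[OF M(1)] this]
  obtain J2 J1t where J: "smooth21 (Inter (kbar K1) K2 m2) (Inter1 \<kappa>1x \<kappa>1y (kbar K1) \<kappa>2x K2 m2 (dd [es ix1] m2)) J2 (Inter (kbar K1) K2 (dd [e_time] m2)) J1t"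
    "\<And>p. p \<in> cQ \<Longrightarrow> \<bar>Inter (kbar K1) K2 m2 p\<bar> \<le> 14 * ibd * M^2 \<and> (\<forall>i. \<bar>Inter1 \<kappa>1x \<kappa>1y (kbar K1) \<kappa>2x K2 m2 (dd [es ix1] m2) i p\<bar> \<le> 14 * ibd * M^2) \<and>
        (\<forall>i j. \<bar>J2 i j p\<bar> \<le> 14 * ibd * M^2) \<and> \<bar>Inter (kbar K1) K2 (dd [e_time] m2) p\<bar> \<le> 14 * ibd * M^2"
    by blast
  have cI: "contQ (Inter (kbar K1) K2 v)" if "C_par A T 3 v" for v
    using cont_Inter[OF kern1D(1)[OF ker(1)] kern1D(1)[OF ker(2)]] C_par_cont[OF that, of "[]"] by (simp add: dir_lists_def pds_Nil)
  have ah: "hpdQ (es i) (Da []) (Da [i])" "hpdQ (es j) (Da [i]) (Da [j, i])" for i j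
    by (intro La(3); simp)+
  have sol: "sol (kbar K1) K2 (Da []) (\<lambda>i. Da [i]) s (Db1 []) u1 m1" "sol (kbar K1) K2 (Da []) (\<lambda>i. Da [i]) s (Db2 []) u2 m2"
    unfolding nil
    by (intro MFGS_sol mfgs u m ah(1)[unfolded nil] La(1)[of "[]", unfolded nil] Lb1(1)[of "[]", unfolded nil] Lb2(1)[of "[]", unfolded nil] La(1) s0(1) cI; simp)+
  interpret P: mfg_pair A T ?k M "kbar K1" \<kappa>1y K2 \<kappa>2y \<kappa>1x \<kappa>2x u1 u2 m1 m2 "Da []" "Db1 []" "Db2 []" s "dd [e_time] s"
    "Inter (kbar K1) K2 m2" "Inter (kbar K1) K2 (dd [e_time] m2)" "\<lambda>i. Da [i]" "\<lambda>i. Db1 [i]" "\<lambda>i. Db2 [i]" "\<lambda>i. dd [es i] s"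
    "Inter1 \<kappa>1x \<kappa>1y (kbar K1) \<kappa>2x K2 m2 (dd [es ix1] m2)" J1t "\<lambda>i j. Da [j, i]" J2
  proof unfold_locales
    show "1000 \<le> ?k" "0 \<le> M" "real CARD('n) \<le> ?k" "T \<le> ?k" "4 * il2 * M^2 \<le> ?k" using kk M by auto
    show "C_par A T 3 u1" "C_par A T 3 u2" "C_par A T 3 m1" "C_par A T 3 m2" by (fact u m)+
    show "\<bar>dd vs u1 p\<bar> \<le> ?k \<and> \<bar>dd vs u2 p\<bar> \<le> ?k \<and> \<bar>dd vs m1 p\<bar> \<le> ?k \<and> \<bar>dd vs m2 p\<bar> \<le> ?k" if "vs \<in> dl 6" "p \<in> cQ" for vs p
      using mb[OF _ that, of u1] mb[OF _ that, of u2] mb[OF _ that, of m1] mb[OF _ that, of m2] kk(2) by simp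
    show "kern1 (kbar K1) \<kappa>1x \<kappa>1y" "kern1 K2 \<kappa>2x \<kappa>2y" by (fact ker)+
    show "\<bar>kbar K1 q\<bar> \<le> M \<and> (\<forall>i. \<bar>\<kappa>1x i q\<bar> \<le> M) \<and> \<bar>\<kappa>1y q\<bar> \<le> M \<and> \<bar>K2 q\<bar> \<le> M \<and> (\<forall>i. \<bar>\<kappa>2x i q\<bar> \<le> M)" if "q \<in> cOO" for q
      using k1(2)[unfolded kern2_le_def, rule_format, OF that] k2(2)[unfolded kern2_le_def, rule_format, OF that] by blast
    show "smooth21 (Inter (kbar K1) K2 m2) (Inter1 \<kappa>1x \<kappa>1y (kbar K1) \<kappa>2x K2 m2 (dd [es ix1] m2)) J2 (Inter (kbar K1) K2 (dd [e_time] m2)) J1t"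
      by (rule J(1))
    show "\<bar>Inter (kbar K1) K2 m2 p\<bar> \<le> ?k \<and> (\<forall>i. \<bar>Inter1 \<kappa>1x \<kappa>1y (kbar K1) \<kappa>2x K2 m2 (dd [es ix1] m2) i p\<bar> \<le> ?k) \<and>
        (\<forall>i j. \<bar>J2 i j p\<bar> \<le> ?k) \<and> \<bar>Inter (kbar K1) K2 (dd [e_time] m2) p\<bar> \<le> ?k" if "p \<in> cQ" for p
      using J(2)[OF that] kk(6) by (meson order_trans)
    show "1 \<le> ?k * \<bar>Inter (kbar K1) K2 m2 p\<bar>" if "p \<in> cQ" for p
    proof -
      have "1 = 1 / c * c" using M by simp
      also have "\<dots> \<le> ?k * \<bar>Inter (kbar K1) K2 m2 p\<bar>"
        using low[OF that] kk(1,7) M by (intro mult_mono) (auto simp: interaction_eq)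
      finally show ?thesis .
    qed
    show "hpdQ (es j) (Da []) (Da [j])" "hpdQ (es j) (Da [i]) (Da [j, i])" for i j by (fact ah)+
    show "hpdQ e_time (Da []) (\<lambda>_. 0)" "hpdQ e_time (Da [i]) (\<lambda>_. 0)" for i by (intro La(4); simp)+
    show "contQ (Da [])" "contQ (Da [i])" for i by (intro La(1); simp)+
    show "\<bar>Da [] p\<bar> \<le> ?k \<and> \<bar>Da [i] p\<bar> \<le> ?k \<and> \<bar>Da [j, i] p\<bar> \<le> ?k" if "p \<in> cQ" for p i j
      using La(2)[of "[]" p] La(2)[of "[i]" p] La(2)[of "[j, i]" p] that kk(2) by simp
    show "hpdQ (es j) (Db1 []) (Db1 [j])" "hpdQ (es j) (Db2 []) (Db2 [j])" for j by (intro Lb1(3) Lb2(3); simp)+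
    show "hpdQ e_time (Db1 []) (\<lambda>_. 0)" "hpdQ e_time (Db2 []) (\<lambda>_. 0)" by (intro Lb1(4) Lb2(4); simp)+
    show "contQ (Db1 [])" "contQ (Db2 [])" "contQ (Db1 [i])" for i by (intro Lb1(1) Lb2(1); simp)+
    show "Db1 [] (x, t) = Db1 [] (x, t') \<and> Db2 [] (x, t) = Db2 [] (x, t') \<and> Db1 [i] (x, t) = Db1 [i] (x, t') \<and> Db2 [i] (x, t) = Db2 [i] (x, t')" for i x t t'
      by (simp add: Db1_def Db2_def)
    show "\<bar>Db1 [] p\<bar> \<le> ?k \<and> \<bar>Db1 [i] p\<bar> \<le> ?k" if "p \<in> cQ" for p i
      using Lb1(2)[of "[]" p] Lb1(2)[of "[i]" p] that kk(2) by simp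
    show "hpdQ e_time s (dd [e_time] s)" "hpdQ (es j) s (dd [es j] s)" for j by (intro sh(1); simp)+
    show "contQ s" by (rule s0)
    show "contQ (dd [e_time] s)" "contQ (dd [es i] s)" for i by (intro sh(2); simp)+
    show "\<bar>s p\<bar> \<le> ?k \<and> \<bar>dd [e_time] s p\<bar> \<le> ?k \<and> \<bar>dd [es i] s p\<bar> \<le> ?k" if "p \<in> cQ" for p i
      using s0(2)[OF that] sh(3)[OF _ that, of e_time] sh(3)[OF _ that, of "es i"] kk(2) by simp
    show "sol (kbar K1) K2 (Da []) (\<lambda>i. Da [i]) s (Db1 []) u1 m1" "sol (kbar K1) K2 (Da []) (\<lambda>i. Da [i]) s (Db2 []) u2 m2" by (fact sol)+
  qed (rule refl)+
  interpret mfg_data A T ?k M "kbar K1" \<kappa>1y K2 \<kappa>2y \<kappa>1x \<kappa>2x u1 u2 m1 m2 "Da []" "Db1 []" "Db2 []" s "dd [e_time] s"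
    "Inter (kbar K1) K2 m2" "Inter (kbar K1) K2 (dd [e_time] m2)" "\<lambda>i. Da [i]" "\<lambda>i. Db1 [i]" "\<lambda>i. Db2 [i]" "\<lambda>i. dd [es i] s"
    "Inter1 \<kappa>1x \<kappa>1y (kbar K1) \<kappa>2x K2 m2 (dd [es ix1] m2)" J1t "\<lambda>i j. Da [j, i]" J2 "S^2"
  proof unfold_locales
    show "0 \<le> S^2" "real (card {is :: 'n list. length is \<le> 3}) \<le> ?k" using kk by auto
    have "1 = 1 / T * T" using T_pos by simp
    also have "\<dots> \<le> ?k * T" using T_pos kk(9) by (intro mult_right_mono) auto
    finally show "1 \<le> ?k * T" .
  qed (use DI DL DL2 in \<open>simp_all add: P.U_def P.N_def\<close>)
  note fb = final_bounds[OF core, folded B_def, unfolded P.U_def P.N_def]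
  show "H_par A T 1 (\<lambda>z. dd us u1 z - dd us u2 z) \<le> sqrt (hp_card * B)" if "us \<in> {[], [e_time]}" for us
    by (rule H_par_diff_le[OF u that]) (use that fb(1)[of "[]"] fb(1-3) fb(2)[of "[]"] in auto)
  show "H_par A T 1 (\<lambda>z. dd us m1 z - dd us m2 z) \<le> sqrt (hp_card * B)" if "us \<in> {[], [e_time]}" for us
    by (rule H_par_diff_le[OF m that]) (use that fb(1)[of "[]"] fb(1-3) fb(2)[of "[]"] in auto)
  show "(L2_Omega A (\<lambda>x. b1 x - b2 x))^2 \<le> B"
    using fb(4) unfolding L2_Omega_sq P.be_def by (simp add: nil)
qed

end

theorem theorem4p5:
  fixes A :: "real ^ 'n::{finite,wellorder}" and T M c :: real
  assumes "\<forall>i. 0 < A $ i" and "0 < T" and "0 < M" and "0 < c"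
  shows "\<exists>C\<^sub>1 > 0. \<forall>K1 K2 a s u\<^sub>1 u\<^sub>2 m\<^sub>1 m\<^sub>2 b\<^sub>1 b\<^sub>2 p\<^sub>1 p\<^sub>2 q\<^sub>1 q\<^sub>2 F\<^sub>1 F\<^sub>2 G\<^sub>1 G\<^sub>2
           f0\<^sub>1 f0\<^sub>2 f1\<^sub>1 f1\<^sub>2 g0\<^sub>1 g0\<^sub>2 g1\<^sub>1 g1\<^sub>2.
      C_Omega'2 A 4 K1 \<and> C_Omega'2_norm A 4 K1 < M \<and>
      C_Omega2 A 4 K2 \<and> C_Omega2_norm A 4 K2 < M \<and>
      C_Omega A 3 a \<and> C_Omega_norm A 3 a < M \<and>
      C_par A T 1 s \<and> C_par_norm A T 1 s < M \<and>
      (u\<^sub>1, m\<^sub>1) \<in> Y1 A T M \<and> b\<^sub>1 \<in> Y2 A M \<and>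
      (u\<^sub>2, m\<^sub>2) \<in> Y1 A T M \<and> b\<^sub>2 \<in> Y2 A M \<and>
      MFGS A T K1 K2 a s b\<^sub>1 u\<^sub>1 m\<^sub>1 \<and> MFGS A T K1 K2 a s b\<^sub>2 u\<^sub>2 m\<^sub>2 \<and>
      has_data A T u\<^sub>1 p\<^sub>1 F\<^sub>1 f0\<^sub>1 f1\<^sub>1 \<and> has_data A T m\<^sub>1 q\<^sub>1 G\<^sub>1 g0\<^sub>1 g1\<^sub>1 \<and>
      has_data A T u\<^sub>2 p\<^sub>2 F\<^sub>2 f0\<^sub>2 f1\<^sub>2 \<and> has_data A T m\<^sub>2 q\<^sub>2 G\<^sub>2 g0\<^sub>2 g1\<^sub>2 \<and>
      (\<forall>z\<in>cQT A T. c \<le> \<bar>interaction A K1 K2 m\<^sub>2 z\<bar>)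
      \<longrightarrow>
      (let R = C\<^sub>1 * (H_Omega A 4 (\<lambda>x. p\<^sub>1 x - p\<^sub>2 x) + H_Omega A 4 (\<lambda>x. q\<^sub>1 x - q\<^sub>2 x))
             + C\<^sub>1 * (H_Omega A 4 (\<lambda>x. F\<^sub>1 x - F\<^sub>2 x) + H_Omega A 4 (\<lambda>x. G\<^sub>1 x - G\<^sub>2 x))
             + C\<^sub>1 * (H21_ST A T (\<lambda>z. Dt A T u\<^sub>1 z - Dt A T u\<^sub>2 z)
                  + H10_ST A T (\<lambda>z. pd (ST A T) e_time f1\<^sub>1 z - pd (ST A T) e_time f1\<^sub>2 z))
             + C\<^sub>1 * (H21_ST A T (\<lambda>z. Dt A T m\<^sub>1 z - Dt A T m\<^sub>2 z)
                  + H10_ST A T (\<lambda>z. pd (ST A T) e_time g1\<^sub>1 z - pd (ST A T) e_time g1\<^sub>2 z))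
       in (\<forall>j\<in>{0, 1}.
             H_par A T 1 (\<lambda>z. (Dt A T ^^ j) u\<^sub>1 z - (Dt A T ^^ j) u\<^sub>2 z) \<le> R \<and>
             H_par A T 1 (\<lambda>z. (Dt A T ^^ j) m\<^sub>1 z - (Dt A T ^^ j) m\<^sub>2 z) \<le> R) \<and>
          L2_Omega A (\<lambda>x. b\<^sub>1 x - b\<^sub>2 x) \<le> R)"
proof -
  interpret boxdom A T by unfold_locales (use assms in auto)
  let ?k = "kconst M c"
  have k1: "1 \<le> ?k" using kconst_ge(1)[OF assms(3,4)] by simp
  \<comment> \<open>Enlarged to at least 1, so that \<open>D\<close> itself is at most
    \<open>K * D\<close>.\<close>
  obtain K where K: "core_prop (?k ^ 130) K" "1 \<le> K" using stability_core[OF one_le_power[OF k1, of 130]] core_prop_mono[of _ _ "max 1 _"] by (metis max.cobounded1 max.cobounded2)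
  \<comment> \<open>\<open>hp_card\<close> counts the terms of the norm of \<open>H^{2,1}\<close>;
    the added 1 lets the same constant serve the single norm of the difference of the
    coefficients.\<close>
  define C where "C = sqrt ((hp_card + 1) * (?k ^ 60 * K))"
  have h0: "0 \<le> hp_card" by (simp add: hp_card_def)
  have kK: "0 < ?k ^ 60 * K" using k1 K(2) by simp
  have C: "0 < C" unfolding C_def using h0 kK by (simp add: mult_pos_pos add_nonneg_pos)
  have CS: "sqrt (h * (?k ^ 60 * (K * S\<^sup>2))) \<le> C * S" if "0 \<le> h" "h \<le> hp_card + 1" "0 \<le> S" for h S
  proof -
    have "sqrt (h * (?k ^ 60 * (K * S\<^sup>2))) = sqrt (h * (?k ^ 60 * K)) * S"
      using that by (simp add: real_sqrt_mult mult.assoc[symmetric])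
    also have "\<dots> \<le> C * S" unfolding C_def using that kK by (intro mult_right_mono real_sqrt_le_mono) auto
    finally show ?thesis .
  qed
  show ?thesis
  proof (intro exI[of _ C] conjI C allI impI, goal_cases)
    case (1 K1 K2 a s u1 u2 m1 m2 b1 b2 p1 p2 q1 q2 F1 F2 G1 G2 f01 f02 f11 f12 g01 g02 g11 g12)
    note H = 1
    let ?p = "H_Omega A 4 (\<lambda>x. p1 x - p2 x)" and ?q = "H_Omega A 4 (\<lambda>x. q1 x - q2 x)"
    let ?F = "H_Omega A 4 (\<lambda>x. F1 x - F2 x)" and ?G = "H_Omega A 4 (\<lambda>x. G1 x - G2 x)"
    let ?u = "H21_ST A T (\<lambda>z. Dt A T u1 z - Dt A T u2 z)" and ?m = "H21_ST A T (\<lambda>z. Dt A T m1 z - Dt A T m2 z)"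
    let ?f = "H10_ST A T (\<lambda>z. pd (ST A T) e_time f11 z - pd (ST A T) e_time f12 z)"
    let ?g = "H10_ST A T (\<lambda>z. pd (ST A T) e_time g11 z - pd (ST A T) e_time g12 z)"
    define S where "S = ?p + ?q + (?F + ?G) + (?u + ?f) + (?m + ?g)"
    have nn: "0 \<le> ?p" "0 \<le> ?q" "0 \<le> ?F" "0 \<le> ?G" "0 \<le> ?u" "0 \<le> ?f" "0 \<le> ?m" "0 \<le> ?g"
      by (intro H_Omega_nonneg ST_norms_nonneg)+
    have le: "?p \<le> S" "?q \<le> S" "?F \<le> S" "?G \<le> S" "?u \<le> S" "?f \<le> S" "?m \<le> S" "?g \<le> S" and S0: "0 \<le> S"
      using nn unfolding S_def by linarith+
    have cl: "C_par A T 3 u1" "C_par A T 3 u2" "C_par A T 3 m1" "C_par A T 3 m2" using H by (auto simp: Y1_def)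
    have hd: "has_data A T u1 p1 F1 f01 f11" "has_data A T m1 q1 G1 g01 g11" "has_data A T u2 p2 F2 f02 f12" "has_data A T m2 q2 G2 g02 g12"
      using H by auto
    note du = data_bounds[OF cl(1,2) hd(1,3) le(1,3,5,6)] and dm = data_bounds[OF cl(3,4) hd(2,4) le(2,4,7,8)]
    have st: "us \<in> {[], [e_time]} \<Longrightarrow> H_par A T 1 (\<lambda>z. dd us u1 z - dd us u2 z) \<le> sqrt (hp_card * (?k ^ 60 * (K * S\<^sup>2)))"
      "us \<in> {[], [e_time]} \<Longrightarrow> H_par A T 1 (\<lambda>z. dd us m1 z - dd us m2 z) \<le> sqrt (hp_card * (?k ^ 60 * (K * S\<^sup>2)))"
      "(L2_Omega A (\<lambda>x. b1 x - b2 x))\<^sup>2 \<le> ?k ^ 60 * (K * S\<^sup>2)" for us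
      by (rule stability_squares[OF assms(3,4) K, where ?K1.0=K1 and ?K2.0=K2 and a=a and s=s and S=S and ?u1.0=u1 and ?u2.0=u2 and ?m1.0=m1 and ?m2.0=m2 and ?b1.0=b1 and ?b2.0=b2];
          (assumption | use H S0 in blast | intro conjI du dm; assumption))+
    have R: "C * (?p + ?q) + C * (?F + ?G) + C * (?u + ?f) + C * (?m + ?g) = C * S"
      by (simp add: S_def distrib_left)
    have D: "(Dt A T ^^ j) v = dd (replicate j e_time) v" if "j \<in> {0, 1}" for j v
      using that by (auto simp: Dt_def[abs_def] pds_Nil pds_Cons)
    have b: "L2_Omega A (\<lambda>x. b1 x - b2 x) \<le> C * S"
      using order_trans[OF real_sqrt_le_mono[OF st(3)] CS[of 1 S, simplified]] h0 S0 by simp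
    have hC: "sqrt (hp_card * (?k ^ 60 * (K * S\<^sup>2))) \<le> C * S" by (rule CS) (use h0 S0 in auto)
    show ?case
      unfolding Let_def R
      using b order_trans[OF st(1) hC] order_trans[OF st(2) hC] by (auto simp: D)
  qed
qed

end
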